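(* Let $\mathcal T$ be a (mixed-)tame theory of fields and $K$ a $\mathcal T$-field. Let $f:X\subseteq K^n\times Y\to K$ be a definable function such that for every $y\in Y$, the fiber $X_y$ is one-dimensional and the restriction of $f$ to $X_y$ is locally $1$-Lipschitz. Then there is a definable $\mathbf k$-partition of $X$ such that for any $y\in Y$, on each $\mathbf k$-part $X_{y,\xi}$ of $X_y$, $f$ is globally $1$-Lipschitz.
   Context: **Tame theories.** Let $p$ be $0$ or a prime and $e\ge0$ an integer. A $(0,p,e)$-field is a Henselian discretely valued field $K$ (surjective valuation $\mathrm{ord}:K^\times\to\mathbb Z$) of characteristic $0$ and residue characteristic $p$ with a chosen uniformizer $\varpi_K$, such that $p=e=0$, or $p>0$ and $\mathrm{ord}(p)=e$. Put $R_{n,K}=\mathcal O_K/\mathfrak M_K^n$ (residue rings), $\overline{\mathrm{ac}}_n(x)=\varpi_K^{-\mathrm{ord}(x)}x\bmod\mathfrak M_K^n$ for $x\neq0$, $\overline{\mathrm{ac}}_n(0)=0$. The language $\mathcal L_{\mathrm{high}}$ has sorts for the valued field (ring language and a constant for $\varpi_K$), the value group (Presburger language) and each $R_n$ (ring language), with symbols $\mathrm{ord}$, $\overline{\mathrm{ac}}_n$ and the projections $R_n\to R_m$; $\mathcal L_{\mathrm{DP}}$ is its restriction to the valued field, value group and residue field sorts with only $\overline{\mathrm{ac}}_1$. $\mathcal T_{(0,p,e)}$ is the set of $\mathcal L_{\mathrm{high}}$-sentences true in all $(0,p,e)$-fields. A $\mathbf k$-partition of a definable $X$ is a definable map $g:X\to\prod_{i=1}^sR_{n_i,K}$;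 its fibers are the $\mathbf k$-parts (for $X\subseteq K^n\times Y$, $X_{y,\xi}=g^{-1}(\xi)_y$ are the $\mathbf k$-parts of $X_y$). A (mixed-)tame theory is a theory $\mathcal T\supseteq\mathcal T_{(0,p,e)}$ in a language $\mathcal L\supseteq\mathcal L_{\mathrm{high}}$ with the same sorts (or, if $p=e=0$, possibly with the sorts of $\mathcal L_{\mathrm{DP}}$), having a $(0,p,e)$-field as model, such that in every model $K$, with value group $\Gamma$: (Split) every definable subset of $\Gamma^r$ is $\Gamma$-definable in $(+,-,0,<)$, and every definable subset of $\Gamma^r\times\prod R_{n_i,K}$ is a finite disjoint union of products of a definable subset of $\Gamma^r$ and a definable subset of $\prod R_{n_i,K}$; (Finite b-minimality) every locally constant definable $K\to K$ has finite image, and for definable $X\subseteq K\times Y$, $Y\subseteq K^n$, there are $\ell\ge1$, a $\mathbf k$-partition $g:X\to A$, a definable $c:Y\times A\to K$ and definable families $B_{y,\xi}\subseteq\Gamma$ such that each nonempty $g^{-1}(\xi)_y$ is either $\{c(y,\xi)\}$ or $\{x:\overline{\mathrm{ac}}_\ell(x-c(y,\xi))=\zeta,\ \mathrm{ord}(x-c(y,\xi))\in B_{y,\xi}\}$ with $\zeta$ a component of $\xi$; (Jacobian property) for each $n\ge1$ and definable $F:X\subseteq K\times Y\to K$ there is a $\mathbf k$-partition of $X$ such that for each $y$ and each ball $B$ in a $\mathbf k$-part of $X_y$, $F(\cdot,y)$ is constant on $B$, or is injective and $C^1$ on $B$ with image a ball, with $F'\ne0$, $\mathrm{ord}(F')$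 and $\overline{\mathrm{ac}}_n(F')$ constant on $B$, and $\mathrm{ord}(F(x)-F(x'))=\mathrm{ord}(F')+\mathrm{ord}(x-x')$, $\overline{\mathrm{ac}}_n(F(x)-F(x'))=\overline{\mathrm{ac}}_n(F')\overline{\mathrm{ac}}_n(x-x')$ for $x\ne x'$ in $B$. A $\mathcal T$-field is a model that is a $(0,p,e)$-field; $K$ is a fixed $\mathcal T$-field with sufficiently saturated residue rings. Definable means $\mathcal L$-definable. **Notation.** $X_y=\{x:(x,y)\in X\}$. $|x|=e^{-\mathrm{ord}(x)}$, $\mathrm{ord}(x)=\min_i\mathrm{ord}(x_i)$ on $K^n$. The dimension of a definable subset of $K^n$ is the largest $d$ such that its image under some coordinate projection $K^n\to K^d$ contains an open ball. $f$ is globally $C$-Lipschitz on $A$ if $|f(x)-f(x')|\le C|x-x'|$ for all $x,x'\in A$, and locally $C$-Lipschitz if every point of $A$ has a ball around it on whose intersection with $A$ it is globally $C$-Lipschitz. *)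

theory Defs
  imports "HOL-Computational_Algebra.Primes" "HOL-Library.Equipollence" Complex_Main
    "HOL-Algebra.QuotRing" "HOL-Algebra.Ideal_Product"
begin

section \<open>Many-sorted first-order logic\<close>

text \<open>
  The sorts are the valued field, the value group and the residue rings, \<open>RR n\<close> standing for
  $\mathcal O/\mathfrak M^n$.  Only \<open>n \<ge> 1\<close> is ever used, see \<open>high_sorts\<close>.
\<close>

datatype vsort = VF | VG | RR nat

datatype 'f tm = Var vsort nat | App 'f "'f tm list"

datatype ('f, 'r) fm =
    FEq "'f tm" "'f tm"
  | FRel 'r "'f tm list"
  | FNot "('f, 'r) fm"
  | FAnd "('f, 'r) fm" "('f, 'r) fm"
  | FEx vsort nat "('f, 'r) fm"

record ('f, 'r) lang =
  sorts :: "vsort set"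
  ftype :: "'f \<Rightarrow> (vsort list \<times> vsort) option"
  rtype :: "'r \<Rightarrow> vsort list option"

definition wf_lang :: "('f, 'r) lang \<Rightarrow> bool" where
  "wf_lang L \<longleftrightarrow>
     (\<forall>f ss s. ftype L f = Some (ss, s) \<longrightarrow> insert s (set ss) \<subseteq> sorts L) \<and>
     (\<forall>r ss. rtype L r = Some ss \<longrightarrow> set ss \<subseteq> sorts L)"

definition extends :: "('f, 'r) lang \<Rightarrow> ('f, 'r) lang \<Rightarrow> bool" where
  "extends L L0 \<longleftrightarrow>
     sorts L = sorts L0 \<and> ftype L0 \<subseteq>\<^sub>m ftype L \<and> rtype L0 \<subseteq>\<^sub>m rtype L"

inductive has_sort :: "('f, 'r) lang \<Rightarrow> 'f tm \<Rightarrow> vsort \<Rightarrow> bool" for L where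
  "s \<in> sorts L \<Longrightarrow> has_sort L (Var s i) s"
| "ftype L f = Some (ss, s) \<Longrightarrow> list_all2 (has_sort L) ts ss \<Longrightarrow> has_sort L (App f ts) s"
monos list_all2_mono

primrec wf_fm :: "('f, 'r) lang \<Rightarrow> ('f, 'r) fm \<Rightarrow> bool" where
  "wf_fm L (FEq t u) \<longleftrightarrow> (\<exists>s. has_sort L t s \<and> has_sort L u s)"
| "wf_fm L (FRel r ts) \<longleftrightarrow> (\<exists>ss. rtype L r = Some ss \<and> list_all2 (has_sort L) ts ss)"
| "wf_fm L (FNot \<phi>) \<longleftrightarrow> wf_fm L \<phi>"
| "wf_fm L (FAnd \<phi> \<psi>) \<longleftrightarrow> wf_fm L \<phi> \<and> wf_fm L \<psi>"
| "wf_fm L (FEx s i \<phi>) \<longleftrightarrow> s \<in> sorts L \<and> wf_fm L \<phi>"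

primrec tm_vars :: "'f tm \<Rightarrow> (vsort \<times> nat) set" where
  "tm_vars (Var s i) = {(s, i)}"
| "tm_vars (App f ts) = \<Union> (set (map tm_vars ts))"

primrec free_vars :: "('f, 'r) fm \<Rightarrow> (vsort \<times> nat) set" where
  "free_vars (FEq t u) = tm_vars t \<union> tm_vars u"
| "free_vars (FRel r ts) = \<Union> (set (map tm_vars ts))"
| "free_vars (FNot \<phi>) = free_vars \<phi>"
| "free_vars (FAnd \<phi> \<psi>) = free_vars \<phi> \<union> free_vars \<psi>"
| "free_vars (FEx s i \<phi>) = free_vars \<phi> - {(s, i)}"

definition sentence :: "('f, 'r) lang \<Rightarrow> ('f, 'r) fm \<Rightarrow> bool" where
  "sentence L \<phi> \<longleftrightarrow> wf_fm L \<phi> \<and> free_vars \<phi> = {}"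

text \<open>All sorts of a structure are interpreted by (not necessarily disjoint) subsets of one
  universe type \<open>'u\<close>.\<close>

record ('f, 'r, 'u) struct =
  car :: "vsort \<Rightarrow> 'u set"
  fint :: "'f \<Rightarrow> 'u list \<Rightarrow> 'u"
  rint :: "'r \<Rightarrow> 'u list \<Rightarrow> bool"

definition tuples :: "('f, 'r, 'u) struct \<Rightarrow> vsort list \<Rightarrow> 'u list set" where
  "tuples M ss = {xs. list_all2 (\<lambda>x s. x \<in> car M s) xs ss}"

definition is_struct :: "('f, 'r) lang \<Rightarrow> ('f, 'r, 'u) struct \<Rightarrow> bool" where
  "is_struct L M \<longleftrightarrow>
     (\<forall>s\<in>sorts L. car M s \<noteq> {}) \<and>
     (\<forall>f ss s. ftype L f = Some (ss, s) \<longrightarrow> (\<forall>xs\<in>tuples M ss. fint M f xs \<in> car M s))"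

primrec tm_val :: "('f, 'r, 'u) struct \<Rightarrow> (vsort \<times> nat \<Rightarrow> 'u) \<Rightarrow> 'f tm \<Rightarrow> 'u" where
  "tm_val M v (Var s i) = v (s, i)"
| "tm_val M v (App f ts) = fint M f (map (tm_val M v) ts)"

primrec sat :: "('f, 'r, 'u) struct \<Rightarrow> (vsort \<times> nat \<Rightarrow> 'u) \<Rightarrow> ('f, 'r) fm \<Rightarrow> bool" where
  "sat M v (FEq t u) \<longleftrightarrow> tm_val M v t = tm_val M v u"
| "sat M v (FRel r ts) \<longleftrightarrow> rint M r (map (tm_val M v) ts)"
| "sat M v (FNot \<phi>) \<longleftrightarrow> \<not> sat M v \<phi>"
| "sat M v (FAnd \<phi> \<psi>) \<longleftrightarrow> sat M v \<phi> \<and> sat M v \<psi>"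
| "sat M v (FEx s i \<phi>) \<longleftrightarrow> (\<exists>a\<in>car M s. sat M (v((s, i) := a)) \<phi>)"

definition holds :: "('f, 'r, 'u) struct \<Rightarrow> ('f, 'r) fm \<Rightarrow> bool" where
  "holds M \<phi> \<longleftrightarrow> (\<forall>v. sat M v \<phi>)"

definition is_model ::
    "('f, 'r) lang \<Rightarrow> ('f, 'r) fm set \<Rightarrow> ('f, 'r, 'u) struct \<Rightarrow> bool" where
  "is_model L T M \<longleftrightarrow> is_struct L M \<and> (\<forall>\<phi>\<in>T. holds M \<phi>)"

text \<open>
  A subset of a product of sorts \<open>ss\<close> is a set of lists; the \<open>j\<close>-th coordinate is denoted by
  the variable \<open>Var (ss ! j) j\<close>.  Definable means without parameters.
\<close>

definition definable ::
    "('f, 'r) lang \<Rightarrow> ('f, 'r, 'u) struct \<Rightarrow> vsort list \<Rightarrow> 'u list set \<Rightarrow> bool" where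
  "definable L M ss D \<longleftrightarrow> set ss \<subseteq> sorts L \<and>
     (\<exists>\<phi>. wf_fm L \<phi> \<and> free_vars \<phi> \<subseteq> {(ss ! j, j) |j. j < length ss} \<and>
          D = {xs \<in> tuples M ss. sat M (\<lambda>(s, j). xs ! j) \<phi>})"

definition definable_with_params ::
    "('f, 'r) lang \<Rightarrow> ('f, 'r, 'u) struct \<Rightarrow> vsort list \<Rightarrow> 'u list set \<Rightarrow> bool" where
  "definable_with_params L M ss D \<longleftrightarrow>
     (\<exists>ss' ps E. ps \<in> tuples M ss' \<and> definable L M (ss @ ss') E \<and>
        D = {xs \<in> tuples M ss. xs @ ps \<in> E})"

definition definable_fun ::
    "('f, 'r) lang \<Rightarrow> ('f, 'r, 'u) struct \<Rightarrow> vsort list \<Rightarrow> 'u list set \<Rightarrow>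
     vsort list \<Rightarrow> ('u list \<Rightarrow> 'u list) \<Rightarrow> bool" where
  "definable_fun L M ss D ts g \<longleftrightarrow>
     definable L M ss D \<and> g ` D \<subseteq> tuples M ts \<and> definable L M (ss @ ts) {x @ g x |x. x \<in> D}"


section \<open>The valued field languages\<close>

text \<open>\<open>SUnif\<close> names the uniformizer; \<open>SFun\<close> and \<open>SRel\<close> provide the additional symbols of a
  language extending $\mathcal L_{\mathrm{high}}$ or $\mathcal L_{\mathrm{DP}}$.\<close>

datatype 'f fsym =
    SZero vsort | SOne vsort | SPlus vsort | SNeg vsort | STimes vsort
  | SUnif | SOrd | SAc nat | SProj nat nat
  | SFun 'f

datatype 'r rsym = SLess | SCong nat | SRel 'r

fun ftype0 :: "'f fsym \<Rightarrow> (vsort list \<times> vsort) option" where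
  "ftype0 (SZero s) = Some ([], s)"
| "ftype0 (SOne s) = Some ([], s)"
| "ftype0 (SPlus s) = Some ([s, s], s)"
| "ftype0 (SNeg s) = Some ([s], s)"
| "ftype0 (STimes s) = (if s = VG then None else Some ([s, s], s))"
| "ftype0 SUnif = Some ([], VF)"
| "ftype0 SOrd = Some ([VF], VG)"
| "ftype0 (SAc n) = Some ([VF], RR n)"
| "ftype0 (SProj n m) = (if m < n then Some ([RR n], RR m) else None)"
| "ftype0 (SFun f) = None"

fun rtype0 :: "'r rsym \<Rightarrow> vsort list option" where
  "rtype0 SLess = Some [VG, VG]"
| "rtype0 (SCong n) = (if n \<ge> 1 then Some [VG, VG] else None)"
| "rtype0 (SRel r) = None"

definition base_lang :: "vsort set \<Rightarrow> ('f fsym, 'r rsym) lang" where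
  "base_lang S = \<lparr>
     sorts = S,
     ftype = (\<lambda>f. case ftype0 f of None \<Rightarrow> None
               | Some (ss, s) \<Rightarrow> if insert s (set ss) \<subseteq> S then Some (ss, s) else None),
     rtype = (\<lambda>r. case rtype0 r of None \<Rightarrow> None
               | Some ss \<Rightarrow> if set ss \<subseteq> S then Some ss else None)\<rparr>"

text \<open>\<open>base_lang high_sorts\<close> is $\mathcal L_{\mathrm{high}}$ and \<open>base_lang dp_sorts\<close> is
  $\mathcal L_{\mathrm{DP}}$.\<close>

definition high_sorts :: "vsort set" where
  "high_sorts = {VF, VG} \<union> {RR n |n. n \<ge> 1}"

definition dp_sorts :: "vsort set" where
  "dp_sorts = {VF, VG, RR 1}"

text \<open>The language $(+,-,0,<)$ on the value group.\<close>

definition ordgroup_lang :: "('f fsym, 'r rsym) lang" where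
  "ordgroup_lang = \<lparr>
     sorts = {VG},
     ftype = [SPlus VG \<mapsto> ([VG, VG], VG), SNeg VG \<mapsto> ([VG], VG), SZero VG \<mapsto> ([], VG)],
     rtype = [SLess \<mapsto> [VG, VG]]\<rparr>"

type_synonym ('f, 'r) vlang = "('f fsym, 'r rsym) lang"
type_synonym ('f, 'r) vfm = "('f fsym, 'r rsym) fm"
type_synonym ('f, 'r, 'u) vstruct = "('f fsym, 'r rsym, 'u) struct"


section \<open>Henselian discretely valued fields\<close>

definition ring_of :: "('f, 'r, 'u) vstruct \<Rightarrow> vsort \<Rightarrow> 'u ring" where
  "ring_of M s = \<lparr>
     carrier = car M s,
     mult = (\<lambda>x y. fint M (STimes s) [x, y]),
     one = fint M (SOne s) [],
     zero = fint M (SZero s) [],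
     add = (\<lambda>x y. fint M (SPlus s) [x, y])\<rparr>"

definition vzero :: "('f, 'r, 'u) vstruct \<Rightarrow> 'u" where
  "vzero M = fint M (SZero VF) []"

definition vdiff :: "('f, 'r, 'u) vstruct \<Rightarrow> 'u \<Rightarrow> 'u \<Rightarrow> 'u" where
  "vdiff M x y = fint M (SPlus VF) [x, fint M (SNeg VF) [y]]"

definition vmult :: "('f, 'r, 'u) vstruct \<Rightarrow> 'u \<Rightarrow> 'u \<Rightarrow> 'u" where
  "vmult M x y = fint M (STimes VF) [x, y]"

definition vord :: "('f, 'r, 'u) vstruct \<Rightarrow> 'u \<Rightarrow> 'u" where
  "vord M x = fint M SOrd [x]"

definition vac :: "('f, 'r, 'u) vstruct \<Rightarrow> nat \<Rightarrow> 'u \<Rightarrow> 'u" where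
  "vac M n x = fint M (SAc n) [x]"

definition gplus :: "('f, 'r, 'u) vstruct \<Rightarrow> 'u \<Rightarrow> 'u \<Rightarrow> 'u" where
  "gplus M \<gamma> \<delta> = fint M (SPlus VG) [\<gamma>, \<delta>]"

definition gless :: "('f, 'r, 'u) vstruct \<Rightarrow> 'u \<Rightarrow> 'u \<Rightarrow> bool" where
  "gless M \<gamma> \<delta> \<longleftrightarrow> rint M SLess [\<gamma>, \<delta>]"

text \<open>The identification of the value group with the integers, as a Presburger structure.\<close>

definition Z_iso :: "('f, 'r, 'u) vstruct \<Rightarrow> ('u \<Rightarrow> int) \<Rightarrow> bool" where
  "Z_iso M h \<longleftrightarrow>
     bij_betw h (car M VG) UNIV \<and>
     fint M (SZero VG) [] \<in> car M VG \<and> h (fint M (SZero VG) []) = 0 \<and>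
     fint M (SOne VG) [] \<in> car M VG \<and> h (fint M (SOne VG) []) = 1 \<and>
     (\<forall>x\<in>car M VG. fint M (SNeg VG) [x] \<in> car M VG \<and> h (fint M (SNeg VG) [x]) = - h x) \<and>
     (\<forall>x\<in>car M VG. \<forall>y\<in>car M VG.
        gplus M x y \<in> car M VG \<and> h (gplus M x y) = h x + h y \<and>
        (gless M x y \<longleftrightarrow> h x < h y) \<and>
        (\<forall>n\<ge>1. rint M (SCong n) [x, y] \<longleftrightarrow> int n dvd h x - h y))"

definition zord :: "('f, 'r, 'u) vstruct \<Rightarrow> 'u \<Rightarrow> int" where
  "zord M x = (SOME h. Z_iso M h) (vord M x)"

definition val_ring :: "('f, 'r, 'u) vstruct \<Rightarrow> 'u ring" where
  "val_ring M = (ring_of M VF)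
     \<lparr>carrier := {x \<in> car M VF. x = vzero M \<or> 0 \<le> zord M x}\<rparr>"

definition max_ideal :: "('f, 'r, 'u) vstruct \<Rightarrow> 'u set" where
  "max_ideal M = {x \<in> car M VF. x = vzero M \<or> 0 < zord M x}"

primrec max_ideal_pow :: "('f, 'r, 'u) vstruct \<Rightarrow> nat \<Rightarrow> 'u set" where
  "max_ideal_pow M 0 = carrier (val_ring M)"
| "max_ideal_pow M (Suc n) = ideal_prod (val_ring M) (max_ideal M) (max_ideal_pow M n)"

definition has_char :: "('a, 'b) ring_scheme \<Rightarrow> nat \<Rightarrow> bool" where
  "has_char R p \<longleftrightarrow> (\<forall>n::nat. add_pow R n \<one>\<^bsub>R\<^esub> = \<zero>\<^bsub>R\<^esub> \<longleftrightarrow> p dvd n)"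

text \<open>Hensel's lemma for the local ring \<open>R\<close> with maximal ideal \<open>I\<close>, and polynomials
  $\sum_{i \le d} c_i X^i$.\<close>

definition henselian :: "('a, 'b) ring_scheme \<Rightarrow> 'a set \<Rightarrow> bool" where
  "henselian R I \<longleftrightarrow>
     (\<forall>d::nat. \<forall>c::nat \<Rightarrow> 'a. \<forall>a\<in>carrier R.
        (\<forall>i\<le>d. c i \<in> carrier R) \<longrightarrow>
        (\<Oplus>\<^bsub>R\<^esub>i\<in>{..d}. c i \<otimes>\<^bsub>R\<^esub> a [^]\<^bsub>R\<^esub> i) \<in> I \<longrightarrow>
        (\<Oplus>\<^bsub>R\<^esub>i\<in>{1..d}. add_pow R i (c i \<otimes>\<^bsub>R\<^esub> a [^]\<^bsub>R\<^esub> (i - 1))) \<notin> I \<longrightarrow>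
        (\<exists>b\<in>carrier R. b \<ominus>\<^bsub>R\<^esub> a \<in> I \<and>
           (\<Oplus>\<^bsub>R\<^esub>i\<in>{..d}. c i \<otimes>\<^bsub>R\<^esub> b [^]\<^bsub>R\<^esub> i) = \<zero>\<^bsub>R\<^esub>))"

text \<open>
  A $(0,p,e)$-field, as a structure with sorts \<open>S\<close>.  The value group and the residue rings are
  taken up to isomorphism; \<open>\<rho> n\<close> identifies $\mathcal O/\mathfrak M^n$ with the sort \<open>RR n\<close>.
  Since \<open>SOrd\<close> is a total function symbol, $\mathrm{ord}(0)$ has to be given a value, namely \<open>0\<close>;
  no definition below depends on it.
\<close>

definition zpe_field ::
    "vsort set \<Rightarrow> nat \<Rightarrow> nat \<Rightarrow> ('f, 'r, 'u) vstruct \<Rightarrow> bool" where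
  "zpe_field S p e M \<longleftrightarrow>
     (let F = ring_of M VF; R = val_ring M; t = fint M SUnif [] in
       field F \<and> has_char F 0 \<and>
       (\<forall>x\<in>carrier F. fint M (SNeg VF) [x] = \<ominus>\<^bsub>F\<^esub> x) \<and>
       (\<exists>h. Z_iso M h) \<and>
       (\<forall>x\<in>carrier F. vord M x \<in> car M VG) \<and>
       vord M \<zero>\<^bsub>F\<^esub> = fint M (SZero VG) [] \<and>
       zord M ` (carrier F - {\<zero>\<^bsub>F\<^esub>}) = UNIV \<and>
       (\<forall>x\<in>carrier F - {\<zero>\<^bsub>F\<^esub>}. \<forall>y\<in>carrier F - {\<zero>\<^bsub>F\<^esub>}.
          zord M (x \<otimes>\<^bsub>F\<^esub> y) = zord M x + zord M y \<and>
          (x \<oplus>\<^bsub>F\<^esub> y \<noteq> \<zero>\<^bsub>F\<^esub> \<longrightarrow> min (zord M x) (zord M y) \<le> zord M (x \<oplus>\<^bsub>F\<^esub> y))) \<and>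
       henselian R (max_ideal M) \<and>
       has_char (R Quot (max_ideal M)) p \<and>
       (p = 0 \<and> e = 0 \<or> prime (p :: nat) \<and> zord M (add_pow F p \<one>\<^bsub>F\<^esub>) = int e) \<and>
       t \<in> carrier F - {\<zero>\<^bsub>F\<^esub>} \<and> zord M t = 1 \<and>
       (\<exists>\<rho>. \<forall>n. RR n \<in> S \<longrightarrow>
          cring (ring_of M (RR n)) \<and>
          (\<forall>x\<in>car M (RR n). fint M (SNeg (RR n)) [x] = \<ominus>\<^bsub>ring_of M (RR n)\<^esub> x) \<and>
          \<rho> n \<in> ring_iso (R Quot (max_ideal_pow M n)) (ring_of M (RR n)) \<and>
          vac M n \<zero>\<^bsub>F\<^esub> = \<zero>\<^bsub>ring_of M (RR n)\<^esub> \<and>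
          (\<forall>x\<in>carrier F - {\<zero>\<^bsub>F\<^esub>}.
             vac M n x =
               \<rho> n (max_ideal_pow M n +>\<^bsub>R\<^esub> (t [^]\<^bsub>F\<^esub> (- zord M x) \<otimes>\<^bsub>F\<^esub> x))) \<and>
          (\<forall>m x. RR m \<in> S \<and> m < n \<and> x \<in> carrier R \<longrightarrow>
             fint M (SProj n m) [\<rho> n (max_ideal_pow M n +>\<^bsub>R\<^esub> x)] =
               \<rho> m (max_ideal_pow M m +>\<^bsub>R\<^esub> x))))"

definition base_theory ::
    "'u itself \<Rightarrow> vsort set \<Rightarrow> nat \<Rightarrow> nat \<Rightarrow> ('f, 'r) vfm set" where
  "base_theory _ S p e =
     {\<phi>. sentence (base_lang S) \<phi> \<and>
         (\<forall>M :: ('f, 'r, 'u) vstruct.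
            is_struct (base_lang S) M \<and> zpe_field S p e M \<longrightarrow> holds M \<phi>)}"

definition T_field ::
    "('f, 'r) vlang \<Rightarrow> nat \<Rightarrow> nat \<Rightarrow> ('f, 'r) vfm set \<Rightarrow> ('f, 'r, 'u) vstruct \<Rightarrow> bool" where
  "T_field L p e T M \<longleftrightarrow> is_model L T M \<and> zpe_field (sorts L) p e M"


section \<open>Tame theories\<close>

text \<open>\<open>vclose M \<gamma> x y\<close> means $\mathrm{ord}(x - y) > \gamma$, with $\mathrm{ord}(0) = \infty$.\<close>

definition vclose :: "('f, 'r, 'u) vstruct \<Rightarrow> 'u \<Rightarrow> 'u \<Rightarrow> 'u \<Rightarrow> bool" where
  "vclose M \<gamma> x y \<longleftrightarrow> x = y \<or> gless M \<gamma> (vord M (vdiff M x y))"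

text \<open>As the value group of a model is discrete, open and closed balls coincide.\<close>

definition vball :: "('f, 'r, 'u) vstruct \<Rightarrow> 'u \<Rightarrow> 'u \<Rightarrow> 'u set" where
  "vball M a \<gamma> = {x \<in> car M VF. vclose M \<gamma> x a}"

definition is_ball :: "('f, 'r, 'u) vstruct \<Rightarrow> 'u set \<Rightarrow> bool" where
  "is_ball M B \<longleftrightarrow> (\<exists>a\<in>car M VF. \<exists>\<gamma>\<in>car M VG. B = vball M a \<gamma>)"

definition k_partition ::
    "('f, 'r) vlang \<Rightarrow> ('f, 'r, 'u) vstruct \<Rightarrow> vsort list \<Rightarrow> 'u list set \<Rightarrow>
     nat list \<Rightarrow> ('u list \<Rightarrow> 'u list) \<Rightarrow> bool" where
  "k_partition L M ss X ns g \<longleftrightarrow> definable_fun L M ss X (map RR ns) g"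

definition split_property :: "('f, 'r) vlang \<Rightarrow> ('f, 'r, 'u) vstruct \<Rightarrow> bool" where
  "split_property L M \<longleftrightarrow>
     (\<forall>r D. definable L M (replicate r VG) D \<longrightarrow>
        definable_with_params ordgroup_lang M (replicate r VG) D) \<and>
     (\<forall>r ns D. definable L M (replicate r VG @ map RR ns) D \<longrightarrow>
        (\<exists>\<C>. finite \<C> \<and>
           (\<forall>(P, Q)\<in>\<C>. definable L M (replicate r VG) P \<and> definable L M (map RR ns) Q) \<and>
           pairwise (\<lambda>(P, Q) (P', Q'). P \<inter> P' = {} \<or> Q \<inter> Q' = {}) \<C> \<and>
           D = (\<Union>(P, Q)\<in>\<C>. {\<gamma> @ \<xi> |\<gamma> \<xi>. \<gamma> \<in> P \<and> \<xi> \<in> Q})))"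

text \<open>The families $B_{y,\xi}$ are given by the definable set \<open>B\<close> of all tuples $(y,\xi,\gamma)$
  with $\gamma \in B_{y,\xi}$.\<close>

definition finitely_b_minimal :: "('f, 'r) vlang \<Rightarrow> ('f, 'r, 'u) vstruct \<Rightarrow> bool" where
  "finitely_b_minimal L M \<longleftrightarrow>
     (\<forall>h. definable_fun L M [VF] (tuples M [VF]) [VF] (\<lambda>z. [h (hd z)]) \<and>
          (\<forall>x\<in>car M VF. \<exists>\<gamma>\<in>car M VG. \<forall>x'\<in>vball M x \<gamma>. h x' = h x) \<longrightarrow>
        finite (h ` car M VF)) \<and>
     (\<forall>n X Y. definable L M (replicate n VF) Y \<and> definable L M (VF # replicate n VF) X \<and>
          X \<subseteq> {x # y |x y. y \<in> Y} \<longrightarrow>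
        (\<exists>l ns g c B. RR l \<in> sorts L \<and>
           k_partition L M (VF # replicate n VF) X ns g \<and>
           definable_fun L M (replicate n VF @ map RR ns)
             {y @ \<xi> |y \<xi>. y \<in> Y \<and> \<xi> \<in> tuples M (map RR ns)} [VF] (\<lambda>z. [c z]) \<and>
           definable L M (replicate n VF @ map RR ns @ [VG]) B \<and>
           (\<forall>y\<in>Y. \<forall>\<xi>\<in>tuples M (map RR ns).
              let part = {x. x # y \<in> X \<and> g (x # y) = \<xi>} in
              part = {} \<or>
              part = {c (y @ \<xi>)} \<or>
              (\<exists>j<length ns. ns ! j = l \<and>
                 part = {x \<in> car M VF. x \<noteq> c (y @ \<xi>) \<and>
                           vac M l (vdiff M x (c (y @ \<xi>))) = \<xi> ! j \<and>
                           y @ \<xi> @ [vord M (vdiff M x (c (y @ \<xi>)))] \<in> B}))))"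

definition has_vderiv ::
    "('f, 'r, 'u) vstruct \<Rightarrow> ('u \<Rightarrow> 'u) \<Rightarrow> 'u set \<Rightarrow> 'u \<Rightarrow> 'u \<Rightarrow> bool" where
  "has_vderiv M F B x d \<longleftrightarrow>
     (\<forall>\<epsilon>\<in>car M VG. \<exists>\<delta>\<in>car M VG. \<forall>x'\<in>B. x' \<noteq> x \<and> vclose M \<delta> x' x \<longrightarrow>
        vclose M (gplus M \<epsilon> (vord M (vdiff M x' x)))
          (vdiff M (F x') (F x)) (vmult M d (vdiff M x' x)))"

definition vcontinuous_on :: "('f, 'r, 'u) vstruct \<Rightarrow> 'u set \<Rightarrow> ('u \<Rightarrow> 'u) \<Rightarrow> bool" where
  "vcontinuous_on M B F \<longleftrightarrow>
     (\<forall>x\<in>B. \<forall>\<epsilon>\<in>car M VG. \<exists>\<delta>\<in>car M VG. \<forall>x'\<in>B.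
        vclose M \<delta> x' x \<longrightarrow> vclose M \<epsilon> (F x') (F x))"

definition jacobian_on ::
    "('f, 'r, 'u) vstruct \<Rightarrow> nat \<Rightarrow> ('u \<Rightarrow> 'u) \<Rightarrow> 'u set \<Rightarrow> bool" where
  "jacobian_on M n F B \<longleftrightarrow> inj_on F B \<and> is_ball M (F ` B) \<and>
     (\<exists>F'. F' ` B \<subseteq> car M VF - {vzero M} \<and>
        (\<forall>x\<in>B. has_vderiv M F B x (F' x)) \<and> vcontinuous_on M B F' \<and>
        (\<forall>x\<in>B. \<forall>x'\<in>B. vord M (F' x) = vord M (F' x') \<and> vac M n (F' x) = vac M n (F' x')) \<and>
        (\<forall>x\<in>B. \<forall>x'\<in>B. x \<noteq> x' \<longrightarrow>
           vord M (vdiff M (F x) (F x')) = gplus M (vord M (F' x)) (vord M (vdiff M x x')) \<and>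
           vac M n (vdiff M (F x) (F x')) =
             vac M n (F' x) \<otimes>\<^bsub>ring_of M (RR n)\<^esub> vac M n (vdiff M x x')))"

definition jacobian_property :: "('f, 'r) vlang \<Rightarrow> ('f, 'r, 'u) vstruct \<Rightarrow> bool" where
  "jacobian_property L M \<longleftrightarrow>
     (\<forall>n ss X Y F. RR n \<in> sorts L \<and> definable L M ss Y \<and> X \<subseteq> {x # y |x y. y \<in> Y} \<and>
          definable_fun L M (VF # ss) X [VF] (\<lambda>z. [F z]) \<longrightarrow>
        (\<exists>ns g. k_partition L M (VF # ss) X ns g \<and>
           (\<forall>y\<in>Y. \<forall>\<xi>\<in>tuples M (map RR ns). \<forall>B.
              is_ball M B \<and> B \<subseteq> {x. x # y \<in> X \<and> g (x # y) = \<xi>} \<longrightarrow>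
              (\<exists>a. \<forall>x\<in>B. F (x # y) = a) \<or> jacobian_on M n (\<lambda>x. F (x # y)) B)))"

text \<open>
  Models range over the structures with universe type \<open>'u\<close>.  If \<open>'u\<close> has at least as many
  elements as there are \<open>L\<close>-formulas, then by the downward Loewenheim-Skolem theorem this is no
  restriction: if one of the conditions fails in some model, it fails in every elementary
  submodel of it, and there is one of at most that size.
\<close>

definition tame ::
    "'u itself \<Rightarrow> ('f, 'r) vlang \<Rightarrow> nat \<Rightarrow> nat \<Rightarrow> ('f, 'r) vfm set \<Rightarrow> bool" where
  "tame U L p e T \<longleftrightarrow>
     wf_lang L \<and>
     (sorts L = high_sorts \<or> sorts L = dp_sorts \<and> p = 0 \<and> e = 0) \<and>
     extends L (base_lang (sorts L)) \<and>
     (\<forall>\<phi>\<in>T. sentence L \<phi>) \<and>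
     base_theory U (sorts L) p e \<subseteq> T \<and>
     (\<exists>M :: ('f, 'r, 'u) vstruct. T_field L p e T M) \<and>
     (\<forall>M :: ('f, 'r, 'u) vstruct. is_model L T M \<longrightarrow>
        split_property L M \<and> finitely_b_minimal L M \<and> jacobian_property L M)"

text \<open>
  $|L|^+$-saturation of the residue rings: every partial type in finitely many residue ring
  variables, consisting of at most $|L| + \aleph_0$ formulas with parameters from any sorts, is
  realised.
\<close>

definition residue_rings_saturated :: "('f, 'r) vlang \<Rightarrow> ('f, 'r, 'u) vstruct \<Rightarrow> bool" where
  "residue_rings_saturated L M \<longleftrightarrow>
     (\<forall>ns \<D>. \<D> \<lesssim> {\<phi>. wf_fm L \<phi>} \<and>
        (\<forall>D\<in>\<D>. definable_with_params L M (map RR ns) D) \<and>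
        (\<forall>\<D>'\<subseteq>\<D>. finite \<D>' \<and> \<D>' \<noteq> {} \<longrightarrow> \<Inter> \<D>' \<noteq> {}) \<longrightarrow>
        \<D> \<noteq> {} \<longrightarrow> \<Inter> \<D> \<noteq> {})"


section \<open>Dimension and Lipschitz maps\<close>

definition vnball :: "('f, 'r, 'u) vstruct \<Rightarrow> 'u list \<Rightarrow> 'u \<Rightarrow> 'u list set" where
  "vnball M a \<gamma> = {x. list_all2 (\<lambda>x\<^sub>i a\<^sub>i. x\<^sub>i \<in> vball M a\<^sub>i \<gamma>) x a}"

definition projection_has_ball ::
    "('f, 'r, 'u) vstruct \<Rightarrow> nat \<Rightarrow> 'u list set \<Rightarrow> nat \<Rightarrow> bool" where
  "projection_has_ball M n A d \<longleftrightarrow>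
     (\<exists>I\<subseteq>{..<n}. card I = d \<and>
        (\<exists>a\<in>tuples M (replicate d VF). \<exists>\<gamma>\<in>car M VG. vnball M a \<gamma> \<subseteq> (\<lambda>x. nths x I) ` A))"

definition has_dim :: "('f, 'r, 'u) vstruct \<Rightarrow> nat \<Rightarrow> 'u list set \<Rightarrow> nat \<Rightarrow> bool" where
  "has_dim M n A d \<longleftrightarrow>
     projection_has_ball M n A d \<and> (\<forall>d'. projection_has_ball M n A d' \<longrightarrow> d' \<le> d)"

definition vabs :: "('f, 'r, 'u) vstruct \<Rightarrow> 'u \<Rightarrow> real" where
  "vabs M x = (if x = vzero M then 0 else exp (- real_of_int (zord M x)))"

text \<open>$|x| = e^{-\min_i \mathrm{ord}(x_i)} = \max_i |x_i|$, with $|x| = 0$ for $n = 0$.\<close>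

definition vnabs :: "('f, 'r, 'u) vstruct \<Rightarrow> 'u list \<Rightarrow> real" where
  "vnabs M xs = Max (insert 0 (vabs M ` set xs))"

definition globally_lipschitz ::
    "('f, 'r, 'u) vstruct \<Rightarrow> real \<Rightarrow> ('u list \<Rightarrow> 'u) \<Rightarrow> 'u list set \<Rightarrow> bool" where
  "globally_lipschitz M C f A \<longleftrightarrow>
     (\<forall>x\<in>A. \<forall>x'\<in>A. vabs M (vdiff M (f x) (f x')) \<le> C * vnabs M (map2 (vdiff M) x x'))"

definition locally_lipschitz ::
    "('f, 'r, 'u) vstruct \<Rightarrow> real \<Rightarrow> ('u list \<Rightarrow> 'u) \<Rightarrow> 'u list set \<Rightarrow> bool" where
  "locally_lipschitz M C f A \<longleftrightarrow>
     (\<forall>x\<in>A. \<exists>\<gamma>\<in>car M VG. globally_lipschitz M C f (vnball M x \<gamma> \<inter> A))"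

definition fiber :: "'u list set \<Rightarrow> nat \<Rightarrow> 'u list \<Rightarrow> 'u list set" where
  "fiber X n y = {x. length x = n \<and> x @ y \<in> X}"

end

theory Submission
  imports Defs "HOL-Algebra.Subrings"
begin

text \<open>Write \<open>x \<equiv>\<^sub>r x'\<close> for \<open>ord (x - x') \<ge> r\<close>; being 1-Lipschitz means preserving all these relations.

In one variable, finite b-minimality yields cells: after coloring by residue rings, a part is a single
point, or a union of balls of radius \<open>ord (x - c) + l\<close> around its points \<open>x\<close>, at most one ball for each
value of \<open>ord (x - c)\<close>, with a definable center \<open>c\<close>; after refinement \<open>f\<close> is 1-Lipschitz on every such
ball by the Jacobian property.  Cells with center \<open>d\<close> on the image side, compatible with the images of
the balls, bound \<open>ord (x - c) - ord (f x - d)\<close> from above.  Points in different balls violate the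
inequality only if this difference is positive, hence one of finitely many values, which a
color can fix.  Then the quotient \<open>u = (f x - d) / (x - c)\<close> has negative order, so \<open>u\<close> and \<open>ord (x - c)\<close>
together determine \<open>x\<close> by contraction.  As unions of small sets over the value group are small, \<open>u\<close> alone
determines \<open>x\<close> up to a residue ring color, and cells on the \<open>u\<close>-line show that \<open>ord (x - c)\<close> is constant on the
parts of a further coloring, which therefore contain only one ball each.

In \<open>K\<^sup>n\<close>, one-dimensionality makes a point of the fiber a function of one of its coordinates and
residue ring colors.  Among the coordinates of such a branch take one, \<open>x\<^sub>j\<close>, whose derivative is dominant:
the other coordinates, and hence \<open>f\<close>, are locally 1-Lipschitz in \<open>x\<^sub>j\<close>, and the one-variable case applies.\<close>

section \<open>Definable sets and maps\<close>

text \<open>Finite b-minimality is given for families with parameters in \<open>K\<close> only,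
  while the argument needs cells that are uniform in residue ring colors and in value group elements
  such as \<open>ord (x - c)\<close>. Finding one small exceptional set that serves all such
  parameters at once is the main obstacle. Residue parameters are controlled by saturation: an order
  that is bounded for every single residue parameter is bounded uniformly. The value group of
  \<open>K\<close> is the group of integers, where nothing of this kind is available. Its substitute
  is parity: evenness of an integer is definable and changes at every step, whereas a definable set
  in one variable is locally constant away from uniformly discrete exceptions. This shows that
  unions over the value group of sets without balls contain no ball, and it produces a common point
  of a definable chain of balls although \<open>K\<close> need not be complete. Lipschitz conditions
  are never treated through real absolute values before the very end; \<open>cl r\<close> with an
  integer \<open>r\<close> carries them, and the maximum norm becomes a congruence in all
  coordinates.\<close>

primrec ren_tm :: "(nat \<Rightarrow> nat) \<Rightarrow> 'f tm \<Rightarrow> 'f tm" where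
  "ren_tm r (Var s i) = Var s (r i)"
| "ren_tm r (App f ts) = App f (map (ren_tm r) ts)"

primrec ren_fm :: "(nat \<Rightarrow> nat) \<Rightarrow> ('f, 'r) fm \<Rightarrow> ('f, 'r) fm" where
  "ren_fm r (FEq t u) = FEq (ren_tm r t) (ren_tm r u)"
| "ren_fm r (FRel q ts) = FRel q (map (ren_tm r) ts)"
| "ren_fm r (FNot \<phi>) = FNot (ren_fm r \<phi>)"
| "ren_fm r (FAnd \<phi> \<psi>) = FAnd (ren_fm r \<phi>) (ren_fm r \<psi>)"
| "ren_fm r (FEx s i \<phi>) = FEx s (r i) (ren_fm r \<phi>)"

lemma tm_val_cong: "(\<And>x. x \<in> tm_vars t \<Longrightarrow> v x = v' x) \<Longrightarrow> tm_val M v t = tm_val M v' t"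
proof (induction t)
  case (App f ts)
  have "map (tm_val M v) ts = map (tm_val M v') ts"
    using App by (intro map_cong) auto
  then show ?case by (metis tm_val.simps(2))
qed simp

lemma sat_cong: "(\<And>x. x \<in> free_vars \<phi> \<Longrightarrow> v x = v' x) \<Longrightarrow> sat M v \<phi> = sat M v' \<phi>"
proof (induction \<phi> arbitrary: v v')
  case (FEq t u)
  then show ?case using tm_val_cong[of t v v' M] tm_val_cong[of u v v' M] by auto
next
  case (FRel r ts)
  have "map (tm_val M v) ts = map (tm_val M v') ts"
    using FRel by (intro map_cong tm_val_cong) auto
  then show ?case by (metis sat.simps(2))
next
  case (FNot \<phi>)
  then show ?case by (metis sat.simps(3) free_vars.simps(3))
next
  case (FAnd \<phi> \<psi>)
  then show ?case by (metis sat.simps(4) free_vars.simps(4) UnCI)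
next
  case (FEx s i \<phi>)
  have "sat M (v((s, i) := a)) \<phi> = sat M (v'((s, i) := a)) \<phi>" for a
    by (rule FEx.IH) (use FEx.prems in auto)
  then show ?case by simp
qed

lemma tm_val_ren: "tm_val M v (ren_tm r t) = tm_val M (\<lambda>(s, i). v (s, r i)) t"
proof (induction t)
  case (App f ts)
  have "map (tm_val M v) (map (ren_tm r) ts) = map (tm_val M (\<lambda>(s, i). v (s, r i))) ts"
    using App by auto
  then show ?case by (metis tm_val.simps(2) ren_tm.simps(2))
qed simp

text \<open>Bound variables are renamed along with the free ones, so injectivity of \<open>r\<close>
  is what prevents capture.\<close>

lemma sat_ren: "inj r \<Longrightarrow> sat M v (ren_fm r \<phi>) = sat M (\<lambda>(s, i). v (s, r i)) \<phi>"
proof (induction \<phi> arbitrary: v)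
  case (FRel q ts)
  have "map (tm_val M v) (map (ren_tm r) ts) = map (tm_val M (\<lambda>(s, i). v (s, r i))) ts"
    by (auto simp: tm_val_ren)
  then show ?case by (metis sat.simps(2) ren_fm.simps(2))
next
  case (FEx s i \<phi>)
  have "(\<lambda>(s', j). (v((s, r i) := a)) (s', r j)) = (\<lambda>(s', j). v (s', r j))((s, i) := a)" for a
    using FEx.prems by (auto simp: fun_eq_iff inj_def)
  then show ?case using FEx by simp
qed (simp_all add: tm_val_ren)

lemma tm_vars_ren: "tm_vars (ren_tm r t) = (\<lambda>(s, i). (s, r i)) ` tm_vars t"
proof (induction t)
  case (App f ts)
  then show ?case by (simp add: image_Union image_image)
qed simp

lemma free_vars_ren: "inj r \<Longrightarrow> free_vars (ren_fm r \<phi>) = (\<lambda>(s, i). (s, r i)) ` free_vars \<phi>"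
proof (induction \<phi>)
  case (FEx s i \<phi>)
  have "inj (\<lambda>(s :: vsort, i). (s, r i))" using FEx.prems by (auto simp: inj_def)
  then show ?case using FEx by (simp add: image_set_diff)
qed (auto simp: tm_vars_ren)

lemma has_sort_ren: "has_sort L t s \<Longrightarrow> has_sort L (ren_tm r t) s"
proof (induction t arbitrary: s)
  case (Var s' i)
  then show ?case by (auto elim: has_sort.cases intro: has_sort.intros)
next
  case (App f ts)
  from App.prems obtain ss where ss: "ftype L f = Some (ss, s)" "list_all2 (has_sort L) ts ss"
    by (auto elim: has_sort.cases)
  have "list_all2 (has_sort L) (map (ren_tm r) ts) ss"
    using ss(2) App.IH by (auto simp: list_all2_conv_all_nth)
  with ss(1) show ?case by (auto intro: has_sort.intros)
qed

lemma wf_ren: "wf_fm L \<phi> \<Longrightarrow> wf_fm L (ren_fm r \<phi>)"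
proof (induction \<phi>)
  case (FRel q ts)
  then show ?case using has_sort_ren by (fastforce simp: list_all2_conv_all_nth)
qed (auto intro: has_sort_ren)

section \<open>Tuples over lists of sorts\<close>

lemma sel_upt: "b \<le> length xs \<Longrightarrow> map ((!) xs) [a..<b] = drop a (take b xs)"
  by (intro nth_equalityI) auto

lemma tuples_append: "e \<in> tuples M (ss @ ts) \<longleftrightarrow>
    take (length ss) e \<in> tuples M ss \<and> drop (length ss) e \<in> tuples M ts"
proof -
  have "list_all2 P e (ss @ ts) \<longleftrightarrow>
    list_all2 P (take (length ss) e) ss \<and> list_all2 P (drop (length ss) e) ts" for P
  proof
    assume "list_all2 P e (ss @ ts)"
    then obtain us vs where "e = us @ vs" "length us = length ss" "list_all2 P us ss" "list_all2 P vs ts"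
      by (auto simp: list_all2_append2)
    then show "list_all2 P (take (length ss) e) ss \<and> list_all2 P (drop (length ss) e) ts" by auto
  next
    assume "list_all2 P (take (length ss) e) ss \<and> list_all2 P (drop (length ss) e) ts"
    then show "list_all2 P e (ss @ ts)"
      by (metis append_take_drop_id list_all2_appendI)
  qed
  then show ?thesis by (auto simp: tuples_def)
qed

lemma tuples_length: "e \<in> tuples M ss \<Longrightarrow> length e = length ss"
  by (auto simp: tuples_def list_all2_lengthD)

lemma tuples_nth: "e \<in> tuples M ss \<Longrightarrow> i < length ss \<Longrightarrow> e ! i \<in> car M (ss ! i)"
  by (auto simp: tuples_def list_all2_conv_all_nth)

lemma tuples_Nil [simp]: "e \<in> tuples M [] \<longleftrightarrow> e = []"
  by (auto simp: tuples_def)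

lemma tuples_Cons: "e \<in> tuples M (s # ss) \<longleftrightarrow> (\<exists>x y. e = x # y \<and> x \<in> car M s \<and> y \<in> tuples M ss)"
  by (auto simp: tuples_def list_all2_Cons2)

lemma tuples_Cons' [simp]: "x # y \<in> tuples M (s # ss) \<longleftrightarrow> x \<in> car M s \<and> y \<in> tuples M ss"
  by (auto simp: tuples_def)

lemma tuples_appendI [intro]: "a \<in> tuples M ss \<Longrightarrow> b \<in> tuples M ts \<Longrightarrow> a @ b \<in> tuples M (ss @ ts)"
  by (auto simp: tuples_def list_all2_appendI)

lemma take_tuple [simp]: "a \<in> tuples M ss \<Longrightarrow> take (length ss) (a @ b) = a"
  by (drule tuples_length) simp

lemma drop_tuple [simp]: "a \<in> tuples M ss \<Longrightarrow> drop (length ss) (a @ b) = b"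
  by (drule tuples_length) simp

lemma take_tuple' [simp]: "a \<in> tuples M ss \<Longrightarrow> take (length ss) a = a"
  by (drule tuples_length) simp

lemma drop_tuple' [simp]: "a \<in> tuples M ss \<Longrightarrow> drop (length ss) a = []"
  by (drule tuples_length) simp

lemma nth_tuple [simp]: "a \<in> tuples M ss \<Longrightarrow> (a @ x # b) ! length ss = x"
  by (metis nth_append_length tuples_length)

lemma tuples_appendE:
  assumes "e \<in> tuples M (ss @ ts)"
  obtains a b where "e = a @ b" "a \<in> tuples M ss" "b \<in> tuples M ts"
  using assms by (metis append_take_drop_id tuples_append)

lemma tuples_sel: "e \<in> tuples M ss \<Longrightarrow> (\<And>i. i \<in> set is \<Longrightarrow> i < length ss) \<Longrightarrow>
    map ((!) e) is \<in> tuples M (map ((!) ss) is)"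
  by (auto simp: tuples_def list_all2_conv_all_nth)

declare take_append [simp del] drop_append [simp del]

lemma take_lengthL [simp]: "length a = n \<Longrightarrow> take n (a @ b) = a"
  by (simp add: take_append)

lemma drop_lengthL [simp]: "length a = n \<Longrightarrow> drop n (a @ b) = b"
  by (simp add: drop_append)

lemma drop_lengthL2 [simp]: "length a = n \<Longrightarrow> drop (n + m) (a @ b) = drop m b"
  by (simp add: drop_append)

lemma take_lengthL2 [simp]: "length a = n \<Longrightarrow> take (n + m) (a @ b) = a @ take m b"
  by (simp add: take_append)

lemma append_tuple_iff [simp]: "a \<in> tuples M ss \<Longrightarrow> a @ b \<in> tuples M (ss @ ts) \<longleftrightarrow> b \<in> tuples M ts"
  by (simp add: tuples_append)

lemma tuples_single [simp]: "e \<in> tuples M [s] \<longleftrightarrow> (\<exists>x\<in>car M s. e = [x])"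
  by (auto simp: tuples_Cons)

section \<open>Closure properties of definable sets\<close>

locale defn =
  fixes L :: "('f, 'r) lang" and M :: "('f, 'r, 'u) struct"
  assumes wfL: "wf_lang L" and struct: "is_struct L M" and VFs: "VF \<in> sorts L"
begin

definition dset0 :: "vsort list \<Rightarrow> ('u list \<Rightarrow> bool) \<Rightarrow> bool" where
  "dset0 ss P \<longleftrightarrow> definable L M ss {e \<in> tuples M ss. P e}"

lemma dset0_iff: "dset0 ss P \<longleftrightarrow> set ss \<subseteq> sorts L \<and>
   (\<exists>\<phi>. wf_fm L \<phi> \<and> free_vars \<phi> \<subseteq> {(ss ! j, j) |j. j < length ss} \<and>
          (\<forall>xs\<in>tuples M ss. P xs \<longleftrightarrow> sat M (\<lambda>(s, j). xs ! j) \<phi>))"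
  unfolding dset0_def definable_def by (intro conj_cong refl ex_cong1) auto

lemma dset0I: "\<lbrakk>set ss \<subseteq> sorts L; wf_fm L \<phi>; free_vars \<phi> \<subseteq> {(ss ! j, j) |j. j < length ss};
  (\<And>xs. xs\<in>tuples M ss \<Longrightarrow> P xs \<longleftrightarrow> sat M (\<lambda>(s, j). xs ! j) \<phi>)\<rbrakk> \<Longrightarrow> dset0 ss P"
  unfolding dset0_iff by blast

lemma dset0_cong: "(\<And>e. e \<in> tuples M ss \<Longrightarrow> P e = Q e) \<Longrightarrow> dset0 ss P = dset0 ss Q"
  unfolding dset0_iff by simp

lemma dset0_cong': "dset0 ss P \<Longrightarrow> (\<And>e. e \<in> tuples M ss \<Longrightarrow> P e = Q e) \<Longrightarrow> dset0 ss Q"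
  unfolding dset0_iff by simp

lemma dset0_not: assumes "dset0 ss P" shows "dset0 ss (\<lambda>e. \<not> P e)"
proof -
  obtain \<phi> where "set ss \<subseteq> sorts L" "wf_fm L \<phi>" "free_vars \<phi> \<subseteq> {(ss ! j, j) |j. j < length ss}"
   "\<forall>xs\<in>tuples M ss. P xs \<longleftrightarrow> sat M (\<lambda>(s, j). xs ! j) \<phi>" using assms unfolding dset0_iff by blast
  then show ?thesis by (intro dset0I[of _ "FNot \<phi>"]) auto
qed

lemma dset0_conj: assumes "dset0 ss P" "dset0 ss Q" shows "dset0 ss (\<lambda>e. P e \<and> Q e)"
proof -
  obtain \<phi> where 1: "set ss \<subseteq> sorts L" "wf_fm L \<phi>" "free_vars \<phi> \<subseteq> {(ss ! j, j) |j. j < length ss}"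
   "\<forall>xs\<in>tuples M ss. P xs \<longleftrightarrow> sat M (\<lambda>(s, j). xs ! j) \<phi>" using assms(1) unfolding dset0_iff by blast
  obtain \<psi> where 2: "wf_fm L \<psi>" "free_vars \<psi> \<subseteq> {(ss ! j, j) |j. j < length ss}"
   "\<forall>xs\<in>tuples M ss. Q xs \<longleftrightarrow> sat M (\<lambda>(s, j). xs ! j) \<psi>" using assms(2) unfolding dset0_iff by blast
  from 1 2 show ?thesis by (intro dset0I[of _ "FAnd \<phi> \<psi>"]) auto
qed

lemma has_sort_Var: "s \<in> sorts L \<Longrightarrow> has_sort L (Var s i) s"
  by (rule has_sort.intros)

lemma dset0_eqvar: assumes "set ss \<subseteq> sorts L" "i < length ss" "j < length ss" "ss ! i = ss ! j"
  shows "dset0 ss (\<lambda>e. e ! i = e ! j)"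
  by (rule dset0I[of _ "FEq (Var (ss ! i) i) (Var (ss ! j) j)"]) (use assms has_sort_Var[of "ss ! j"] in \<open>auto intro: nth_mem\<close>)

text \<open>The list \<open>ss\<close> may be empty, so truth is expressed by a closed formula over
  the valued field sort.\<close>

lemma dset0_True: assumes "set ss \<subseteq> sorts L" shows "dset0 ss (\<lambda>e. True)"
proof -
  have "car M VF \<noteq> {}" using struct VFs by (auto simp: is_struct_def)
  then show ?thesis
    by (intro dset0I[of _ "FEx VF 0 (FEq (Var VF 0) (Var VF 0))"]) (use assms VFs has_sort_Var in auto)
qed

lemma dset0_ball: fixes k :: nat assumes "set ss \<subseteq> sorts L" "\<And>j. j < k \<Longrightarrow> dset0 ss (P j)"
  shows "dset0 ss (\<lambda>e. \<forall>j<k. P j e)"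
  using assms(2)
proof (induction k)
  case 0
  then show ?case using dset0_True[OF assms(1)] by simp
next
  case (Suc k)
  have "(\<lambda>e. \<forall>j<Suc k. P j e) = (\<lambda>e. (\<forall>j<k. P j e) \<and> P k e)" by (auto simp: less_Suc_eq)
  then show ?case using dset0_conj[OF Suc.IH Suc.prems] Suc.prems by auto
qed

lemma dset0_ex: assumes "dset0 (ss @ [s]) P" shows "dset0 ss (\<lambda>e. \<exists>a\<in>car M s. P (e @ [a]))"
proof -
  let ?n = "length ss"
  obtain \<phi> where 1: "set (ss @ [s]) \<subseteq> sorts L" "wf_fm L \<phi>"
    "free_vars \<phi> \<subseteq> {((ss @ [s]) ! j, j) |j. j < length (ss @ [s])}"
   "\<forall>xs\<in>tuples M (ss @ [s]). P xs \<longleftrightarrow> sat M (\<lambda>(s, j). xs ! j) \<phi>" using assms unfolding dset0_iff by blast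
  show ?thesis
  proof (rule dset0I[of _ "FEx s ?n \<phi>"])
    show "free_vars (FEx s ?n \<phi>) \<subseteq> {(ss ! j, j) |j. j < length ss}"
    proof
      fix x assume x: "x \<in> free_vars (FEx s ?n \<phi>)"
      then obtain j where j: "x = ((ss @ [s]) ! j, j)" "j < Suc ?n" using 1(3) by auto
      then have "j \<noteq> ?n" using x by auto
      then show "x \<in> {(ss ! j, j) |j. j < length ss}" using j by (auto simp: nth_append)
    qed
  next
    fix xs assume xs: "xs \<in> tuples M ss"
    have "P (xs @ [a]) \<longleftrightarrow> sat M ((\<lambda>(s, j). xs ! j)((s, ?n) := a)) \<phi>" if a: "a \<in> car M s" for a
    proof -
      have "P (xs @ [a]) \<longleftrightarrow> sat M (\<lambda>(s, j). (xs @ [a]) ! j) \<phi>"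
        by (rule 1(4)[rule_format]) (use xs a in auto)
      also have "\<dots> \<longleftrightarrow> sat M ((\<lambda>(s, j). xs ! j)((s, ?n) := a)) \<phi>"
      proof (rule sat_cong)
        fix x assume "x \<in> free_vars \<phi>"
        then obtain j where j: "x = ((ss @ [s]) ! j, j)" "j < Suc ?n" using 1(3) by auto
        have len: "length xs = ?n" using xs by (rule tuples_length)
        show "(case x of (s, j) \<Rightarrow> (xs @ [a]) ! j) = ((\<lambda>(s, j). xs ! j)((s, ?n) := a)) x"
          using j len by (cases "j = ?n") (auto simp: nth_append)
      qed
      finally show ?thesis .
    qed
    then show "(\<exists>a\<in>car M s. P (xs @ [a])) \<longleftrightarrow> sat M (\<lambda>(s, j). xs ! j) (FEx s ?n \<phi>)" by simp
  qed (use 1 in auto)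
qed

lemma dset0_exB: "dset0 (ss @ ts) P \<Longrightarrow> dset0 ss (\<lambda>e. \<exists>b\<in>tuples M ts. P (e @ b))"
proof (induction ts arbitrary: P rule: rev_induct)
  case (snoc t ts)
  have "dset0 (ss @ ts) (\<lambda>e. \<exists>a\<in>car M t. P (e @ [a]))"
    by (rule dset0_ex) (use snoc.prems in simp)
  from snoc.IH[OF this] have "dset0 ss (\<lambda>e. \<exists>b\<in>tuples M ts. \<exists>a\<in>car M t. P ((e @ b) @ [a]))" .
  moreover have "(\<lambda>e. \<exists>b\<in>tuples M ts. \<exists>a\<in>car M t. P ((e @ b) @ [a])) =
      (\<lambda>e. \<exists>b\<in>tuples M (ts @ [t]). P (e @ b))"
    by (auto simp: fun_eq_iff tuples_Cons elim!: tuples_appendE) (metis append_assoc tuples_appendI tuples_Cons' tuples_Nil)+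
  ultimately show ?case by simp
qed simp

lemma dset0_drop: assumes "dset0 ts R" "set ss \<subseteq> sorts L" shows "dset0 (ss @ ts) (\<lambda>z. R (drop (length ss) z))"
proof -
  let ?n = "length ss" let ?r = "\<lambda>i. i + ?n"
  have inj: "inj ?r" by (auto simp: inj_def)
  obtain \<phi> where 1: "set ts \<subseteq> sorts L" "wf_fm L \<phi>" "free_vars \<phi> \<subseteq> {(ts ! j, j) |j. j < length ts}"
   "\<forall>xs\<in>tuples M ts. R xs \<longleftrightarrow> sat M (\<lambda>(s, j). xs ! j) \<phi>" using assms(1) unfolding dset0_iff by blast
  show ?thesis
  proof (rule dset0I[of _ "ren_fm ?r \<phi>"])
    show "free_vars (ren_fm ?r \<phi>) \<subseteq> {((ss @ ts) ! j, j) |j. j < length (ss @ ts)}"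
      using 1(3) by (force simp: free_vars_ren[OF inj] nth_append)
    fix xs assume "xs \<in> tuples M (ss @ ts)"
    then obtain a b where ab: "xs = a @ b" "a \<in> tuples M ss" "b \<in> tuples M ts" by (rule tuples_appendE)
    have "R b \<longleftrightarrow> sat M (\<lambda>(s, j). b ! j) \<phi>" using 1(4) ab by blast
    also have "\<dots> = sat M (\<lambda>(s, j). xs ! j) (ren_fm ?r \<phi>)"
      unfolding sat_ren[OF inj] using ab tuples_length[OF ab(2)]
      by (intro sat_cong) (auto simp: nth_append)
    finally show "R (drop ?n xs) \<longleftrightarrow> sat M (\<lambda>(s, j). xs ! j) (ren_fm ?r \<phi>)" using ab by simp
  qed (use 1 assms wf_ren in auto)
qed

lemma dset0_sorts: "dset0 ss P \<Longrightarrow> set ss \<subseteq> sorts L"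
  by (auto simp: dset0_iff)

text \<open>Selected coordinates may repeat, so \<open>is\<close> need not come from an injective
  renaming. The selection is introduced as a block of new variables, tied to the old ones by
  equations and then quantified away.\<close>

lemma dset0_sel: assumes R: "dset0 ts R" and ts: "ts = map ((!) ss) is" and i: "\<And>i. i \<in> set is \<Longrightarrow> i < length ss"
    and ss: "set ss \<subseteq> sorts L"
  shows "dset0 ss (\<lambda>e. R (map ((!) e) is))"
proof -
  let ?n = "length ss"
  have "dset0 (ss @ ts) (\<lambda>z. R (drop ?n z) \<and> (\<forall>j<length is. z ! (?n + j) = z ! (is ! j)))"
    using ss dset0_sorts[OF R] i
    by (intro dset0_conj dset0_drop R dset0_ball dset0_eqvar) (auto simp: ts nth_append less_Suc_eq trans_less_add1)
  from dset0_exB[OF this]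
  have "dset0 ss (\<lambda>e. \<exists>b\<in>tuples M ts. R (drop ?n (e @ b)) \<and> (\<forall>j<length is. (e @ b) ! (?n + j) = (e @ b) ! (is ! j)))" .
  moreover have "(\<exists>b\<in>tuples M ts. R (drop ?n (e @ b)) \<and> (\<forall>j<length is. (e @ b) ! (?n + j) = (e @ b) ! (is ! j)))
      \<longleftrightarrow> R (map ((!) e) is)" if e: "e \<in> tuples M ss" for e
  proof -
    have len: "length e = ?n" using e by (rule tuples_length)
    have *: "(\<forall>j<length is. (e @ b) ! (?n + j) = (e @ b) ! (is ! j)) \<longleftrightarrow> b = map ((!) e) is"
      if "b \<in> tuples M ts" for b
    proof
      have l: "length b = length is" using tuples_length[OF that] by (simp add: ts)
      assume "\<forall>j<length is. (e @ b) ! (?n + j) = (e @ b) ! (is ! j)"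
      then show "b = map ((!) e) is"
        using l i len by (intro nth_equalityI) (auto simp: nth_append)
    next
      assume "b = map ((!) e) is"
      then show "\<forall>j<length is. (e @ b) ! (?n + j) = (e @ b) ! (is ! j)"
        using i len by (auto simp: nth_append)
    qed
    have "map ((!) e) is \<in> tuples M ts" unfolding ts by (rule tuples_sel[OF e i])
    moreover have "drop ?n (e @ b) = b" for b using len by simp
    ultimately show ?thesis using * by (auto simp del: ex_simps)
  qed
  ultimately show ?thesis by (rule dset0_cong')
qed

text \<open>The flag \<open>b\<close> says whether parameters from the structure are allowed.\<close>

definition dset :: "bool \<Rightarrow> vsort list \<Rightarrow> ('u list \<Rightarrow> bool) \<Rightarrow> bool" where
  "dset b ss P \<longleftrightarrow> (\<exists>ts ps E. (\<not> b \<longrightarrow> ts = []) \<and> ps \<in> tuples M ts \<and> dset0 (ts @ ss) E \<and>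
      (\<forall>e\<in>tuples M ss. P e \<longleftrightarrow> E (ps @ e)))"

lemma dset_False: "dset False ss P \<longleftrightarrow> dset0 ss P"
proof
  assume "dset False ss P"
  then obtain E where "dset0 ss E" "\<forall>e\<in>tuples M ss. P e \<longleftrightarrow> E e" unfolding dset_def by auto
  then show "dset0 ss P" using dset0_cong[of ss P E] by auto
next
  assume "dset0 ss P"
  then show "dset False ss P" unfolding dset_def by (intro exI[of _ "[]"] exI[of _ P]) auto
qed

lemma dset_cong: "(\<And>e. e \<in> tuples M ss \<Longrightarrow> P e = Q e) \<Longrightarrow> dset b ss P = dset b ss Q"
  unfolding dset_def by simp

lemma dset_cong': "dset b ss P \<Longrightarrow> (\<And>e. e \<in> tuples M ss \<Longrightarrow> P e = Q e) \<Longrightarrow> dset b ss Q"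
  unfolding dset_def by auto

lemma dset_mono: "dset False ss P \<Longrightarrow> dset b ss P"
  unfolding dset_def by blast

lemma dset_sorts: "dset b ss P \<Longrightarrow> set ss \<subseteq> sorts L"
  unfolding dset_def using dset0_sorts by fastforce

lemma dset_not: "dset b ss P \<Longrightarrow> dset b ss (\<lambda>e. \<not> P e)"
  unfolding dset_def using dset0_not by blast

lemma sel_blocks:
  assumes "e \<in> tuples M ss" "f \<in> tuples M ts"
  shows "map ((!) (e @ f)) [0..<length ss] = e" "map ((!) (e @ f)) [length ss..<length ss + length ts] = f"
  using tuples_length[OF assms(1)] tuples_length[OF assms(2)]
  by (auto simp: sel_upt)

lemma dset_conj: assumes "dset b ss P" "dset b ss Q" shows "dset b ss (\<lambda>e. P e \<and> Q e)"
proof -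
  obtain ts ps E where 1: "\<not> b \<longrightarrow> ts = []" "ps \<in> tuples M ts" "dset0 (ts @ ss) E"
      "\<forall>e\<in>tuples M ss. P e \<longleftrightarrow> E (ps @ e)" using assms(1) unfolding dset_def by blast
  obtain us qs G where 2: "\<not> b \<longrightarrow> us = []" "qs \<in> tuples M us" "dset0 (us @ ss) G"
      "\<forall>e\<in>tuples M ss. Q e \<longleftrightarrow> G (qs @ e)" using assms(2) unfolding dset_def by blast
  let ?c = "(ts @ us) @ ss"
  \<comment> \<open>The parameter lists of the two sets are concatenated; \<open>?i1\<close> skips
    the block that belongs to the other set.\<close>
  let ?i1 = "[0..<length ts] @ [length ts + length us..<length ts + length us + length ss]"
  have s: "set ?c \<subseteq> sorts L" using dset0_sorts[OF 1(3)] dset0_sorts[OF 2(3)] by auto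
  have "dset0 ?c (\<lambda>z. E (map ((!) z) ?i1) \<and> G (drop (length ts) z))"
  proof (rule dset0_conj)
    show "dset0 ?c (\<lambda>z. E (map ((!) z) ?i1))"
      by (rule dset0_sel[OF 1(3)]) (use s in \<open>auto simp: sel_upt\<close>)
    show "dset0 ?c (\<lambda>z. G (drop (length ts) z))"
      using dset0_drop[OF 2(3), of ts] s by simp
  qed
  moreover have "(E (map ((!) ((ps @ qs) @ e)) ?i1) \<and> G (drop (length ts) ((ps @ qs) @ e))) \<longleftrightarrow> P e \<and> Q e"
    if e: "e \<in> tuples M ss" for e
  proof -
    have "map ((!) ((ps @ qs) @ e)) ?i1 = ps @ e"
      using tuples_length[OF 1(2)] tuples_length[OF 2(2)] tuples_length[OF e]
      by (auto simp: sel_upt)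
    moreover have "drop (length ts) ((ps @ qs) @ e) = qs @ e" using tuples_length[OF 1(2)] by simp
    ultimately show ?thesis using 1(4) 2(4) e by metis
  qed
  moreover have "\<not> b \<longrightarrow> ts @ us = []" "ps @ qs \<in> tuples M (ts @ us)" using 1 2 by auto
  ultimately show ?thesis unfolding dset_def by blast
qed

lemma dset_exB': assumes "dset b (ss @ ts) P" shows "dset b ss (\<lambda>e. \<exists>c\<in>tuples M ts. P (e @ c))"
proof -
  obtain us ps E where 1: "\<not> b \<longrightarrow> us = []" "ps \<in> tuples M us" "dset0 (us @ (ss @ ts)) E"
      "\<forall>e\<in>tuples M (ss @ ts). P e \<longleftrightarrow> E (ps @ e)" using assms(1) unfolding dset_def by blast
  have "dset0 (us @ ss) (\<lambda>e. \<exists>c\<in>tuples M ts. E (e @ c))"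
    by (rule dset0_exB) (use 1(3) in simp)
  moreover have "(\<exists>c\<in>tuples M ts. P (e @ c)) \<longleftrightarrow> (\<exists>c\<in>tuples M ts. E ((ps @ e) @ c))"
    if "e \<in> tuples M ss" for e
    using 1(4) that by auto
  ultimately show ?thesis unfolding dset_def using 1 by blast
qed

lemma dset_sel: assumes R: "dset b ts R" and ts: "ts = map ((!) ss) is" and i: "\<And>i. i \<in> set is \<Longrightarrow> i < length ss"
    and ss: "set ss \<subseteq> sorts L"
  shows "dset b ss (\<lambda>e. R (map ((!) e) is))"
proof -
  obtain us ps E where 1: "\<not> b \<longrightarrow> us = []" "ps \<in> tuples M us" "dset0 (us @ ts) E"
      "\<forall>e\<in>tuples M ts. R e \<longleftrightarrow> E (ps @ e)" using R unfolding dset_def by blast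
  let ?is = "[0..<length us] @ map (\<lambda>i. length us + i) is"
  have "dset0 (us @ ss) (\<lambda>e. E (map ((!) e) ?is))"
    by (rule dset0_sel[OF 1(3)]) (use ts i ss dset0_sorts[OF 1(3)] in \<open>auto simp: sel_upt\<close>)
  moreover have "R (map ((!) e) is) \<longleftrightarrow> E (map ((!) (ps @ e)) ?is)" if e: "e \<in> tuples M ss" for e
  proof -
    have "map ((!) (ps @ e)) ?is = ps @ map ((!) e) is"
      using tuples_length[OF 1(2)] by (auto simp: sel_upt nth_append take_append)
    moreover have "map ((!) e) is \<in> tuples M ts" unfolding ts by (rule tuples_sel[OF e i])
    ultimately show ?thesis using 1(4) by metis
  qed
  ultimately show ?thesis unfolding dset_def using 1 by blast
qed

lemma dset_drop: assumes "dset b ts R" "set ss \<subseteq> sorts L" shows "dset b (ss @ ts) (\<lambda>z. R (drop (length ss) z))"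
proof -
  have "dset b (ss @ ts) (\<lambda>z. R (map ((!) z) [length ss..<length ss + length ts]))"
    by (rule dset_sel[OF assms(1)]) (use assms(2) dset_sorts[OF assms(1)] in \<open>auto simp: sel_upt\<close>)
  moreover have "map ((!) z) [length ss..<length ss + length ts] = drop (length ss) z" if "z \<in> tuples M (ss @ ts)" for z
    using that by (elim tuples_appendE) (simp add: sel_blocks tuples_length)
  ultimately show ?thesis using dset_cong[of "ss @ ts"] by (smt (verit))
qed

lemma dset_take: assumes "dset b ss R" "set ts \<subseteq> sorts L" shows "dset b (ss @ ts) (\<lambda>z. R (take (length ss) z))"
proof -
  have "dset b (ss @ ts) (\<lambda>z. R (map ((!) z) [0..<length ss]))"
    by (rule dset_sel[OF assms(1)]) (use assms(2) dset_sorts[OF assms(1)] in \<open>auto simp: sel_upt\<close>)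
  moreover have "map ((!) z) [0..<length ss] = take (length ss) z" if "z \<in> tuples M (ss @ ts)" for z
    using that by (elim tuples_appendE) (simp add: sel_blocks tuples_length)
  ultimately show ?thesis using dset_cong[of "ss @ ts"] by (smt (verit))
qed

section \<open>Definable maps and terms\<close>

definition dmap :: "bool \<Rightarrow> vsort list \<Rightarrow> vsort list \<Rightarrow> ('u list \<Rightarrow> 'u list) \<Rightarrow> bool" where
  "dmap b ss ts a \<longleftrightarrow> set ss \<subseteq> sorts L \<and> set ts \<subseteq> sorts L \<and> (\<forall>e\<in>tuples M ss. a e \<in> tuples M ts) \<and>
     dset b (ss @ ts) (\<lambda>z. a (take (length ss) z) = drop (length ss) z)"

definition dtm :: "bool \<Rightarrow> vsort list \<Rightarrow> vsort \<Rightarrow> ('u list \<Rightarrow> 'u) \<Rightarrow> bool" where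
  "dtm b ss s t \<longleftrightarrow> dmap b ss [s] (\<lambda>e. [t e])"

lemma dmap_tuples: "dmap b ss ts a \<Longrightarrow> e \<in> tuples M ss \<Longrightarrow> a e \<in> tuples M ts"
  by (simp add: dmap_def)

lemma dtm_car: "dtm b ss s t \<Longrightarrow> e \<in> tuples M ss \<Longrightarrow> t e \<in> car M s"
  by (auto simp: dtm_def dest: dmap_tuples)

lemma dmap_mono: "dmap False ss ts a \<Longrightarrow> dmap b ss ts a"
  by (auto simp: dmap_def dset_mono)

lemma dtm_mono: "dtm False ss s t \<Longrightarrow> dtm b ss s t"
  by (auto simp: dtm_def dmap_mono)

lemma dmap_sorts: "dmap b ss ts a \<Longrightarrow> set ss \<subseteq> sorts L \<and> set ts \<subseteq> sorts L"
  by (simp add: dmap_def)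

text \<open>Substitution by means of the graph: the value of the map is quantified over and tied to
  its argument.\<close>

lemma dset_rel: assumes R: "dset b ts R" and a: "dmap b ss ts a" shows "dset b ss (\<lambda>e. R (a e))"
proof -
  have "dset b (ss @ ts) (\<lambda>z. a (take (length ss) z) = drop (length ss) z \<and> R (drop (length ss) z))"
    using a by (intro dset_conj dset_drop R) (auto simp: dmap_def)
  from dset_exB'[OF this] show ?thesis
    by (rule dset_cong') (use dmap_tuples[OF a] in auto)
qed

lemma dset_imp: "dset b ss P \<Longrightarrow> dset b ss Q \<Longrightarrow> dset b ss (\<lambda>e. P e \<longrightarrow> Q e)"
  using dset_not[OF dset_conj[of b ss P "\<lambda>e. \<not> Q e", OF _ dset_not]] by simp

lemma dset_disj: "dset b ss P \<Longrightarrow> dset b ss Q \<Longrightarrow> dset b ss (\<lambda>e. P e \<or> Q e)"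
  using dset_imp[of b ss "\<lambda>e. \<not> P e" Q, OF dset_not] by (simp add: disj_imp)

lemma dset_iff: "dset b ss P \<Longrightarrow> dset b ss Q \<Longrightarrow> dset b ss (\<lambda>e. P e \<longleftrightarrow> Q e)"
  by (simp only: iff_conv_conj_imp) (intro dset_conj dset_imp)

lemma dset_const: "set ss \<subseteq> sorts L \<Longrightarrow> dset b ss (\<lambda>e. c)"
proof -
  assume "set ss \<subseteq> sorts L"
  then have *: "dset b ss (\<lambda>e. True)" by (simp add: dset_False dset0_True dset_mono)
  show ?thesis using * dset_not[OF *] by (cases c) auto
qed

lemma dset_exB: "dset b (ss @ ts) (\<lambda>z. P (take (length ss) z) (drop (length ss) z)) \<Longrightarrow>
    dset b ss (\<lambda>e. \<exists>c\<in>tuples M ts. P e c)"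
  by (drule dset_exB', erule dset_cong') auto

lemma dset_ex: "dset b (ss @ [s]) (\<lambda>z. P (take (length ss) z) (z ! length ss)) \<Longrightarrow>
    dset b ss (\<lambda>e. \<exists>a\<in>car M s. P e a)"
proof (drule dset_exB', erule dset_cong')
  fix e assume e: "e \<in> tuples M ss"
  have "(\<exists>c\<in>tuples M [s]. P (take (length ss) (e @ c)) ((e @ c) ! length ss)) \<longleftrightarrow>
     (\<exists>a\<in>car M s. P (take (length ss) (e @ [a])) ((e @ [a]) ! length ss))" by auto
  then show "(\<exists>c\<in>tuples M [s]. P (take (length ss) (e @ c)) ((e @ c) ! length ss)) \<longleftrightarrow> (\<exists>a\<in>car M s. P e a)"
    using e by simp
qed

lemma dset_all: "dset b (ss @ [s]) (\<lambda>z. P (take (length ss) z) (z ! length ss)) \<Longrightarrow>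
    dset b ss (\<lambda>e. \<forall>a\<in>car M s. P e a)"
  using dset_not[OF dset_ex[OF dset_not, of b ss s P]] by simp

lemma dset_allB: "dset b (ss @ ts) (\<lambda>z. P (take (length ss) z) (drop (length ss) z)) \<Longrightarrow>
    dset b ss (\<lambda>e. \<forall>c\<in>tuples M ts. P e c)"
  using dset_not[OF dset_exB[OF dset_not, of b ss ts P]] by simp

lemma dset_finall: fixes k :: nat assumes "set ss \<subseteq> sorts L" "\<And>j. j < k \<Longrightarrow> dset b ss (P j)"
  shows "dset b ss (\<lambda>e. \<forall>j<k. P j e)"
  using assms(2)
proof (induction k)
  case 0
  then show ?case using dset_const[OF assms(1)] by simp
next
  case (Suc k)
  have "(\<lambda>e. \<forall>j<Suc k. P j e) = (\<lambda>e. (\<forall>j<k. P j e) \<and> P k e)" by (auto simp: less_Suc_eq)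
  then show ?case using dset_conj[OF Suc.IH Suc.prems] Suc.prems by auto
qed

lemma dset_finex: fixes k :: nat assumes "set ss \<subseteq> sorts L" "\<And>j. j < k \<Longrightarrow> dset b ss (P j)"
  shows "dset b ss (\<lambda>e. \<exists>j<k. P j e)"
proof -
  have "dset b ss (\<lambda>e. \<not> (\<forall>j<k. \<not> P j e))"
    by (intro dset_not dset_finall assms)
  then show ?thesis by simp
qed

lemma dset_eqnth: "\<lbrakk>set ss \<subseteq> sorts L; i < length ss; j < length ss; ss ! i = ss ! j\<rbrakk> \<Longrightarrow> dset b ss (\<lambda>e. e ! i = e ! j)"
  by (simp add: dset0_eqvar dset_False dset_mono)

lemma dmap_sel: assumes "ts = map ((!) ss) is" "\<And>i. i \<in> set is \<Longrightarrow> i < length ss" "set ss \<subseteq> sorts L"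
  shows "dmap b ss ts (\<lambda>e. map ((!) e) is)"
proof -
  have s: "set ts \<subseteq> sorts L" using assms by (auto intro!: subsetD[OF assms(3)] nth_mem)
  have "dset b (ss @ ts) (\<lambda>z. \<forall>j<length is. z ! (is ! j) = z ! (length ss + j))"
    using assms s by (intro dset_finall dset_eqnth) (auto simp: nth_append trans_less_add1)
  then have "dset b (ss @ ts) (\<lambda>z. map ((!) (take (length ss) z)) is = drop (length ss) z)"
  proof (rule dset_cong')
    fix z assume "z \<in> tuples M (ss @ ts)"
    then obtain e c where "z = e @ c" "e \<in> tuples M ss" "c \<in> tuples M ts" by (rule tuples_appendE)
    then show "(\<forall>j<length is. z ! (is ! j) = z ! (length ss + j)) \<longleftrightarrow>
        map ((!) (take (length ss) z)) is = drop (length ss) z"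
      using tuples_length[of e M ss] tuples_length[of c M ts] assms(1,2)
      by (auto simp: nth_append intro!: nth_equalityI dest!: arg_cong[where f = "\<lambda>l. \<forall>j<length is. l ! j = c ! j"])
  qed
  then show ?thesis using assms s unfolding dmap_def by (auto intro: tuples_sel)
qed

lemma dmap_cong': "dmap b ss ts f \<Longrightarrow> (\<And>e. e \<in> tuples M ss \<Longrightarrow> f e = g e) \<Longrightarrow> dmap b ss ts g"
  unfolding dmap_def by (auto elim!: dset_cong' tuples_appendE)

lemma dtm_cong': "dtm b ss s f \<Longrightarrow> (\<And>e. e \<in> tuples M ss \<Longrightarrow> f e = g e) \<Longrightarrow> dtm b ss s g"
  unfolding dtm_def by (auto elim!: dmap_cong')

lemma dmap_id: "set ss \<subseteq> sorts L \<Longrightarrow> dmap b ss ss (\<lambda>e. e)"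
  by (rule dmap_cong'[OF dmap_sel[of _ _ "[0..<length ss]"]])
    (auto simp: sel_upt tuples_length)

lemma dmap_append: assumes "dmap b ss ts a" "dmap b ss us c" shows "dmap b ss (ts @ us) (\<lambda>e. a e @ c e)"
proof -
  let ?i = "[0..<length ss] @ [length ss + length ts..<length ss + length ts + length us]"
  let ?s = "ss @ (ts @ us)"
  have s: "set ?s \<subseteq> sorts L" using assms by (auto simp: dmap_def)
  have "dset b ?s (\<lambda>z. a (take (length ss) (take (length (ss @ ts)) z)) = drop (length ss) (take (length (ss @ ts)) z)
     \<and> c (take (length ss) (map ((!) z) ?i)) = drop (length ss) (map ((!) z) ?i))"
  proof (rule dset_conj)
    have "dset b (ss @ ts) (\<lambda>z. a (take (length ss) z) = drop (length ss) z)" using assms by (simp add: dmap_def)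
    from dset_take[OF this, of us]
    show "dset b ?s (\<lambda>z. a (take (length ss) (take (length (ss @ ts)) z)) = drop (length ss) (take (length (ss @ ts)) z))"
      using s by simp
    show "dset b ?s (\<lambda>z. c (take (length ss) (map ((!) z) ?i)) = drop (length ss) (map ((!) z) ?i))"
      by (rule dset_sel[of b "ss @ us" "\<lambda>z. c (take (length ss) z) = drop (length ss) z"])
        (use assms s in \<open>auto simp: dmap_def sel_upt\<close>)
  qed
  then have "dset b ?s (\<lambda>z. a (take (length ss) z) @ c (take (length ss) z) = drop (length ss) z)"
  proof (rule dset_cong')
    fix z assume "z \<in> tuples M ?s"
    then obtain e x y where z: "z = e @ x @ y" "e \<in> tuples M ss" "x \<in> tuples M ts" "y \<in> tuples M us"
      by (auto elim!: tuples_appendE)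
    have i: "map ((!) z) ?i = e @ y"
      using tuples_length[OF z(2)] tuples_length[OF z(3)] tuples_length[OF z(4)] z(1)
      by (auto simp: sel_upt)
    have l: "length (a e) = length x"
      using tuples_length[OF z(3)] tuples_length[OF dmap_tuples[OF assms(1) z(2)]] by simp
    have t: "take (length (ss @ ts)) z = e @ x" using tuples_length[OF z(2)] tuples_length[OF z(3)] z(1) by simp
    show "(a (take (length ss) (take (length (ss @ ts)) z)) = drop (length ss) (take (length (ss @ ts)) z)
     \<and> c (take (length ss) (map ((!) z) ?i)) = drop (length ss) (map ((!) z) ?i)) \<longleftrightarrow>
     (a (take (length ss) z) @ c (take (length ss) z) = drop (length ss) z)"
      unfolding i t using z l by (simp add: append_eq_append_conv)
  qed
  then show ?thesis using assms s by (auto simp: dmap_def)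
qed

lemma dset_eq: assumes "dmap b ss ts a" "dmap b ss ts c" shows "dset b ss (\<lambda>e. a e = c e)"
proof -
  let ?id = "\<lambda>e. e"
  have "dmap b ss (ss @ ts) (\<lambda>e. ?id e @ c e)"
    by (rule dmap_append) (use assms dmap_id dmap_sorts in blast)+
  from dset_rel[OF _ this] assms(1)
  have "dset b ss (\<lambda>e. a (take (length ss) (e @ c e)) = drop (length ss) (e @ c e))"
    unfolding dmap_def by blast
  then show ?thesis by (rule dset_cong') auto
qed

lemma dmap_comp: assumes "dmap b ts us c" "dmap b ss ts a" shows "dmap b ss us (\<lambda>e. c (a e))"
proof -
  have s: "set ss \<subseteq> sorts L" "set ts \<subseteq> sorts L" "set us \<subseteq> sorts L" using assms dmap_sorts by auto
  have "dmap b (ss @ us) ss (\<lambda>z. take (length ss) z)"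
    by (rule dmap_cong'[OF dmap_sel[of _ _ "[0..<length ss]"]])
      (use s in \<open>auto simp: sel_upt tuples_length\<close>)
  have d: "dmap b (ss @ us) us (\<lambda>z. drop (length ss) z)"
    by (rule dmap_cong'[OF dmap_sel[of _ _ "[length ss..<length ss + length us]"]])
      (use s in \<open>auto simp: sel_upt tuples_length\<close>)
  have "dset b ((ss @ us) @ ts) (\<lambda>z. a (take (length ss) (take (length (ss @ us)) z)) = drop (length (ss @ us)) z)"
  proof -
    let ?i = "[0..<length ss] @ [length ss + length us..<length ss + length us + length ts]"
    have "dset b ((ss @ us) @ ts) (\<lambda>z. a (take (length ss) (map ((!) z) ?i)) = drop (length ss) (map ((!) z) ?i))"
      by (rule dset_sel[of b "ss @ ts" "\<lambda>z. a (take (length ss) z) = drop (length ss) z"])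
        (use assms s in \<open>auto simp: dmap_def sel_upt\<close>)
    then show ?thesis
    proof (rule dset_cong')
      fix z assume "z \<in> tuples M ((ss @ us) @ ts)"
      then obtain e x y where z: "z = (e @ x) @ y" "e \<in> tuples M ss" "x \<in> tuples M us" "y \<in> tuples M ts"
        by (auto elim!: tuples_appendE)
      have i: "map ((!) z) ?i = e @ y" "take (length (ss @ us)) z = e @ x" "drop (length (ss @ us)) z = y"
        using tuples_length[OF z(2)] tuples_length[OF z(3)] tuples_length[OF z(4)] z(1)
        by (auto simp: sel_upt)
      show "(a (take (length ss) (map ((!) z) ?i)) = drop (length ss) (map ((!) z) ?i)) \<longleftrightarrow>
        (a (take (length ss) (take (length (ss @ us)) z)) = drop (length (ss @ us)) z)"
        unfolding i using z by simp
    qed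
  qed
  then have "dmap b (ss @ us) ts (\<lambda>z. a (take (length ss) z))"
    unfolding dmap_def using s assms(2) by (auto simp: dmap_def elim!: tuples_appendE)
  from dmap_append[OF this d]
  have "dmap b (ss @ us) (ts @ us) (\<lambda>z. a (take (length ss) z) @ drop (length ss) z)" .
  from dset_rel[OF _ this] assms(1)
  have "dset b (ss @ us) (\<lambda>z. c (take (length ts) (a (take (length ss) z) @ drop (length ss) z)) =
      drop (length ts) (a (take (length ss) z) @ drop (length ss) z))"
    unfolding dmap_def by blast
  then have "dset b (ss @ us) (\<lambda>z. c (a (take (length ss) z)) = drop (length ss) z)"
    by (rule dset_cong') (use tuples_length[OF dmap_tuples[OF assms(2)]] in \<open>auto elim!: tuples_appendE\<close>)
  then show ?thesis using assms s by (auto simp: dmap_def)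
qed

lemma dmap_take: assumes "dmap b ss ts a" "us = take n ts" shows "dmap b ss us (\<lambda>e. take n (a e))"
proof -
  have s: "set ts \<subseteq> sorts L" using assms dmap_sorts by auto
  have "dmap b ts us (\<lambda>e. take n e)"
    by (rule dmap_cong'[OF dmap_sel[of _ _ "[0..<min n (length ts)]"]])
      (use s assms in \<open>auto simp: sel_upt tuples_length min_def split: if_splits\<close>)
  from dmap_comp[OF this assms(1)] show ?thesis .
qed

lemma dmap_drop: assumes "dmap b ss ts a" "us = drop n ts" shows "dmap b ss us (\<lambda>e. drop n (a e))"
proof -
  have s: "set ts \<subseteq> sorts L" using assms dmap_sorts by auto
  have "dmap b ts us (\<lambda>e. drop n e)"
    by (rule dmap_cong'[OF dmap_sel[of _ _ "[n..<length ts]"]])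
      (use s assms in \<open>auto simp: sel_upt tuples_length\<close>)
  from dmap_comp[OF this assms(1)] show ?thesis .
qed

lemma dmap_tl: assumes "dmap b ss (s # ts) a" shows "dmap b ss ts (\<lambda>e. tl (a e))"
  using dmap_drop[OF assms, of ts 1] by (simp add: drop_Suc)

lemma dtm_nth: assumes "dmap b ss ts a" "n < length ts" "s = ts ! n" shows "dtm b ss s (\<lambda>e. a e ! n)"
proof -
  have s: "set ts \<subseteq> sorts L" using assms dmap_sorts by auto
  have "dmap b ts [s] (\<lambda>e. [e ! n])"
    by (rule dmap_cong'[OF dmap_sel[of _ _ "[n]"]]) (use s assms in auto)
  from dmap_comp[OF this assms(1)] show ?thesis by (simp add: dtm_def)
qed

lemma dtm_hd: assumes "dmap b ss (s # ts) a" shows "dtm b ss s (\<lambda>e. hd (a e))"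
  by (rule dtm_cong'[OF dtm_nth[OF assms, of 0 s]]) (use dmap_tuples[OF assms] in \<open>force simp: tuples_Cons\<close>)+

lemma dmap_Cons: "dtm b ss s t \<Longrightarrow> dmap b ss ts a \<Longrightarrow> dmap b ss (s # ts) (\<lambda>e. t e # a e)"
  using dmap_append[of b ss "[s]" "\<lambda>e. [t e]" ts a] by (simp add: dtm_def)

lemma dmap_Nil: "set ss \<subseteq> sorts L \<Longrightarrow> dmap b ss [] (\<lambda>e. [])"
  by (rule dmap_cong'[OF dmap_sel[of _ _ "[]"]]) auto

lemma dmap_lift: "dmap b ss us a \<Longrightarrow> set ts \<subseteq> sorts L \<Longrightarrow> dmap b (ss @ ts) us (\<lambda>z. a (take (length ss) z))"
  by (rule dmap_comp[OF _ dmap_take[OF dmap_id]]) (auto dest: dmap_sorts)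

lemma dtm_lift: "dtm b ss s t \<Longrightarrow> set ts \<subseteq> sorts L \<Longrightarrow> dtm b (ss @ ts) s (\<lambda>z. t (take (length ss) z))"
  unfolding dtm_def by (rule dmap_lift)

lemma dtm_last: "set ss \<subseteq> sorts L \<Longrightarrow> s \<in> sorts L \<Longrightarrow> dtm b (ss @ [s]) s (\<lambda>z. z ! length ss)"
  by (rule dtm_nth[OF dmap_id]) auto

lemma dmap_last: "set ss \<subseteq> sorts L \<Longrightarrow> set ts \<subseteq> sorts L \<Longrightarrow> dmap b (ss @ ts) ts (\<lambda>z. drop (length ss) z)"
  by (rule dmap_drop[OF dmap_id]) auto

lemma dtm_app: "dtm b ts s t \<Longrightarrow> dmap b ss ts a \<Longrightarrow> dtm b ss s (\<lambda>e. t (a e))"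
  unfolding dtm_def by (rule dmap_comp)

lemma dset_eqt: "dtm b ss s t \<Longrightarrow> dtm b ss s u \<Longrightarrow> dset b ss (\<lambda>e. t e = u e)"
  unfolding dtm_def by (drule (1) dset_eq) simp

lemma dmap_const: assumes "ps \<in> tuples M ts" "set ss \<subseteq> sorts L" "set ts \<subseteq> sorts L" shows "dmap True ss ts (\<lambda>e. ps)"
proof -
  have "dset0 (ts @ (ss @ ts)) (\<lambda>z. take (length ts) z = drop (length ts + length ss) z)"
    unfolding dset_False[symmetric]
    by (rule dset_eq[OF dmap_take[OF dmap_id] dmap_drop[OF dmap_id]]) (use assms in auto)
  then have "dset True (ss @ ts) (\<lambda>z. ps = drop (length ss) z)"
    unfolding dset_def using assms(1)
    by (intro exI[of _ ts] exI[of _ ps] exI conjI) (auto elim!: tuples_appendE simp: tuples_length)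
  then show ?thesis using assms by (auto simp: dmap_def)
qed

lemma dtm_const: "\<lbrakk>a \<in> car M s; set ss \<subseteq> sorts L; s \<in> sorts L\<rbrakk> \<Longrightarrow> dtm True ss s (\<lambda>e. a)"
  unfolding dtm_def by (rule dmap_const) auto

lemma dset_if: "\<lbrakk>dset b ss P; dset b ss Q; dset b ss R\<rbrakk> \<Longrightarrow> dset b ss (\<lambda>e. if P e then Q e else R e)"
  by (simp only: if_bool_eq_conj) (intro dset_conj dset_imp dset_not)

lemma dmap_if: assumes P: "dset b ss P" and a: "dmap b ss ts a" and c: "dmap b ss ts c"
  shows "dmap b ss ts (\<lambda>e. if P e then a e else c e)"
proof -
  have s: "set ss \<subseteq> sorts L" "set ts \<subseteq> sorts L" using a dmap_sorts by auto
  have "dset b (ss @ ts) (\<lambda>z. if P (take (length ss) z) then a (take (length ss) z) = drop (length ss) z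
      else c (take (length ss) z) = drop (length ss) z)"
    by (intro dset_if dset_take P) (use a c s in \<open>auto simp: dmap_def\<close>)
  then have "dset b (ss @ ts) (\<lambda>z. (if P (take (length ss) z) then a (take (length ss) z) else c (take (length ss) z)) = drop (length ss) z)"
    by (rule dset_cong') auto
  then show ?thesis using a c by (auto simp: dmap_def)
qed

lemma dtm_if: "\<lbrakk>dset b ss P; dtm b ss s a; dtm b ss s c\<rbrakk> \<Longrightarrow> dtm b ss s (\<lambda>e. if P e then a e else c e)"
  unfolding dtm_def by (drule (2) dmap_if) (erule dmap_cong', simp)

lemma dmap_graph: assumes "dset b (ss @ ts) (\<lambda>z. G (take (length ss) z) (drop (length ss) z))"
   "set ss \<subseteq> sorts L" "set ts \<subseteq> sorts L"
   "\<And>e. e \<in> tuples M ss \<Longrightarrow> a e \<in> tuples M ts"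
   "\<And>e c. e \<in> tuples M ss \<Longrightarrow> c \<in> tuples M ts \<Longrightarrow> G e c \<longleftrightarrow> a e = c"
  shows "dmap b ss ts a"
proof -
  have "dset b (ss @ ts) (\<lambda>z. a (take (length ss) z) = drop (length ss) z)"
    using assms(1) by (rule dset_cong') (auto elim!: tuples_appendE simp: assms(5))
  then show ?thesis using assms by (auto simp: dmap_def)
qed

lemma dtm_graph: assumes "dset b (ss @ [s]) (\<lambda>z. G (take (length ss) z) (z ! length ss))"
   "set ss \<subseteq> sorts L" "s \<in> sorts L"
   "\<And>e. e \<in> tuples M ss \<Longrightarrow> a e \<in> car M s"
   "\<And>e c. e \<in> tuples M ss \<Longrightarrow> c \<in> car M s \<Longrightarrow> G e c \<longleftrightarrow> a e = c"
  shows "dtm b ss s a"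
  unfolding dtm_def
proof (rule dmap_graph[of _ _ _ "\<lambda>e c. G e (hd c)"])
  show "dset b (ss @ [s]) (\<lambda>z. G (take (length ss) z) (hd (drop (length ss) z)))"
    using assms(1) by (rule dset_cong') (auto elim!: tuples_appendE simp: tuples_Cons)
qed (use assms in \<open>auto simp: tuples_Cons\<close>)

lemma dtm_fint: assumes f: "ftype L f = Some (ts, s)" and a: "dmap b ss ts a"
  shows "dtm b ss s (\<lambda>e. fint M f (a e))"
proof -
  have s: "set ts \<subseteq> sorts L" "s \<in> sorts L" using f wfL by (auto simp: wf_lang_def)
  have cl: "fint M f xs \<in> car M s" if "xs \<in> tuples M ts" for xs
    using struct f that by (auto simp: is_struct_def)
  let ?vs = "map (\<lambda>j. Var (ts ! j) j) [0..<length ts]"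
  have "dset0 (ts @ [s]) (\<lambda>z. fint M f (take (length ts) z) = z ! length ts)"
  proof (rule dset0I[of _ "FEq (App f ?vs) (Var s (length ts))"])
    have "has_sort L (App f ?vs) s"
      by (rule has_sort.intros(2)[OF f]) (use s in \<open>auto simp: list_all2_conv_all_nth intro!: has_sort_Var nth_mem[THEN subsetD[OF s(1)]]\<close>)
    then show "wf_fm L (FEq (App f ?vs) (Var s (length ts)))" using s has_sort_Var by auto
    show "free_vars (FEq (App f ?vs) (Var s (length ts))) \<subseteq> {((ts @ [s]) ! j, j) |j. j < length (ts @ [s])}"
    proof
      fix x assume "x \<in> free_vars (FEq (App f ?vs) (Var s (length ts)))"
      then consider j where "x = (ts ! j, j)" "j < length ts" | "x = (s, length ts)" by auto
      then show "x \<in> {((ts @ [s]) ! j, j) |j. j < length (ts @ [s])}"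
        by cases (auto simp: nth_append intro: less_SucI)
    qed
    fix xs assume "xs \<in> tuples M (ts @ [s])"
    then have "length xs = Suc (length ts)" by (auto dest: tuples_length)
    then have "map (tm_val M (\<lambda>(s, j). xs ! j)) ?vs = take (length ts) xs"
      by (auto intro!: nth_equalityI)
    then show "(fint M f (take (length ts) xs) = xs ! length ts) =
        sat M (\<lambda>(s, j). xs ! j) (FEq (App f ?vs) (Var s (length ts)))" by simp
  qed (use s in auto)
  then have "dtm False ts s (\<lambda>e. fint M f e)"
    by (intro dtm_graph[of _ _ _ "\<lambda>e c. fint M f e = c"]) (use s cl dset_False in auto)
  from dtm_app[OF dtm_mono[OF this] a] show ?thesis .
qed

lemma dset_rint: assumes r: "rtype L r = Some ts" and a: "dmap b ss ts a"
  shows "dset b ss (\<lambda>e. rint M r (a e))"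
proof -
  have s: "set ts \<subseteq> sorts L" using r wfL by (auto simp: wf_lang_def)
  let ?vs = "map (\<lambda>j. Var (ts ! j) j) [0..<length ts]"
  have "dset0 ts (\<lambda>z. rint M r z)"
  proof (rule dset0I[of _ "FRel r ?vs"])
    show "wf_fm L (FRel r ?vs)"
      using s r by (auto simp: list_all2_conv_all_nth intro!: has_sort_Var nth_mem[THEN subsetD[OF s(1)]])
    fix xs assume "xs \<in> tuples M ts"
    then have "map (tm_val M (\<lambda>(s, j). xs ! j)) ?vs = xs"
      by (auto simp: tuples_length intro!: nth_equalityI)
    then show "rint M r xs = sat M (\<lambda>(s, j). xs ! j) (FRel r ?vs)" by simp
  qed (use s in auto)
  then show ?thesis using dset_rel[OF dset_mono a] dset_False by blast
qed

lemma dtm_params: assumes "dtm True us s F"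
  obtains ts ps E where "ps \<in> tuples M ts" "set ts \<subseteq> sorts L" "dset False (ts @ us @ [s]) E"
    "\<And>e w. e \<in> tuples M us \<Longrightarrow> w \<in> car M s \<Longrightarrow> E (ps @ e @ [w]) \<longleftrightarrow> F e = w"
proof -
  have "dset True (us @ [s]) (\<lambda>z. [F (take (length us) z)] = drop (length us) z)"
    using assms unfolding dtm_def dmap_def by auto
  then obtain ts ps E where E: "ps \<in> tuples M ts" "dset0 (ts @ us @ [s]) E"
     "\<forall>e\<in>tuples M (us @ [s]). ([F (take (length us) e)] = drop (length us) e) \<longleftrightarrow> E (ps @ e)"
    unfolding dset_def by blast
  have "E (ps @ e @ [w]) \<longleftrightarrow> F e = w" if "e \<in> tuples M us" "w \<in> car M s" for e w
    using E(3)[rule_format, of "e @ [w]"] that by auto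
  then show ?thesis using that[of ps ts E] E dset_False dset0_sorts[OF E(2)] by auto
qed

end

section \<open>The valued field\<close>

locale tfield =
  fixes L :: "('f, 'r) vlang" and T :: "('f, 'r) vfm set" and p e :: nat
    and K :: "('f, 'r, 'u) vstruct"
  assumes tame: "tame TYPE('u) L p e T" and TK: "T_field L p e T K"
    and satK: "residue_rings_saturated L K"
begin

lemma sortsL: "sorts L = high_sorts \<or> sorts L = dp_sorts"
  using tame by (auto simp: tame_def)

lemma VF_sort [simp]: "VF \<in> sorts L" and VG_sort [simp]: "VG \<in> sorts L"
proof -
  have "VF \<in> high_sorts" "VG \<in> high_sorts" "VF \<in> dp_sorts" "VG \<in> dp_sorts"
    by (simp_all add: high_sorts_def dp_sorts_def)
  then show "VF \<in> sorts L" "VG \<in> sorts L" using sortsL by metis+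
qed

lemma RR_iff: "(\<forall>n. RR n \<in> sorts L \<longleftrightarrow> n \<ge> 1) \<or> (\<forall>n. RR n \<in> sorts L \<longleftrightarrow> n = 1)"
  using sortsL
proof
  assume "sorts L = high_sorts"
  then show ?thesis by (simp add: high_sorts_def)
next
  assume "sorts L = dp_sorts"
  then show ?thesis by (simp add: dp_sorts_def)
qed

lemma RR1_sort [simp]: "RR 1 \<in> sorts L" "RR (Suc 0) \<in> sorts L"
  using RR_iff by (metis order_refl One_nat_def)+

lemma RR_pos: "RR n \<in> sorts L \<Longrightarrow> n \<ge> 1"
  using RR_iff by (metis order_refl)

lemma RR_max: "RR m \<in> sorts L \<Longrightarrow> RR n \<in> sorts L \<Longrightarrow> RR (max m n) \<in> sorts L"
  by (simp add: max_def)

text \<open>If the residue field is the only residue ring sort, the only depth is \<open>1\<close>,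
  so two depths have to be combined into \<open>m + n - 1\<close> and not into \<open>m + n\<close>.
  This is the source of the shifts by one in later radii.\<close>

lemma RR_add: "RR m \<in> sorts L \<Longrightarrow> RR n \<in> sorts L \<Longrightarrow> RR (m + n - 1) \<in> sorts L"
proof -
  assume *: "RR m \<in> sorts L" "RR n \<in> sorts L"
  then have mn: "m \<ge> 1" "n \<ge> 1" using RR_pos by blast+
  from RR_iff show ?thesis
  proof
    assume "\<forall>n. RR n \<in> sorts L \<longleftrightarrow> n \<ge> 1"
    then show ?thesis using mn by simp
  next
    assume a: "\<forall>n. RR n \<in> sorts L \<longleftrightarrow> n = 1"
    then have "m = 1" "n = 1" using * by blast+
    then show ?thesis using * by simp
  qed
qed

end

sublocale tfield \<subseteq> defn L K
  using tame TK by unfold_locales (simp_all add: tame_def T_field_def is_model_def)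

context tfield
begin

lemma ext: "extends L (base_lang (sorts L))"
  using tame by (auto simp: tame_def)

lemma ftL: assumes "ftype0 f = Some (ss, s)" "set ss \<subseteq> sorts L" "s \<in> sorts L" shows "ftype L f = Some (ss, s)"
proof -
  have "ftype (base_lang (sorts L)) f = Some (ss, s)" using assms by (auto simp: base_lang_def)
  then show ?thesis using ext unfolding extends_def map_le_def by (metis domI)
qed

lemma rtL: assumes "rtype0 f = Some ss" "set ss \<subseteq> sorts L" shows "rtype L f = Some ss"
proof -
  have "rtype (base_lang (sorts L)) f = Some ss" using assms by (auto simp: base_lang_def)
  then show ?thesis using ext unfolding extends_def map_le_def by (metis domI)
qed

abbreviation "KF \<equiv> car K VF"
abbreviation "F \<equiv> ring_of K VF"
abbreviation "ord \<equiv> zord K"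
abbreviation "zz \<equiv> vzero K"
abbreviation "vd \<equiv> vdiff K"
abbreviation "unif \<equiv> fint K SUnif []"

text \<open>The same choice of identification as in \<open>zord\<close>, so that orders can be
  computed with as integers.\<close>

definition hh :: "'u \<Rightarrow> int" where "hh = (SOME h. Z_iso K h)"
definition hinv :: "int \<Rightarrow> 'u" where "hinv = inv_into (car K VG) hh"

lemma zpe: "zpe_field (sorts L) p e K" using TK by (simp add: T_field_def)

lemmas zpe' = zpe[unfolded zpe_field_def Let_def]

lemma fieldF: "field F" using zpe' by blast

sublocale F: field F by (rule fieldF)

lemma Fsimps [simp]: "carrier F = KF" "\<zero>\<^bsub>F\<^esub> = zz"
  by (simp_all add: ring_of_def vzero_def)

lemmas Fcl [simp] = F.a_closed[simplified] F.m_closed[simplified] F.a_inv_closed[simplified] F.l_zero[simplified]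
  F.r_zero[simplified] F.l_null[simplified] F.r_null[simplified] F.minus_zero[simplified] F.one_closed[simplified]
  F.zero_closed[simplified] F.l_neg[simplified] F.r_neg[simplified] F.minus_minus[simplified]
  F.l_one[simplified] F.r_one[simplified] F.r_neg1[simplified] F.r_neg2[simplified]

lemma Zh: "Z_iso K hh" unfolding hh_def using zpe' by (metis someI_ex)

lemma hh_bij: "bij_betw hh (car K VG) UNIV" using Zh by (simp add: Z_iso_def)

lemma hinv_car [simp]: "hinv r \<in> car K VG" and hh_hinv [simp]: "hh (hinv r) = r"
  using hh_bij unfolding hinv_def bij_betw_def by (auto intro: inv_into_into f_inv_into_f)

lemma hinv_hh [simp]: "x \<in> car K VG \<Longrightarrow> hinv (hh x) = x"
  using hh_bij unfolding hinv_def bij_betw_def by auto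

lemma hinv_eq [simp]: "hinv r = hinv s \<longleftrightarrow> r = s" by (metis hh_hinv)

lemma ord_hh: "ord x = hh (vord K x)" by (simp add: zord_def hh_def)

lemma vord_car: "x \<in> KF \<Longrightarrow> vord K x \<in> car K VG" using zpe' by simp

lemma hinv_ord: "x \<in> KF \<Longrightarrow> hinv (ord x) = vord K x" by (simp add: ord_hh vord_car)

lemma vd_eq: assumes "x \<in> KF" "y \<in> KF" shows "vd x y = x \<ominus>\<^bsub>F\<^esub> y"
proof -
  have "\<forall>x\<in>carrier F. fint K (SNeg VF) [x] = \<ominus>\<^bsub>F\<^esub> x" using zpe' by blast
  then show ?thesis using assms by (simp add: vdiff_def a_minus_def) (simp add: ring_of_def)
qed

lemma vmult_eq: "vmult K x y = x \<otimes>\<^bsub>F\<^esub> y" by (simp add: vmult_def ring_of_def)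

lemma zz_in [simp]: "zz \<in> KF" using F.zero_closed by simp

lemma vd_in [simp]: "x \<in> KF \<Longrightarrow> y \<in> KF \<Longrightarrow> vd x y \<in> KF" 
  using F.minus_closed by (simp add: vd_eq)

lemma vd_zero [simp]: "x \<in> KF \<Longrightarrow> y \<in> KF \<Longrightarrow> vd x y = zz \<longleftrightarrow> x = y"
  using F.r_right_minus_eq by (simp add: vd_eq)

lemma vd_zz [simp]: "x \<in> KF \<Longrightarrow> vd x zz = x"
  by (simp add: vd_eq a_minus_def)

lemma vd_vd [simp]: assumes "x \<in> KF" "y \<in> KF" "c \<in> KF" shows "vd (vd x c) (vd y c) = vd x y"
proof -
  have "(x \<ominus>\<^bsub>F\<^esub> c) \<ominus>\<^bsub>F\<^esub> (y \<ominus>\<^bsub>F\<^esub> c) = x \<ominus>\<^bsub>F\<^esub> y"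
    using assms unfolding a_minus_def by (simp add: F.minus_add F.a_ac)
  then show ?thesis using assms F.minus_closed by (simp add: vd_eq)
qed

lemma ord_mult: assumes "x \<in> KF" "y \<in> KF" "x \<noteq> zz" "y \<noteq> zz" shows "ord (x \<otimes>\<^bsub>F\<^esub> y) = ord x + ord y"
  using zpe' assms by simp

lemma ord_add: assumes "x \<in> KF" "y \<in> KF" "x \<noteq> zz" "y \<noteq> zz" "x \<oplus>\<^bsub>F\<^esub> y \<noteq> zz"
  shows "min (ord x) (ord y) \<le> ord (x \<oplus>\<^bsub>F\<^esub> y)"
  using zpe' assms by simp

lemma ord_surj: obtains x where "x \<in> KF" "x \<noteq> zz" "ord x = r"
proof -
  have "ord ` (carrier F - {\<zero>\<^bsub>F\<^esub>}) = UNIV" using zpe' by blast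
  then have "r \<in> ord ` (carrier F - {\<zero>\<^bsub>F\<^esub>})" by blast
  then show ?thesis using that by auto
qed

lemma one_nz: "\<one>\<^bsub>F\<^esub> \<noteq> zz" using F.one_not_zero by simp

lemma ord_one: "ord \<one>\<^bsub>F\<^esub> = 0"
  using ord_mult[of "\<one>\<^bsub>F\<^esub>" "\<one>\<^bsub>F\<^esub>"] one_nz F.r_one[of "\<one>\<^bsub>F\<^esub>"] by simp

lemma mult_nz: "\<lbrakk>x \<in> KF; y \<in> KF; x \<noteq> zz; y \<noteq> zz\<rbrakk> \<Longrightarrow> x \<otimes>\<^bsub>F\<^esub> y \<noteq> zz"
  using F.integral[of x y] by auto

lemma ord_uminus: assumes "x \<in> KF" shows "ord (\<ominus>\<^bsub>F\<^esub> x) = ord x"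
proof (cases "x = zz")
  case True
  then show ?thesis using F.minus_zero by simp
next
  case False
  have in': "\<ominus>\<^bsub>F\<^esub> x \<in> KF" using F.a_inv_closed assms by simp
  have nz: "\<ominus>\<^bsub>F\<^esub> x \<noteq> zz" using False assms Fcl(13)[of x] Fcl(8) by metis
  have "(\<ominus>\<^bsub>F\<^esub> x) \<otimes>\<^bsub>F\<^esub> (\<ominus>\<^bsub>F\<^esub> x) = x \<otimes>\<^bsub>F\<^esub> x" using assms F.l_minus F.r_minus F.minus_minus by simp
  then have "2 * ord (\<ominus>\<^bsub>F\<^esub> x) = 2 * ord x"
    using ord_mult[OF in' in' nz nz] ord_mult[OF assms assms False False] by simp
  then show ?thesis by simp
qed

section \<open>Congruences and the ultrametric inequality\<close>

definition cl :: "int \<Rightarrow> 'u \<Rightarrow> 'u \<Rightarrow> bool" where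
  "cl r x y \<longleftrightarrow> x = y \<or> r \<le> ord (vd x y)"

lemma vd_uminus: "x \<in> KF \<Longrightarrow> y \<in> KF \<Longrightarrow> vd y x = \<ominus>\<^bsub>F\<^esub> (vd x y)"
  by (simp add: vd_eq a_minus_def F.minus_add F.a_comm)

lemma ord_sym: "x \<in> KF \<Longrightarrow> y \<in> KF \<Longrightarrow> ord (vd x y) = ord (vd y x)"
  by (metis vd_uminus ord_uminus vd_in)

lemma vd_split: assumes "x \<in> KF" "y \<in> KF" "z \<in> KF" shows "vd x z = vd x y \<oplus>\<^bsub>F\<^esub> vd y z"
proof -
  have "(x \<oplus>\<^bsub>F\<^esub> \<ominus>\<^bsub>F\<^esub> y) \<oplus>\<^bsub>F\<^esub> (y \<oplus>\<^bsub>F\<^esub> \<ominus>\<^bsub>F\<^esub> z) = x \<oplus>\<^bsub>F\<^esub> \<ominus>\<^bsub>F\<^esub> z"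
    using assms by (simp add: F.a_assoc F.r_neg1)
  then show ?thesis using assms by (simp add: vd_eq a_minus_def)
qed

lemma ord_tri: assumes "x \<in> KF" "y \<in> KF" "z \<in> KF" "x \<noteq> z" "x \<noteq> y" "y \<noteq> z"
  shows "min (ord (vd x y)) (ord (vd y z)) \<le> ord (vd x z)"
  using ord_add[of "vd x y" "vd y z"] assms vd_split[of x y z] vd_zero[of x z] by simp

lemma cl_refl [simp]: "cl r x x" by (simp add: cl_def)

lemma cl_sym: "\<lbrakk>x \<in> KF; y \<in> KF; cl r x y\<rbrakk> \<Longrightarrow> cl r y x"
  by (auto simp: cl_def ord_sym)

lemma cl_trans: "\<lbrakk>x \<in> KF; y \<in> KF; z \<in> KF; cl r x y; cl r y z\<rbrakk> \<Longrightarrow> cl r x z"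
  using ord_tri[of x y z] unfolding cl_def by (cases "x = y"; cases "y = z"; cases "x = z") auto

lemma cl_mono: "cl s x y \<Longrightarrow> r \<le> s \<Longrightarrow> cl r x y"
  by (auto simp: cl_def)

lemma cl_vd [simp]: "\<lbrakk>x \<in> KF; y \<in> KF; c \<in> KF\<rbrakk> \<Longrightarrow> cl r (vd x c) (vd y c) = cl r x y"
  by (auto simp: cl_def) (metis vd_vd vd_zero)

text \<open>Every integer is an order, so every sphere is nonempty. This is how radii are shown to
  be sharp and how sets are shown to contain no ball.\<close>

lemma ex_exact: assumes "x \<in> KF" obtains x' where "x' \<in> KF" "x' \<noteq> x" "ord (vd x' x) = r" "ord (vd x x') = r"
proof -
  obtain t where t: "t \<in> KF" "t \<noteq> zz" "ord t = r" by (rule ord_surj)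
  let ?x = "x \<oplus>\<^bsub>F\<^esub> t"
  have i: "?x \<in> KF" using F.a_closed assms t by simp
  have "vd ?x x = t" using assms t i by (simp add: vd_eq a_minus_def F.a_comm[of x t] F.a_assoc)
  moreover from this have "?x \<noteq> x" using t assms by (metis vd_zero)
  ultimately show ?thesis using that[of ?x] i t assms by (metis ord_sym)
qed

lemma ord_cl_eq: assumes "x \<in> KF" "x' \<in> KF" "c \<in> KF" "x \<noteq> c" "cl (ord (vd x c) + 1) x x'"
  shows "x' \<noteq> c \<and> ord (vd x' c) = ord (vd x c)"
proof (cases "x = x'")
  case False
  then have o: "ord (vd x x') \<ge> ord (vd x c) + 1" using assms by (simp add: cl_def)
  have n: "x' \<noteq> c" using o by auto
  have "min (ord (vd x x')) (ord (vd x' c)) \<le> ord (vd x c)" using assms n False by (intro ord_tri) auto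
  moreover have "min (ord (vd x' x)) (ord (vd x c)) \<le> ord (vd x' c)" using assms n False by (intro ord_tri) auto
  ultimately show ?thesis using o n assms ord_sym[of x x'] by auto
qed (use assms in auto)

lemma ord_ne: assumes "x \<in> KF" "x' \<in> KF" "c \<in> KF" "x \<noteq> c" "x' \<noteq> c" "ord (vd x c) \<noteq> ord (vd x' c)"
  shows "x \<noteq> x' \<and> ord (vd x x') = min (ord (vd x c)) (ord (vd x' c))"
proof -
  have n: "x \<noteq> x'" using assms by auto
  have 1: "min (ord (vd x c)) (ord (vd c x')) \<le> ord (vd x x')" using assms n by (intro ord_tri) auto
  have 2: "min (ord (vd x x')) (ord (vd x' c)) \<le> ord (vd x c)" using assms n by (intro ord_tri) auto
  have 3: "min (ord (vd x' x)) (ord (vd x c)) \<le> ord (vd x' c)" using assms n by (intro ord_tri) auto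
  show ?thesis using 1 2 3 n assms ord_sym[of x x'] ord_sym[of x' c] by auto
qed

lemma cl_all_eq: assumes "x \<in> KF" "y \<in> KF" "\<And>r. r \<ge> r0 \<Longrightarrow> cl r x y" shows "x = y"
proof (rule ccontr)
  assume "x \<noteq> y"
  then have "max r0 (ord (vd x y) + 1) \<le> ord (vd x y)" using assms(3)[of "max r0 (ord (vd x y) + 1)"] by (simp add: cl_def)
  then show False by simp
qed

subsection \<open>Residue rings\<close>

abbreviation "VR \<equiv> val_ring K"

lemma VR_carrier: "carrier VR = {x \<in> KF. x = zz \<or> 0 \<le> ord x}"
  by (simp add: val_ring_def)

lemma VR_simps: "mult VR = mult F" "add VR = add F" "\<one>\<^bsub>VR\<^esub> = \<one>\<^bsub>F\<^esub>" "\<zero>\<^bsub>VR\<^esub> = \<zero>\<^bsub>F\<^esub>"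
  by (simp_all add: val_ring_def)

text \<open>By \<open>mpow\<close> these are the powers of the maximal ideal, here in a form that
  only refers to orders.\<close>

definition MI :: "nat \<Rightarrow> 'u set" where "MI n = {x \<in> KF. x = zz \<or> int n \<le> ord x}"

lemma MI_add: "x \<in> MI n \<Longrightarrow> y \<in> MI n \<Longrightarrow> x \<oplus>\<^bsub>F\<^esub> y \<in> MI n"
  using ord_add[of x y] by (cases "x = zz"; cases "y = zz"; cases "x \<oplus>\<^bsub>F\<^esub> y = zz") (auto simp: MI_def)

lemma MI_neg: "x \<in> MI n \<Longrightarrow> \<ominus>\<^bsub>F\<^esub> x \<in> MI n"
  using ord_uminus[of x] F.a_inv_closed[of x] F.minus_zero by (auto simp: MI_def)

lemma MI_mult: assumes "x \<in> MI n" "y \<in> MI m" shows "x \<otimes>\<^bsub>F\<^esub> y \<in> MI (n + m)"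
  using assms ord_mult[of x y] F.m_closed[of x y] F.l_null[of y] F.r_null[of x]
  by (cases "x = zz"; cases "y = zz") (auto simp: MI_def)

lemma MI_VR: "carrier VR = MI 0" by (simp add: MI_def VR_carrier)

lemma ringVR: "ring VR"
proof -
  have "subring (MI 0) F"
  proof (rule F.subringI)
    show "MI 0 \<subseteq> carrier F" "\<one>\<^bsub>F\<^esub> \<in> MI 0" using ord_one by (auto simp: MI_def)
  qed (use MI_neg MI_add MI_mult[of _ 0 _ 0] in simp_all)
  from F.subring_is_ring[OF this] show ?thesis
    by (simp add: val_ring_def MI_def)
qed

interpretation VR: ring VR by (rule ringVR)

lemma VR_neg: assumes "x \<in> MI 0" shows "\<ominus>\<^bsub>VR\<^esub> x = \<ominus>\<^bsub>F\<^esub> x"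
proof -
  have "\<ominus>\<^bsub>F\<^esub> x \<in> carrier VR" using MI_neg[OF assms] by (simp add: MI_VR)
  moreover have "(\<ominus>\<^bsub>F\<^esub> x) \<oplus>\<^bsub>VR\<^esub> x = \<zero>\<^bsub>VR\<^esub>"
    using F.l_neg assms by (simp add: VR_simps MI_def)
  ultimately show ?thesis using VR.minus_equality assms by (metis MI_VR)
qed

lemma MI_ideal: "ideal (MI n) VR"
proof (rule idealI[OF ringVR])
  have sub: "MI n \<subseteq> MI 0" by (auto simp: MI_def)
  show "subgroup (MI n) (add_monoid VR)"
  proof (rule VR.add.subgroupI)
    show "MI n \<subseteq> carrier VR" using sub by (simp add: MI_VR)
    have "zz \<in> MI n" by (simp add: MI_def)
    then show "MI n \<noteq> {}" by blast
    show "\<ominus>\<^bsub>VR\<^esub> a \<in> MI n" if "a \<in> MI n" for a using that sub VR_neg MI_neg by auto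
    show "a \<oplus>\<^bsub>VR\<^esub> b \<in> MI n" if "a \<in> MI n" "b \<in> MI n" for a b using that MI_add by (simp add: VR_simps)
  qed
  fix a x assume "a \<in> MI n" "x \<in> carrier VR"
  then show "x \<otimes>\<^bsub>VR\<^esub> a \<in> MI n" "a \<otimes>\<^bsub>VR\<^esub> x \<in> MI n"
    using MI_mult[of x 0 a n] MI_mult[of a n x 0] by (simp_all add: VR_simps MI_VR)
qed

lemma unif_facts: "unif \<in> KF" "unif \<noteq> zz" "ord unif = 1" using zpe' by simp_all

lemma div_ex: assumes "x \<in> KF" "u \<in> KF" "u \<noteq> zz" obtains w where "w \<in> KF" "u \<otimes>\<^bsub>F\<^esub> w = x"
proof -
  have u: "u \<in> Units F" using F.field_Units assms by simp
  have "u \<otimes>\<^bsub>F\<^esub> (inv\<^bsub>F\<^esub> u \<otimes>\<^bsub>F\<^esub> x) = x"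
    using assms u F.Units_inv_closed[OF u] F.Units_r_inv[OF u] by (simp flip: F.m_assoc)
  moreover have "inv\<^bsub>F\<^esub> u \<otimes>\<^bsub>F\<^esub> x \<in> KF" using F.Units_inv_closed[OF u] assms by simp
  ultimately show ?thesis using that by blast
qed

lemma mpow: "max_ideal_pow K n = MI n"
proof (induction n)
  case 0
  then show ?case by (simp add: MI_VR)
next
  case (Suc n)
  have mx: "max_ideal K = MI 1" by (auto simp: max_ideal_def MI_def)
  have "ideal_prod VR (MI 1) (MI n) = MI (Suc n)"
  proof
    show "ideal_prod VR (MI 1) (MI n) \<subseteq> MI (Suc n)"
    proof
      fix s assume "s \<in> ideal_prod VR (MI 1) (MI n)"
      then show "s \<in> MI (Suc n)"
        by (induction rule: ideal_prod.induct) (use MI_mult[of _ 1 _ n] MI_add in \<open>auto simp: VR_simps\<close>)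
    qed
    \<comment> \<open>The maximal ideal is principal: an element of order at least
      \<open>n + 1\<close> is the uniformizer times one of order at least \<open>n\<close>.\<close>
    show "MI (Suc n) \<subseteq> ideal_prod VR (MI 1) (MI n)"
    proof
      fix x assume x: "x \<in> MI (Suc n)"
      then obtain w where w: "w \<in> KF" "unif \<otimes>\<^bsub>F\<^esub> w = x" using div_ex[of x unif] unif_facts by (auto simp: MI_def)
      have "w = zz \<or> int n \<le> ord w" using x w ord_mult[OF unif_facts(1) w(1) unif_facts(2)] unif_facts(3)
        mult_nz[OF unif_facts(1) w(1) unif_facts(2)] by (cases "w = zz") (auto simp: MI_def)
      then have "w \<in> MI n" using w by (simp add: MI_def)
      moreover have "unif \<in> MI 1" using unif_facts by (simp add: MI_def)
      ultimately show "x \<in> ideal_prod VR (MI 1) (MI n)"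
        using ideal_prod.prod[of unif "MI 1" w "MI n" VR] w by (simp add: VR_simps)
    qed
  qed
  then show ?case using Suc by (simp add: mx)
qed

lemma ac_rho: assumes "RR n \<in> sorts L"
  obtains \<rho> where "\<rho> \<in> ring_iso (VR Quot MI n) (ring_of K (RR n))" "cring (ring_of K (RR n))"
    "\<And>x. x \<in> car K (RR n) \<Longrightarrow> fint K (SNeg (RR n)) [x] = \<ominus>\<^bsub>ring_of K (RR n)\<^esub> x"
    "vac K n zz = \<zero>\<^bsub>ring_of K (RR n)\<^esub>"
    "\<And>x. x \<in> KF \<Longrightarrow> x \<noteq> zz \<Longrightarrow> vac K n x = \<rho> (MI n +>\<^bsub>VR\<^esub> (unif [^]\<^bsub>F\<^esub> (- ord x) \<otimes>\<^bsub>F\<^esub> x))"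
proof -
  have "\<exists>\<rho>. \<forall>n. RR n \<in> sorts L \<longrightarrow>
          cring (ring_of K (RR n)) \<and>
          (\<forall>x\<in>car K (RR n). fint K (SNeg (RR n)) [x] = \<ominus>\<^bsub>ring_of K (RR n)\<^esub> x) \<and>
          \<rho> n \<in> ring_iso (VR Quot (MI n)) (ring_of K (RR n)) \<and>
          vac K n \<zero>\<^bsub>F\<^esub> = \<zero>\<^bsub>ring_of K (RR n)\<^esub> \<and>
          (\<forall>x\<in>carrier F - {\<zero>\<^bsub>F\<^esub>}.
             vac K n x =
               \<rho> n (MI n +>\<^bsub>VR\<^esub> (unif [^]\<^bsub>F\<^esub> (- ord x) \<otimes>\<^bsub>F\<^esub> x)))"
    using zpe'[unfolded mpow] by (elim conjE ex_forward) blast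
  then show ?thesis using assms that by auto
qed

lemma tpow: "unif [^]\<^bsub>F\<^esub> (r::int) \<in> KF" "unif [^]\<^bsub>F\<^esub> r \<noteq> zz" "ord (unif [^]\<^bsub>F\<^esub> r) = r"
  "unif [^]\<^bsub>F\<^esub> (- r) \<otimes>\<^bsub>F\<^esub> unif [^]\<^bsub>F\<^esub> r = \<one>\<^bsub>F\<^esub>"
proof -
  have n: "unif [^]\<^bsub>F\<^esub> (k::nat) \<in> KF \<and> unif [^]\<^bsub>F\<^esub> k \<noteq> zz \<and> ord (unif [^]\<^bsub>F\<^esub> k) = int k" for k
    by (induction k) (use unif_facts ord_mult mult_nz F.m_closed one_nz ord_one in auto)
  have U: "unif [^]\<^bsub>F\<^esub> (k::nat) \<in> Units F" for k using n F.field_Units by simp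
  have pos: "unif [^]\<^bsub>F\<^esub> (int k) = unif [^]\<^bsub>F\<^esub> k" for k by (simp add: int_pow_def nat_pow_def)
  have neg: "unif [^]\<^bsub>F\<^esub> (- int k) = inv\<^bsub>F\<^esub> (unif [^]\<^bsub>F\<^esub> k)" for k
    by (cases "k = 0") (simp_all add: int_pow_def nat_pow_def F.inv_one)
  have inv: "inv\<^bsub>F\<^esub> (unif [^]\<^bsub>F\<^esub> (k::nat)) \<in> KF" "inv\<^bsub>F\<^esub> (unif [^]\<^bsub>F\<^esub> k) \<otimes>\<^bsub>F\<^esub> unif [^]\<^bsub>F\<^esub> k = \<one>\<^bsub>F\<^esub>"
     "unif [^]\<^bsub>F\<^esub> k \<otimes>\<^bsub>F\<^esub> inv\<^bsub>F\<^esub> (unif [^]\<^bsub>F\<^esub> k) = \<one>\<^bsub>F\<^esub>" for k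
    using F.Units_inv_closed[OF U] F.Units_l_inv[OF U] F.Units_r_inv[OF U] by simp_all
  have invnz: "inv\<^bsub>F\<^esub> (unif [^]\<^bsub>F\<^esub> (k::nat)) \<noteq> zz" for k
    using inv(2)[of k] one_nz F.l_null n[of k] by auto
  have invord: "ord (inv\<^bsub>F\<^esub> (unif [^]\<^bsub>F\<^esub> (k::nat))) = - int k" for k
    using ord_mult[OF inv(1)[of k] _ invnz[of k], of "unif [^]\<^bsub>F\<^esub> k"] n[of k] inv(2)[of k] ord_one by simp
  have "r = int (nat r) \<or> r = - int (nat (- r))" by auto
  then consider k where "r = int k" | k where "r = - int k" by metis
  then have "unif [^]\<^bsub>F\<^esub> (r::int) \<in> KF \<and> unif [^]\<^bsub>F\<^esub> r \<noteq> zz \<and> ord (unif [^]\<^bsub>F\<^esub> r) = r \<and>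
    unif [^]\<^bsub>F\<^esub> (- r) \<otimes>\<^bsub>F\<^esub> unif [^]\<^bsub>F\<^esub> r = \<one>\<^bsub>F\<^esub>"
    by cases (simp_all add: pos neg n inv invnz invord)
  then show "unif [^]\<^bsub>F\<^esub> (r::int) \<in> KF" "unif [^]\<^bsub>F\<^esub> r \<noteq> zz" "ord (unif [^]\<^bsub>F\<^esub> r) = r"
   "unif [^]\<^bsub>F\<^esub> (- r) \<otimes>\<^bsub>F\<^esub> unif [^]\<^bsub>F\<^esub> r = \<one>\<^bsub>F\<^esub>" by auto
qed

text \<open>Both elements are scaled by the same power of the uniformizer into the valuation ring,
  where equality of cosets means that the difference lies in the \<open>n\<close>-th power of the
  maximal ideal. Scaling back adds \<open>ord x\<close> to the radius.\<close>

lemma vac_eq0: assumes n: "RR n \<in> sorts L" and x: "x \<in> KF" "x \<noteq> zz" "y \<in> KF" "y \<noteq> zz" "ord x = ord y"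
  shows "vac K n x = vac K n y \<longleftrightarrow> cl (ord x + int n) x y"
proof -
  obtain \<rho> where r: "\<rho> \<in> ring_iso (VR Quot MI n) (ring_of K (RR n))"
    "\<And>x. x \<in> KF \<Longrightarrow> x \<noteq> zz \<Longrightarrow> vac K n x = \<rho> (MI n +>\<^bsub>VR\<^esub> (unif [^]\<^bsub>F\<^esub> (- ord x) \<otimes>\<^bsub>F\<^esub> x))"
    using ac_rho[OF n] by metis
  interpret I: ideal "MI n" VR by (rule MI_ideal)
  let ?t = "unif [^]\<^bsub>F\<^esub> (- ord x)"
  let ?x = "?t \<otimes>\<^bsub>F\<^esub> x" and ?y = "?t \<otimes>\<^bsub>F\<^esub> y"
  have t: "?t \<in> KF" "?t \<noteq> zz" "ord ?t = - ord x" using tpow by auto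
  have in': "?x \<in> KF" "?y \<in> KF" using t x F.m_closed by simp_all
  have c: "?x \<in> carrier VR" "?y \<in> carrier VR"
    using in' ord_mult[OF t(1) x(1) t(2) x(2)] ord_mult[OF t(1) x(3) t(2) x(4)] t x by (auto simp: VR_carrier)
  have inj: "inj_on \<rho> (carrier (VR Quot MI n))" using r(1) by (auto simp: ring_iso_def bij_betw_def)
  have q: "MI n +>\<^bsub>VR\<^esub> ?x \<in> carrier (VR Quot MI n)" "MI n +>\<^bsub>VR\<^esub> ?y \<in> carrier (VR Quot MI n)"
    using c by (auto simp: FactRing_def A_RCOSETS_def' a_r_coset_def')
  have "vac K n x = vac K n y \<longleftrightarrow> MI n +>\<^bsub>VR\<^esub> ?x = MI n +>\<^bsub>VR\<^esub> ?y"
    using r(2)[of x] r(2)[of y] x inj_onD[OF inj _ q] by auto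
  also have "\<dots> \<longleftrightarrow> ?x \<ominus>\<^bsub>VR\<^esub> ?y \<in> MI n"
    using VR.quotient_eq_iff_same_a_r_cos[OF MI_ideal c] by simp
  also have "?x \<ominus>\<^bsub>VR\<^esub> ?y = ?x \<ominus>\<^bsub>F\<^esub> ?y"
    using VR_neg[of ?y] c by (simp add: a_minus_def VR_simps MI_VR)
  also have "\<dots> = ?t \<otimes>\<^bsub>F\<^esub> (x \<ominus>\<^bsub>F\<^esub> y)"
    using t x by (simp add: a_minus_def F.r_distr F.r_minus)
  also have "\<dots> = ?t \<otimes>\<^bsub>F\<^esub> vd x y" using x by (simp add: vd_eq)
  also have "?t \<otimes>\<^bsub>F\<^esub> vd x y \<in> MI n \<longleftrightarrow> cl (ord x + int n) x y"
  proof (cases "x = y")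
    case True
    then have "vd x y = zz" using x by simp
    then show ?thesis using t True by (simp add: MI_def)
  next
    case False
    then have "vd x y \<noteq> zz" "vd x y \<in> KF" using x by auto
    then show ?thesis using False ord_mult[of ?t "vd x y"] mult_nz[of ?t "vd x y"] t F.m_closed[of ?t "vd x y"]
      by (auto simp: MI_def cl_def)
  qed
  finally show ?thesis .
qed

lemma vac_eq: assumes "RR n \<in> sorts L" "x \<in> KF" "x' \<in> KF" "c \<in> KF" "x \<noteq> c" "x' \<noteq> c" "ord (vd x c) = ord (vd x' c)"
  shows "vac K n (vd x c) = vac K n (vd x' c) \<longleftrightarrow> cl (ord (vd x c) + int n) x x'"
  using vac_eq0[of n "vd x c" "vd x' c"] assms by simp

lemma ringR: "RR n \<in> sorts L \<Longrightarrow> cring (ring_of K (RR n))"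
  using ac_rho by metis

definition radd where "radd n x y = fint K (SPlus (RR n)) [x, y]"
definition rneg where "rneg n x = fint K (SNeg (RR n)) [x]"
definition rone where "rone n = fint K (SOne (RR n)) []"
definition rzero where "rzero n = fint K (SZero (RR n)) []"

text \<open>Lift \<open>\<xi>\<close> to \<open>u\<close> in the valuation ring. If \<open>u\<close>
  is not a unit, then \<open>u + 1\<close> is. A unit times a power of the uniformizer reaches every
  order without changing the angular component.\<close>

lemma ac_surj: assumes n: "RR n \<in> sorts L" and xi: "\<xi> \<in> car K (RR n)"
  shows "(\<forall>r. \<exists>z\<in>KF. z \<noteq> zz \<and> ord z = r \<and> vac K n z = \<xi>) \<or>
    (\<forall>r. \<exists>z\<in>KF. z \<noteq> zz \<and> ord z = r \<and> vac K n z = radd n \<xi> (rone n))"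
proof -
  obtain \<rho> where r: "\<rho> \<in> ring_iso (VR Quot MI n) (ring_of K (RR n))"
    "\<And>x. x \<in> KF \<Longrightarrow> x \<noteq> zz \<Longrightarrow> vac K n x = \<rho> (MI n +>\<^bsub>VR\<^esub> (unif [^]\<^bsub>F\<^esub> (- ord x) \<otimes>\<^bsub>F\<^esub> x))"
    using ac_rho[OF n] by metis
  interpret I: ideal "MI n" VR by (rule MI_ideal)
  have "\<rho> ` carrier (VR Quot MI n) = car K (RR n)" using r(1) by (auto simp: ring_iso_def bij_betw_def ring_of_def)
  then have "\<xi> \<in> \<rho> ` (\<Union>u\<in>carrier VR. {MI n +>\<^bsub>VR\<^esub> u})" using xi unfolding FactRing_def A_RCOSETS_def' by simp
  then obtain u where u: "u \<in> carrier VR" "\<xi> = \<rho> (MI n +>\<^bsub>VR\<^esub> u)" by blast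
  have unit: "\<exists>z\<in>KF. z \<noteq> zz \<and> ord z = s \<and> vac K n z = \<rho> (MI n +>\<^bsub>VR\<^esub> v)"
    if v: "v \<in> KF" "v \<noteq> zz" "ord v = 0" for v s
  proof (intro bexI[of _ "unif [^]\<^bsub>F\<^esub> s \<otimes>\<^bsub>F\<^esub> v"] conjI)
    let ?z = "unif [^]\<^bsub>F\<^esub> s \<otimes>\<^bsub>F\<^esub> v"
    show z: "?z \<in> KF" using tpow v F.m_closed by simp
    show nz: "?z \<noteq> zz" using tpow v mult_nz by simp
    show o: "ord ?z = s" using tpow v ord_mult by simp
    have "unif [^]\<^bsub>F\<^esub> (- s) \<otimes>\<^bsub>F\<^esub> ?z = v"
      using tpow v by (simp flip: F.m_assoc)
    then show "vac K n ?z = \<rho> (MI n +>\<^bsub>VR\<^esub> v)" using r(2)[OF z nz] o by simp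
  qed
  show ?thesis
  proof (cases "u \<noteq> zz \<and> ord u = 0")
    case True
    then show ?thesis using unit[of u] u by (simp add: VR_carrier)
  next
    case False
    let ?v = "u \<oplus>\<^bsub>F\<^esub> \<one>\<^bsub>F\<^esub>"
    have uK: "u \<in> KF" using u by (simp add: VR_carrier)
    have v: "?v \<in> KF" using uK F.a_closed by simp
    have "vd ?v \<one>\<^bsub>F\<^esub> = u" using uK v by (simp add: vd_eq a_minus_def F.a_assoc F.r_neg)
    then have "cl 1 ?v \<one>\<^bsub>F\<^esub>" using False u by (auto simp: cl_def VR_carrier)
    then have "?v \<noteq> zz \<and> ord (vd ?v zz) = ord (vd \<one>\<^bsub>F\<^esub> zz)"
      using ord_cl_eq[of "\<one>\<^bsub>F\<^esub>" ?v zz] v one_nz ord_one cl_sym by simp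
    then have vv: "?v \<noteq> zz" "ord ?v = 0" using v ord_one by auto
    have one: "\<one>\<^bsub>F\<^esub> \<in> carrier VR" using ord_one by (simp add: VR_carrier)
    have hom: "\<rho> \<in> ring_hom (VR Quot MI n) (ring_of K (RR n))" using r(1) by (simp add: ring_iso_def)
    have "MI n +>\<^bsub>VR\<^esub> ?v = (MI n +>\<^bsub>VR\<^esub> u) \<oplus>\<^bsub>VR Quot MI n\<^esub> (MI n +>\<^bsub>VR\<^esub> \<one>\<^bsub>F\<^esub>)"
      using I.a_rcos_sum[OF u(1) one] by (simp add: FactRing_def VR_simps)
    then have "\<rho> (MI n +>\<^bsub>VR\<^esub> ?v) = \<rho> (MI n +>\<^bsub>VR\<^esub> u) \<oplus>\<^bsub>ring_of K (RR n)\<^esub> \<rho> (MI n +>\<^bsub>VR\<^esub> \<one>\<^bsub>F\<^esub>)"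
      using ring_hom_add[OF hom] u(1) one by (auto simp: FactRing_def A_RCOSETS_def')
    also have "\<rho> (MI n +>\<^bsub>VR\<^esub> \<one>\<^bsub>F\<^esub>) = rone n"
      using ring_hom_one[OF hom] by (simp add: FactRing_def VR_simps rone_def ring_of_def)
    finally have "\<rho> (MI n +>\<^bsub>VR\<^esub> ?v) = radd n \<xi> (rone n)" using u by (simp add: radd_def ring_of_def)
    then show ?thesis using unit[OF v vv] by simp
  qed
qed

lemma radd_rneg: assumes n: "RR n \<in> sorts L" and xi: "\<xi> \<in> car K (RR n)"
  shows "radd n (radd n \<xi> (rone n)) (rneg n (rone n)) = \<xi>" "rone n \<in> car K (RR n)" "rzero n \<in> car K (RR n)"
    "rneg n (rone n) \<in> car K (RR n)"
proof -
  obtain \<rho> where r: "cring (ring_of K (RR n))"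
    "\<And>x. x \<in> car K (RR n) \<Longrightarrow> fint K (SNeg (RR n)) [x] = \<ominus>\<^bsub>ring_of K (RR n)\<^esub> x"
    using ac_rho[OF n] by metis
  interpret R: cring "ring_of K (RR n)" by fact
  have c: "carrier (ring_of K (RR n)) = car K (RR n)" "rone n = \<one>\<^bsub>ring_of K (RR n)\<^esub>" "rzero n = \<zero>\<^bsub>ring_of K (RR n)\<^esub>"
    "radd n x y = x \<oplus>\<^bsub>ring_of K (RR n)\<^esub> y" for x y
    by (simp_all add: ring_of_def rone_def rzero_def radd_def)
  show o: "rone n \<in> car K (RR n)" "rzero n \<in> car K (RR n)" using R.one_closed R.zero_closed by (simp_all add: c)
  show "rneg n (rone n) \<in> car K (RR n)" using r(2)[OF o(1)] R.a_inv_closed[of "\<one>\<^bsub>ring_of K (RR n)\<^esub>"] R.one_closed by (simp add: rneg_def c)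
  show "radd n (radd n \<xi> (rone n)) (rneg n (rone n)) = \<xi>"
    using r(2)[OF o(1)] xi R.one_closed R.a_assoc[of \<xi> "\<one>\<^bsub>ring_of K (RR n)\<^esub>" "\<ominus>\<^bsub>ring_of K (RR n)\<^esub> \<one>\<^bsub>ring_of K (RR n)\<^esub>"]
      R.r_neg[of "\<one>\<^bsub>ring_of K (RR n)\<^esub>"] R.r_zero[of \<xi>] R.a_inv_closed[of "\<one>\<^bsub>ring_of K (RR n)\<^esub>"]
    by (simp add: rneg_def c)
qed

lemma vac_car: "RR n \<in> sorts L \<Longrightarrow> x \<in> KF \<Longrightarrow> vac K n x \<in> car K (RR n)"
  using struct ftL[of "SAc n" "[VF]" "RR n"] unfolding is_struct_def vac_def by simp

text \<open>The two constants of the residue field serve as flags for definable conditions, so they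
  have to be distinct.\<close>

lemma rone_ne: "rone 1 \<noteq> rzero 1"
proof -
  have n: "RR 1 \<in> sorts L" by simp
  obtain \<rho> where r: "\<rho> \<in> ring_iso (VR Quot MI 1) (ring_of K (RR 1))" using ac_rho[OF n] by metis
  interpret I: ideal "MI 1" VR by (rule MI_ideal)
  have hom: "\<rho> \<in> ring_hom (VR Quot MI 1) (ring_of K (RR 1))" using r by (simp add: ring_iso_def)
  have one: "\<one>\<^bsub>F\<^esub> \<in> carrier VR" "\<zero>\<^bsub>F\<^esub> \<in> carrier VR" using ord_one by (simp_all add: VR_carrier)
  have inj: "inj_on \<rho> (carrier (VR Quot MI 1))" using r by (auto simp: ring_iso_def bij_betw_def)
  interpret Q: ring "VR Quot MI 1" by (rule I.quotient_is_ring)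
  interpret R: cring "ring_of K (RR 1)" by (rule ringR[OF n])
  have "\<rho> \<zero>\<^bsub>VR Quot MI 1\<^esub> = \<zero>\<^bsub>ring_of K (RR 1)\<^esub>"
    by (rule ring_hom_zero[OF hom Q.ring_axioms R.ring_axioms])
  then have z: "\<rho> (MI 1 +>\<^bsub>VR\<^esub> \<zero>\<^bsub>F\<^esub>) = rzero 1"
    using VR.a_coset_add_zero[OF I.a_subset] by (simp add: FactRing_def rzero_def ring_of_def[of K "RR _"] VR_simps)
  have o: "\<rho> (MI 1 +>\<^bsub>VR\<^esub> \<one>\<^bsub>F\<^esub>) = rone 1"
    using ring_hom_one[OF hom] by (simp add: FactRing_def VR_simps rone_def ring_of_def)
  have "MI 1 +>\<^bsub>VR\<^esub> \<one>\<^bsub>F\<^esub> \<noteq> MI 1 +>\<^bsub>VR\<^esub> \<zero>\<^bsub>F\<^esub>"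
  proof
    assume "MI 1 +>\<^bsub>VR\<^esub> \<one>\<^bsub>F\<^esub> = MI 1 +>\<^bsub>VR\<^esub> \<zero>\<^bsub>F\<^esub>"
    then have "\<one>\<^bsub>F\<^esub> \<ominus>\<^bsub>VR\<^esub> \<zero>\<^bsub>F\<^esub> \<in> MI 1" using VR.quotient_eq_iff_same_a_r_cos[OF MI_ideal one] by simp
    then have "\<one>\<^bsub>F\<^esub> \<in> MI 1"
      using one VR.minus_zero VR.r_zero[of "\<one>\<^bsub>F\<^esub>"] by (simp add: a_minus_def VR_simps)
    then show False using ord_one one_nz by (simp add: MI_def)
  qed
  then have "\<rho> (MI 1 +>\<^bsub>VR\<^esub> \<one>\<^bsub>F\<^esub>) \<noteq> \<rho> (MI 1 +>\<^bsub>VR\<^esub> \<zero>\<^bsub>F\<^esub>)"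
    using inj_onD[OF inj] one unfolding FactRing_def A_RCOSETS_def' by auto
  then show ?thesis using o z by simp
qed

lemmas tuple_simps [simp] = take_tuple[where M = K] drop_tuple[where M = K] take_tuple'[where M = K]
  drop_tuple'[where M = K] nth_tuple[where M = K] append_tuple_iff[where M = K]

definition VV :: "nat \<Rightarrow> vsort list" where "VV m = replicate m VF"
definition RRs :: "nat list \<Rightarrow> vsort list" where "RRs ns = map RR ns"

lemma VV_sorts [simp]: "set (VV m) \<subseteq> sorts L" by (auto simp: VV_def)
lemma VV_Suc: "VV (Suc m) = VV m @ [VF]" by (simp add: VV_def replicate_append_same)
lemma VV_add: "VV (m + n) = VV m @ VV n" by (simp add: VV_def replicate_add)
lemma VV_0 [simp]: "VV 0 = []" by (simp add: VV_def)
lemma VV_1: "VV (Suc 0) = [VF]" by (simp add: VV_def)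
lemma RRs_append: "RRs (ns @ ms) = RRs ns @ RRs ms" by (simp add: RRs_def)
lemma RRs_Cons: "RRs (n # ns) = RR n # RRs ns" by (simp add: RRs_def)
lemma RRs_Nil [simp]: "RRs [] = []" by (simp add: RRs_def)

subsection \<open>Definability in the valued field\<close>

definition dint :: "bool \<Rightarrow> vsort list \<Rightarrow> ('u list \<Rightarrow> int) \<Rightarrow> bool" where
  "dint b ss t \<longleftrightarrow> dtm b ss VG (\<lambda>e. hinv (t e))"

lemma dtm_sorts: "dtm b ss s t \<Longrightarrow> set ss \<subseteq> sorts L \<and> s \<in> sorts L"
  unfolding dtm_def by (auto dest: dmap_sorts)

lemma dtm_f1: assumes "ftype0 f = Some ([s1], s)" "dtm b ss s1 t" "s \<in> sorts L"
  shows "dtm b ss s (\<lambda>e. fint K f [t e])"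
proof -
  have "ftype L f = Some ([s1], s)" using assms dtm_sorts by (intro ftL) auto
  from dtm_fint[OF this dmap_Cons[OF assms(2) dmap_Nil]] show ?thesis using assms dtm_sorts by auto
qed

lemma dtm_f2: assumes "ftype0 f = Some ([s1, s2], s)" "dtm b ss s1 t" "dtm b ss s2 u" "s \<in> sorts L"
  shows "dtm b ss s (\<lambda>e. fint K f [t e, u e])"
proof -
  have "ftype L f = Some ([s1, s2], s)" using assms dtm_sorts by (intro ftL) auto
  from dtm_fint[OF this dmap_Cons[OF assms(2) dmap_Cons[OF assms(3) dmap_Nil]]] show ?thesis using assms dtm_sorts by auto
qed

lemma dtm_f0: assumes "ftype0 f = Some ([], s)" "set ss \<subseteq> sorts L" "s \<in> sorts L"
  shows "dtm b ss s (\<lambda>e. fint K f [])"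
proof -
  have "ftype L f = Some ([], s)" using assms by (intro ftL) auto
  from dtm_fint[OF this dmap_Nil] show ?thesis using assms by auto
qed

lemma dtm_vd: "dtm b ss VF t \<Longrightarrow> dtm b ss VF u \<Longrightarrow> dtm b ss VF (\<lambda>e. vd (t e) (u e))"
  unfolding vdiff_def by (intro dtm_f2 dtm_f1) auto

lemma dtm_vmult: "dtm b ss VF t \<Longrightarrow> dtm b ss VF u \<Longrightarrow> dtm b ss VF (\<lambda>e. t e \<otimes>\<^bsub>F\<^esub> u e)"
  unfolding vmult_eq[symmetric] vmult_def by (intro dtm_f2) auto

lemma dtm_vadd: "dtm b ss VF t \<Longrightarrow> dtm b ss VF u \<Longrightarrow> dtm b ss VF (\<lambda>e. t e \<oplus>\<^bsub>F\<^esub> u e)"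
  using dtm_f2[of "SPlus VF" VF VF VF] by (simp add: ring_of_def)

lemma dtm_zz: "set ss \<subseteq> sorts L \<Longrightarrow> dtm b ss VF (\<lambda>e. zz)"
  unfolding vzero_def by (intro dtm_f0) auto

lemma dtm_vac: "dtm b ss VF t \<Longrightarrow> RR n \<in> sorts L \<Longrightarrow> dtm b ss (RR n) (\<lambda>e. vac K n (t e))"
  unfolding vac_def by (intro dtm_f1) auto

lemma dtm_radd: "dtm b ss (RR n) t \<Longrightarrow> dtm b ss (RR n) u \<Longrightarrow> dtm b ss (RR n) (\<lambda>e. radd n (t e) (u e))"
  unfolding radd_def by (intro dtm_f2) (auto dest: dtm_sorts)

lemma dtm_rneg: "dtm b ss (RR n) t \<Longrightarrow> dtm b ss (RR n) (\<lambda>e. rneg n (t e))"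
  unfolding rneg_def by (intro dtm_f1) (auto dest: dtm_sorts)

lemma dtm_rone: "set ss \<subseteq> sorts L \<Longrightarrow> RR n \<in> sorts L \<Longrightarrow> dtm b ss (RR n) (\<lambda>e. rone n)"
  unfolding rone_def by (intro dtm_f0) auto

lemma dtm_rzero: "set ss \<subseteq> sorts L \<Longrightarrow> RR n \<in> sorts L \<Longrightarrow> dtm b ss (RR n) (\<lambda>e. rzero n)"
  unfolding rzero_def by (intro dtm_f0) auto

lemma dint_ord: assumes t: "dtm b ss VF t" shows "dint b ss (\<lambda>e. ord (t e))"
proof -
  have "dtm b ss VG (\<lambda>e. vord K (t e))" unfolding vord_def by (rule dtm_f1) (use t in auto)
  then show ?thesis unfolding dint_def by (rule dtm_cong') (use dtm_car[OF t] in \<open>simp add: hinv_ord\<close>)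
qed

lemma Zh': "hh (fint K (SZero VG) []) = 0" "hh (fint K (SOne VG) []) = 1"
  "fint K (SZero VG) [] \<in> car K VG" "fint K (SOne VG) [] \<in> car K VG"
  "x \<in> car K VG \<Longrightarrow> fint K (SNeg VG) [x] \<in> car K VG \<and> hh (fint K (SNeg VG) [x]) = - hh x"
  "x \<in> car K VG \<Longrightarrow> y \<in> car K VG \<Longrightarrow> gplus K x y \<in> car K VG \<and> hh (gplus K x y) = hh x + hh y
     \<and> (gless K x y \<longleftrightarrow> hh x < hh y)"
  using Zh by (auto simp: Z_iso_def)

lemma hinv_ops: "fint K (SNeg VG) [hinv r] = hinv (- r)" "gplus K (hinv r) (hinv s) = hinv (r + s)"
  "fint K (SZero VG) [] = hinv 0" "fint K (SOne VG) [] = hinv 1" "gless K (hinv r) (hinv s) \<longleftrightarrow> r < s"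
proof -
  show "fint K (SNeg VG) [hinv r] = hinv (- r)" using Zh'(5)[of "hinv r"] hinv_hh by (metis hh_hinv hinv_car)
  show "gplus K (hinv r) (hinv s) = hinv (r + s)" using Zh'(6)[of "hinv r" "hinv s"] by (metis hh_hinv hinv_car hinv_hh)
  show "fint K (SZero VG) [] = hinv 0" "fint K (SOne VG) [] = hinv 1" using Zh'(1-4) by (metis hinv_hh)+
  show "gless K (hinv r) (hinv s) \<longleftrightarrow> r < s" using Zh'(6)[of "hinv r" "hinv s"] by simp
qed

lemma dint_uminus: "dint b ss t \<Longrightarrow> dint b ss (\<lambda>e. - t e)"
  unfolding dint_def hinv_ops[symmetric] by (intro dtm_f1) auto

lemma dint_add: "dint b ss t \<Longrightarrow> dint b ss u \<Longrightarrow> dint b ss (\<lambda>e. t e + u e)"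
  unfolding dint_def hinv_ops(2)[symmetric] gplus_def by (intro dtm_f2) auto

lemma dint_diff: "dint b ss t \<Longrightarrow> dint b ss u \<Longrightarrow> dint b ss (\<lambda>e. t e - u e)"
  using dint_add[OF _ dint_uminus, of b ss t u] by simp

lemma dint_const: assumes s: "set ss \<subseteq> sorts L" shows "dint b ss (\<lambda>e. r)"
proof -
  have 0: "dint b ss (\<lambda>e. 0)" "dint b ss (\<lambda>e. 1)"
    unfolding dint_def hinv_ops(3,4)[symmetric] by (intro dtm_f0 s; simp)+
  have n: "dint b ss (\<lambda>e. int n)" for n
  proof (induction n)
    case (Suc n)
    show ?case using dint_add[OF Suc 0(2)] by (simp add: add.commute)
  qed (use 0 in simp)
  have "r = int (nat r) \<or> r = - int (nat (- r))" by auto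
  then show ?thesis using n dint_uminus[OF n] by metis
qed

lemma dset_less: "dint b ss t \<Longrightarrow> dint b ss u \<Longrightarrow> dset b ss (\<lambda>e. t e < u e)"
proof -
  assume *: "dint b ss t" "dint b ss u"
  have r: "rtype L SLess = Some [VG, VG]" by (rule rtL) auto
  have "dset b ss (\<lambda>e. rint K SLess [hinv (t e), hinv (u e)])"
    by (rule dset_rint[OF r]) (intro dmap_Cons dmap_Nil, use * dtm_sorts in \<open>auto simp: dint_def\<close>)
  then show ?thesis by (simp add: hinv_ops flip: gless_def)
qed

lemma dset_le: "dint b ss t \<Longrightarrow> dint b ss u \<Longrightarrow> dset b ss (\<lambda>e. t e \<le> u e)"
  using dset_not[OF dset_less, of b ss u t] by (simp add: not_less)

lemma dset_inteq: "dint b ss t \<Longrightarrow> dint b ss u \<Longrightarrow> dset b ss (\<lambda>e. t e = u e)"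
  unfolding dint_def by (drule (1) dset_eqt) simp

lemma dset_exint: assumes "dset b (ss @ [VG]) (\<lambda>z. P (take (length ss) z) (hh (z ! length ss)))"
  shows "dset b ss (\<lambda>e. \<exists>r. P e r)"
proof -
  have "dset b ss (\<lambda>e. \<exists>a\<in>car K VG. P e (hh a))" by (rule dset_ex) (use assms in simp)
  moreover have "(\<exists>a\<in>car K VG. P e (hh a)) \<longleftrightarrow> (\<exists>r. P e r)" for e by (metis hh_hinv hinv_car)
  ultimately show ?thesis by simp
qed

lemma dset_allint: "dset b (ss @ [VG]) (\<lambda>z. P (take (length ss) z) (hh (z ! length ss))) \<Longrightarrow>
   dset b ss (\<lambda>e. \<forall>r. P e r)"
  using dset_not[OF dset_exint[OF dset_not, of b ss P]] by simp

lemma dint_hh: assumes "dtm b ss VG t" shows "dint b ss (\<lambda>e. hh (t e))"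
  unfolding dint_def by (rule dtm_cong'[OF assms]) (use dtm_car[OF assms] in simp)

lemma dint_last: "set ss \<subseteq> sorts L \<Longrightarrow> dint b (ss @ [VG]) (\<lambda>z. hh (z ! length ss))"
  by (intro dint_hh dtm_last) auto

lemma dint_lift: "dint b ss t \<Longrightarrow> set ts \<subseteq> sorts L \<Longrightarrow> dint b (ss @ ts) (\<lambda>z. t (take (length ss) z))"
  unfolding dint_def by (rule dtm_lift)

lemma dtm_hinv: "dint b ss t \<Longrightarrow> dtm b ss VG (\<lambda>e. hinv (t e))" by (simp add: dint_def)

lemma dset_even: "dint b ss t \<Longrightarrow> dset b ss (\<lambda>e. even (t e))"
proof -
  assume t: "dint b ss t"
  then have s: "set ss \<subseteq> sorts L" unfolding dint_def by (auto dest: dtm_sorts)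
  have "dset b ss (\<lambda>e. \<exists>k. t e = k + k)"
    by (rule dset_exint) (intro dset_inteq dint_add dint_last dint_lift t s, simp)
  moreover have "(\<exists>k. x = k + k) \<longleftrightarrow> even x" for x :: int by (auto elim!: evenE)
  ultimately show ?thesis by simp
qed

lemma dset_cl: "\<lbrakk>dint b ss r; dtm b ss VF t; dtm b ss VF u\<rbrakk> \<Longrightarrow> dset b ss (\<lambda>e. cl (r e) (t e) (u e))"
  unfolding cl_def by (intro dset_disj dset_eqt dset_le dint_ord dtm_vd)

lemma dint_sorts: "dint b ss t \<Longrightarrow> set ss \<subseteq> sorts L"
  unfolding dint_def by (auto dest: dtm_sorts)

lemma dset_lift: "dset b ss P \<Longrightarrow> set ts \<subseteq> sorts L \<Longrightarrow> dset b (ss @ ts) (\<lambda>z. P (take (length ss) z))"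
  by (rule dset_take)

lemma dset_app0: "dset False ts R \<Longrightarrow> dmap b ss ts a \<Longrightarrow> dset b ss (\<lambda>e. R (a e))"
  by (rule dset_rel[OF dset_mono])

lemma dmap_app0: "dmap False ts us c \<Longrightarrow> dmap b ss ts a \<Longrightarrow> dmap b ss us (\<lambda>e. c (a e))"
  by (rule dmap_comp[OF dmap_mono])

lemma dtm_app0: "dtm False ts s t \<Longrightarrow> dmap b ss ts a \<Longrightarrow> dtm b ss s (\<lambda>e. t (a e))"
  by (rule dtm_app[OF dtm_mono])

text \<open>Introduction rules indexed by the shape of a term. Definability of an explicitly written
  condition is proved by resolving with them until only conditions on sorts remain.\<close>

lemmas dI = dset_const dset_conj dset_disj dset_imp dset_iff dset_not dset_all dset_ex dset_allB dset_exB dset_exint dset_allint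
  dset_less dset_le dset_even dset_cl
  dint_const dint_lift dint_last dint_add dint_diff dint_uminus dint_ord dint_hh
  dtm_const dtm_lift dtm_last dtm_hd dtm_vd dtm_vmult dtm_vadd dtm_vac dtm_zz dtm_rzero dtm_rone dtm_radd dtm_rneg dtm_hinv
  dmap_const dmap_lift dmap_id dmap_last dmap_tl dmap_Nil dmap_Cons dmap_append dmap_take dmap_drop

text \<open>Makes a relation into a total definable function, with default \<open>zz\<close> where a
  solution is missing or not unique. Functions that are meaningful for some arguments only can then
  be handled without domains.\<close>

lemma dtm_the: assumes G: "dset b (ss @ [VF]) (\<lambda>z. G (take (length ss) z) (z ! length ss))"
   and s: "set ss \<subseteq> sorts L"
   shows "dtm b ss VF (\<lambda>e. if \<exists>!x. x \<in> KF \<and> G e x then THE x. x \<in> KF \<and> G e x else zz)"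
proof -
  let ?H = "\<lambda>e x. (G e x \<and> (\<forall>x'\<in>KF. G e x' \<longrightarrow> x' = x)) \<or> (x = zz \<and> \<not> (\<exists>u\<in>KF. G e u \<and> (\<forall>x'\<in>KF. G e x' \<longrightarrow> x' = u)))"
  let ?c = "ss @ [VF]" let ?d = "?c @ [VF]"
  have s2: "set ?c \<subseteq> sorts L" "set ?d \<subseteq> sorts L" "set (?d @ [VF]) \<subseteq> sorts L" using s by auto
  have t: "dmap b ?c ss (\<lambda>z. take (length ss) z)" by (rule dmap_take[OF dmap_id]) (use s2 in auto)
  have G': "dset b c (\<lambda>z. G (a z) (u z))" if "dmap b c ss a" "dtm b c VF u" for c a u
  proof -
    have "dmap b c (ss @ [VF]) (\<lambda>z. a z @ [u z])" using that by (intro dmap_append) (auto simp: dtm_def)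
    from dset_rel[OF G this] have "dset b c (\<lambda>z. G (take (length ss) (a z @ [u z])) ((a z @ [u z]) ! length ss))" .
    then show ?thesis by (rule dset_cong') (use dmap_tuples[OF that(1)] in auto)
  qed
  have "dset b ?c (\<lambda>z. ?H (take (length ss) z) (z ! length ss))"
    by (rule dset_conj dset_disj dset_all dset_ex dset_imp dset_not G' dset_eqt dtm_zz dtm_last dtm_lift dmap_lift dmap_id t
       | (use s in \<open>simp; fail\<close>))+
  then show ?thesis
  proof (rule dtm_graph[where G = ?H])
    fix e assume e: "e \<in> tuples K ss"
    show "(if \<exists>!x. x \<in> KF \<and> G e x then THE x. x \<in> KF \<and> G e x else zz) \<in> KF"
      using theI'[of "\<lambda>x. x \<in> KF \<and> G e x"] by simp
  next
    fix e c assume e: "e \<in> tuples K ss" and c: "c \<in> KF"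
    show "?H e c \<longleftrightarrow> (if \<exists>!x. x \<in> KF \<and> G e x then THE x. x \<in> KF \<and> G e x else zz) = c"
    proof (cases "\<exists>!x. x \<in> KF \<and> G e x")
      case True
      then obtain u where "u \<in> KF \<and> G e u" "\<forall>x. x \<in> KF \<and> G e x \<longrightarrow> x = u" by (rule ex1E)
      then have u: "u \<in> KF" "G e u" "\<And>x. x \<in> KF \<Longrightarrow> G e x \<Longrightarrow> x = u" by blast+
      have 1: "(THE x. x \<in> KF \<and> G e x) = u" using u by blast
      have 2: "\<exists>w\<in>KF. G e w \<and> (\<forall>x'\<in>KF. G e x' \<longrightarrow> x' = w)" using u by blast
      have 3: "(G e c \<and> (\<forall>x'\<in>KF. G e x' \<longrightarrow> x' = c)) \<longleftrightarrow> u = c" using u c by blast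
      show ?thesis unfolding if_P[OF True] 1 3 using 2 by blast
    next
      case False
      then have "\<not> (\<exists>w\<in>KF. G e w \<and> (\<forall>x'\<in>KF. G e x' \<longrightarrow> x' = w))" by blast
      then show ?thesis unfolding if_not_P[OF False] using c by blast
    qed
  qed (use s in simp_all)
qed

subsection \<open>Saturation of the residue rings\<close>

text \<open>Parameters stand in front in \<open>dset\<close> and at the end in
  \<open>definable_with_params\<close>, hence the exchange of the two blocks.\<close>

lemma dset_True_params: assumes "dset True ss P" shows "definable_with_params L K ss {e \<in> tuples K ss. P e}"
proof -
  obtain ts ps E where E: "ps \<in> tuples K ts" "dset0 (ts @ ss) E" "\<forall>e\<in>tuples K ss. P e \<longleftrightarrow> E (ps @ e)"
    using assms unfolding dset_def by blast
  have s: "set ts \<subseteq> sorts L" "set ss \<subseteq> sorts L" using dset0_sorts[OF E(2)] by auto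
  have "dmap False (ss @ ts) (ts @ ss) (\<lambda>z. drop (length ss) z @ take (length ss) z)"
    by (intro dmap_append dmap_last dmap_take[OF dmap_id]) (use s in auto)
  from dset_rel[OF _ this] E(2) have "dset0 (ss @ ts) (\<lambda>z. E (drop (length ss) z @ take (length ss) z))"
    by (simp add: dset_False)
  then have "definable L K (ss @ ts) {z \<in> tuples K (ss @ ts). E (drop (length ss) z @ take (length ss) z)}"
    by (simp add: dset0_def)
  then show ?thesis unfolding definable_with_params_def
  proof (rule_tac exI[of _ ts], rule_tac exI[of _ ps], rule_tac exI[of _ "{z \<in> tuples K (ss @ ts). E (drop (length ss) z @ take (length ss) z)}"], intro conjI)
    show "{e \<in> tuples K ss. P e} = {xs \<in> tuples K ss. xs @ ps \<in>
        {z \<in> tuples K (ss @ ts). E (drop (length ss) z @ take (length ss) z)}}"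
    proof (rule Collect_cong, rule conj_cong[OF refl])
      fix e assume e: "e \<in> tuples K ss"
      then have "e @ ps \<in> tuples K (ss @ ts)" using E(1) by simp
      then show "P e \<longleftrightarrow> e @ ps \<in> {z \<in> tuples K (ss @ ts). E (drop (length ss) z @ take (length ss) z)}"
        using E(3) e by simp
    qed
  qed (use E in simp_all)
qed

text \<open>Saturation admits as many sets as there are formulas, and the iterated negations of one
  formula show that countably many are allowed. A finite intersection contains the member of largest
  index, so it is nonempty.\<close>

lemma rr_sat: fixes P :: "nat \<Rightarrow> 'u list \<Rightarrow> bool"
  assumes P: "\<And>k. dset True (RRs ns) (P k)" and dec: "\<And>k \<xi>. P (Suc k) \<xi> \<Longrightarrow> P k \<xi>"
   and ne: "\<And>k. \<exists>\<xi>\<in>tuples K (RRs ns). P k \<xi>"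
  obtains \<xi> where "\<xi> \<in> tuples K (RRs ns)" "\<And>k. P k \<xi>"
proof -
  define S where "S k = {\<xi> \<in> tuples K (RRs ns). P k \<xi>}" for k
  define \<phi>0 :: "('f, 'r) vfm" where "\<phi>0 = FEx VF 0 (FEq (Var VF 0) (Var VF 0))"
  have wf: "wf_fm L ((FNot ^^ k) \<phi>0)" for k
    by (induction k) (use has_sort_Var[OF VF_sort] in \<open>auto simp: \<phi>0_def\<close>)
  have sz: "(FNot ^^ k) \<phi>0 = (FNot ^^ k') \<phi>0 \<Longrightarrow> k = k'" for k k'
  proof (induction k arbitrary: k')
    case 0
    then show ?case by (cases k') (auto simp: \<phi>0_def)
  next
    case (Suc k)
    then show ?case by (cases k') (auto simp: \<phi>0_def)
  qed
  have "(UNIV :: nat set) \<lesssim> {\<phi>. wf_fm L \<phi>}"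
    unfolding lepoll_def by (rule exI[of _ "\<lambda>k. (FNot ^^ k) \<phi>0"]) (use wf sz in \<open>auto simp: inj_on_def\<close>)
  moreover have "range S \<lesssim> (UNIV :: nat set)" by (rule image_lepoll)
  ultimately have le: "range S \<lesssim> {\<phi>. wf_fm L \<phi>}" using lepoll_trans by blast
  have mono: "S (k + j) \<subseteq> S k" for k j
    by (induction j) (use dec in \<open>auto simp: S_def\<close>)
  have fin: "\<Inter> \<D> \<noteq> {}" if D: "\<D> \<subseteq> range S" "finite \<D>" "\<D> \<noteq> {}" for \<D>
  proof -
    obtain A where A: "finite A" "\<D> = S ` A" using finite_subset_image[OF D(2,1)] by blast
    have "S (Max A) \<subseteq> S k" if "k \<in> A" for k using mono[of k "Max A - k"] A that by simp
    then have "S (Max A) \<subseteq> \<Inter> \<D>" using A by auto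
    moreover have "S (Max A) \<noteq> {}" using ne[of "Max A"] by (auto simp: S_def)
    ultimately show ?thesis by blast
  qed
  have def': "\<forall>D\<in>range S. definable_with_params L K (map RR ns) D"
    using dset_True_params[OF P] by (auto simp: S_def RRs_def)
  have "\<Inter> (range S) \<noteq> {}"
    using satK unfolding residue_rings_saturated_def using le def' fin by blast
  then show ?thesis using that by (auto simp: S_def)
qed

text \<open>Without a uniform bound the conditions \<open>?S k\<close> would form a decreasing
  sequence of nonempty sets, and a common point of them would contradict \<open>bd\<close>.\<close>

lemma rr_bound: assumes P: "dset True (RRs ns @ [VG]) (\<lambda>z. P (take (length (RRs ns)) z) (hh (z ! length (RRs ns))))"
   and bd: "\<And>\<xi>. \<xi> \<in> tuples K (RRs ns) \<Longrightarrow> \<exists>b. \<forall>r. P \<xi> r \<longrightarrow> r \<le> b"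
  obtains b :: int where "\<And>\<xi> r. \<xi> \<in> tuples K (RRs ns) \<Longrightarrow> P \<xi> r \<Longrightarrow> r \<le> b"
proof (cases "\<exists>b. \<forall>\<xi>\<in>tuples K (RRs ns). \<forall>r. P \<xi> r \<longrightarrow> r \<le> b")
  case False
  let ?S = "\<lambda>k \<xi>. \<exists>r. P \<xi> r \<and> int k < r"
  have s: "set (RRs ns) \<subseteq> sorts L" using dset_sorts[OF P] by auto
  obtain \<xi> where x: "\<xi> \<in> tuples K (RRs ns)" "\<And>k. ?S k \<xi>"
  proof (rule rr_sat[of ns ?S])
    show "dset True (RRs ns) (?S k)" for k
      by (rule dset_exint) (intro dset_conj P dset_less dint_const dint_last, use s in auto)
    show "\<exists>\<xi>\<in>tuples K (RRs ns). ?S k \<xi>" for k using False by (metis not_less)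
  qed force+
  obtain b where b: "\<forall>r. P \<xi> r \<longrightarrow> r \<le> b" using bd[OF x(1)] by blast
  obtain r where "P \<xi> r" "int (nat b) < r" using x(2) by blast
  then have False using b[rule_format, of r] by linarith
  then show ?thesis ..
qed (use that in blast)

subsection \<open>The axioms of a tame theory\<close>

lemma tameK: "finitely_b_minimal L K" "jacobian_property L K"
  using tame TK by (auto simp: tame_def T_field_def)

lemma dmap_zeros: "set ss \<subseteq> sorts L \<Longrightarrow> set ts \<subseteq> sorts L \<Longrightarrow> dmap b ss ts (\<lambda>e. map (\<lambda>s. fint K (SZero s) []) ts)"
  by (induction ts) (auto intro!: dmap_Nil dmap_Cons dtm_f0)

text \<open>Outside \<open>D\<close> the tuple of zeros is taken as value, so that the partial maps
  of the axioms can be replaced by total ones.\<close>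

lemma dfun_total: assumes g: "definable_fun L K ss D ts g" and ts: "set ts \<subseteq> sorts L"
  obtains g' where "dmap False ss ts g'" "\<And>e. e \<in> D \<Longrightarrow> g' e = g e"
proof -
  let ?g = "\<lambda>e. if e \<in> D then g e else map (\<lambda>s. fint K (SZero s) []) ts"
  have D: "definable L K ss D" and g2: "g ` D \<subseteq> tuples K ts" "definable L K (ss @ ts) {x @ g x |x. x \<in> D}"
    using g by (auto simp: definable_fun_def)
  have DK: "D \<subseteq> tuples K ss" and s: "set ss \<subseteq> sorts L" using D by (auto simp: definable_def)
  have dD: "dset False ss (\<lambda>e. e \<in> D)"
    using D DK by (simp add: dset_False dset0_def Collect_conj_eq Int_absorb1)
  have gK: "{x @ g x |x. x \<in> D} \<subseteq> tuples K (ss @ ts)" using DK g2 by auto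
  then have dG: "dset False (ss @ ts) (\<lambda>z. z \<in> {x @ g x |x. x \<in> D})"
    using g2 by (simp add: dset_False dset0_def Collect_conj_eq Int_absorb1)
  have "dset False (ss @ ts) (\<lambda>z. if take (length ss) z \<in> D then z \<in> {x @ g x |x. x \<in> D}
      else map (\<lambda>s. fint K (SZero s) []) ts = drop (length ss) z)"
    by (intro dset_if dset_take[OF dD] dG dset_eq[OF dmap_zeros] dmap_last) (use s ts in auto)
  then have "dset False (ss @ ts) (\<lambda>z. ?g (take (length ss) z) = drop (length ss) z)"
  proof (rule dset_cong')
    fix z assume "z \<in> tuples K (ss @ ts)"
    then obtain e c where z: "z = e @ c" "e \<in> tuples K ss" "c \<in> tuples K ts" by (rule tuples_appendE)
    have "z \<in> {x @ g x |x. x \<in> D} \<longleftrightarrow> e \<in> D \<and> c = g e"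
    proof
      assume "z \<in> {x @ g x |x. x \<in> D}"
      then obtain x where x: "x \<in> D" "e @ c = x @ g x" using z by auto
      then have "x = e" using tuples_length[OF z(2)] tuples_length[of x K ss] DK by auto
      then show "e \<in> D \<and> c = g e" using x by simp
    qed (use z in auto)
    then show "(if take (length ss) z \<in> D then z \<in> {x @ g x |x. x \<in> D}
      else map (\<lambda>s. fint K (SZero s) []) ts = drop (length ss) z) \<longleftrightarrow> (?g (take (length ss) z) = drop (length ss) z)"
      using z by auto
  qed
  moreover have "?g e \<in> tuples K ts" if "e \<in> tuples K ss" for e
    using g2 dmap_tuples[OF dmap_zeros[OF s ts] that] by auto
  ultimately have "dmap False ss ts ?g" unfolding dmap_def using s ts by blast
  then show ?thesis using that[of ?g] by simp
qed

lemma dmap_dfun: assumes "dset False ss D" "dmap False ss ts g"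
  shows "definable_fun L K ss {e \<in> tuples K ss. D e} ts g"
proof -
  have s: "set ss \<subseteq> sorts L" "set ts \<subseteq> sorts L" using assms dmap_sorts by auto
  have "dset False (ss @ ts) (\<lambda>z. D (take (length ss) z) \<and> g (take (length ss) z) = drop (length ss) z)"
    by (intro dset_conj dset_take assms) (use assms s in \<open>auto simp: dmap_def\<close>)
  moreover have "{z \<in> tuples K (ss @ ts). D (take (length ss) z) \<and> g (take (length ss) z) = drop (length ss) z} =
     {x @ g x |x. x \<in> {e \<in> tuples K ss. D e}}"
    using dmap_tuples[OF assms(2)] by (auto elim!: tuples_appendE)
  ultimately show ?thesis using assms dmap_tuples[OF assms(2)]
    by (auto simp: definable_fun_def dset_False dset0_def)
qed

text \<open>The parts from finite b-minimality in an encoding that mentions neither the prescribed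
  angular component nor the family of orders. All later arguments about cells refer to this
  form.\<close>

abbreviation bcell where
  "bcell X l g c x y \<equiv> (x = c (y @ g (x # y)) \<and> (\<forall>x'\<in>KF. X (x' # y) \<and> g (x' # y) = g (x # y) \<longrightarrow> x' = x)) \<or>
     (x \<noteq> c (y @ g (x # y)) \<and>
      (\<forall>x'\<in>KF. cl (ord (vd x (c (y @ g (x # y)))) + int l) x x' \<longrightarrow> X (x' # y) \<and> g (x' # y) = g (x # y)) \<and>
      (\<forall>x'\<in>KF. X (x' # y) \<and> g (x' # y) = g (x # y) \<longrightarrow> x' \<noteq> c (y @ g (x # y)) \<and>
         (ord (vd x' (c (y @ g (x # y)))) = ord (vd x (c (y @ g (x # y)))) \<longrightarrow>
           cl (ord (vd x (c (y @ g (x # y)))) + int l) x x')))"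

text \<open>Within a part the angular component is prescribed by a component of the color, so by
  \<open>vac_eq\<close> two points of equal order agree to depth \<open>l\<close>. Conversely,
  points that agree with \<open>x\<close> to this depth share its order, because
  \<open>l \<ge> 1\<close>, and its angular component, hence they belong to the same part.\<close>

lemma bmin: assumes X: "dset False (VF # VV m) X"
  obtains l ns g c where "RR l \<in> sorts L" "set (RRs ns) \<subseteq> sorts L" "dmap False (VF # VV m) (RRs ns) g"
   "dtm False (VV m @ RRs ns) VF c"
   "\<And>x y. \<lbrakk>x \<in> KF; y \<in> tuples K (VV m); X (x # y)\<rbrakk> \<Longrightarrow> bcell X l g c x y"
proof -
  let ?Y = "tuples K (replicate m VF)"
  let ?X = "{e \<in> tuples K (VF # VV m). X e}"
  have Y: "definable L K (replicate m VF) ?Y"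
    using dset_const[OF VV_sorts, of False m True] unfolding dset_False dset0_def VV_def by simp
  have X': "definable L K (VF # replicate m VF) ?X" using X by (simp add: dset_False dset0_def VV_def)
  have XY: "?X \<subseteq> {x # y |x y. y \<in> ?Y}" by (auto simp: tuples_Cons VV_def)
  obtain l ns g c B where l: "RR l \<in> sorts L" and g: "k_partition L K (VF # replicate m VF) ?X ns g"
    and c: "definable_fun L K (replicate m VF @ map RR ns)
             {y @ \<xi> |y \<xi>. y \<in> ?Y \<and> \<xi> \<in> tuples K (map RR ns)} [VF] (\<lambda>z. [c z])"
    and part: "\<forall>y\<in>?Y. \<forall>\<xi>\<in>tuples K (map RR ns).
              let part = {x. x # y \<in> ?X \<and> g (x # y) = \<xi>} in
              part = {} \<or> part = {c (y @ \<xi>)} \<or>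
              (\<exists>j<length ns. ns ! j = l \<and>
                 part = {x \<in> car K VF. x \<noteq> c (y @ \<xi>) \<and>
                           vac K l (vdiff K x (c (y @ \<xi>))) = \<xi> ! j \<and>
                           y @ \<xi> @ [vord K (vdiff K x (c (y @ \<xi>)))] \<in> B})"
  proof -
    have "\<exists>l ns g c B. RR l \<in> sorts L \<and>
           k_partition L K (VF # replicate m VF) ?X ns g \<and>
           definable_fun L K (replicate m VF @ map RR ns)
             {y @ \<xi> |y \<xi>. y \<in> ?Y \<and> \<xi> \<in> tuples K (map RR ns)} [VF] (\<lambda>z. [c z]) \<and>
           definable L K (replicate m VF @ map RR ns @ [VG]) B \<and>
           (\<forall>y\<in>?Y. \<forall>\<xi>\<in>tuples K (map RR ns).
              let part = {x. x # y \<in> ?X \<and> g (x # y) = \<xi>} in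
              part = {} \<or>
              part = {c (y @ \<xi>)} \<or>
              (\<exists>j<length ns. ns ! j = l \<and>
                 part = {x \<in> car K VF. x \<noteq> c (y @ \<xi>) \<and>
                           vac K l (vdiff K x (c (y @ \<xi>))) = \<xi> ! j \<and>
                           y @ \<xi> @ [vord K (vdiff K x (c (y @ \<xi>)))] \<in> B}))"
      by (rule tameK(1)[unfolded finitely_b_minimal_def, THEN conjunct2, THEN spec, THEN spec, THEN spec, THEN mp])
        (use Y X' XY in simp)
    then show ?thesis using that by (elim exE conjE) assumption
  qed
  have ns: "set (RRs ns) \<subseteq> sorts L"
    using g unfolding k_partition_def definable_fun_def definable_def RRs_def by auto
  obtain g' where g': "dmap False (VF # VV m) (RRs ns) g'" "\<And>e. e \<in> ?X \<Longrightarrow> g' e = g e"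
    using dfun_total[OF g[unfolded k_partition_def]] ns by (auto simp: RRs_def VV_def)
  obtain c' where c': "dmap False (VV m @ RRs ns) [VF] c'"
     "\<And>e. e \<in> {y @ \<xi> |y \<xi>. y \<in> ?Y \<and> \<xi> \<in> tuples K (map RR ns)} \<Longrightarrow> c' e = [c e]"
    using dfun_total[OF c] by (auto simp: RRs_def VV_def)
  have ceq: "c' (y @ \<xi>) = [c (y @ \<xi>)]" if "y \<in> tuples K (VV m)" "\<xi> \<in> tuples K (RRs ns)" for y \<xi>
    using c'(2) that by (auto simp: RRs_def VV_def)
  have dc: "dtm False (VV m @ RRs ns) VF c" unfolding dtm_def
  proof (rule dmap_cong'[OF c'(1)])
    fix e assume "e \<in> tuples K (VV m @ RRs ns)"
    then show "c' e = [c e]" using ceq by (auto elim!: tuples_appendE)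
  qed
  show ?thesis
  proof (rule that[OF l ns g'(1) dc])
    fix x y assume x: "x \<in> KF" and y: "y \<in> tuples K (VV m)" and X: "X (x # y)"
    let ?\<xi> = "g' (x # y)"
    let ?part = "{x'. x' # y \<in> ?X \<and> g (x' # y) = ?\<xi>}"
    let ?c = "c (y @ ?\<xi>)"
    have xi: "?\<xi> \<in> tuples K (RRs ns)" by (rule dmap_tuples[OF g'(1)]) (use x y in auto)
    have cK: "?c \<in> KF" by (rule dtm_car[OF dc]) (use xi y in auto)
    have pt: "x' \<in> ?part \<longleftrightarrow> x' \<in> KF \<and> X (x' # y) \<and> g' (x' # y) = ?\<xi>" for x'
      using g'(2) y by auto
    have xp: "x \<in> ?part" using pt x X by simp
    have "?part = {} \<or> ?part = {?c} \<or>
              (\<exists>j<length ns. ns ! j = l \<and>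
                 ?part = {x \<in> car K VF. x \<noteq> ?c \<and> vac K l (vdiff K x ?c) = ?\<xi> ! j \<and>
                           y @ ?\<xi> @ [vord K (vdiff K x ?c)] \<in> B})"
      using part[rule_format, of y ?\<xi>] xi y unfolding Let_def by (simp add: RRs_def VV_def)
    then consider "?part = {?c}" | j where "?part = {x \<in> car K VF. x \<noteq> ?c \<and> vac K l (vdiff K x ?c) = ?\<xi> ! j \<and>
                           y @ ?\<xi> @ [vord K (vdiff K x ?c)] \<in> B}" using xp by blast
    then show "(x = ?c \<and> (\<forall>x'\<in>KF. X (x' # y) \<and> g' (x' # y) = g' (x # y) \<longrightarrow> x' = x)) \<or>
     (x \<noteq> ?c \<and>
      (\<forall>x'\<in>KF. cl (ord (vd x ?c) + int l) x x' \<longrightarrow> X (x' # y) \<and> g' (x' # y) = g' (x # y)) \<and>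
      (\<forall>x'\<in>KF. X (x' # y) \<and> g' (x' # y) = g' (x # y) \<longrightarrow> x' \<noteq> ?c \<and>
         (ord (vd x' ?c) = ord (vd x ?c) \<longrightarrow> cl (ord (vd x ?c) + int l) x x')))"
    proof cases
      case 1
      then have "x' \<in> KF \<and> X (x' # y) \<and> g' (x' # y) = ?\<xi> \<longleftrightarrow> x' = ?c" for x' using pt[of x'] by blast
      then show ?thesis using x X by metis
    next
      case (2 j)
      have P: "x' \<in> KF \<and> X (x' # y) \<and> g' (x' # y) = ?\<xi> \<longleftrightarrow> x' \<in> KF \<and> x' \<noteq> ?c \<and> vac K l (vd x' ?c) = ?\<xi> ! j \<and>
                           y @ ?\<xi> @ [vord K (vd x' ?c)] \<in> B" for x' using pt[of x'] unfolding 2 by blast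
      have xx: "x \<noteq> ?c" "vac K l (vd x ?c) = ?\<xi> ! j" "y @ ?\<xi> @ [vord K (vd x ?c)] \<in> B" using P[of x] x X by auto
      have l1: "l \<ge> 1" using RR_pos[OF l] .
      have "X (x' # y) \<and> g' (x' # y) = ?\<xi>" if x': "x' \<in> KF" "cl (ord (vd x ?c) + int l) x x'" for x'
      proof -
        have "cl (ord (vd x ?c) + 1) x x'" using cl_mono[OF x'(2)] l1 by simp
        from ord_cl_eq[OF x x'(1) cK xx(1) this] have o: "x' \<noteq> ?c" "ord (vd x' ?c) = ord (vd x ?c)" by auto
        have "vac K l (vd x' ?c) = ?\<xi> ! j" using vac_eq[OF l x x'(1) cK xx(1) o(1)] o x'(2) xx(2) by simp
        moreover have "vord K (vd x' ?c) = vord K (vd x ?c)" using o(2) x x' cK by (metis hinv_ord vd_in)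
        ultimately show ?thesis using P[of x'] o x' xx by metis
      qed
      moreover have "x' \<noteq> ?c \<and> (ord (vd x' ?c) = ord (vd x ?c) \<longrightarrow> cl (ord (vd x ?c) + int l) x x')"
        if x': "x' \<in> KF" "X (x' # y) \<and> g' (x' # y) = ?\<xi>" for x'
        using P[of x'] x' xx vac_eq[OF l x x'(1) cK xx(1)] by metis
      ultimately show ?thesis using xx(1) by blast
    qed
  qed
qed

section \<open>Functions that are constant or scale distances on a ball\<close>

definition constjac :: "('u \<Rightarrow> 'u) \<Rightarrow> 'u \<Rightarrow> int \<Rightarrow> bool" where
  "constjac f a r \<longleftrightarrow> (\<forall>x\<in>KF. cl r a x \<longrightarrow> f x = f a) \<or>
    (\<exists>\<epsilon>. (\<forall>x\<in>KF. \<forall>x'\<in>KF. cl r a x \<and> cl r a x' \<and> x \<noteq> x' \<longrightarrow> f x \<noteq> f x' \<and> ord (vd (f x) (f x')) = \<epsilon> + ord (vd x x')) \<and>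
      (\<forall>w\<in>KF. cl (r + \<epsilon>) (f a) w \<longrightarrow> (\<exists>x\<in>KF. cl r a x \<and> f x = w)))"

lemma vclose_cl: "\<lbrakk>x \<in> KF; a \<in> KF; \<gamma> \<in> car K VG\<rbrakk> \<Longrightarrow> vclose K \<gamma> x a \<longleftrightarrow> cl (hh \<gamma> + 1) a x"
  using Zh'(6)[of \<gamma> "vord K (vd x a)"] vord_car[of "vd x a"] ord_sym[of x a]
  by (auto simp: vclose_def cl_def ord_hh)

lemma vball_cl: "a \<in> KF \<Longrightarrow> \<gamma> \<in> car K VG \<Longrightarrow> vball K a \<gamma> = {x \<in> KF. cl (hh \<gamma> + 1) a x}"
  by (auto simp: vball_def vclose_cl)

lemma is_ball_cl: "is_ball K B \<longleftrightarrow> (\<exists>a\<in>KF. \<exists>r. B = {x \<in> KF. cl r a x})"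
proof
  assume "is_ball K B"
  then show "\<exists>a\<in>KF. \<exists>r. B = {x \<in> KF. cl r a x}" unfolding is_ball_def using vball_cl by blast
next
  assume "\<exists>a\<in>KF. \<exists>r. B = {x \<in> KF. cl r a x}"
  then obtain a r where a: "a \<in> KF" "B = {x \<in> KF. cl r a x}" by blast
  have "vball K a (hinv (r - 1)) = B" using a vball_cl[OF a(1), of "hinv (r - 1)"] by simp
  then show "is_ball K B" unfolding is_ball_def using a hinv_car by blast
qed

text \<open>In \<open>constjac\<close> the integer \<open>\<epsilon>\<close> is the order of the
  derivative. The axiom says that the image is some ball; a point at distance exactly
  \<open>r\<close> from \<open>a\<close> has its image at distance \<open>r + \<epsilon>\<close>, so
  the image ball is at least that large.\<close>

lemma jac: assumes F: "dtm False (VF # ss) VF f"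
  obtains ns g where "set (RRs ns) \<subseteq> sorts L" "dmap False (VF # ss) (RRs ns) g"
    "\<And>y a r. \<lbrakk>y \<in> tuples K ss; a \<in> KF; (\<forall>x\<in>KF. cl r a x \<longrightarrow> g (x # y) = g (a # y))\<rbrakk> \<Longrightarrow> constjac (\<lambda>x. f (x # y)) a r"
proof -
  let ?Y = "tuples K ss" and ?X = "tuples K (VF # ss)"
  have s: "set ss \<subseteq> sorts L" using dtm_sorts[OF F] by auto
  have Y: "definable L K ss ?Y" using dset_const[OF s, of False True] by (simp add: dset_False dset0_def)
  have X: "?X \<subseteq> {x # y |x y. y \<in> ?Y}" by (auto simp: tuples_Cons)
  have dX: "dset False (VF # ss) (\<lambda>e. True)" by (rule dset_const) (use s in auto)
  have dF: "definable_fun L K (VF # ss) ?X [VF] (\<lambda>z. [f z])"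
    using dmap_dfun[OF dX F[unfolded dtm_def]] by simp
  obtain ns g where g: "k_partition L K (VF # ss) ?X ns g"
     and J: "\<forall>y\<in>?Y. \<forall>\<xi>\<in>tuples K (map RR ns). \<forall>B.
              is_ball K B \<and> B \<subseteq> {x. x # y \<in> ?X \<and> g (x # y) = \<xi>} \<longrightarrow>
              (\<exists>a. \<forall>x\<in>B. f (x # y) = a) \<or> jacobian_on K 1 (\<lambda>x. f (x # y)) B"
  proof -
    have "\<exists>ns g. k_partition L K (VF # ss) ?X ns g \<and>
           (\<forall>y\<in>?Y. \<forall>\<xi>\<in>tuples K (map RR ns). \<forall>B.
              is_ball K B \<and> B \<subseteq> {x. x # y \<in> ?X \<and> g (x # y) = \<xi>} \<longrightarrow>
              (\<exists>a. \<forall>x\<in>B. f (x # y) = a) \<or> jacobian_on K 1 (\<lambda>x. f (x # y)) B)"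
      by (rule tameK(2)[unfolded jacobian_property_def, THEN spec, THEN spec, THEN spec, THEN spec, THEN spec, THEN mp])
        (use Y X dF RR1_sort in simp)
    then show ?thesis using that by (elim exE conjE) assumption
  qed
  have ns: "set (RRs ns) \<subseteq> sorts L"
    using g unfolding k_partition_def definable_fun_def definable_def RRs_def by auto
  obtain g' where g': "dmap False (VF # ss) (RRs ns) g'" "\<And>e. e \<in> ?X \<Longrightarrow> g' e = g e"
    using dfun_total[OF g[unfolded k_partition_def]] ns by (auto simp: RRs_def)
  show ?thesis
  proof (rule that[OF ns g'(1)])
    fix y a r assume y: "y \<in> tuples K ss" and a: "a \<in> KF"
      and c: "\<forall>x\<in>KF. cl r a x \<longrightarrow> g' (x # y) = g' (a # y)"
    let ?B = "{x \<in> KF. cl r a x}" and ?f = "\<lambda>x. f (x # y)"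
    have fK: "?f x \<in> KF" if "x \<in> KF" for x by (rule dtm_car[OF F]) (use that y in simp)
    have ball: "is_ball K ?B" using a is_ball_cl by blast
    have xi: "g (a # y) \<in> tuples K (map RR ns)" using dmap_tuples[OF g'(1), of "a # y"] g'(2)[of "a # y"] a y by (simp add: RRs_def)
    have "g (x # y) = g (a # y)" if "x \<in> KF" "cl r a x" for x
      using c[rule_format, OF that] g'(2)[of "x # y"] g'(2)[of "a # y"] that y a by simp
    then have "?B \<subseteq> {x. x # y \<in> ?X \<and> g (x # y) = g (a # y)}" using y by auto
    then have "(\<exists>a. \<forall>x\<in>?B. f (x # y) = a) \<or> jacobian_on K 1 ?f ?B" using J y xi ball by blast
    then consider b where "\<forall>x\<in>?B. f (x # y) = b" | "jacobian_on K 1 ?f ?B" by blast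
    then show "constjac ?f a r"
    proof cases
      case 1
      then show ?thesis unfolding constjac_def using a by (metis (no_types, lifting) cl_refl mem_Collect_eq)
    next
      case 2
      note J2 = 2[unfolded jacobian_on_def]
      from J2 obtain F' where F0: "F' ` ?B \<subseteq> car K VF - {vzero K} \<and>
        (\<forall>x\<in>?B. has_vderiv K ?f ?B x (F' x)) \<and> vcontinuous_on K ?B F' \<and>
        (\<forall>x\<in>?B. \<forall>x'\<in>?B. vord K (F' x) = vord K (F' x') \<and> vac K 1 (F' x) = vac K 1 (F' x')) \<and>
        (\<forall>x\<in>?B. \<forall>x'\<in>?B. x \<noteq> x' \<longrightarrow>
           vord K (vdiff K (?f x) (?f x')) = gplus K (vord K (F' x)) (vord K (vdiff K x x')) \<and>
           vac K 1 (vdiff K (?f x) (?f x')) =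
             vac K 1 (F' x) \<otimes>\<^bsub>ring_of K (RR 1)\<^esub> vac K 1 (vdiff K x x'))"
        by (elim conjE exE) (rule that, intro conjI)
      have F': "inj_on ?f ?B" "is_ball K (?f ` ?B)" "F' ` ?B \<subseteq> car K VF - {vzero K}"
        "\<And>x x'. x\<in>?B \<Longrightarrow> x'\<in>?B \<Longrightarrow> vord K (F' x) = vord K (F' x')"
        "\<And>x x'. \<lbrakk>x\<in>?B; x'\<in>?B; x \<noteq> x'\<rbrakk> \<Longrightarrow> vord K (vdiff K (?f x) (?f x')) = gplus K (vord K (F' x)) (vord K (vdiff K x x'))"
        using J2 F0 by blast+
      have aB: "a \<in> ?B" using a by simp
      have sc: "?f x \<noteq> ?f x' \<and> ord (vd (?f x) (?f x')) = ord (F' a) + ord (vd x x')"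
        if x: "x \<in> ?B" "x' \<in> ?B" "x \<noteq> x'" for x x'
      proof
        show "?f x \<noteq> ?f x'" using F'(1) x by (auto simp: inj_on_def)
        have "F' x \<in> KF" "F' a \<in> KF" using F'(3) x(1) aB by blast+
        moreover have "vord K (F' x) = vord K (F' a)" using F'(4) x aB by blast
        ultimately show "ord (vd (?f x) (?f x')) = ord (F' a) + ord (vd x x')"
          using F'(5) x Zh'(6)[of "vord K (F' a)" "vord K (vd x x')"] vord_car by (simp add: ord_hh)
      qed
      obtain b s where b: "b \<in> KF" "?f ` ?B = {w \<in> KF. cl s b w}" using F'(2) is_ball_cl by auto
      have fa: "cl s b (?f a)" using b(2) aB by blast
      obtain x where x: "x \<in> KF" "x \<noteq> a" "ord (vd x a) = r" "ord (vd a x) = r" using ex_exact[OF a] by metis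
      have xB: "x \<in> ?B" using x by (simp add: cl_def)
      have "cl s b (?f x)" using b(2) xB by blast
      then have "cl s (?f a) (?f x)" using fa cl_trans[OF fK[OF a] b(1) fK[OF x(1)]] cl_sym[OF b(1) fK[OF a]] by blast
      then have sr: "s \<le> r + ord (F' a)" using sc[OF aB xB] x by (auto simp: cl_def)
      have "\<exists>x\<in>KF. cl r a x \<and> ?f x = w" if w: "w \<in> KF" "cl (r + ord (F' a)) (?f a) w" for w
      proof -
        have "cl s b w" using cl_trans[OF b(1) fK[OF a] w(1) fa] cl_mono[OF w(2) sr] by blast
        then have "w \<in> ?f ` ?B" using b(2) w(1) by blast
        then show ?thesis by blast
      qed
      then show ?thesis unfolding constjac_def using sc by blast
    qed
  qed
qed

subsection \<open>Small sets\<close>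

text \<open>Containing no ball (\<open>nob\<close>) and being uniformly discrete (\<open>ud\<close>) are equivalent for definable sets.\<close>

definition nob :: "('u \<Rightarrow> bool) \<Rightarrow> bool" where
  "nob S \<longleftrightarrow> (\<forall>a\<in>KF. \<forall>r. \<exists>x\<in>KF. cl r a x \<and> \<not> S x)"

definition ud :: "('u \<Rightarrow> bool) \<Rightarrow> bool" where
  "ud S \<longleftrightarrow> (\<exists>\<rho>. \<forall>x\<in>KF. \<forall>x'\<in>KF. S x \<and> S x' \<and> cl \<rho> x x' \<longrightarrow> x = x')"

lemma nobE: assumes "\<not> nob S" obtains a r where "a \<in> KF" "\<And>x. x \<in> KF \<Longrightarrow> cl r a x \<Longrightarrow> S x"
proof -
  have "\<exists>a\<in>KF. \<exists>r. \<forall>x\<in>KF. cl r a x \<longrightarrow> S x" using assms unfolding nob_def by simp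
  then obtain a r where "a \<in> KF" "\<forall>x\<in>KF. cl r a x \<longrightarrow> S x" by blast
  then show ?thesis using that[of a r] by simp
qed

lemma nob_mono: "nob S \<Longrightarrow> (\<And>x. x \<in> KF \<Longrightarrow> S' x \<Longrightarrow> S x) \<Longrightarrow> nob S'"
  unfolding nob_def by blast

lemma ud_nob: assumes "ud S" shows "nob S"
proof (rule ccontr)
  assume "\<not> nob S"
  then obtain a r where a: "a \<in> KF" "\<And>x. x \<in> KF \<Longrightarrow> cl r a x \<Longrightarrow> S x" by (rule nobE) (rule that)
  obtain \<rho> where \<rho>: "\<forall>x\<in>KF. \<forall>x'\<in>KF. S x \<and> S x' \<and> cl \<rho> x x' \<longrightarrow> x = x'" using assms unfolding ud_def by blast
  obtain x where x: "x \<in> KF" "x \<noteq> a" "ord (vd a x) = max r \<rho>" using ex_exact[OF a(1)] by metis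
  have "cl r a x" "cl \<rho> a x" using x by (auto simp: cl_def)
  then show False using \<rho> a x by (metis cl_refl)
qed

lemma rel1: "dset b [VF] (\<lambda>e. S (hd e)) \<Longrightarrow> dtm b c VF t \<Longrightarrow> dset b c (\<lambda>e. S (t e))"
  using dset_rel[of b "[VF]" "\<lambda>e. S (hd e)" c "\<lambda>e. [t e]"] by (simp add: dtm_def)

lemma relR: "\<lbrakk>dset b (VF # us) (\<lambda>e. I (hd e) (tl e)); dtm b c VF t; dmap b c us a\<rbrakk> \<Longrightarrow> dset b c (\<lambda>e. I (t e) (a e))"
  using dset_rel[of b "VF # us" "\<lambda>e. I (hd e) (tl e)" c "\<lambda>e. t e # a e"] by (simp add: dmap_Cons)

lemma rel2: "\<lbrakk>dset b [VF, VF] (\<lambda>e. G (hd e) (hd (tl e))); dtm b c VF t; dtm b c VF u\<rbrakk> \<Longrightarrow> dset b c (\<lambda>e. G (t e) (u e))"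
  using dset_rel[of b "[VF, VF]" "\<lambda>e. G (hd e) (hd (tl e))" c "\<lambda>e. [t e, u e]"] dtm_sorts[of b c VF t]
  by (simp add: dmap_Cons dmap_Nil)

lemma relG: "\<lbrakk>dset b [VF, VG] (\<lambda>e. G (hd e) (hh (hd (tl e)))); dtm b c VF t; dint b c u\<rbrakk> \<Longrightarrow> dset b c (\<lambda>e. G (t e) (u e))"
  using dset_rel[of b "[VF, VG]" "\<lambda>e. G (hd e) (hh (hd (tl e)))" c "\<lambda>e. [t e, hinv (u e)]"] dtm_sorts[of b c VF t]
  by (simp add: dmap_Cons dmap_Nil dint_def)

text \<open>For a fixed pair of residue parameters at most one distance occurs, so the distances are
  bounded for each pair. Saturation, applied to pairs, makes the bound uniform.\<close>

lemma UDrel: assumes R: "dset True (VF # RRs ns) (\<lambda>e. R (hd e) (tl e))"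
   and un: "\<And>x x' \<xi>. \<lbrakk>x \<in> KF; x' \<in> KF; \<xi> \<in> tuples K (RRs ns); R x \<xi>; R x' \<xi>\<rbrakk> \<Longrightarrow> x = x'"
  shows "ud (\<lambda>x. \<exists>\<xi>\<in>tuples K (RRs ns). R x \<xi>)"
proof -
  let ?n = "length (RRs ns)"
  let ?P = "\<lambda>\<zeta> r. \<exists>x\<in>KF. \<exists>x'\<in>KF. R x (take ?n \<zeta>) \<and> R x' (drop ?n \<zeta>) \<and> x \<noteq> x' \<and> ord (vd x x') = r"
  have s: "set (RRs ns) \<subseteq> sorts L" using dset_sorts[OF R] by simp
  have "dset True (RRs (ns @ ns) @ [VG]) (\<lambda>z. ?P (take (length (RRs (ns @ ns))) z) (hh (z ! length (RRs (ns @ ns)))))"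
    unfolding RRs_append
    by (rule dI dset_eqt dset_inteq relR[OF R] | (use s in \<open>simp; fail\<close>))+
  then obtain b where b: "\<And>\<zeta> r. \<zeta> \<in> tuples K (RRs (ns @ ns)) \<Longrightarrow> ?P \<zeta> r \<Longrightarrow> r \<le> b"
  proof (rule rr_bound)
    fix \<zeta> assume "\<zeta> \<in> tuples K (RRs (ns @ ns))"
    then have t: "take ?n \<zeta> \<in> tuples K (RRs ns)" "drop ?n \<zeta> \<in> tuples K (RRs ns)"
      by (simp_all add: RRs_append tuples_append)
    show "\<exists>b. \<forall>r. ?P \<zeta> r \<longrightarrow> r \<le> b"
    proof (cases "\<exists>r. ?P \<zeta> r")
      case True
      then obtain x x' where x: "x \<in> KF" "x' \<in> KF" "R x (take ?n \<zeta>)" "R x' (drop ?n \<zeta>)" by blast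
      show ?thesis
      proof (intro exI[of _ "ord (vd x x')"] allI impI, elim bexE conjE)
        fix r y y' assume y: "y \<in> KF" "y' \<in> KF" "R y (take ?n \<zeta>)" "R y' (drop ?n \<zeta>)" "ord (vd y y') = r"
        have "y = x" by (rule un[OF y(1) x(1) t(1) y(3) x(3)])
        moreover have "y' = x'" by (rule un[OF y(2) x(2) t(2) y(4) x(4)])
        ultimately show "r \<le> ord (vd x x')" using y by simp
      qed
    qed blast
  qed blast
  show ?thesis unfolding ud_def
  proof (intro exI[of _ "b + 1"] ballI impI, elim conjE bexE, rule ccontr)
    fix x x' \<xi> \<xi>' assume *: "x \<in> KF" "x' \<in> KF" "cl (b + 1) x x'" "\<xi> \<in> tuples K (RRs ns)" "R x \<xi>"
      "\<xi>' \<in> tuples K (RRs ns)" "R x' \<xi>'" "x \<noteq> x'"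
    have t: "\<xi> @ \<xi>' \<in> tuples K (RRs (ns @ ns))" using * by (simp add: RRs_append)
    have "?P (\<xi> @ \<xi>') (ord (vd x x'))"
      by (intro bexI[of _ x] bexI[of _ x'] conjI refl) (use * in simp_all)
    from b[OF t this] show False using *(3,8) by (simp add: cl_def)
  qed
qed

text \<open>Equivalently, \<open>x\<close> differs from every such \<open>c\<close> and
  \<open>ord (x - c) + l \<le> r\<close>, so that the ball of radius \<open>r\<close> about
  \<open>x\<close> is contained in the ball of radius \<open>ord (x - c) + l\<close>. For
  \<open>l = 1\<close> it says that the ball of radius \<open>r\<close> misses the set.\<close>

abbreviation far where
  "far C l r x y \<equiv> \<forall>c\<in>KF. C (c # y) \<longrightarrow> \<not> cl (r + 1 - int l) x c"

text \<open>\<open>C\<close> collects the centers of the cells of \<open>X\<close> for all colors,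
  so \<open>UDrel\<close> applies to it. A point of \<open>X\<close> far from the centers has its
  ball inside its own cell. Farness passes to every point of that ball, so one implication is
  enough.\<close>

lemma bm_near: assumes X: "dset False (VF # VV m) X"
  obtains l C where "RR l \<in> sorts L" "dset False (VF # VV m) C" "\<And>y. y \<in> tuples K (VV m) \<Longrightarrow> ud (\<lambda>x. C (x # y))"
   "\<And>y x x' r. \<lbrakk>y \<in> tuples K (VV m); x \<in> KF; x' \<in> KF; far C l r x y;
     cl r x x'\<rbrakk> \<Longrightarrow> X (x # y) \<longleftrightarrow> X (x' # y)"
proof -
  from bmin[OF X] obtain l ns g c where l: "RR l \<in> sorts L" and ns: "set (RRs ns) \<subseteq> sorts L" 
   and g: "dmap False (VF # VV m) (RRs ns) g"
   and c: "dtm False (VV m @ RRs ns) VF c" and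
   P: "\<And>x y. \<lbrakk>x \<in> KF; y \<in> tuples K (VV m); X (x # y)\<rbrakk> \<Longrightarrow> bcell X l g c x y"
    by blast
  let ?C = "\<lambda>e. \<exists>\<xi>\<in>tuples K (RRs ns). hd e = c (tl e @ \<xi>)"
  have l1: "l \<ge> 1" by (rule RR_pos[OF l])
  have dC: "dset False (VF # VV m) ?C"
    by (rule dI dset_eqt dtm_app0[OF c] | (use ns in \<open>simp; fail\<close>))+
  have half: "X (x' # y)" if y: "y \<in> tuples K (VV m)" and x: "x \<in> KF" "x' \<in> KF" "far ?C l r x y"
     "cl r x x'" "X (x # y)" for x x' y r
  proof -
    let ?c = "c (y @ g (x # y))"
    have xi: "g (x # y) \<in> tuples K (RRs ns)" by (rule dmap_tuples[OF g]) (use x y in simp)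
    have cK: "?c \<in> KF" by (rule dtm_car[OF c]) (use xi y in simp)
    have nc: "\<not> cl (r + 1 - int l) x ?c" using x(3) cK xi by auto
    then have "x \<noteq> ?c" by auto
    then have b: "\<forall>x'\<in>KF. cl (ord (vd x ?c) + int l) x x' \<longrightarrow> X (x' # y) \<and> g (x' # y) = g (x # y)" using P[OF x(1) y x(5)] by blast
    have "ord (vd x ?c) + int l \<le> r" using nc by (simp add: cl_def)
    then show ?thesis using b x(2) cl_mono[OF x(4)] by blast
  qed
  show ?thesis
  proof (rule that[OF l dC])
    fix y assume y: "y \<in> tuples K (VV m)"
    have "ud (\<lambda>x. \<exists>\<xi>\<in>tuples K (RRs ns). x = c (y @ \<xi>))"
      by (rule UDrel) (rule dI dset_eqt dtm_app0[OF c] | (use ns y in \<open>simp; fail\<close>))+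
    then show "ud (\<lambda>x. ?C (x # y))" by simp
    fix x x' r assume x: "x \<in> KF" "x' \<in> KF" "far ?C l r x y" "cl r x x'"
    have x': "cl (r + 1 - int l) x' x" using cl_mono[OF cl_sym[OF x(1,2,4)]] l1 by simp
    have "far ?C l r x' y"
      using x x' cl_trans[OF x(1) x(2)] cl_sym[OF x(2) x(1) x'] by blast
    then show "X (x # y) \<longleftrightarrow> X (x' # y)"
      using half[OF y x(1,2,3,4)] half[OF y x(2,1) _ cl_sym[OF x(1,2,4)]] by blast
  qed
qed

lemma dset_nob: assumes X: "dset b (VF # us) X" shows "dset b us (\<lambda>y. nob (\<lambda>x. X (x # y)))"
proof -
  have s: "set us \<subseteq> sorts L" using dset_sorts[OF X] by simp
  show ?thesis unfolding nob_def
    by (rule dI dset_eqt dset_rel[OF X] | (use s in \<open>simp; fail\<close>))+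
qed

text \<open>Restrict \<open>X\<close> to its fibers without balls. A cell of the restricted set that
  is not a single point would contain a ball, so the color determines the point.\<close>

lemma code0: assumes X: "dset False (VF # VV m) X"
  obtains ns g where "set (RRs ns) \<subseteq> sorts L" "dmap False (VF # VV m) (RRs ns) g"
   "\<And>y x x'. \<lbrakk>y \<in> tuples K (VV m); nob (\<lambda>x. X (x # y)); x \<in> KF; x' \<in> KF; X (x # y); X (x' # y);
     g (x # y) = g (x' # y)\<rbrakk> \<Longrightarrow> x = x'"
proof -
  let ?X = "\<lambda>e. X e \<and> nob (\<lambda>x. X (x # tl e))"
  have dX: "dset False (VF # VV m) ?X"
    by (rule dI X dset_rel[OF dset_nob[OF X]] | (simp; fail))+
  from bmin[OF dX] obtain l ns g c where l: "RR l \<in> sorts L" and ns: "set (RRs ns) \<subseteq> sorts L" 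
   and g: "dmap False (VF # VV m) (RRs ns) g"
   and c: "dtm False (VV m @ RRs ns) VF c" and
   P: "\<And>x y. \<lbrakk>x \<in> KF; y \<in> tuples K (VV m); ?X (x # y)\<rbrakk> \<Longrightarrow> bcell ?X l g c x y"
    by blast
  show ?thesis
  proof (rule that[OF ns g])
    fix y x x' assume *: "y \<in> tuples K (VV m)" "nob (\<lambda>x. X (x # y))" "x \<in> KF" "x' \<in> KF" "X (x # y)" "X (x' # y)"
      "g (x # y) = g (x' # y)"
    show "x = x'"
    proof (rule ccontr)
      assume "x \<noteq> x'"
      then have "\<forall>x'\<in>KF. cl (ord (vd x (c (y @ g (x # y)))) + int l) x x' \<longrightarrow> X (x' # y)"
        using P[of x y] * by auto
      then show False using *(2,3) unfolding nob_def by blast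
    qed
  qed
qed

subsection \<open>Replacing parameters by field elements\<close>

text \<open>Finite b-minimality takes its parameters from \<open>K\<close>, so the other sorts are
  represented by field elements: the value group by orders, a residue ring by angular components,
  from which \<open>1\<close> is subtracted if a second field element is nonzero. The correction
  reaches the nonunits.\<close>

lemma surj_VF: "set ss \<subseteq> sorts L \<Longrightarrow> \<exists>m h. dmap False (VV m) ss h \<and> h ` tuples K (VV m) = tuples K ss"
proof (induction ss)
  case Nil
  then show ?case by (intro exI[of _ 0] exI[of _ "\<lambda>e. []"]) (auto intro: dmap_Nil)
next
  case (Cons s ss)
  then obtain m h where h: "dmap False (VV m) ss h" "h ` tuples K (VV m) = tuples K ss" by auto
  have "\<exists>k t. dtm False (VV k) s t \<and> (\<forall>a\<in>car K s. \<exists>e\<in>tuples K (VV k). t e = a)"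
  proof (cases s)
    case VF
    have "dtm False (VV 1) VF (\<lambda>e. hd e)" unfolding One_nat_def VV_1 by (rule dI | (simp; fail))+
    moreover have "\<exists>e\<in>tuples K (VV 1). hd e = a" if "a \<in> KF" for a
      using that by (intro bexI[of _ "[a]"]) (simp_all add: VV_def)
    ultimately show ?thesis using VF by blast
  next
    case VG
    have "dtm False (VV 1) VG (\<lambda>e. hinv (ord (hd e)))" unfolding One_nat_def VV_1 by (rule dI | (simp; fail))+
    moreover have "\<exists>e\<in>tuples K (VV 1). hinv (ord (hd e)) = a" if a: "a \<in> car K VG" for a
    proof -
      obtain x where "x \<in> KF" "ord x = hh a" using ord_surj by metis
      then show ?thesis using a by (intro bexI[of _ "[x]"]) (auto simp: VV_def)
    qed
    ultimately show ?thesis using VG by blast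
  next
    case (RR n)
    then have n: "RR n \<in> sorts L" using Cons.prems by simp
    let ?t = "\<lambda>e. if hd (tl e) = zz then vac K n (hd e) else radd n (vac K n (hd e)) (rneg n (rone n))"
    have V2: "VV 2 = [VF, VF]" by (simp add: VV_def numeral_2_eq_2)
    have "dtm False (VV 2) (RR n) ?t" unfolding V2
      by (rule dtm_if dI dset_eqt | (use n in \<open>simp; fail\<close>))+
    moreover have "\<exists>e\<in>tuples K (VV 2). ?t e = a" if a: "a \<in> car K (RR n)" for a
      using ac_surj[OF n a]
    proof
      assume "\<forall>r. \<exists>z\<in>KF. z \<noteq> zz \<and> ord z = r \<and> vac K n z = a"
      then obtain z where "z \<in> KF" "vac K n z = a" by blast
      then show ?thesis by (intro bexI[of _ "[z, zz]"]) (auto simp: V2)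
    next
      assume "\<forall>r. \<exists>z\<in>KF. z \<noteq> zz \<and> ord z = r \<and> vac K n z = radd n a (rone n)"
      then obtain z where "z \<in> KF" "vac K n z = radd n a (rone n)" by blast
      then show ?thesis using radd_rneg[OF n a] one_nz by (intro bexI[of _ "[z, \<one>\<^bsub>F\<^esub>]"]) (auto simp: V2)
    qed
    ultimately show ?thesis using RR by blast
  qed
  then obtain k t where t: "dtm False (VV k) s t" "\<forall>a\<in>car K s. \<exists>e\<in>tuples K (VV k). t e = a" by blast
  let ?h = "\<lambda>e. t (take (length (VV k)) e) # h (drop (length (VV k)) e)"
  have d: "dmap False (VV (k + m)) (s # ss) ?h" unfolding VV_add
    by (rule dmap_Cons dtm_app0[OF t(1)] dmap_app0[OF h(1)] dI | (simp; fail))+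
  have "\<exists>e\<in>tuples K (VV (k + m)). ?h e = x # y" if xy: "x \<in> car K s" "y \<in> tuples K ss" for x y
  proof -
    obtain e1 where "e1 \<in> tuples K (VV k)" "t e1 = x" using t xy by blast
    moreover have "y \<in> h ` tuples K (VV m)" using h(2) xy by simp
    then obtain e2 where "e2 \<in> tuples K (VV m)" "h e2 = y" by (elim imageE) simp
    ultimately show ?thesis by (intro bexI[of _ "e1 @ e2"]) (auto simp: VV_add)
  qed
  then have "?h ` tuples K (VV (k + m)) = tuples K (s # ss)"
    using dmap_tuples[OF d] by (auto simp: tuples_Cons image_iff) metis
  then show ?case using d by blast
qed

lemma lift_params: assumes P: "dset True ss P"
  obtains m w X where "w \<in> tuples K (VV m)" "dset False (VV m @ ss) X" "\<And>e. e \<in> tuples K ss \<Longrightarrow> P e \<longleftrightarrow> X (w @ e)"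
proof -
  obtain ts ps E where E: "ps \<in> tuples K ts" "dset False (ts @ ss) E" "\<forall>e\<in>tuples K ss. P e \<longleftrightarrow> E (ps @ e)"
    using P unfolding dset_def[of True] dset_False by blast
  have s: "set ts \<subseteq> sorts L" "set ss \<subseteq> sorts L" using dset_sorts[OF E(2)] by auto
  obtain m h where h: "dmap False (VV m) ts h" "h ` tuples K (VV m) = tuples K ts" using surj_VF[OF s(1)] by blast
  have "ps \<in> h ` tuples K (VV m)" using h(2) E(1) by simp
  then obtain w where w: "w \<in> tuples K (VV m)" "h w = ps" by (elim imageE) simp
  have "dset False (VV m @ ss) (\<lambda>z. E (h (take (length (VV m)) z) @ drop (length (VV m)) z))"
    by (rule dset_app0[OF E(2)] dmap_app0[OF h(1)] dI | (use s in \<open>simp; fail\<close>))+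
  from that[OF w(1) this] show ?thesis using E w by simp
qed

lemma lift2: assumes P: "dset True (VF # us) P"
  obtains m w X where "w \<in> tuples K (VV m)" "dset False (VF # VV m @ us) X"
    "\<And>x u. x \<in> KF \<Longrightarrow> u \<in> tuples K us \<Longrightarrow> P (x # u) \<longleftrightarrow> X (x # w @ u)"
proof -
  obtain m w X where X: "w \<in> tuples K (VV m)" "dset False (VV m @ VF # us) X"
     "\<And>e. e \<in> tuples K (VF # us) \<Longrightarrow> P e \<longleftrightarrow> X (w @ e)" by (rule lift_params[OF P]) (rule that)
  have s: "set us \<subseteq> sorts L" using dset_sorts[OF P] by auto
  have "dset False (VF # VV m @ us) (\<lambda>e. X (take (length (VV m)) (tl e) @ hd e # drop (length (VV m)) (tl e)))"
    by (rule dset_app0[OF X(2)] dI | (use s in \<open>simp; fail\<close>))+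
  from that[OF X(1) this] show ?thesis using X by simp
qed

text \<open>The parameters of \<open>P\<close> and the varying \<open>u\<close> both become field
  variables of one family without parameters. The price is that \<open>w\<close> is merely known to
  exist for each \<open>u\<close>.\<close>

lemma lift_all: assumes P: "dset True (VF # us) P"
  obtains m X where "dset False (VF # VV m) X"
    "\<And>u. u \<in> tuples K us \<Longrightarrow> \<exists>w\<in>tuples K (VV m). \<forall>x\<in>KF. P (x # u) \<longleftrightarrow> X (x # w)"
proof -
  obtain m w X where X: "w \<in> tuples K (VV m)" "dset False (VF # VV m @ us) X"
    "\<And>x u. x \<in> KF \<Longrightarrow> u \<in> tuples K us \<Longrightarrow> P (x # u) \<longleftrightarrow> X (x # w @ u)" by (rule lift2[OF P]) (rule that)
  have s: "set us \<subseteq> sorts L" using dset_sorts[OF P] by auto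
  obtain k h where h: "dmap False (VV k) us h" "h ` tuples K (VV k) = tuples K us" using surj_VF[OF s] by blast
  let ?X = "\<lambda>e. X (hd e # take (length (VV m)) (tl e) @ h (drop (length (VV m)) (tl e)))"
  have d: "dset False (VF # VV (m + k)) ?X" unfolding VV_add
    by (rule dset_app0[OF X(2)] dmap_app0[OF h(1)] dI | (use s in \<open>simp; fail\<close>))+
  show ?thesis
  proof (rule that[OF d])
    fix u assume u: "u \<in> tuples K us"
    then have "u \<in> h ` tuples K (VV k)" using h(2) by simp
    then obtain v where v: "v \<in> tuples K (VV k)" "h v = u" by (elim imageE) simp
    show "\<exists>w\<in>tuples K (VV (m + k)). \<forall>x\<in>KF. P (x # u) \<longleftrightarrow> ?X (x # w)"
      by (rule bexI[of _ "w @ v"]) (use X u v in \<open>simp_all add: VV_add\<close>)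
  qed
qed

text \<open>The depth \<open>l\<close> is uniform in \<open>u\<close>, but \<open>C\<close> is
  obtained for one \<open>u\<close> at a time, because it depends on the field elements chosen to
  represent \<open>u\<close>.\<close>

lemma bm_nearP: assumes P: "dset True (VF # us) P"
  obtains l where "RR l \<in> sorts L"
   "\<And>u. u \<in> tuples K us \<Longrightarrow> \<exists>C. ud C \<and> (\<forall>x\<in>KF. \<forall>x'\<in>KF. \<forall>r. (\<forall>c\<in>KF. C c \<longrightarrow> \<not> cl (r + 1 - int l) x c) \<longrightarrow> cl r x x' \<longrightarrow>
      (P (x # u) \<longleftrightarrow> P (x' # u)))"
proof -
  obtain m X where X: "dset False (VF # VV m) X"
    "\<And>u. u \<in> tuples K us \<Longrightarrow> \<exists>w\<in>tuples K (VV m). \<forall>x\<in>KF. P (x # u) \<longleftrightarrow> X (x # w)" by (rule lift_all[OF P]) (rule that)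
  obtain l C where l: "RR l \<in> sorts L" "\<And>y. y \<in> tuples K (VV m) \<Longrightarrow> ud (\<lambda>x. C (x # y))"
   "\<And>y x x' r. \<lbrakk>y \<in> tuples K (VV m); x \<in> KF; x' \<in> KF; far C l r x y;
     cl r x x'\<rbrakk> \<Longrightarrow> X (x # y) \<longleftrightarrow> X (x' # y)" by (rule bm_near[OF X(1)]) (rule that)
  show ?thesis
  proof (rule that[OF l(1)])
    fix u assume "u \<in> tuples K us"
    then obtain w where w: "w \<in> tuples K (VV m)" "\<forall>x\<in>KF. P (x # u) \<longleftrightarrow> X (x # w)" using X(2) by blast
    show "\<exists>C. ud C \<and> (\<forall>x\<in>KF. \<forall>x'\<in>KF. \<forall>r. (\<forall>c\<in>KF. C c \<longrightarrow> \<not> cl (r + 1 - int l) x c) \<longrightarrow> cl r x x' \<longrightarrow>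
      (P (x # u) \<longleftrightarrow> P (x' # u)))"
      by (rule exI[of _ "\<lambda>x. C (x # w)"]) (use l w in blast)
  qed
qed

lemma code0P: assumes P: "dset True (VF # VV k) P"
  obtains ns g where "set (RRs ns) \<subseteq> sorts L" "dmap True (VF # VV k) (RRs ns) g"
   "\<And>y x x'. \<lbrakk>y \<in> tuples K (VV k); nob (\<lambda>x. P (x # y)); x \<in> KF; x' \<in> KF; P (x # y); P (x' # y);
     g (x # y) = g (x' # y)\<rbrakk> \<Longrightarrow> x = x'"
proof -
  obtain m w X where X: "w \<in> tuples K (VV m)" "dset False (VF # VV m @ VV k) X"
    "\<And>x u. x \<in> KF \<Longrightarrow> u \<in> tuples K (VV k) \<Longrightarrow> P (x # u) \<longleftrightarrow> X (x # w @ u)" by (rule lift2[OF P]) (rule that)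
  from code0[OF X(2)[folded VV_add]] obtain ns g where ns: "set (RRs ns) \<subseteq> sorts L" and g: "dmap False (VF # VV (m + k)) (RRs ns) g"
   and inj: "\<And>y x x'. \<lbrakk>y \<in> tuples K (VV (m + k)); nob (\<lambda>x. X (x # y)); x \<in> KF; x' \<in> KF; X (x # y); X (x' # y);
     g (x # y) = g (x' # y)\<rbrakk> \<Longrightarrow> x = x'" by blast
  have d: "dmap True (VF # VV k) (RRs ns) (\<lambda>e. g (hd e # w @ tl e))"
    by (rule dmap_app0[OF g, unfolded VV_add] dI | (use X in \<open>simp; fail\<close>))+
  show ?thesis
  proof (rule that[OF ns d])
    fix y x x' assume *: "y \<in> tuples K (VV k)" "nob (\<lambda>x. P (x # y))" "x \<in> KF" "x' \<in> KF" "P (x # y)" "P (x' # y)"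
      "g (hd (x # y) # w @ tl (x # y)) = g (hd (x' # y) # w @ tl (x' # y))"
    have "nob (\<lambda>x. X (x # w @ y))" by (rule nob_mono[OF *(2)]) (use X * in simp)
    then show "x = x'" using inj[of "w @ y" x x'] X * by (simp add: VV_add)
  qed
qed

text \<open>By \<open>code0P\<close> the set has at most one point for each residue code, so
  \<open>UDrel\<close> applies.\<close>

lemma nob_ud: assumes S: "dset True [VF] (\<lambda>e. S (hd e))" and n: "nob S" shows "ud S"
proof -
  have S': "dset True (VF # VV 0) (\<lambda>e. S (hd e))" using S by simp
  from code0P[OF S'] obtain ns g where ns: "set (RRs ns) \<subseteq> sorts L" and g: "dmap True (VF # VV 0) (RRs ns) g"
   and inj: "\<And>y x x'. \<lbrakk>y \<in> tuples K (VV 0); nob (\<lambda>x. S (hd (x # y))); x \<in> KF; x' \<in> KF; S (hd (x # y)); S (hd (x' # y));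
     g (x # y) = g (x' # y)\<rbrakk> \<Longrightarrow> x = x'" by blast
  have "ud (\<lambda>x. \<exists>\<xi>\<in>tuples K (RRs ns). S x \<and> g [x] = \<xi>)"
  proof (rule UDrel)
    show "dset True (VF # RRs ns) (\<lambda>e. S (hd e) \<and> g [hd e] = tl e)"
      by (rule dI rel1[OF S] dset_eq dmap_comp[OF g, simplified] | (use ns in \<open>simp; fail\<close>))+
  qed (use inj[of "[]"] n in auto)
  moreover have "g [x] \<in> tuples K (RRs ns)" if "x \<in> KF" for x by (rule dmap_tuples[OF g]) (use that in simp)
  ultimately show ?thesis unfolding ud_def by blast
qed

text \<open>Each member is uniformly discrete, and by saturation with a spacing independent of
  \<open>\<xi>\<close>. In a ball finer than this spacing every member has at most one point, so by
  \<open>UDrel\<close> the union is uniformly discrete there and cannot fill the ball.\<close>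

lemma nob_union: assumes I: "dset True (VF # RRs ns) (\<lambda>e. I (hd e) (tl e))"
   and n: "\<And>\<xi>. \<xi> \<in> tuples K (RRs ns) \<Longrightarrow> nob (\<lambda>x. I x \<xi>)"
  shows "nob (\<lambda>x. \<exists>\<xi>\<in>tuples K (RRs ns). I x \<xi>)"
proof (rule ccontr)
  assume "\<not> ?thesis"
  then obtain a r where a: "a \<in> KF" "\<And>x. x \<in> KF \<Longrightarrow> cl r a x \<Longrightarrow> \<exists>\<xi>\<in>tuples K (RRs ns). I x \<xi>" by (rule nobE) blast
  let ?P = "\<lambda>\<xi> r. \<exists>x\<in>KF. \<exists>x'\<in>KF. I x \<xi> \<and> I x' \<xi> \<and> x \<noteq> x' \<and> ord (vd x x') = r"
  have s: "set (RRs ns) \<subseteq> sorts L" using dset_sorts[OF I] by simp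
  have "dset True (RRs ns @ [VG]) (\<lambda>z. ?P (take (length (RRs ns)) z) (hh (z ! length (RRs ns))))"
    by (rule dI dset_eqt dset_inteq relR[OF I] | (use s in \<open>simp; fail\<close>))+
  then obtain b where b: "\<And>\<xi> r. \<xi> \<in> tuples K (RRs ns) \<Longrightarrow> ?P \<xi> r \<Longrightarrow> r \<le> b"
  proof (rule rr_bound)
    fix \<xi> assume x: "\<xi> \<in> tuples K (RRs ns)"
    have "ud (\<lambda>x. I x \<xi>)"
      by (rule nob_ud[OF _ n[OF x]]) (rule relR[OF I] dI | (use s x in \<open>simp; fail\<close>))+
    then obtain \<rho> where \<rho>: "\<forall>x\<in>KF. \<forall>x'\<in>KF. I x \<xi> \<and> I x' \<xi> \<and> cl \<rho> x x' \<longrightarrow> x = x'" unfolding ud_def by blast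
    have "r \<le> \<rho>" if "?P \<xi> r" for r using \<rho> that by (auto simp: cl_def) (meson linear)
    then show "\<exists>b. \<forall>r. ?P \<xi> r \<longrightarrow> r \<le> b" by blast
  qed blast
  let ?s = "max r (b + 1)"
  have "ud (\<lambda>x. \<exists>\<xi>\<in>tuples K (RRs ns). I x \<xi> \<and> cl ?s a x)"
  proof (rule UDrel)
    show "dset True (VF # RRs ns) (\<lambda>e. I (hd e) (tl e) \<and> cl ?s a (hd e))"
      by (rule dI I | (use s a in \<open>simp; fail\<close>))+
    fix x x' \<xi> assume *: "x \<in> KF" "x' \<in> KF" "\<xi> \<in> tuples K (RRs ns)" "I x \<xi> \<and> cl ?s a x" "I x' \<xi> \<and> cl ?s a x'"
    show "x = x'"
    proof (rule ccontr)
      assume ne: "x \<noteq> x'"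
      then have "ord (vd x x') \<le> b" using b[OF *(3)] * by blast
      moreover have "cl ?s x x'" using * a cl_trans[of x a x'] cl_sym by blast
      ultimately show False using ne by (simp add: cl_def)
    qed
  qed
  from ud_nob[OF this] obtain x where "x \<in> KF" "cl ?s a x" "\<not> (\<exists>\<xi>\<in>tuples K (RRs ns). I x \<xi>)"
    unfolding nob_def using a(1) by blast
  then show False using a(2)[of x] cl_mono[of ?s a x r] by auto
qed

text \<open>The two sets are labelled by \<open>1\<close> and \<open>0\<close> of the residue field,
  which makes this a union over residue parameters.\<close>

lemma nob_Un: assumes S: "dset True [VF] (\<lambda>e. S (hd e))" "dset True [VF] (\<lambda>e. S' (hd e))" "nob S" "nob S'"
  shows "nob (\<lambda>x. S x \<or> S' x)"
proof -
  have R: "RRs [1] = [RR 1]" by (simp add: RRs_def)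
  have "nob (\<lambda>x. \<exists>\<xi>\<in>tuples K (RRs [1]). (hd \<xi> = rone 1 \<and> S x) \<or> (hd \<xi> = rzero 1 \<and> S' x))"
  proof (rule nob_union)
    show "dset True (VF # RRs [1]) (\<lambda>e. (hd (tl e) = rone 1 \<and> S (hd e)) \<or> (hd (tl e) = rzero 1 \<and> S' (hd e)))"
      unfolding R by (rule dI dset_eqt rel1[OF S(1)] rel1[OF S(2)] | (simp; fail))+
    show "nob (\<lambda>x. (hd \<xi> = rone 1 \<and> S x) \<or> (hd \<xi> = rzero 1 \<and> S' x))" for \<xi>
      using S(3,4) rone_ne by (cases "hd \<xi> = rone 1") (auto elim: nob_mono)
  qed
  then show ?thesis
  proof (rule nob_mono)
    have z: "rone 1 \<in> car K (RR 1)" "rzero 1 \<in> car K (RR 1)"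
      using radd_rneg(2,3)[OF RR1_sort(1) vac_car[OF RR1_sort(1) zz_in]] by auto
    show "\<exists>\<xi>\<in>tuples K (RRs [1]). hd \<xi> = rone 1 \<and> S x \<or> hd \<xi> = rzero 1 \<and> S' x" if "S x \<or> S' x" for x
      using that
    proof
      assume "S x"
      then show ?thesis using z unfolding R by (intro bexI[of _ "[rone 1]"]) simp_all
    next
      assume "S' x"
      then show ?thesis using z unfolding R by (intro bexI[of _ "[rzero 1]"]) simp_all
    qed
  qed
qed

text \<open>If the union contained a ball, give a point \<open>x\<close> the least level \<open>\<phi> x\<close> of an \<open>I\<close> containing it and color it by
  the parity of the distance to the nearest point of smaller level.  The color is constant on some ball,
  but around a point of least level in that ball all small distances occur.\<close>

lemma nob_unionG: assumes I: "dset True [VF, VG] (\<lambda>e. I (hd e) (hh (hd (tl e))))"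
   and n: "\<And>k. nob (\<lambda>x. I x k)"
  shows "nob (\<lambda>x. \<exists>k. I x k)"
proof (rule ccontr)
  assume "\<not> ?thesis"
  then obtain a r where a: "a \<in> KF" "\<And>x. x \<in> KF \<Longrightarrow> cl r a x \<Longrightarrow> \<exists>k. I x k" by (rule nobE) (rule that)
  \<comment> \<open>Levels bound the absolute value of the index, so that they are natural numbers
    and the sets increase with them.\<close>
  define D where "D x k \<longleftrightarrow> (\<exists>r. - k \<le> r \<and> r \<le> k \<and> I x r)" for x k
  have Dmono: "D x k'" if D': "D x k" "k \<le> k'" for x k k'
  proof -
    obtain r where "- k \<le> r" "r \<le> k" "I x r" using D'(1) unfolding D_def by blast
    then show ?thesis unfolding D_def using D'(2) by (intro exI[of _ r]) simp
  qed
  have dD: "dset True [VF] (\<lambda>e. D (hd e) k)" for k unfolding D_def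
    by (rule dI relG[OF I] | (simp; fail))+
  have dI': "dset True [VF] (\<lambda>e. I (hd e) k)" for k
    by (rule dI relG[OF I] | (simp; fail))+
  have nD: "nob (\<lambda>x. D x (int k))" for k
  proof (induction k)
    case 0
    show ?case by (rule nob_mono[OF n[of 0]]) (auto simp: D_def)
  next
    case (Suc k)
    have "nob (\<lambda>x. I x (int (Suc k)) \<or> I x (- int (Suc k)))" by (rule nob_Un[OF dI' dI' n n])
    with Suc have "nob (\<lambda>x. D x (int k) \<or> (I x (int (Suc k)) \<or> I x (- int (Suc k))))"
      by (rule nob_Un[OF dD dset_disj[OF dI' dI']])
    then show ?case
    proof (rule nob_mono)
      fix x assume "D x (int (Suc k))"
      then obtain r where r: "- int (Suc k) \<le> r" "r \<le> int (Suc k)" "I x r" unfolding D_def by blast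
      then consider "r = int (Suc k)" | "r = - int (Suc k)" | "- int k \<le> r \<and> r \<le> int k" by linarith
      then show "D x (int k) \<or> (I x (int (Suc k)) \<or> I x (- int (Suc k)))"
        using r(3) unfolding D_def by cases blast+
    qed
  qed
  have udD: "ud (\<lambda>x. D x (int k))" for k by (rule nob_ud[OF dD nD])
  have exD: "\<exists>k. D x (int k)" if "x \<in> KF" "cl r a x" for x
  proof -
    obtain j where "I x j" using a(2)[OF \<open>x \<in> KF\<close> \<open>cl r a x\<close>] by blast
    then have "D x (int (nat \<bar>j\<bar>))" unfolding D_def by (intro exI[of _ j]) auto
    then show ?thesis by blast
  qed
  define \<phi> where "\<phi> x = (LEAST k. D x (int k))" for x
  have Dphi: "D x (int k) \<longleftrightarrow> \<phi> x \<le> k" if "x \<in> KF" "cl r a x" for x k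
    unfolding \<phi>_def using LeastI_ex[OF exD[OF that]] Least_le[of "\<lambda>k. D x (int k)" k] Dmono[of x _ "int k"]
    by auto
  define lt where "lt x' x \<longleftrightarrow> (\<exists>k. 0 \<le> k \<and> D x' k \<and> \<not> D x k)" for x' x
  have lt: "lt x' x \<longleftrightarrow> \<phi> x' < \<phi> x" if "x \<in> KF" "cl r a x" "x' \<in> KF" "cl r a x'" for x x'
  proof -
    have "lt x' x \<longleftrightarrow> (\<exists>k::nat. D x' (int k) \<and> \<not> D x (int k))"
      unfolding lt_def by (metis nonneg_int_cases of_nat_0_le_iff)
    also have "\<dots> \<longleftrightarrow> \<phi> x' < \<phi> x" using Dphi[OF that(1,2)] Dphi[OF that(3,4)] by (auto simp: not_le intro: exI[of _ "\<phi> x'"])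
    finally show ?thesis .
  qed
  define nu where "nu x s \<longleftrightarrow> (\<exists>x'\<in>KF. cl r a x' \<and> x' \<noteq> x \<and> lt x' x \<and> ord (vd x x') = s) \<and>
     (\<forall>x'\<in>KF. cl r a x' \<and> x' \<noteq> x \<and> lt x' x \<longrightarrow> ord (vd x x') \<le> s)" for x s
  define X where "X x \<longleftrightarrow> cl r a x \<and> (\<exists>s. nu x s \<and> even s)" for x
  have dX: "dset True [VF] (\<lambda>e. X (hd e))" unfolding X_def nu_def lt_def D_def
    by (rule dI dset_eqt dset_inteq relG[OF I] | (use a in \<open>simp; fail\<close>))+
  have dY: "dset True [VF] (\<lambda>e. cl r a (hd e) \<and> \<not> X (hd e))"
    by (rule dI dX | (use a in \<open>simp; fail\<close>))+
  have "\<not> nob (\<lambda>x. X x \<or> (cl r a x \<and> \<not> X x))" using a(1) unfolding nob_def by blast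
  then have "\<not> nob X \<or> \<not> nob (\<lambda>x. cl r a x \<and> \<not> X x)" using nob_Un[OF dX dY] by blast
  then obtain b s B where b: "b \<in> KF" "\<forall>x\<in>KF. cl s b x \<longrightarrow> cl r a x \<and> X x = B"
  proof
    assume "\<not> nob X"
    then obtain b s where "b \<in> KF" "\<And>x. x \<in> KF \<Longrightarrow> cl s b x \<Longrightarrow> X x" by (rule nobE) (rule that)
    then show ?thesis using that[of b s True] unfolding X_def by blast
  next
    assume "\<not> nob (\<lambda>x. cl r a x \<and> \<not> X x)"
    then obtain b s where "b \<in> KF" "\<And>x. x \<in> KF \<Longrightarrow> cl s b x \<Longrightarrow> cl r a x \<and> \<not> X x" by (rule nobE) (rule that)
    then show ?thesis using that[of b s False] by blast
  qed
  have "\<exists>x0. (x0 \<in> KF \<and> cl s b x0) \<and> (\<forall>y. y \<in> KF \<and> cl s b y \<longrightarrow> \<phi> x0 \<le> \<phi> y)"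
    by (rule ex_has_least_nat[of _ b]) (use b(1) in simp)
  then obtain x0 where x0: "x0 \<in> KF" "cl s b x0" "\<And>y. y \<in> KF \<Longrightarrow> cl s b y \<Longrightarrow> \<phi> x0 \<le> \<phi> y" by blast
  obtain \<rho> where \<rho>: "\<forall>x\<in>KF. \<forall>x'\<in>KF. D x (int (\<phi> x0)) \<and> D x' (int (\<phi> x0)) \<and> cl \<rho> x x' \<longrightarrow> x = x'"
    using udD[of "\<phi> x0"] unfolding ud_def by blast
  have ann: "B = even j" if j: "j \<ge> s" "j \<ge> \<rho>" for j
  proof -
    obtain x1 where x1: "x1 \<in> KF" "x1 \<noteq> x0" "ord (vd x1 x0) = j" using ex_exact[OF x0(1)] by metis
    \<comment> \<open>A point of least level on the sphere of radius \<open>j\<close> about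
      \<open>x0\<close>. Whatever is closer to it than \<open>j\<close> lies on the same sphere, so
      no point of smaller level is nearer than \<open>x0\<close>; and \<open>x0\<close> has smaller
      level because \<open>j \<ge> \<rho>\<close> separates the points of its level.\<close>
    have "\<exists>x. (x \<in> KF \<and> x \<noteq> x0 \<and> ord (vd x x0) = j) \<and> (\<forall>y. y \<in> KF \<and> y \<noteq> x0 \<and> ord (vd y x0) = j \<longrightarrow> \<phi> x \<le> \<phi> y)"
      by (rule ex_has_least_nat[of _ x1]) (use x1 in simp)
    then obtain x where x: "x \<in> KF" "x \<noteq> x0" "ord (vd x x0) = j"
      "\<And>y. \<lbrakk>y \<in> KF; y \<noteq> x0; ord (vd y x0) = j\<rbrakk> \<Longrightarrow> \<phi> x \<le> \<phi> y" by blast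
    have jx: "cl j x x0" using x by (simp add: cl_def)
    then have xb: "cl s b x" using cl_trans[OF b(1) x0(1) x(1) x0(2)] cl_sym[OF x(1) x0(1)] cl_mono j by blast
    have xr: "cl r a x" "cl r a x0" using b x xb x0 by auto
    have lt0: "\<phi> x0 < \<phi> x"
    proof -
      have "\<not> D x (int (\<phi> x0))"
        using \<rho> Dphi[OF x0(1) xr(2)] x x0(1) cl_mono[OF jx j(2)] by blast
      then show ?thesis using Dphi[OF x(1) xr(1)] by simp
    qed
    have le: "ord (vd x x') \<le> j" if x': "x' \<in> KF" "cl r a x'" "x' \<noteq> x" "\<phi> x' < \<phi> x" for x'
    proof (rule ccontr)
      assume "\<not> ord (vd x x') \<le> j"
      then have "cl (j + 1) x x'" using x' by (simp add: cl_def)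
      then have "x' \<noteq> x0 \<and> ord (vd x' x0) = j" using ord_cl_eq[OF x(1) x'(1) x0(1) x(2)] x(3) by simp
      then show False using x(4)[of x'] x' by simp
    qed
    have nuj: "nu x j" unfolding nu_def
    proof (intro conjI ballI impI)
      show "\<exists>x'\<in>KF. cl r a x' \<and> x' \<noteq> x \<and> lt x' x \<and> ord (vd x x') = j"
        using x0(1) xr x lt0 lt[OF x(1) xr(1) x0(1) xr(2)] by (intro bexI[of _ x0]) simp_all
    next
      fix x' assume "x' \<in> KF" "cl r a x' \<and> x' \<noteq> x \<and> lt x' x"
      then show "ord (vd x x') \<le> j" using le lt[OF x(1) xr(1)] by blast
    qed
    then have "s' = j" if "nu x s'" for s' using that unfolding nu_def by (metis order_antisym)
    then have "X x = even j" using nuj xr(1) unfolding X_def by metis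
    then show ?thesis using b(2) x(1) xb by simp
  qed
  have "B = even (max s \<rho>)" "B = even (max s \<rho> + 1)" using ann[of "max s \<rho>"] ann[of "max s \<rho> + 1"] by auto
  then show False by simp
qed

section \<open>Generic behavior of functions and products of balls\<close>

lemma constjac_cong: "\<lbrakk>constjac f a r; (\<And>x. x \<in> KF \<Longrightarrow> f x = f' x); a \<in> KF\<rbrakk> \<Longrightarrow> constjac f' a r"
  unfolding constjac_def by simp

lemma constjac_sub: assumes c: "constjac f a r" and f: "\<And>x. x \<in> KF \<Longrightarrow> f x \<in> KF" and a: "a \<in> KF" "b \<in> KF" "cl r a b" "r \<le> r'"
  shows "constjac f b r'"
proof -
  have sub: "cl r a x" if "x \<in> KF" "cl r' b x" for x using cl_trans[OF a(1,2) that(1) a(3)] cl_mono[OF that(2) a(4)] .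
  show ?thesis using c unfolding constjac_def[of f a r]
  proof
    assume h: "\<forall>x\<in>KF. cl r a x \<longrightarrow> f x = f a"
    have "f b = f a" using h a by blast
    moreover have "\<forall>x\<in>KF. cl r' b x \<longrightarrow> f x = f a" using h sub by blast
    ultimately show ?thesis unfolding constjac_def by simp
  next
    assume "\<exists>\<epsilon>. (\<forall>x\<in>KF. \<forall>x'\<in>KF. cl r a x \<and> cl r a x' \<and> x \<noteq> x' \<longrightarrow> f x \<noteq> f x' \<and> ord (vd (f x) (f x')) = \<epsilon> + ord (vd x x')) \<and>
      (\<forall>w\<in>KF. cl (r + \<epsilon>) (f a) w \<longrightarrow> (\<exists>x\<in>KF. cl r a x \<and> f x = w))"
    then obtain \<epsilon> where E: "(\<forall>x\<in>KF. \<forall>x'\<in>KF. cl r a x \<and> cl r a x' \<and> x \<noteq> x' \<longrightarrow> f x \<noteq> f x' \<and> ord (vd (f x) (f x')) = \<epsilon> + ord (vd x x')) \<and>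
      (\<forall>w\<in>KF. cl (r + \<epsilon>) (f a) w \<longrightarrow> (\<exists>x\<in>KF. cl r a x \<and> f x = w))" by (elim exE) (rule that)
    have e: "\<And>x x'. \<lbrakk>x\<in>KF; x'\<in>KF; cl r a x; cl r a x';
      x \<noteq> x'\<rbrakk> \<Longrightarrow> f x \<noteq> f x' \<and> ord (vd (f x) (f x')) = \<epsilon> + ord (vd x x')"
      "\<And>w. w\<in>KF \<Longrightarrow> cl (r + \<epsilon>) (f a) w \<Longrightarrow> \<exists>x\<in>KF. cl r a x \<and> f x = w" using E by simp_all
    have "\<exists>x\<in>KF. cl r' b x \<and> f x = w" if w: "w \<in> KF" "cl (r' + \<epsilon>) (f b) w" for w
    proof -
      have "cl (r + \<epsilon>) (f a) (f b)" using e(1)[OF a(1,2) _ a(3)] a(3) by (cases "a = b") (auto simp: cl_def)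
      then have "cl (r + \<epsilon>) (f a) w" using cl_trans[OF f[OF a(1)] f[OF a(2)] w(1)] cl_mono[OF w(2), of "r + \<epsilon>"] a(4) by simp
      from e(2)[OF w(1) this] obtain x where x: "x \<in> KF" "cl r a x" "f x = w" by blast
      have "cl r' b x" using e(1)[OF a(2) x(1) a(3) x(2)] w(2) x(3) by (cases "b = x") (auto simp: cl_def)
      then show ?thesis using x by blast
    qed
    then show ?thesis unfolding constjac_def using e(1) sub by blast
  qed
qed

text \<open>Freeing the parameters in the graph of \<open>f\<close> gives a relation that need not
  be functional elsewhere. \<open>dtm_the\<close> makes it a total definable function that agrees
  with \<open>f\<close> at the given parameters.\<close>

lemma jacP: assumes F: "dtm True (VF # ss) VF f"
  obtains ns g where "set (RRs ns) \<subseteq> sorts L" "dmap True (VF # ss) (RRs ns) g"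
    "\<And>y a r. \<lbrakk>y \<in> tuples K ss; a \<in> KF; (\<forall>x\<in>KF. cl r a x \<longrightarrow> g (x # y) = g (a # y))\<rbrakk> \<Longrightarrow> constjac (\<lambda>x. f (x # y)) a r"
proof -
  obtain ts ps E where E: "ps \<in> tuples K ts" "set ts \<subseteq> sorts L" "dset False (ts @ (VF # ss) @ [VF]) E"
    "\<And>e w. e \<in> tuples K (VF # ss) \<Longrightarrow> w \<in> KF \<Longrightarrow> E (ps @ e @ [w]) \<longleftrightarrow> f e = w"
    by (rule dtm_params[OF F]) (rule that)
  have s: "set ss \<subseteq> sorts L" using dtm_sorts[OF F] by simp
  let ?G = "\<lambda>e w. E (take (length ts) (tl e) @ (hd e # drop (length ts) (tl e)) @ [w])"
  have dG: "dset False ((VF # ts @ ss) @ [VF]) (\<lambda>z. ?G (take (length (VF # ts @ ss)) z) (z ! length (VF # ts @ ss)))"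
    by (rule dset_app0[OF E(3)] dI | (use s E(2) in \<open>simp; fail\<close>))+
  let ?f = "\<lambda>e. if \<exists>!x. x \<in> KF \<and> ?G e x then THE x. x \<in> KF \<and> ?G e x else zz"
  have df: "dtm False (VF # ts @ ss) VF ?f"
    by (rule dtm_the[OF dG]) (use s E(2) in simp)
  have feq: "?f (x # ps @ y) = f (x # y)" if "x \<in> KF" "y \<in> tuples K ss" for x y
  proof -
    have fx: "f (x # y) \<in> KF" by (rule dtm_car[OF F]) (use that in simp)
    have "w \<in> KF \<and> ?G (x # ps @ y) w \<longleftrightarrow> w = f (x # y)" for w
      using E(4)[of "x # y" w] E(1) that fx by auto
    then show ?thesis by simp
  qed
  obtain ns g where g: "set (RRs ns) \<subseteq> sorts L" "dmap False (VF # ts @ ss) (RRs ns) g"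
    "\<And>y a r. \<lbrakk>y \<in> tuples K (ts @ ss); a \<in> KF;
      (\<forall>x\<in>KF. cl r a x \<longrightarrow> g (x # y) = g (a # y))\<rbrakk> \<Longrightarrow> constjac (\<lambda>x. ?f (x # y)) a r" by (rule jac[OF df]) (rule that)
  have dg: "dmap True (VF # ss) (RRs ns) (\<lambda>e. g (hd e # ps @ tl e))"
    by (rule dmap_app0[OF g(2)] dI | (use s E in \<open>simp; fail\<close>))+
  show ?thesis
  proof (rule that[OF g(1) dg])
    fix y a r assume y: "y \<in> tuples K ss" "a \<in> KF"
     "\<forall>x\<in>KF. cl r a x \<longrightarrow> g (hd (x # y) # ps @ tl (x # y)) = g (hd (a # y) # ps @ tl (a # y))"
    have y3: "\<forall>x\<in>KF. cl r a x \<longrightarrow> g (x # ps @ y) = g (a # ps @ y)" using y(3) by (simp only: list.sel)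
    have "constjac (\<lambda>x. ?f (x # ps @ y)) a r" by (rule g(3)[OF _ y(2) y3]) (use y(1) E(1) in simp)
    then show "constjac (\<lambda>x. f (x # y)) a r" by (rule constjac_cong) (use feq y in simp_all)
  qed
qed

text \<open>The parts of the coloring from \<open>jacP\<close> cover the ball of radius
  \<open>r\<close> about \<open>a\<close>, so by \<open>nob_union\<close> the intersection of some
  part with this ball contains a ball.\<close>

lemma good_jac: assumes f: "dtm True [VF] VF (\<lambda>e. f (hd e))" and a: "a \<in> KF"
  obtains b s where "b \<in> KF" "cl r a b" "r \<le> s" "constjac f b s"
proof -
  obtain ns g where g: "set (RRs ns) \<subseteq> sorts L" "dmap True [VF] (RRs ns) g"
    "\<And>y a r. \<lbrakk>y \<in> tuples K []; a \<in> KF; (\<forall>x\<in>KF. cl r a x \<longrightarrow> g (x # y) = g (a # y))\<rbrakk> \<Longrightarrow> constjac (\<lambda>x. f (hd (x # y))) a r" by (rule jacP[OF f]) (rule that)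
  have d: "dset True (VF # RRs ns) (\<lambda>e. cl r a (hd e) \<and> g [hd e] = tl e)"
    by (rule dset_conj dset_cl dset_eq dmap_comp[OF g(2)] dI | (use a g(1) in \<open>simp; fail\<close>))+
  have "\<not> nob (\<lambda>x. \<exists>\<xi>\<in>tuples K (RRs ns). cl r a x \<and> g [x] = \<xi>)"
  proof
    assume n: "nob (\<lambda>x. \<exists>\<xi>\<in>tuples K (RRs ns). cl r a x \<and> g [x] = \<xi>)"
    have "g [x] \<in> tuples K (RRs ns)" if "x \<in> KF" for x by (rule dmap_tuples[OF g(2)]) (use that in simp)
    then show False using n a unfolding nob_def by blast
  qed
  then obtain \<xi> where "\<xi> \<in> tuples K (RRs ns)" "\<not> nob (\<lambda>x. cl r a x \<and> g [x] = \<xi>)" using nob_union[OF d] by blast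
  then obtain b s where b: "b \<in> KF" "\<And>x. x \<in> KF \<Longrightarrow> cl s b x \<Longrightarrow> cl r a x \<and> g [x] = \<xi>" by (elim nobE) (rule that)
  have "constjac (\<lambda>x. f (hd [x])) b (max r s)"
    by (rule g(3)) (use b cl_mono[of "max r s" b _ s] in auto)
  then show ?thesis using that[of b "max r s"] b by auto
qed

lemma vd_swap: assumes "x \<in> KF" "c \<in> KF" "c' \<in> KF" shows "cl r (vd x c) (vd x c') \<longleftrightarrow> cl r c c'"
proof -
  have eq: "vd (vd x c) (vd x c') = vd c' c"
    using assms vd_split[of c' x c] vd_uminus[of x c'] F.a_comm[of "vd x c" "\<ominus>\<^bsub>F\<^esub> vd x c'"]
    by (simp add: vd_eq[of "vd x c" "vd x c'"] a_minus_def)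
  have "vd x c = vd x c' \<longleftrightarrow> c = c'" using eq assms vd_zero[of "vd x c" "vd x c'"] vd_zero[of c' c] by auto
  then show ?thesis unfolding cl_def eq using ord_sym assms by auto
qed

lemma cl_of_vd: assumes "x \<in> KF" "x' \<in> KF" "c \<in> KF" "c' \<in> KF" "cl r (vd x c) (vd x' c')" "cl r c c'" shows "cl r x x'"
proof -
  have "cl r (vd x' c') (vd x' c)" using vd_swap[of x' c' c] cl_sym assms by blast
  then have "cl r (vd x c) (vd x' c)" using cl_trans[of "vd x c" "vd x' c'" "vd x' c"] assms by simp
  then show ?thesis using assms(1-4) vd_vd[of x x' c] unfolding cl_def by (metis vd_in vd_zero)
qed

text \<open>Every fiber over the ball contains a cell ball, described by a center depending on
  \<open>a\<close> and \<open>\<xi>\<close>, an angular component and an order. By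
  \<open>nob_unionG\<close> the order, and by \<open>nob_union\<close> the residue data, can be
  taken constant for \<open>a\<close> in some ball. By \<open>good_jac\<close> the center moves,
  after shrinking, by no more than the radius of the cell balls. One fixed ball then lies in all
  these fibers.\<close>

lemma dim2:
  assumes Z: "dset True [VF, VF] (\<lambda>e. Z (hd e) (hd (tl e)))" and a0: "a0 \<in> KF"
    and nn: "\<And>a. a \<in> KF \<Longrightarrow> cl r a0 a \<Longrightarrow> \<not> nob (\<lambda>x. Z x a)"
  obtains a1 s b t where "a1 \<in> KF" "cl r a0 a1" "r \<le> s" "b \<in> KF"
    "\<And>a x. \<lbrakk>a \<in> KF; x \<in> KF; cl s a1 a; cl t b x\<rbrakk> \<Longrightarrow> Z x a"
proof -
  obtain m w X where X: "w \<in> tuples K (VV m)" "dset False (VF # VV m @ [VF]) X"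
    "\<And>x u. x \<in> KF \<Longrightarrow> u \<in> tuples K [VF] \<Longrightarrow> Z (hd (x # u)) (hd (tl (x # u))) \<longleftrightarrow> X (x # w @ u)"
    by (rule lift2[OF Z]) (rule that)
  have ZX: "Z x a \<longleftrightarrow> X (x # w @ [a])" if "x \<in> KF" "a \<in> KF" for x a using X(3)[of x "[a]"] that by simp
  have W: "w @ [a] \<in> tuples K (VV (Suc m))" if "a \<in> KF" for a using X(1) that by (simp add: VV_Suc)
  obtain l ns g c where l: "RR l \<in> sorts L" and ns: "set (RRs ns) \<subseteq> sorts L" 
   and g: "dmap False (VF # VV (Suc m)) (RRs ns) g"
   and c0: "dtm False (VV (Suc m) @ RRs ns) VF c" and
   P: "\<And>x y. \<lbrakk>x \<in> KF; y \<in> tuples K (VV (Suc m)); X (x # y)\<rbrakk> \<Longrightarrow> bcell X l g c x y"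
    by (rule bmin[OF X(2)[folded VV_Suc]]) (rule that)
  have c: "dtm False (VV m @ VF # RRs ns) VF c" using c0 by (simp add: VV_Suc)
  have cK: "c (w @ a # \<xi>) \<in> KF" if "a \<in> KF" "\<xi> \<in> tuples K (RRs ns)" for a \<xi>
    by (rule dtm_car[OF c]) (use that X(1) in simp)
  define good where "good a \<xi> \<zeta> \<gamma> \<longleftrightarrow> (\<exists>x\<in>KF. x \<noteq> c (w @ a # \<xi>) \<and> vac K l (vd x (c (w @ a # \<xi>))) = \<zeta> \<and>
     ord (vd x (c (w @ a # \<xi>))) = \<gamma> \<and> (\<forall>x'\<in>KF. cl (\<gamma> + int l) x x' \<longrightarrow> Z x' a))" for a \<xi> \<zeta> \<gamma>
  have ex: "\<exists>\<gamma>. \<exists>\<xi>\<in>tuples K (RRs ns). \<exists>\<zeta>\<in>car K (RR l). good a \<xi> \<zeta> \<gamma>" if a: "a \<in> KF" "cl r a0 a" for a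
  proof -
    have "\<exists>x\<in>KF. Z x a \<and> x \<noteq> c (w @ a # g (x # w @ [a]))"
    proof (rule ccontr)
      assume no: "\<not> ?thesis"
      have "ud (\<lambda>x. \<exists>\<xi>\<in>tuples K (RRs ns). x = c (w @ a # \<xi>))"
        by (rule UDrel) (rule dI dset_eqt dtm_app0[OF c] | (use X(1) a ns in \<open>simp; fail\<close>))+
      then have "nob (\<lambda>x. Z x a)"
      proof (rule nob_mono[OF ud_nob])
        fix x assume x: "x \<in> KF" "Z x a"
        have "g (x # w @ [a]) \<in> tuples K (RRs ns)" by (rule dmap_tuples[OF g]) (use x W a in simp)
        then show "\<exists>\<xi>\<in>tuples K (RRs ns). x = c (w @ a # \<xi>)" using no x by blast
      qed
      then show False using nn a by blast
    qed
    then obtain x where x: "x \<in> KF" "Z x a" "x \<noteq> c (w @ a # g (x # w @ [a]))" by blast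
    have xi: "g (x # w @ [a]) \<in> tuples K (RRs ns)" by (rule dmap_tuples[OF g]) (use x W a in simp)
    let ?c = "c (w @ a # g (x # w @ [a]))"
    have "\<forall>x'\<in>KF. cl (ord (vd x ?c) + int l) x x' \<longrightarrow> X (x' # w @ [a])"
      using P[OF x(1) W[OF a(1)] ZX[OF x(1) a(1), THEN iffD1, OF x(2)], unfolded append_assoc append_Cons append_Nil] x(3) by blast
    then have "good a (g (x # w @ [a])) (vac K l (vd x ?c)) (ord (vd x ?c))"
      unfolding good_def using x ZX[OF _ a(1)] by (intro bexI[of _ x]) simp_all
    moreover have "vac K l (vd x ?c) \<in> car K (RR l)" using vac_car[OF l] x cK[OF a(1) xi] by simp
    ultimately show ?thesis using xi by blast
  qed
  have "dset True [VF, VG] (\<lambda>e. cl r a0 (hd e) \<and> (\<exists>\<xi>\<in>tuples K (RRs ns). \<exists>\<zeta>\<in>car K (RR l). good (hd e) \<xi> \<zeta> (hh (hd (tl e)))))"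
    unfolding good_def
    by (rule dI dset_eqt dset_inteq dtm_app0[OF c] rel2[OF Z] | (use X(1) a0 ns l in \<open>simp; fail\<close>))+
  moreover have "\<not> nob (\<lambda>a. \<exists>\<gamma>. cl r a0 a \<and> (\<exists>\<xi>\<in>tuples K (RRs ns). \<exists>\<zeta>\<in>car K (RR l). good a \<xi> \<zeta> \<gamma>))"
    unfolding nob_def using ex a0 by blast
  ultimately obtain \<gamma> where ga: "\<not> nob (\<lambda>a. cl r a0 a \<and> (\<exists>\<xi>\<in>tuples K (RRs ns). \<exists>\<zeta>\<in>car K (RR l). good a \<xi> \<zeta> \<gamma>))"
    using nob_unionG[of "\<lambda>a \<gamma>. cl r a0 a \<and> (\<exists>\<xi>\<in>tuples K (RRs ns). \<exists>\<zeta>\<in>car K (RR l). good a \<xi> \<zeta> \<gamma>)"] by blast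
  have "dset True (VF # RRs (l # ns)) (\<lambda>e. cl r a0 (hd e) \<and> good (hd e) (tl (tl e)) (hd (tl e)) \<gamma>)"
    unfolding good_def RRs_Cons
    by (rule dI dset_eqt dset_inteq dtm_app0[OF c] rel2[OF Z] | (use X(1) a0 ns l in \<open>simp; fail\<close>))+
  moreover have "\<not> nob (\<lambda>a. \<exists>\<eta>\<in>tuples K (RRs (l # ns)). cl r a0 a \<and> good a (tl \<eta>) (hd \<eta>) \<gamma>)"
  proof
    assume n: "nob (\<lambda>a. \<exists>\<eta>\<in>tuples K (RRs (l # ns)). cl r a0 a \<and> good a (tl \<eta>) (hd \<eta>) \<gamma>)"
    have "nob (\<lambda>a. cl r a0 a \<and> (\<exists>\<xi>\<in>tuples K (RRs ns). \<exists>\<zeta>\<in>car K (RR l). good a \<xi> \<zeta> \<gamma>))"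
    proof (rule nob_mono[OF n], elim conjE bexE)
      fix a \<xi> \<zeta> assume "cl r a0 a" "\<xi> \<in> tuples K (RRs ns)" "\<zeta> \<in> car K (RR l)" "good a \<xi> \<zeta> \<gamma>"
      then show "\<exists>\<eta>\<in>tuples K (RRs (l # ns)). cl r a0 a \<and> good a (tl \<eta>) (hd \<eta>) \<gamma>"
        by (intro bexI[of _ "\<zeta> # \<xi>"]) (simp_all add: RRs_Cons)
    qed
    then show False using ga by blast
  qed
  ultimately obtain \<eta> where eta: "\<eta> \<in> tuples K (RRs (l # ns))" "\<not> nob (\<lambda>a. cl r a0 a \<and> good a (tl \<eta>) (hd \<eta>) \<gamma>)"
    using nob_union[of "l # ns" "\<lambda>a \<eta>. cl r a0 a \<and> good a (tl \<eta>) (hd \<eta>) \<gamma>"] by blast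
  define \<xi> \<zeta> where "\<xi> = tl \<eta>" and "\<zeta> = hd \<eta>"
  have xi: "\<xi> \<in> tuples K (RRs ns)" using eta(1) unfolding \<xi>_def by (auto simp: RRs_Cons tuples_Cons)
  have eta2: "\<not> nob (\<lambda>a. cl r a0 a \<and> good a \<xi> \<zeta> \<gamma>)" using eta(2) unfolding \<xi>_def \<zeta>_def .
  obtain a2 s2 where a2: "a2 \<in> KF" "\<And>a. a \<in> KF \<Longrightarrow> cl s2 a2 a \<Longrightarrow> cl r a0 a \<and> good a \<xi> \<zeta> \<gamma>"
    by (rule nobE[OF eta2]) (rule that)
  have df: "dtm True [VF] VF (\<lambda>e. c (w @ hd e # \<xi>))"
    by (rule dI dtm_app0[OF c] | (use X(1) xi ns in \<open>simp; fail\<close>))+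
  obtain a1 s1 where a1: "a1 \<in> KF" "cl (max s2 r) a2 a1" "max s2 r \<le> s1" "constjac (\<lambda>a. c (w @ a # \<xi>)) a1 s1"
    by (rule good_jac[OF df a2(1)]) (rule that)
  have "\<exists>s\<ge>s1. \<forall>a\<in>KF. cl s a1 a \<longrightarrow> cl (\<gamma> + int l) (c (w @ a1 # \<xi>)) (c (w @ a # \<xi>))"
    using a1(4) unfolding constjac_def
  proof
    assume "\<forall>x\<in>KF. cl s1 a1 x \<longrightarrow> c (w @ x # \<xi>) = c (w @ a1 # \<xi>)"
    then show ?thesis by (intro exI[of _ s1]) simp
  next
    assume "\<exists>\<epsilon>. (\<forall>x\<in>KF. \<forall>x'\<in>KF. cl s1 a1 x \<and> cl s1 a1 x' \<and> x \<noteq> x' \<longrightarrow> c (w @ x # \<xi>) \<noteq> c (w @ x' # \<xi>) \<and> ord (vd (c (w @ x # \<xi>)) (c (w @ x' # \<xi>))) = \<epsilon> + ord (vd x x')) \<and>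
      (\<forall>v\<in>KF. cl (s1 + \<epsilon>) (c (w @ a1 # \<xi>)) v \<longrightarrow> (\<exists>x\<in>KF. cl s1 a1 x \<and> c (w @ x # \<xi>) = v))"
    then obtain \<epsilon> where e: "\<And>x. \<lbrakk>x\<in>KF; cl s1 a1 x;
      a1 \<noteq> x\<rbrakk> \<Longrightarrow> ord (vd (c (w @ a1 # \<xi>)) (c (w @ x # \<xi>))) = \<epsilon> + ord (vd a1 x)"
      using a1(1) cl_refl by (elim exE conjE) blast
    show ?thesis
    proof (intro exI[of _ "max s1 (\<gamma> + int l - \<epsilon>)"] conjI ballI impI)
      fix a assume a: "a \<in> KF" "cl (max s1 (\<gamma> + int l - \<epsilon>)) a1 a"
      have "cl s1 a1 a" using cl_mono[OF a(2)] by simp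
      then show "cl (\<gamma> + int l) (c (w @ a1 # \<xi>)) (c (w @ a # \<xi>))"
        using e[OF a(1)] a(2) by (cases "a1 = a") (auto simp: cl_def)
    qed simp
  qed
  then obtain s where s: "s \<ge> s1" "\<And>a. a\<in>KF \<Longrightarrow> cl s a1 a \<Longrightarrow> cl (\<gamma> + int l) (c (w @ a1 # \<xi>)) (c (w @ a # \<xi>))" by blast
  have s2: "cl s2 a2 a" if "a \<in> KF" "cl s a1 a" for a
    using cl_trans[OF a2(1) a1(1) that(1)] cl_mono[OF a1(2), of s2] cl_mono[OF that(2), of s2] s(1) a1(3) by simp
  obtain b where b: "b \<in> KF" "b \<noteq> c (w @ a1 # \<xi>)" "vac K l (vd b (c (w @ a1 # \<xi>))) = \<zeta>" "ord (vd b (c (w @ a1 # \<xi>))) = \<gamma>"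
    using a2(2)[OF a1(1) s2[OF a1(1)]] unfolding good_def by auto
  show ?thesis
  proof (rule that[OF a1(1) _ _ b(1)])
    show "cl r a0 a1" using a2(2)[OF a1(1) s2[OF a1(1)]] by simp
    show "r \<le> s" using s(1) a1(3) by simp
    \<comment> \<open>The cell balls over \<open>a\<close> and over \<open>a1\<close> have the same
      order and angular component relative to centers that agree to \<open>\<gamma> + l\<close>, so
      they coincide.\<close>
    fix a x assume a: "a \<in> KF" "x \<in> KF" "cl s a1 a" "cl (\<gamma> + int l) b x"
    obtain x1 where x1: "x1 \<in> KF" "x1 \<noteq> c (w @ a # \<xi>)" "vac K l (vd x1 (c (w @ a # \<xi>))) = \<zeta>" "ord (vd x1 (c (w @ a # \<xi>))) = \<gamma>"
      "\<forall>x'\<in>KF. cl (\<gamma> + int l) x1 x' \<longrightarrow> Z x' a" using a2(2)[OF a(1) s2[OF a(1,3)]] unfolding good_def by blast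
    have k: "c (w @ a # \<xi>) \<in> KF" "c (w @ a1 # \<xi>) \<in> KF" using cK xi a a1 by blast+
    have "cl (\<gamma> + int l) (vd x1 (c (w @ a # \<xi>))) (vd b (c (w @ a1 # \<xi>)))"
      using vac_eq0[OF l, of "vd x1 (c (w @ a # \<xi>))" "vd b (c (w @ a1 # \<xi>))"] x1 b k by simp
    from cl_of_vd[OF x1(1) b(1) k this] have "cl (\<gamma> + int l) x1 b" using s(2)[OF a(1,3)] cl_sym k by blast
    then have "cl (\<gamma> + int l) x1 x" using cl_trans x1 b a by blast
    then show "Z x a" using x1 a by blast
  qed
qed

text \<open>If the exceptional \<open>x\<close> filled a ball, \<open>dim2\<close> would put a
  product of two balls into \<open>G\<close>, and the fiber over a point \<open>z\<close> of one
  factor would contain the other factor.\<close>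

lemma nob_dual: assumes G: "dset True [VF, VF] (\<lambda>e. G (hd e) (hd (tl e)))"
    and n: "\<And>z. z \<in> KF \<Longrightarrow> nob (\<lambda>x. G x z)"
  shows "nob (\<lambda>x. \<not> nob (\<lambda>z. G x z))"
proof (rule ccontr)
  assume "\<not> ?thesis"
  then obtain a r where a: "a \<in> KF" "\<And>x. x \<in> KF \<Longrightarrow> cl r a x \<Longrightarrow> \<not> nob (\<lambda>z. G x z)" by (rule nobE) (rule that)
  have d: "dset True [VF, VF] (\<lambda>e. G (hd (tl e)) (hd e))"
    by (rule rel2[OF G] dI | (simp; fail))+
  obtain a1 s b t where "a1 \<in> KF" "b \<in> KF" "\<And>x z. \<lbrakk>x \<in> KF; z \<in> KF; cl s a1 x; cl t b z\<rbrakk> \<Longrightarrow> G x z"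
    by (rule dim2[of "\<lambda>z x. G x z" a r, OF d a(1) a(2)]) (assumption, assumption, rule that)
  then show False using n[of b] unfolding nob_def by (meson cl_refl)
qed

subsection \<open>Chains of balls\<close>

text \<open>If no point lies in all balls of the chain, the parity of the last radius whose ball contains \<open>x\<close> is a
  definable color that alternates arbitrarily deep in the chain, where b-minimality makes it constant.\<close>

lemma chain_point: assumes Q: "dset True [VF, VG] (\<lambda>e. Q (hd e) (hh (hd (tl e))))"
   and T1: "\<And>\<rho>. r0 \<le> \<rho> \<Longrightarrow> \<exists>x\<in>KF. Q x \<rho>"
   and T2: "\<And>x x' \<rho>. \<lbrakk>x \<in> KF; x' \<in> KF; r0 \<le> \<rho>; Q x \<rho>; Q x' \<rho>\<rbrakk> \<Longrightarrow> cl \<rho> x x'"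
   and T3: "\<And>x x' \<rho>. \<lbrakk>x \<in> KF; x' \<in> KF; r0 \<le> \<rho>; Q x \<rho>; cl \<rho> x x'\<rbrakk> \<Longrightarrow> Q x' \<rho>"
   and T4: "\<And>x \<rho> \<rho>'. \<lbrakk>x \<in> KF; r0 \<le> \<rho>; \<rho> \<le> \<rho>'; Q x \<rho>'\<rbrakk> \<Longrightarrow> Q x \<rho>"
 obtains c where "c \<in> KF" "\<And>\<rho>. r0 \<le> \<rho> \<Longrightarrow> Q c \<rho>"
proof (rule ccontr)
  assume nt: "\<not> thesis"
  note ti = that
  have no: "\<exists>\<rho>\<ge>r0. \<not> Q c \<rho>" if c: "c \<in> KF" for c using ti[of c] nt c by blast
  define P where "P x \<longleftrightarrow> (\<exists>s. Q x s \<and> \<not> Q x (s + 1) \<and> r0 \<le> s \<and> even s)" for x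
  have dP: "dset True [VF] (\<lambda>e. P (hd e))" unfolding P_def
    by (rule dI relG[OF Q] | (simp; fail))+
  have Pev: "P x \<longleftrightarrow> even s" if x: "x \<in> KF" "Q x s" "\<not> Q x (s + 1)" "r0 \<le> s" for x s
  proof -
    have "s' = s" if s': "Q x s'" "\<not> Q x (s' + 1)" "r0 \<le> s'" for s'
    proof (rule linorder_cases[of s s'])
      assume "s < s'" then show ?thesis using T4[of x "s + 1" s'] x s' by simp
    next
      assume "s' < s" then show ?thesis using T4[of x "s' + 1" s] x s' by simp
    qed simp
    then show ?thesis unfolding P_def using x by metis
  qed
  obtain l where l: "RR l \<in> sorts L" 
   "\<And>u. u \<in> tuples K [] \<Longrightarrow> \<exists>C. ud C \<and> (\<forall>x\<in>KF. \<forall>x'\<in>KF. \<forall>r. (\<forall>c\<in>KF. C c \<longrightarrow> \<not> cl (r + 1 - int l) x c) \<longrightarrow> cl r x x' \<longrightarrow>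
      (P (hd (x # u)) \<longleftrightarrow> P (hd (x' # u))))" by (rule bm_nearP[OF dP]) (rule that)
  obtain C where C: "ud C" "\<forall>x\<in>KF. \<forall>x'\<in>KF. \<forall>r. (\<forall>c\<in>KF. C c \<longrightarrow> \<not> cl (r + 1 - int l) x c) \<longrightarrow> cl r x x' \<longrightarrow> (P x \<longleftrightarrow> P x')"
    using l(2)[of "[]"] by auto
  obtain \<rho>0 where \<rho>0: "\<forall>x\<in>KF. \<forall>x'\<in>KF. C x \<and> C x' \<and> cl \<rho>0 x x' \<longrightarrow> x = x'" using C(1) unfolding ud_def by blast
  define \<rho>1 where "\<rho>1 = max r0 \<rho>0"
  \<comment> \<open>By its spacing \<open>C\<close> has at most one point in the ball of the chain
    at \<open>\<rho>1\<close>, and by \<open>no\<close> this point leaves the chain at some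
    radius.\<close>
  have "\<exists>\<rho>\<ge>\<rho>1. \<forall>c\<in>KF. C c \<longrightarrow> \<not> Q c \<rho>"
  proof (cases "\<exists>c\<in>KF. C c \<and> Q c \<rho>1")
    case True
    then obtain c where c: "c \<in> KF" "C c" "Q c \<rho>1" by blast
    obtain \<rho> where \<rho>: "\<rho> \<ge> r0" "\<not> Q c \<rho>" using no c by blast
    show ?thesis
    proof (intro exI[of _ "max \<rho>1 \<rho>"] conjI ballI impI notI)
      fix c' assume c': "c' \<in> KF" "C c'" "Q c' (max \<rho>1 \<rho>)"
      have "Q c' \<rho>1" "Q c' \<rho>" using T4[OF c'(1) _ _ c'(3)] \<rho> by (simp_all add: \<rho>1_def)
      moreover have "cl \<rho>0 c c'" using T2[OF c(1) c'(1) _ c(3) \<open>Q c' \<rho>1\<close>] cl_mono[of \<rho>1 c c' \<rho>0] by (simp add: \<rho>1_def)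
      ultimately show False using \<rho>0 c c' \<rho>(2) by blast
    qed simp
  qed blast
  then obtain \<rho> where \<rho>: "\<rho> \<ge> \<rho>1" "\<forall>c\<in>KF. C c \<longrightarrow> \<not> Q c \<rho>" by blast
  have \<rho>r: "r0 \<le> \<rho>" using \<rho>(1) by (simp add: \<rho>1_def)
  \<comment> \<open>With this radius, being far from \<open>C\<close> at depth \<open>l\<close>
    means that the ball of radius \<open>\<rho>\<close> misses \<open>C\<close>, and for points of
    the chain this ball is its member at \<open>\<rho>\<close>.\<close>
  define r where "r = \<rho> + int l - 1"
  have l1: "l \<ge> 1" by (rule RR_pos[OF l(1)])
  have r: "\<rho> \<le> r" "r0 \<le> r" using l1 \<rho>r by (simp_all add: r_def)
  have ex: "\<exists>x\<in>KF. Q x s \<and> \<not> Q x (s + 1)" if s: "r \<le> s" for s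
  proof -
    obtain z where z: "z \<in> KF" "Q z (s + 1)" using T1[of "s + 1"] r s by auto
    obtain x where x: "x \<in> KF" "x \<noteq> z" "ord (vd x z) = s" using ex_exact[OF z(1)] by metis
    have "Q z s" by (rule T4[OF z(1) _ _ z(2)]) (use s r in simp_all)
    then have "Q x s" using T3[OF z(1) x(1), of s] cl_sym[OF x(1) z(1), of s] x s r by (simp add: cl_def)
    moreover have "\<not> Q x (s + 1)" using T2[OF x(1) z(1), of "s + 1"] z x s r by (auto simp: cl_def)
    ultimately show ?thesis using x by blast
  qed
  obtain x where x: "x \<in> KF" "Q x r" "\<not> Q x (r + 1)" using ex[of r] by auto
  obtain x' where x': "x' \<in> KF" "Q x' (r + 1)" "\<not> Q x' (r + 1 + 1)" using ex[of "r + 1"] by auto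
  have "Q x' r" by (rule T4[OF x'(1) r(2) _ x'(2)]) simp
  then have "cl r x x'" using T2[OF x(1) x'(1) r(2) x(2)] by blast
  moreover have "\<forall>c\<in>KF. C c \<longrightarrow> \<not> cl (r + 1 - int l) x c"
  proof (intro ballI impI notI)
    fix c assume c: "c \<in> KF" "C c" "cl (r + 1 - int l) x c"
    have "Q x \<rho>" by (rule T4[OF x(1) \<rho>r r(1) x(2)])
    then have "Q c \<rho>" using T3[OF x(1) c(1) \<rho>r] c(3) by (simp add: r_def)
    then show False using \<rho>(2) c by blast
  qed
  ultimately have "P x \<longleftrightarrow> P x'" using C(2) x(1) x'(1) by blast
  moreover have "P x \<longleftrightarrow> even r" by (rule Pev[OF x r(2)])
  moreover have "P x' \<longleftrightarrow> even (r + 1)" by (rule Pev[OF x']) (use r in simp)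
  ultimately show False by simp
qed

section \<open>Accumulation points of definable families\<close>

lemma rr_unb: assumes P: "dset True (RRs ns @ [VG]) (\<lambda>z. P (take (length (RRs ns)) z) (hh (z ! length (RRs ns))))"
   and unb: "\<And>R. \<exists>\<xi>\<in>tuples K (RRs ns). \<exists>r>R. P \<xi> r"
  obtains \<xi> where "\<xi> \<in> tuples K (RRs ns)" "\<And>R. \<exists>r>R. P \<xi> r"
proof (rule ccontr)
  assume nt: "\<not> thesis"
  note ti = that
  have bd: "\<exists>b. \<forall>r. P \<xi> r \<longrightarrow> r \<le> b" if x: "\<xi> \<in> tuples K (RRs ns)" for \<xi>
  proof (rule ccontr)
    assume "\<not> ?thesis"
    then have "\<exists>r>R. P \<xi> r" for R by (meson not_le)
    then show False using ti[OF x] nt by blast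
  qed
  obtain b where "\<And>\<xi> r. \<xi> \<in> tuples K (RRs ns) \<Longrightarrow> P \<xi> r \<Longrightarrow> r \<le> b" by (rule rr_bound[OF P bd]) (assumption, rule that)
  then show False using unb[of b] by force
qed

text \<open>One descends through balls that meet \<open>V\<close> for unboundedly many
  \<open>r\<close>. To make the descent a definable chain, the subball is selected by the least
  \<open>r\<close> such that all points of \<open>V\<close> at \<open>r\<close> in the present ball
  lie in a single accumulating subball. The hypothesis \<open>low\<close> makes least values exist.
  The hypothesis \<open>big\<close> makes suitable \<open>r\<close> exist, unless a whole ball lies
  in \<open>V\<close> for unboundedly many \<open>r\<close>. \<open>chain_point\<close> then
  supplies the limit.\<close>

lemma accum: assumes V: "dset True [VF, VG] (\<lambda>e. V (hd e) (hh (hd (tl e))))"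
  and low: "\<And>c r. c \<in> KF \<Longrightarrow> V c r \<Longrightarrow> r1 \<le> r"
  and big: "\<And>c c' y r. \<lbrakk>c \<in> KF; c' \<in> KF; y \<in> KF; V c r; V c' r; c \<noteq> c'; cl (ord (vd c c')) c y\<rbrakk> \<Longrightarrow> V y r"
  and a: "a \<in> KF" and unb: "\<And>R. \<exists>r>R. \<exists>c\<in>KF. V c r \<and> cl r0 a c"
  obtains c where "c \<in> KF" "cl r0 a c" "\<And>\<rho> R. \<exists>r>R. \<exists>d\<in>KF. V d r \<and> cl \<rho> c d"
proof -
  define M where "M x \<rho> r \<longleftrightarrow> (\<exists>d\<in>KF. V d r \<and> cl \<rho> x d)" for x \<rho> r
  define Ac where "Ac x \<rho> \<longleftrightarrow> (\<forall>R. \<exists>r. R < r \<and> M x \<rho> r)" for x \<rho>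
  have Mcl: "M x' \<rho> r" if "M x \<rho> r" "cl \<rho> x x'" "x \<in> KF" "x' \<in> KF" for x x' \<rho> r
    using that unfolding M_def by (meson cl_sym cl_trans)
  have Mmono: "M x \<rho>' r" if "M x \<rho> r" "\<rho>' \<le> \<rho>" for x \<rho> \<rho>' r
    using that unfolding M_def by (meson cl_mono)
  show ?thesis
  \<comment> \<open>If a whole ball lies in \<open>V\<close> for unboundedly many \<open>r\<close>,
    its center is already an accumulation point.\<close>
  proof (cases "\<exists>x\<in>KF. \<exists>\<rho>. r0 \<le> \<rho> \<and> cl r0 a x \<and> (\<forall>R. \<exists>r>R. \<forall>y\<in>KF. cl \<rho> x y \<longrightarrow> V y r)")
    case True
    then obtain x \<rho> where x: "x \<in> KF" "cl r0 a x" "\<forall>R. \<exists>r>R. \<forall>y\<in>KF. cl \<rho> x y \<longrightarrow> V y r" by blast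
    show ?thesis
    proof (rule that[OF x(1,2)])
      fix \<rho>' R
      obtain r where "r > R" "\<forall>y\<in>KF. cl \<rho> x y \<longrightarrow> V y r" using x(3) by blast
      then show "\<exists>r>R. \<exists>d\<in>KF. V d r \<and> cl \<rho>' x d" using x(1) by (intro exI[of _ r] conjI bexI[of _ x]) simp_all
    qed
  next
    case False
    have nofull: "\<exists>R. \<forall>r>R. \<not> (\<forall>y\<in>KF. cl \<rho> x y \<longrightarrow> V y r)" if x: "x \<in> KF" "r0 \<le> \<rho>" "cl r0 a x" for x \<rho>
    proof (rule ccontr)
      assume "\<not> ?thesis"
      then have "\<forall>R. \<exists>r>R. \<forall>y\<in>KF. cl \<rho> x y \<longrightarrow> V y r" by simp
      then show False using False x by blast
    qed
    have child: "\<exists>x'\<in>KF. cl \<rho> x x' \<and> Ac x' (\<rho> + 1)" if x: "x \<in> KF" "Ac x \<rho>" for x \<rho>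
    proof (cases "Ac x (\<rho> + 1)")
      case True
      then show ?thesis using x by (intro bexI[of _ x]) simp_all
    next
      case nA: False
      then obtain R0 where R0: "\<And>r. R0 < r \<Longrightarrow> \<not> M x (\<rho> + 1) r" unfolding Ac_def by blast
      let ?P = "\<lambda>\<zeta> r. \<exists>d\<in>KF. V d r \<and> cl \<rho> x d \<and> \<not> cl (\<rho> + 1) x d \<and> vac K 1 (vd d x) = hd \<zeta>"
      have P: "dset True (RRs [1] @ [VG]) (\<lambda>z. ?P (take (length (RRs [1])) z) (hh (z ! length (RRs [1]))))"
        unfolding RRs_Cons RRs_Nil
        by (rule dI dset_eqt relG[OF V] | (use x in \<open>simp; fail\<close>))+
      have unbP: "\<exists>\<xi>\<in>tuples K (RRs [1]). \<exists>r>R. ?P \<xi> r" for R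
      proof -
        obtain r where r: "max R R0 < r" "M x \<rho> r" using x(2) unfolding Ac_def by blast
        then obtain d where d: "d \<in> KF" "V d r" "cl \<rho> x d" unfolding M_def by blast
        have nd: "\<not> cl (\<rho> + 1) x d" using R0[of r] r d unfolding M_def by auto
        have "[vac K 1 (vd d x)] \<in> tuples K (RRs [1])" using vac_car[OF RR1_sort(1), of "vd d x"] x d by (simp add: RRs_Cons)
        then show ?thesis using r d nd by (intro bexI[of _ "[vac K 1 (vd d x)]"] exI[of _ r]) auto
      qed
      \<comment> \<open>A pigeonhole principle over the possibly infinite residue field: one
        subball, given by the angular component \<open>\<zeta>\<close>, is met for unboundedly many
        \<open>r\<close>.\<close>
      obtain \<zeta> where z: "\<zeta> \<in> tuples K (RRs [1])" "\<And>R. \<exists>r>R. ?P \<zeta> r" by (rule rr_unb[OF P unbP]) (rule that)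
      obtain r d where d: "d \<in> KF" "V d r" "cl \<rho> x d" "\<not> cl (\<rho> + 1) x d" "vac K 1 (vd d x) = hd \<zeta>" using z(2)[of 0] by blast
      have od: "d' \<noteq> x \<and> ord (vd d' x) = \<rho>" if "d' \<in> KF" "cl \<rho> x d'" "\<not> cl (\<rho> + 1) x d'" for d'
        using that ord_sym[OF x(1) that(1)] by (auto simp: cl_def)
      have "Ac d (\<rho> + 1)" unfolding Ac_def
      proof
        fix R
        obtain r' d' where d': "r' > R" "d' \<in> KF" "V d' r'" "cl \<rho> x d'" "\<not> cl (\<rho> + 1) x d'" "vac K 1 (vd d' x) = hd \<zeta>" using z(2)[of R] by blast
        have "cl (\<rho> + 1) d d'" using vac_eq[OF RR1_sort(1) d(1) d'(2) x(1)] od[OF d(1,3,4)] od[OF d'(2,4,5)] d(5) d'(6) by simp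
        then show "\<exists>r>R. M d (\<rho> + 1) r" using d' unfolding M_def by blast
      qed
      then show ?thesis using d by blast
    qed
    define good where "good x \<sigma> r \<longleftrightarrow> Ac x (\<sigma> + 1) \<and> M x (\<sigma> + 1) r \<and> (\<forall>d\<in>KF. V d r \<and> cl \<sigma> x d \<longrightarrow> cl (\<sigma> + 1) x d)" for x \<sigma> r
    define Ch where "Ch x \<sigma> \<longleftrightarrow> (\<exists>r. good x \<sigma> r \<and> (\<forall>r'. r' < r \<longrightarrow> \<not> (\<exists>x'\<in>KF. cl \<sigma> x x' \<and> good x' \<sigma> r')))" for x \<sigma>
    define Q where "Q x \<rho> \<longleftrightarrow> cl r0 a x \<and> (\<forall>\<sigma>. r0 \<le> \<sigma> \<and> \<sigma> < \<rho> \<longrightarrow> Ch x \<sigma>)" for x \<rho>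
    have Accl: "Ac x' \<rho>" if "Ac x \<rho>" "cl \<rho> x x'" "x \<in> KF" "x' \<in> KF" for x x' \<rho>
      using that Mcl unfolding Ac_def by blast
    have s1: "cl \<sigma> x y" if "cl (\<sigma> + 1) x y" for \<sigma> x y using cl_mono[OF that] by simp
    have goodcl: "good x' \<sigma> r" if g: "good x \<sigma> r" and c: "cl (\<sigma> + 1) x x'" "x \<in> KF" "x' \<in> KF" for x x' \<sigma> r
      unfolding good_def
    proof (intro conjI ballI impI)
      show "Ac x' (\<sigma> + 1)" using Accl[OF _ c] g unfolding good_def by blast
      show "M x' (\<sigma> + 1) r" using Mcl[OF _ c] g unfolding good_def by blast
      fix d assume d: "d \<in> KF" "V d r \<and> cl \<sigma> x' d"
      then have "cl \<sigma> x d" using cl_trans[OF c(2,3) d(1) s1[OF c(1)]] by blast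
      then have "cl (\<sigma> + 1) x d" using g d unfolding good_def by blast
      then show "cl (\<sigma> + 1) x' d" using cl_trans[OF c(3,2) d(1) cl_sym[OF c(2,3,1)]] by blast
    qed
    have Chcl: "Ch x' \<sigma>" if g: "Ch x \<sigma>" and c: "cl (\<sigma> + 1) x x'" "x \<in> KF" "x' \<in> KF" for x x' \<sigma>
    proof -
      obtain r where r: "good x \<sigma> r" "\<forall>r'. r' < r \<longrightarrow> \<not> (\<exists>x'\<in>KF. cl \<sigma> x x' \<and> good x' \<sigma> r')" using g unfolding Ch_def by blast
      have "\<not> (\<exists>y\<in>KF. cl \<sigma> x' y \<and> good y \<sigma> r')" if "r' < r" for r'
        using r(2) \<open>r' < r\<close> cl_trans[OF c(2,3) _ s1[OF c(1)]] by blast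
      then show ?thesis unfolding Ch_def using goodcl[OF r(1) c] by blast
    qed
    have exCh: "\<exists>x'\<in>KF. cl \<sigma> x x' \<and> Ch x' \<sigma>" if x: "x \<in> KF" "cl r0 a x" "r0 \<le> \<sigma>" "Ac x \<sigma>" for x \<sigma>
    proof -
      obtain x1 where x1: "x1 \<in> KF" "cl \<sigma> x x1" "Ac x1 (\<sigma> + 1)" using child[OF x(1,4)] by blast
      have c1: "cl r0 a x1" using cl_trans[OF a x(1) x1(1) x(2)] cl_mono[OF x1(2) x(3)] by blast
      obtain R where R: "\<forall>r>R. \<not> (\<forall>y\<in>KF. cl \<sigma> x1 y \<longrightarrow> V y r)" using nofull[OF x1(1) x(3) c1] by blast
      obtain r where r: "R < r" "M x1 (\<sigma> + 1) r" using x1(3) unfolding Ac_def by blast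
      then obtain d where d: "d \<in> KF" "V d r" "cl (\<sigma> + 1) x1 d" unfolding M_def by blast
      \<comment> \<open>Two points of \<open>V\<close> at \<open>r\<close> in different subballs
        would by \<open>big\<close> put the whole ball into \<open>V\<close>, which is excluded for
        \<open>r > R\<close>.\<close>
      have "cl (\<sigma> + 1) x1 d'" if d': "d' \<in> KF" "V d' r" "cl \<sigma> x1 d'" for d'
      proof (rule ccontr)
        assume n: "\<not> cl (\<sigma> + 1) x1 d'"
        have n': "\<not> cl (\<sigma> + 1) d d'" using cl_trans[OF x1(1) d(1) d'(1) d(3)] n by blast
        have "cl \<sigma> d d'" using cl_trans[OF d(1) x1(1) d'(1) cl_sym[OF x1(1) d(1) s1[OF d(3)]] d'(3)] .
        then have "ord (vd d d') = \<sigma>" "d \<noteq> d'" using n' by (auto simp: cl_def)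
        then have "V y r" if "y \<in> KF" "cl \<sigma> d y" for y using big[OF d(1) d'(1) that(1) d(2) d'(2)] that by simp
        then have "\<forall>y\<in>KF. cl \<sigma> x1 y \<longrightarrow> V y r" using cl_trans[OF d(1) x1(1) _ cl_sym[OF x1(1) d(1) s1[OF d(3)]]] by blast
        then show False using R r by blast
      qed
      then have g1: "good x1 \<sigma> r" unfolding good_def using x1(3) r(2) by blast
      have lo: "r1 \<le> r'" if "good y \<sigma> r'" for y r' using that low unfolding good_def M_def by blast
      let ?S = "\<lambda>k::nat. \<exists>y\<in>KF. cl \<sigma> x y \<and> good y \<sigma> (r1 + int k)"
      have "?S (nat (r - r1))" using x1 g1 lo[OF g1] by auto
      then have L: "?S (LEAST k. ?S k)" by (rule LeastI)
      let ?k = "LEAST k. ?S k"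
      obtain y where y: "y \<in> KF" "cl \<sigma> x y" "good y \<sigma> (r1 + int ?k)" using L by blast
      have "\<not> (\<exists>x'\<in>KF. cl \<sigma> y x' \<and> good x' \<sigma> r')" if r': "r' < r1 + int ?k" for r'
      proof
        assume "\<exists>x'\<in>KF. cl \<sigma> y x' \<and> good x' \<sigma> r'"
        then obtain x' where x': "x' \<in> KF" "cl \<sigma> y x'" "good x' \<sigma> r'" by blast
        have "cl \<sigma> x x'" using cl_trans[OF x(1) y(1) x'(1) y(2) x'(2)] .
        moreover have "r1 + int (nat (r' - r1)) = r'" using lo[OF x'(3)] by simp
        ultimately have "?S (nat (r' - r1))" using x' by auto
        from Least_le[of ?S, OF this] show False using r' lo[OF x'(3)] by linarith
      qed
      then have "Ch y \<sigma>" unfolding Ch_def using y(3) by blast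
      then show ?thesis using y by blast
    qed
    have unCh: "cl (\<sigma> + 1) x x'" if x: "x \<in> KF" "x' \<in> KF" "cl \<sigma> x x'" "Ch x \<sigma>" "Ch x' \<sigma>" for x x' \<sigma>
    proof -
      obtain r where r: "good x \<sigma> r" "\<forall>r'. r' < r \<longrightarrow> \<not> (\<exists>x'\<in>KF. cl \<sigma> x x' \<and> good x' \<sigma> r')" using x(4) unfolding Ch_def by blast
      obtain s where s: "good x' \<sigma> s" "\<forall>r'. r' < s \<longrightarrow> \<not> (\<exists>y\<in>KF. cl \<sigma> x' y \<and> good y \<sigma> r')" using x(5) unfolding Ch_def by blast
      have "\<not> s < r" using r(2) s(1) x by blast
      moreover have "\<not> r < s" using s(2) r(1) x(1) cl_sym[OF x(1,2,3)] by blast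
      ultimately have rs: "r = s" by simp
      obtain d where d: "d \<in> KF" "V d r" "cl (\<sigma> + 1) x d" using r(1) unfolding good_def M_def by blast
      have "cl \<sigma> x' d" using cl_trans[OF x(2,1) d(1) cl_sym[OF x(1,2,3)] s1[OF d(3)]] .
      then have "cl (\<sigma> + 1) x' d" using s(1) d rs unfolding good_def by blast
      then show ?thesis using cl_trans[OF x(1) d(1) x(2) d(3)] cl_sym[OF x(2) d(1)] by blast
    qed
    have dQ: "dset True [VF, VG] (\<lambda>e. Q (hd e) (hh (hd (tl e))))"
      unfolding Q_def Ch_def good_def Ac_def M_def
      by (rule dI dset_eqt relG[OF V] | (use a in \<open>simp; fail\<close>))+
    have Q3: "Q x' \<rho>" if x: "x \<in> KF" "x' \<in> KF" "r0 \<le> \<rho>" "Q x \<rho>" "cl \<rho> x x'" for x x' \<rho>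
      unfolding Q_def
    proof (intro conjI allI impI)
      show "cl r0 a x'" using cl_trans[OF a x(1,2)] cl_mono[OF x(5,3)] x(4) unfolding Q_def by blast
      fix \<sigma> assume s: "r0 \<le> \<sigma> \<and> \<sigma> < \<rho>"
      then show "Ch x' \<sigma>" using Chcl[OF _ cl_mono[OF x(5)] x(1,2), of \<sigma>] x(4) unfolding Q_def by simp
    qed
    have Q4: "Q x \<rho>" if "\<rho> \<le> \<rho>'" "Q x \<rho>'" for x \<rho> \<rho>' using that unfolding Q_def by simp
    have Q1: "\<exists>x\<in>KF. Q x \<rho> \<and> Ac x \<rho>" if "r0 \<le> \<rho>" for \<rho>
      using that
    proof (induction \<rho> rule: int_ge_induct)
      case base
      have "Ac a r0" unfolding Ac_def M_def using unb by blast
      then show ?case using a unfolding Q_def by (intro bexI[of _ a]) auto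
    next
      case (step \<rho>)
      then obtain x where x: "x \<in> KF" "Q x \<rho>" "Ac x \<rho>" by blast
      obtain y where y: "y \<in> KF" "cl \<rho> x y" "Ch y \<rho>" using exCh[OF x(1) _ step(1) x(3)] x(2) unfolding Q_def by blast
      have q: "Q y \<rho>" using Q3[OF x(1) y(1) step(1) x(2) y(2)] .
      have "Ch y \<sigma>" if "r0 \<le> \<sigma>" "\<sigma> < \<rho> + 1" for \<sigma> using q y(3) that unfolding Q_def by (cases "\<sigma> = \<rho>") simp_all
      then have "Q y (\<rho> + 1)" using q unfolding Q_def by blast
      moreover have "Ac y (\<rho> + 1)" using y(3) unfolding Ch_def good_def by blast
      ultimately show ?case using y(1) by blast
    qed
    have Q2: "cl \<rho> x x'" if x: "x \<in> KF" "x' \<in> KF" and r: "r0 \<le> \<rho>" and q: "Q x \<rho>" "Q x' \<rho>" for x x' \<rho>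
      using r q
    proof (induction \<rho> rule: int_ge_induct)
      case base
      then show ?case using cl_trans[OF x(1) a x(2)] cl_sym[OF a x(1)] unfolding Q_def by blast
    next
      case (step \<rho>)
      have "cl \<rho> x x'" using step.IH Q4[OF _ step.prems(1)] Q4[OF _ step.prems(2)] by simp
      then show ?case using unCh[OF x] step.prems step.hyps unfolding Q_def by simp
    qed
    have Q1': "\<exists>x\<in>KF. Q x \<rho>" if "r0 \<le> \<rho>" for \<rho> using Q1[OF that] by blast
    obtain c where c: "c \<in> KF" "\<And>\<rho>. r0 \<le> \<rho> \<Longrightarrow> Q c \<rho>"
      by (rule chain_point[OF dQ Q1' Q2 Q3 Q4]) (assumption | rule that)+
    show ?thesis
    proof (rule that[OF c(1)])
      show "cl r0 a c" using c(2)[of r0] unfolding Q_def by simp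
      fix \<rho> R
      have "Ch c (max \<rho> r0)" using c(2)[of "max \<rho> r0 + 1"] unfolding Q_def by simp
      then have "Ac c (max \<rho> r0 + 1)" unfolding Ch_def good_def by blast
      then obtain r where r: "R < r" "M c (max \<rho> r0 + 1) r" unfolding Ac_def by blast
      then show "\<exists>r>R. \<exists>d\<in>KF. V d r \<and> cl \<rho> c d" using Mmono[OF r(2), of \<rho>] unfolding M_def by auto
    qed
  qed
qed

lemma app1: "dtm b [VF] s (\<lambda>e. f (hd e)) \<Longrightarrow> dtm b c VF t \<Longrightarrow> dtm b c s (\<lambda>e. f (t e))"
  using dtm_app[of b "[VF]" s "\<lambda>e. f (hd e)" c "\<lambda>e. [t e]"] by (simp add: dtm_def)

text \<open>For fixed \<open>\<xi>\<close> the exceptional points of \<open>bm_nearP\<close> are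
  uniformly discrete, so the nonzero ones have bounded order and the equivalence fails only up to
  that order. \<open>rr_bound\<close> makes the bound independent of \<open>\<xi>\<close>. Beyond
  it, \<open>E\<close> depends on \<open>z\<close> only through its order and angular
  component.\<close>

lemma near_zero: assumes E: "dset True (VF # RRs ns) (\<lambda>e. E (hd e) (tl e))"
  obtains l r1 where "RR l \<in> sorts L"
    "\<And>z z' \<xi>. \<lbrakk>z \<in> KF; z' \<in> KF; z \<noteq> zz; r1 < ord z; cl (ord z + int l) z z';
      \<xi> \<in> tuples K (RRs ns)\<rbrakk> \<Longrightarrow> E z \<xi> \<longleftrightarrow> E z' \<xi>"
proof -
  have s: "set (RRs ns) \<subseteq> sorts L" using dset_sorts[OF E] by simp
  obtain l where l: "RR l \<in> sorts L"
   "\<And>u. u \<in> tuples K (RRs ns) \<Longrightarrow> \<exists>C. ud C \<and> (\<forall>x\<in>KF. \<forall>x'\<in>KF. \<forall>r. (\<forall>c\<in>KF. C c \<longrightarrow> \<not> cl (r + 1 - int l) x c) \<longrightarrow> cl r x x' \<longrightarrow>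
      (E (hd (x # u)) (tl (x # u)) \<longleftrightarrow> E (hd (x' # u)) (tl (x' # u))))" by (rule bm_nearP[OF E]) (rule that)
  let ?P = "\<lambda>\<xi> r. \<exists>z\<in>KF. \<exists>z'\<in>KF. z \<noteq> zz \<and> ord z = r \<and> cl (r + int l) z z' \<and> \<not> (E z \<xi> \<longleftrightarrow> E z' \<xi>)"
  have P: "dset True (RRs ns @ [VG]) (\<lambda>z. ?P (take (length (RRs ns)) z) (hh (z ! length (RRs ns))))"
    by (rule dI dset_eqt dset_inteq relR[OF E] | (use s in \<open>simp; fail\<close>))+
  have bd: "\<exists>b. \<forall>r. ?P \<xi> r \<longrightarrow> r \<le> b" if x: "\<xi> \<in> tuples K (RRs ns)" for \<xi>
  proof -
    obtain C where C: "ud C" "\<forall>x\<in>KF. \<forall>x'\<in>KF. \<forall>r. (\<forall>c\<in>KF. C c \<longrightarrow> \<not> cl (r + 1 - int l) x c) \<longrightarrow> cl r x x' \<longrightarrow>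
      (E x \<xi> \<longleftrightarrow> E x' \<xi>)" using l(2)[OF x] by auto
    obtain \<rho> where \<rho>: "\<forall>x\<in>KF. \<forall>x'\<in>KF. C x \<and> C x' \<and> cl \<rho> x x' \<longrightarrow> x = x'" using C(1) unfolding ud_def by blast
    have "\<exists>b\<ge>\<rho>. \<forall>c\<in>KF. C c \<and> c \<noteq> zz \<longrightarrow> ord c \<le> b"
    proof (cases "\<exists>c\<in>KF. C c \<and> cl \<rho> zz c")
      case True
      then obtain c where c: "c \<in> KF" "C c" "cl \<rho> zz c" by blast
      show ?thesis
      proof (intro exI[of _ "max \<rho> (ord c)"] conjI ballI impI)
        fix d assume d: "d \<in> KF" "C d \<and> d \<noteq> zz"
        show "ord d \<le> max \<rho> (ord c)"
        proof (rule ccontr)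
          assume h: "\<not> ord d \<le> max \<rho> (ord c)"
          then have "cl \<rho> d zz" using d by (simp add: cl_def)
          then have "cl \<rho> d c" using cl_trans[OF d(1) zz_in c(1)] c(3) by blast
          then have "d = c" using \<rho> d(1,2) c(1,2) by blast
          then show False using h by simp
        qed
      qed simp
    next
      case False
      show ?thesis
      proof (intro exI[of _ \<rho>] conjI ballI impI)
        fix d assume d: "d \<in> KF" "C d \<and> d \<noteq> zz"
        then have "\<not> cl \<rho> d zz" using False cl_sym[OF d(1) zz_in] by blast
        then show "ord d \<le> \<rho>" using d by (simp add: cl_def)
      qed simp
    qed
    then obtain b where b: "\<forall>c\<in>KF. C c \<and> c \<noteq> zz \<longrightarrow> ord c \<le> b" by blast
    show ?thesis
    proof (intro exI[of _ b] allI impI, elim bexE conjE)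
      fix r z z' assume z: "z \<in> KF" "z' \<in> KF" "z \<noteq> zz" "ord z = r" "cl (r + int l) z z'" "\<not> (E z \<xi> \<longleftrightarrow> E z' \<xi>)"
      obtain c where c: "c \<in> KF" "C c" "cl (r + 1) z c"
        using C(2)[rule_format, of z z' "r + int l"] z by auto
      have "c \<noteq> zz \<and> ord (vd c zz) = ord (vd z zz)" using ord_cl_eq[OF z(1) c(1) zz_in z(3)] c(3) z by simp
      then show "r \<le> b" using b c z by auto
    qed
  qed
  obtain r1 where r1: "\<And>\<xi> r. \<xi> \<in> tuples K (RRs ns) \<Longrightarrow> ?P \<xi> r \<Longrightarrow> r \<le> r1" by (rule rr_bound[OF P bd]) (assumption, rule that)
  show ?thesis
  proof (rule that[OF l(1), of r1])
    fix z z' \<xi> assume z: "z \<in> KF" "z' \<in> KF" "z \<noteq> zz" "r1 < ord z" "cl (ord z + int l) z z'" "\<xi> \<in> tuples K (RRs ns)"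
    show "E z \<xi> \<longleftrightarrow> E z' \<xi>"
    proof (rule ccontr)
      assume n: "\<not> (E z \<xi> \<longleftrightarrow> E z' \<xi>)"
      then have "?P \<xi> (ord z)" using z by blast
      from r1[OF z(6) this] z(4) show False by simp
    qed
  qed
qed

text \<open>A code for the fibers, fixed by saturation, reduces \<open>C\<close> to the graph of a
  function \<open>f\<close>, and saturation once more fixes an angular component of the arguments.
  The arguments of one large order then form a ball on which \<open>f\<close> is constant or scales,
  so the values at that order form a point or a ball. This yields the hypothesis \<open>big\<close>
  of \<open>accum\<close>.\<close>

lemma compact: assumes C: "dset True [VF, VF] (\<lambda>e. C (hd e) (hd (tl e)))"
   and nC: "\<And>z. z \<in> KF \<Longrightarrow> nob (\<lambda>c. C c z)" and a: "a \<in> KF"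
   and unb: "\<And>R. \<exists>z\<in>KF. z \<noteq> zz \<and> R < ord z \<and> (\<exists>c\<in>KF. C c z \<and> cl r0 a c)"
  obtains c where "c \<in> KF" "cl r0 a c" "\<And>\<rho> R. \<exists>z\<in>KF. z \<noteq> zz \<and> R < ord z \<and> (\<exists>d\<in>KF. C d z \<and> cl \<rho> c d)"
proof -
  define C' where "C' c z \<longleftrightarrow> C c z \<and> cl r0 a c" for c z
  have dC': "dset True (VF # VV (Suc 0)) (\<lambda>e. C' (hd e) (hd (tl e)))" unfolding C'_def VV_1
    by (rule dI rel2[OF C] | (use a in \<open>simp; fail\<close>))+
  obtain ns g where g: "set (RRs ns) \<subseteq> sorts L" "dmap True (VF # VV (Suc 0)) (RRs ns) g"
   "\<And>y x x'. \<lbrakk>y \<in> tuples K (VV (Suc 0)); nob (\<lambda>x. C' (hd (x # y)) (hd (tl (x # y)))); x \<in> KF; x' \<in> KF;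
     C' (hd (x # y)) (hd (tl (x # y))); C' (hd (x' # y)) (hd (tl (x' # y))); g (x # y) = g (x' # y)\<rbrakk> \<Longrightarrow> x = x'" by (rule code0P[OF dC']) (rule that)
  have nC': "nob (\<lambda>c. C' c z)" if "z \<in> KF" for z by (rule nob_mono[OF nC[OF that]]) (simp add: C'_def)
  have ginj: "x = x'" if "z \<in> KF" "x \<in> KF" "x' \<in> KF" "C' x z" "C' x' z" "g [x, z] = g [x', z]" for z x x'
    using g(3)[of "[z]" x x'] that nC' by (simp add: VV_1)
  have dg: "dmap True [VF, VF] (RRs ns) g" using g(2) by (simp add: VV_1)
  let ?P = "\<lambda>\<eta> r. \<exists>z\<in>KF. \<exists>c\<in>KF. z \<noteq> zz \<and> ord z = r \<and> C' c z \<and> g [c, z] = \<eta>"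
  have P: "dset True (RRs ns @ [VG]) (\<lambda>z. ?P (take (length (RRs ns)) z) (hh (z ! length (RRs ns))))"
    unfolding C'_def
    by (rule dset_all dset_ex dset_conj dset_not dset_cl dset_eq dmap_comp[OF dg] dset_inteq rel2[OF C] dI dset_eqt | (use g(1) a in \<open>simp; fail\<close>))+
  have unbP: "\<exists>\<xi>\<in>tuples K (RRs ns). \<exists>r>R. ?P \<xi> r" for R
  proof -
    obtain z c where zc: "z \<in> KF" "z \<noteq> zz" "R < ord z" "c \<in> KF" "C' c z" using unb[of R] unfolding C'_def by blast
    have "g [c, z] \<in> tuples K (RRs ns)" by (rule dmap_tuples[OF dg]) (use zc in simp)
    then show ?thesis using zc by blast
  qed
  obtain \<eta> where eta: "\<eta> \<in> tuples K (RRs ns)" "\<And>R. \<exists>r>R. ?P \<eta> r" by (rule rr_unb[OF P unbP]) (rule that)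
  define G where "G z c \<longleftrightarrow> C' c z \<and> g [c, z] = \<eta>" for z c
  have dG: "dset True [VF, VF] (\<lambda>e. G (hd e) (hd (tl e)))" unfolding G_def C'_def
    by (rule dset_conj dset_cl dset_eq dmap_comp[OF dg] rel2[OF C] dI dset_eqt | (use g(1) a eta(1) in \<open>simp; fail\<close>))+
  define f where "f z = (if \<exists>!x. x \<in> KF \<and> G z x then THE x. x \<in> KF \<and> G z x else zz)" for z
  have df: "dtm True [VF] VF (\<lambda>e. f (hd e))" unfolding f_def
    by (rule dtm_the) (rule rel2[OF dG] dI | (simp; fail))+
  have fG: "f z = c" if z: "z \<in> KF" "c \<in> KF" "G z c" for z c
  proof -
    have "x \<in> KF \<and> G z x \<longleftrightarrow> x = c" for x using ginj[OF z(1) _ z(2)] z unfolding G_def by metis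
    then show ?thesis unfolding f_def by simp
  qed
  have fK: "f z \<in> KF" if "z \<in> KF" for z using dtm_car[OF df, of "[z]"] that by simp
  obtain ms h where h: "set (RRs ms) \<subseteq> sorts L" "dmap True [VF] (RRs ms) h"
    "\<And>y a r. \<lbrakk>y \<in> tuples K []; a \<in> KF; (\<forall>x\<in>KF. cl r a x \<longrightarrow> h (x # y) = h (a # y))\<rbrakk> \<Longrightarrow> constjac (\<lambda>x. f (hd (x # y))) a r" by (rule jacP[OF df]) (rule that)
  define Z0 where "Z0 z \<longleftrightarrow> (\<exists>c\<in>KF. G z c)" for z
  have dZ0: "dset True [VF] (\<lambda>e. Z0 (hd e))" unfolding Z0_def
    by (rule rel2[OF dG] dI | (simp; fail))+
  have dE: "dset True (VF # RRs ms) (\<lambda>e. Z0 (hd e) \<and> h [hd e] = tl e)"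
    by (rule dset_conj rel1[OF dZ0] dset_eq dmap_comp[OF h(2)] dI | (use h(1) in \<open>simp; fail\<close>))+
  obtain l r1 where l: "RR l \<in> sorts L"
    "\<And>z z' \<xi>. \<lbrakk>z \<in> KF; z' \<in> KF; z \<noteq> zz; r1 < ord z; cl (ord z + int l) z z';
      \<xi> \<in> tuples K (RRs ms)\<rbrakk> \<Longrightarrow> (Z0 z \<and> h [z] = \<xi>) \<longleftrightarrow> (Z0 z' \<and> h [z'] = \<xi>)" by (rule near_zero[OF dE]) (rule that)
  have l1: "l \<ge> 1" by (rule RR_pos[OF l(1)])
  have near: "Z0 z' \<and> h [z'] = h [z]" if "z \<in> KF" "z' \<in> KF" "z \<noteq> zz" "r1 < ord z" "cl (ord z + int l) z z'" "Z0 z" for z z'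
  proof -
    have "h [z] \<in> tuples K (RRs ms)" by (rule dmap_tuples[OF h(2)]) (use that in simp)
    from l(2)[OF that(1-5) this] show ?thesis using that(6) by blast
  qed
  have cj: "constjac f z (ord z + int l)" if z: "z \<in> KF" "z \<noteq> zz" "r1 < ord z" "Z0 z" for z
  proof -
    have "\<forall>x\<in>KF. cl (ord z + int l) z x \<longrightarrow> h [x] = h [z]" using near[OF z(1) _ z(2,3) _ z(4)] by blast
    from h(3)[OF _ z(1) this] show ?thesis by simp
  qed
  let ?P' = "\<lambda>\<beta> r. \<exists>z\<in>KF. z \<noteq> zz \<and> ord z = r \<and> Z0 z \<and> vac K l z = hd \<beta>"
  have P': "dset True (RRs [l] @ [VG]) (\<lambda>z. ?P' (take (length (RRs [l])) z) (hh (z ! length (RRs [l]))))"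
    unfolding RRs_Cons RRs_Nil
    by (rule rel1[OF dZ0] dI dset_eqt dset_inteq | (use l(1) in \<open>simp; fail\<close>))+
  have unbP': "\<exists>\<xi>\<in>tuples K (RRs [l]). \<exists>r>R. ?P' \<xi> r" for R
  proof -
    obtain r z c where z: "r > R" "z \<in> KF" "c \<in> KF" "z \<noteq> zz" "ord z = r" "C' c z" "g [c, z] = \<eta>" using eta(2)[of R] by blast
    have "[vac K l z] \<in> tuples K (RRs [l])" using vac_car[OF l(1), of z] z by (simp add: RRs_Cons)
    moreover have "Z0 z" unfolding Z0_def G_def using z by blast
    ultimately show ?thesis using z by (intro bexI[of _ "[vac K l z]"] exI[of _ r]) auto
  qed
  obtain \<beta> where beta: "\<beta> \<in> tuples K (RRs [l])" "\<And>R. \<exists>r>R. ?P' \<beta> r" by (rule rr_unb[OF P' unbP']) (rule that)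
  have hb: "hd \<beta> \<in> car K (RR l)" using beta(1) by (auto simp: RRs_Cons)
  define U where "U r z \<longleftrightarrow> z \<noteq> zz \<and> Z0 z \<and> ord z = r \<and> vac K l z = hd \<beta>" for r z
  define V where "V c r \<longleftrightarrow> r1 < r \<and> (\<exists>z\<in>KF. U r z \<and> f z = c)" for c r
  have dV: "dset True [VF, VG] (\<lambda>e. V (hd e) (hh (hd (tl e))))" unfolding V_def U_def
    by (rule rel1[OF dZ0] app1[OF df] dI dset_eqt dset_inteq | (use l(1) hb in \<open>simp; fail\<close>))+
  obtain c where c: "c \<in> KF" "cl r0 a c" "\<And>\<rho> R. \<exists>r>R. \<exists>d\<in>KF. V d r \<and> cl \<rho> c d"
  proof (rule accum[OF dV _ _ a, of r1 r0])
    show "r1 \<le> r" if "V c r" for c r using that unfolding V_def by simp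
    show "\<exists>r>R. \<exists>c\<in>KF. V c r \<and> cl r0 a c" for R
    proof -
      obtain r z where z: "r > max R r1" "z \<in> KF" "U r z" using beta(2)[of "max R r1"] unfolding U_def by blast
      then obtain c where c: "c \<in> KF" "G z c" unfolding U_def Z0_def by blast
      then have "cl r0 a c" unfolding G_def C'_def by simp
      then show ?thesis using z c fG[OF z(2) c] unfolding V_def by (intro exI[of _ r] conjI bexI[of _ c] bexI[of _ z]) simp_all
    qed
    \<comment> \<open>The two values come from one ball of arguments, on which \<open>f\<close> is
      then not constant. Since \<open>y\<close> is at least as close to \<open>c\<close> as
      \<open>c'\<close> is, it belongs to the image of that ball.\<close>
    fix c c' y r assume A: "c \<in> KF" "c' \<in> KF" "y \<in> KF" "V c r" "V c' r" "c \<noteq> c'" "cl (ord (vd c c')) c y"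
    obtain z where z: "z \<in> KF" "U r z" "f z = c" using A(4) unfolding V_def by blast
    obtain z' where z': "z' \<in> KF" "U r z'" "f z' = c'" using A(5) unfolding V_def by blast
    have r: "r1 < r" using A(4) unfolding V_def by simp
    have zc: "cl (r + int l) z z'" using vac_eq0[OF l(1), of z z'] z z' unfolding U_def by simp
    have zz: "z \<noteq> zz" "ord z = r" "Z0 z" "vac K l z = hd \<beta>" using z unfolding U_def by auto
    show "V y r" using cj[OF z(1) zz(1) _ zz(3)] r zz(2) unfolding constjac_def
    proof (simp, elim disjE exE conjE)
      assume "\<forall>x\<in>KF. cl (r + int l) z x \<longrightarrow> f x = f z"
      then show ?thesis using zc z z' A(6) by auto
    next
      fix \<epsilon> assume e: "\<forall>x\<in>KF. \<forall>x'\<in>KF. cl (r + int l) z x \<and> cl (r + int l) z x' \<and> x \<noteq> x' \<longrightarrow> f x \<noteq> f x' \<and> ord (vd (f x) (f x')) = \<epsilon> + ord (vd x x')"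
        "\<forall>w\<in>KF. cl (r + int l + \<epsilon>) (f z) w \<longrightarrow> (\<exists>x\<in>KF. cl (r + int l) z x \<and> f x = w)"
      have zne: "z \<noteq> z'" using z z' A(6) by auto
      have "ord (vd c c') = \<epsilon> + ord (vd z z')" using e(1) z(1,3) z'(1,3) zc zne cl_refl by blast
      moreover have "r + int l \<le> ord (vd z z')" using zc zne by (simp add: cl_def)
      ultimately have "cl (r + int l + \<epsilon>) (f z) y" using cl_mono[OF A(7)] z(3) by simp
      then obtain x where x: "x \<in> KF" "cl (r + int l) z x" "f x = y" using e(2) A(3) by blast
      have "cl (r + 1) z x" using cl_mono[OF x(2)] l1 by simp
      then have "x \<noteq> zz \<and> ord (vd x zz) = ord (vd z zz)" using ord_cl_eq[OF z(1) x(1) zz_in zz(1)] z zz by simp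
      then have xo: "x \<noteq> zz" "ord x = r" using x z zz by auto
      have "Z0 x" using near[OF z(1) x(1) zz(1) _ _ zz(3)] r x zz(2) by simp
      moreover have "vac K l x = hd \<beta>" using vac_eq0[OF l(1) z(1) zz(1) x(1) xo(1)] xo zz x by simp
      ultimately show "V y r" unfolding V_def U_def using r x xo by blast
    qed
  qed (rule that)
  show ?thesis
  proof (rule that[OF c(1,2)])
    fix \<rho> R
    obtain r d where d: "r > R" "d \<in> KF" "V d r" "cl \<rho> c d" using c(3)[of R \<rho>] by blast
    then obtain z where z: "z \<in> KF" "U r z" "f z = d" unfolding V_def by blast
    obtain d' where "d' \<in> KF" "G z d'" using z unfolding U_def Z0_def by blast
    then have "C d z" using fG[OF z(1)] z(3) unfolding G_def C'_def by blast
    then show "\<exists>z\<in>KF. z \<noteq> zz \<and> R < ord z \<and> (\<exists>d\<in>KF. C d z \<and> cl \<rho> c d)" using z d unfolding U_def by blast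
  qed
qed

text \<open>Suppose a ball consists of accumulation points. Outside a small set, the set of
  \<open>z\<close> with \<open>C x z\<close> contains no ball (by \<open>nob_dual\<close>), has a
  nonzero element, and has no largest order of nonzero elements. The exceptions to the last two
  properties are small because every ball contains some \<open>d\<close> with \<open>C d z\<close>
  for a nonzero \<open>z\<close> of order as large as desired; for the last one
  \<open>nob_unionG\<close> collects the possible orders. But a set without balls is uniformly
  discrete, so the orders of its nonzero elements are bounded and a largest one exists.\<close>

lemma acc_nob: assumes C: "dset True [VF, VF] (\<lambda>e. C (hd e) (hd (tl e)))"
   and nC: "\<And>z. z \<in> KF \<Longrightarrow> nob (\<lambda>c. C c z)"
  shows "nob (\<lambda>c. \<forall>\<rho> R. \<exists>z\<in>KF. z \<noteq> zz \<and> R < ord z \<and> (\<exists>d\<in>KF. C d z \<and> cl \<rho> c d))"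
proof (rule ccontr)
  assume "\<not> ?thesis"
  then obtain a r where a: "a \<in> KF" "\<And>c. c \<in> KF \<Longrightarrow> cl r a c \<Longrightarrow> \<forall>\<rho> R. \<exists>z\<in>KF. z \<noteq> zz \<and> R < ord z \<and> (\<exists>d\<in>KF. C d z \<and> cl \<rho> c d)"
    by (rule nobE) (rule that)
  define D where "D x \<longleftrightarrow> \<not> nob (\<lambda>z. C x z)" for x
  define dm where "dm x \<longleftrightarrow> (\<exists>z\<in>KF. z \<noteq> zz \<and> C x z)" for x
  define mx where "mx x k \<longleftrightarrow> (\<exists>z\<in>KF. z \<noteq> zz \<and> C x z \<and> ord z = k) \<and> (\<forall>z\<in>KF. z \<noteq> zz \<and> C x z \<longrightarrow> ord z \<le> k)" for x k
  have dsw: "dset True [VF, VF] (\<lambda>e. C (hd (tl e)) (hd e))"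
    by (rule rel2[OF C] dI | (simp; fail))+
  have dD: "dset True [VF] (\<lambda>e. D (hd e))"
    unfolding D_def using dset_not[OF dset_nob[OF dsw]] by (rule dset_cong') (auto simp: tuples_Cons)
  have nD: "nob D" unfolding D_def by (rule nob_dual[OF C nC])
  have dm: "dset True [VF] (\<lambda>e. \<not> dm (hd e))" unfolding dm_def
    by (rule rel2[OF C] dI dset_eqt | (simp; fail))+
  have ndm: "nob (\<lambda>x. \<not> dm x \<and> cl r a x)"
  proof (rule ccontr)
    assume "\<not> ?thesis"
    then obtain b s where b: "b \<in> KF" "\<And>x. x \<in> KF \<Longrightarrow> cl s b x \<Longrightarrow> \<not> dm x \<and> cl r a x" by (rule nobE) (rule that)
    obtain z d where "z \<in> KF" "z \<noteq> zz" "d \<in> KF" "C d z" "cl s b d" using a(2)[OF b(1)] b by (meson cl_refl)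
    then show False using b(2)[of d] unfolding dm_def by blast
  qed
  have dmx: "dset True [VF, VG] (\<lambda>e. mx (hd e) (hh (hd (tl e))) \<and> cl r a (hd e))" unfolding mx_def
    by (rule rel2[OF C] dI dset_eqt dset_inteq | (use a in \<open>simp; fail\<close>))+
  have nmx: "nob (\<lambda>x. mx x k \<and> cl r a x)" for k
  proof (rule ccontr)
    assume "\<not> ?thesis"
    then obtain b s where b: "b \<in> KF" "\<And>x. x \<in> KF \<Longrightarrow> cl s b x \<Longrightarrow> mx x k \<and> cl r a x" by (rule nobE) (rule that)
    have "cl r a b" using b by simp
    from a(2)[OF b(1) this] obtain z d where "z \<in> KF" "z \<noteq> zz" "k < ord z" "d \<in> KF" "C d z" "cl s b d" by blast
    then show False using b(2)[of d] unfolding mx_def by fastforce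
  qed
  have "nob (\<lambda>x. \<exists>k. mx x k \<and> cl r a x)" by (rule nob_unionG[OF dmx nmx])
  moreover have "dset True [VF] (\<lambda>e. \<exists>k. mx (hd e) k \<and> cl r a (hd e))" unfolding mx_def
    by (rule rel2[OF C] dI dset_eqt dset_inteq | (use a in \<open>simp; fail\<close>))+
  moreover have "dset True [VF] (\<lambda>e. \<not> dm (hd e) \<and> cl r a (hd e))"
    by (rule dm dI | (use a in \<open>simp; fail\<close>))+
  ultimately have "nob (\<lambda>x. D x \<or> ((\<not> dm x \<and> cl r a x) \<or> (\<exists>k. mx x k \<and> cl r a x)))"
    by (intro nob_Un dD dset_disj nD ndm)
  then obtain x where x: "x \<in> KF" "cl r a x" "\<not> D x" "dm x" "\<not> (\<exists>k. mx x k)" using a(1) unfolding nob_def by blast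
  have "nob (\<lambda>z. C x z)" using x(3) unfolding D_def by simp
  then have "ud (\<lambda>z. C x z)"
    by (rule nob_ud[rotated]) (rule rel2[OF C] dI | (use x in \<open>simp; fail\<close>))+
  then obtain \<rho> where \<rho>: "\<forall>z\<in>KF. \<forall>z'\<in>KF. C x z \<and> C x z' \<and> cl \<rho> z z' \<longrightarrow> z = z'" unfolding ud_def by blast
  obtain z0 where z0: "z0 \<in> KF" "z0 \<noteq> zz" "C x z0" using x(4) unfolding dm_def by blast
  have "\<exists>b. \<forall>z\<in>KF. z \<noteq> zz \<and> C x z \<longrightarrow> ord z \<le> b"
  proof (rule ccontr)
    assume "\<not> ?thesis"
    then have un: "\<exists>z\<in>KF. z \<noteq> zz \<and> C x z \<and> b < ord z" for b by (meson not_le)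
    obtain z1 where z1: "z1 \<in> KF" "z1 \<noteq> zz" "C x z1" "\<rho> < ord z1" using un by blast
    obtain z2 where z2: "z2 \<in> KF" "z2 \<noteq> zz" "C x z2" "ord z1 < ord z2" using un by blast
    have "cl \<rho> z1 zz" "cl \<rho> zz z2" using z1 z2 cl_sym[OF z2(1) zz_in, of \<rho>] by (auto simp: cl_def)
    then have "cl \<rho> z1 z2" using cl_trans[OF z1(1) zz_in z2(1)] by blast
    then show False using \<rho> z1 z2 by auto
  qed
  then obtain b where b: "\<And>z. \<lbrakk>z\<in>KF; z \<noteq> zz; C x z\<rbrakk> \<Longrightarrow> ord z \<le> b" by blast
  let ?S = "\<lambda>k::nat. \<exists>z\<in>KF. z \<noteq> zz \<and> C x z \<and> ord z = b - int k"
  have "?S (nat (b - ord z0))" using z0 b[OF z0] by (intro bexI[of _ z0]) auto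
  then have L: "?S (LEAST k. ?S k)" by (rule LeastI)
  have "mx x (b - int (LEAST k. ?S k))" unfolding mx_def
  proof (intro conjI ballI impI)
    show "\<exists>z\<in>KF. z \<noteq> zz \<and> C x z \<and> ord z = b - int (LEAST k. ?S k)" using L .
    fix z assume z: "z \<in> KF" "z \<noteq> zz \<and> C x z"
    have "?S (nat (b - ord z))" using z b[of z] by (intro bexI[of _ z]) auto
    from Least_le[of ?S, OF this] show "ord z \<le> b - int (LEAST k. ?S k)" using b[of z] z by linarith
  qed
  then show False using x(5) by blast
qed

subsection \<open>Cells with arbitrary parameters\<close>

text \<open>The exceptional set depends on \<open>y\<close> alone and serves all values of the
  parameters from \<open>ls\<close> at once. This uniformity permits an induction on
  \<open>ls\<close> in which one parameter is traded for a further field variable.\<close>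

definition prep :: "nat \<Rightarrow> vsort list \<Rightarrow> bool" where
  "prep m ls \<longleftrightarrow> (\<forall>E. dset False (VF # VV m @ ls) E \<longrightarrow>
     (\<exists>l C. RR l \<in> sorts L \<and> dset False (VF # VV m) C \<and> (\<forall>y\<in>tuples K (VV m). nob (\<lambda>c. C (c # y))) \<and>
       (\<forall>y\<in>tuples K (VV m). \<forall>\<Lambda>\<in>tuples K ls. \<forall>x\<in>KF. \<forall>x'\<in>KF. \<forall>r.
          far C l r x y \<longrightarrow> cl r x x' \<longrightarrow> (E (x # y @ \<Lambda>) \<longleftrightarrow> E (x' # y @ \<Lambda>)))))"

lemma prepE: assumes "prep m ls" "dset False (VF # VV m @ ls) E"
  obtains l C where "RR l \<in> sorts L" "dset False (VF # VV m) C" "\<And>y. y \<in> tuples K (VV m) \<Longrightarrow> nob (\<lambda>c. C (c # y))"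
    "\<And>y \<Lambda> x x' r. \<lbrakk>y \<in> tuples K (VV m); \<Lambda> \<in> tuples K ls; x \<in> KF; x' \<in> KF; far C l r x y;
      cl r x x'\<rbrakk> \<Longrightarrow> E (x # y @ \<Lambda>) \<longleftrightarrow> E (x' # y @ \<Lambda>)"
proof -
  obtain l C where "RR l \<in> sorts L \<and> dset False (VF # VV m) C \<and> (\<forall>y\<in>tuples K (VV m). nob (\<lambda>c. C (c # y))) \<and>
       (\<forall>y\<in>tuples K (VV m). \<forall>\<Lambda>\<in>tuples K ls. \<forall>x\<in>KF. \<forall>x'\<in>KF. \<forall>r.
          far C l r x y \<longrightarrow> cl r x x' \<longrightarrow> (E (x # y @ \<Lambda>) \<longleftrightarrow> E (x' # y @ \<Lambda>)))"
    using assms(1)[unfolded prep_def, THEN spec, THEN mp, OF assms(2)] by (elim exE) (rule that)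
  note H = this
  note H4 = H[THEN conjunct2, THEN conjunct2, THEN conjunct2]
  show ?thesis
  proof (rule that[of l C])
    fix y \<Lambda> x x' r assume *: "y \<in> tuples K (VV m)" "\<Lambda> \<in> tuples K ls" "x \<in> KF" "x' \<in> KF"
          "far C l r x y" "cl r x x'"
    show "E (x # y @ \<Lambda>) \<longleftrightarrow> E (x' # y @ \<Lambda>)"
      by (rule H4[THEN bspec, OF *(1), THEN bspec, OF *(2), THEN bspec, OF *(3), THEN bspec, OF *(4), THEN spec,
        THEN mp, OF *(5), THEN mp, OF *(6)])
  qed (use H in simp_all)
qed

lemma prep_Nil: "prep m []"
  unfolding prep_def
proof (intro allI impI)
  fix E assume "dset False (VF # VV m @ []) E"
  then have E: "dset False (VF # VV m) E" by simp
  obtain l C where C: "RR l \<in> sorts L" "dset False (VF # VV m) C" "\<And>y. y \<in> tuples K (VV m) \<Longrightarrow> ud (\<lambda>x. C (x # y))"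
   "\<And>y x x' r. \<lbrakk>y \<in> tuples K (VV m); x \<in> KF; x' \<in> KF; far C l r x y;
     cl r x x'\<rbrakk> \<Longrightarrow> E (x # y) \<longleftrightarrow> E (x' # y)" by (rule bm_near[OF E]) (rule that)
  show "\<exists>l C. RR l \<in> sorts L \<and> dset False (VF # VV m) C \<and> (\<forall>y\<in>tuples K (VV m). nob (\<lambda>c. C (c # y))) \<and>
       (\<forall>y\<in>tuples K (VV m). \<forall>\<Lambda>\<in>tuples K []. \<forall>x\<in>KF. \<forall>x'\<in>KF. \<forall>r.
          far C l r x y \<longrightarrow> cl r x x' \<longrightarrow> (E (x # y @ \<Lambda>) \<longleftrightarrow> E (x' # y @ \<Lambda>)))"
  proof (intro exI conjI ballI allI impI)
    fix y \<Lambda> x x' r assume *: "y \<in> tuples K (VV m)" "\<Lambda> \<in> tuples K []" "x \<in> KF" "x' \<in> KF"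
      "far C l r x y" "cl r x x'"
    show "E (x # y @ \<Lambda>) \<longleftrightarrow> E (x' # y @ \<Lambda>)" using C(4)[OF *(1,3,4,5,6)] *(2) by simp
  qed (use C ud_nob in auto)
qed

text \<open>A residue coordinate is replaced by the angular component of a field element tending to zero;
  the exceptional points then accumulate in a small set.\<close>

lemma prep_RR0: assumes IH: "prep (Suc m) ls" and n: "RR n \<in> sorts L" and ls: "set ls \<subseteq> sorts L"
   and t: "dtm False [VF] (RR n) (\<lambda>e. t (hd e))" and E: "dset False (VF # VV m @ RR n # ls) E"
  obtains l C where "RR l \<in> sorts L" "dset False (VF # VV m) C" "\<And>y. y \<in> tuples K (VV m) \<Longrightarrow> nob (\<lambda>c. C (c # y))"
    "\<And>y \<xi> \<Lambda> x x' r. \<lbrakk>y \<in> tuples K (VV m); \<Lambda> \<in> tuples K ls; x \<in> KF; x' \<in> KF;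
      (\<forall>r. \<exists>z\<in>KF. z \<noteq> zz \<and> ord z = r \<and> t z = \<xi>); far C l r x y; cl r x x'\<rbrakk> \<Longrightarrow> E (x # y @ \<xi> # \<Lambda>) \<longleftrightarrow> E (x' # y @ \<xi> # \<Lambda>)"
proof -
  let ?E = "\<lambda>e. E (hd e # take (length (VV m)) (tl e) @ t (tl e ! length (VV m)) # drop (Suc (length (VV m))) (tl e))"
  have dl: "dtm False (VF # VV (Suc m) @ ls) VF (\<lambda>e. tl e ! length (VV m))"
    by (rule dtm_nth[OF dmap_tl[OF dmap_id]]) (use ls in \<open>simp_all add: VV_Suc\<close>)
  have dd: "dmap False (VF # VV (Suc m) @ ls) ls (\<lambda>e. drop (Suc (length (VV m))) (tl e))"
    by (rule dmap_drop[OF dmap_tl[OF dmap_id]]) (use ls in \<open>simp_all add: VV_Suc drop_append\<close>)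
  have dE: "dset False (VF # VV (Suc m) @ ls) ?E"
    by (rule dset_app0[OF E] dd app1[OF t] dl dI | (use ls in \<open>simp add: VV_Suc; fail\<close>))+
  obtain l C where C: "RR l \<in> sorts L" "dset False (VF # VV (Suc m)) C" "\<And>y. y \<in> tuples K (VV (Suc m)) \<Longrightarrow> nob (\<lambda>c. C (c # y))"
    "\<And>y \<Lambda> x x' r. \<lbrakk>y \<in> tuples K (VV (Suc m)); \<Lambda> \<in> tuples K ls; x \<in> KF; x' \<in> KF; far C l r x y;
      cl r x x'\<rbrakk> \<Longrightarrow> ?E (x # y @ \<Lambda>) \<longleftrightarrow> ?E (x' # y @ \<Lambda>)"
    by (rule prepE[OF IH dE]) (rule that)
  have dC: "dset False (VF # VV m @ [VF]) C" using C(2) by (simp add: VV_Suc)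
  \<comment> \<open>The accumulation points, as \<open>z\<close> tends to zero, of the exceptional
    points of the family that has \<open>z\<close> as additional field variable.\<close>
  define A where "A e \<longleftrightarrow> (\<forall>\<rho> R. \<exists>z\<in>KF. z \<noteq> zz \<and> R < ord z \<and> (\<exists>d\<in>KF. C (d # tl e @ [z]) \<and> cl \<rho> (hd e) d))" for e
  have dA: "dset False (VF # VV m) A" unfolding A_def
    by (rule dset_app0[OF dC] dI dset_eqt | (simp; fail))+
  have dCy: "dset True [VF, VF] (\<lambda>e. C (hd e # y @ [hd (tl e)]))" if "y \<in> tuples K (VV m)" for y
    by (rule dset_app0[OF dC] dI | (use that in \<open>simp; fail\<close>))+
  have nCy: "nob (\<lambda>c. C (c # y @ [z]))" if "y \<in> tuples K (VV m)" "z \<in> KF" for y z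
    by (rule C(3)) (use that in \<open>simp add: VV_Suc\<close>)
  show ?thesis
  proof (rule that[OF C(1) dA])
    fix y assume y: "y \<in> tuples K (VV m)"
    show "nob (\<lambda>c. A (c # y))" unfolding A_def list.sel
      by (rule acc_nob[of "\<lambda>d z. C (d # y @ [z])", OF dCy[OF y] nCy[OF y]])
  next
    fix y \<xi> \<Lambda> x x' r
    assume y: "y \<in> tuples K (VV m)" and lam: "\<Lambda> \<in> tuples K ls" and x: "x \<in> KF" "x' \<in> KF"
      and z: "\<forall>r. \<exists>z\<in>KF. z \<noteq> zz \<and> ord z = r \<and> t z = \<xi>"
      and far: "far A l r x y" and c: "cl r x x'"
    \<comment> \<open>Otherwise \<open>compact\<close> would give a point of \<open>A\<close> within
      the excluded distance from \<open>x\<close>. Beyond \<open>R\<close> any \<open>z\<close>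
      representing \<open>\<xi>\<close> may be inserted.\<close>
    have "\<exists>R. \<forall>z\<in>KF. z \<noteq> zz \<and> R < ord z \<longrightarrow> \<not> (\<exists>d\<in>KF. C (d # y @ [z]) \<and> cl (r + 1 - int l) x d)"
    proof (rule ccontr)
      assume "\<not> ?thesis"
      then have unb: "\<exists>z\<in>KF. z \<noteq> zz \<and> R < ord z \<and> (\<exists>d\<in>KF. C (d # y @ [z]) \<and> cl (r + 1 - int l) x d)" for R by blast
      obtain c where "c \<in> KF" "cl (r + 1 - int l) x c" "\<And>\<rho> R. \<exists>z\<in>KF. z \<noteq> zz \<and> R < ord z \<and> (\<exists>d\<in>KF. C (d # y @ [z]) \<and> cl \<rho> c d)"
        by (rule compact[of "\<lambda>d z. C (d # y @ [z])", OF dCy[OF y] nCy[OF y] x(1) unb]) (assumption, rule that)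
      then show False using far unfolding A_def list.sel by blast
    qed
    then obtain R where R: "\<forall>z\<in>KF. z \<noteq> zz \<and> R < ord z \<longrightarrow> \<not> (\<exists>d\<in>KF. C (d # y @ [z]) \<and> cl (r + 1 - int l) x d)" by blast
    obtain z where z: "z \<in> KF" "z \<noteq> zz" "ord z = R + 1" "t z = \<xi>" using z by blast
    have far': "\<forall>c\<in>KF. C (c # y @ [z]) \<longrightarrow> \<not> cl (r + 1 - int l) x c" using R[rule_format, of z] z by auto
    have yz: "y @ [z] \<in> tuples K (VV (Suc m))" using y z by (simp add: VV_Suc)
    have "?E (x # (y @ [z]) @ \<Lambda>) \<longleftrightarrow> ?E (x' # (y @ [z]) @ \<Lambda>)" by (rule C(4)[OF yz lam x far' c])
    moreover have "length y = length (VV m)" using y by (rule tuples_length)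
    ultimately show "E (x # y @ \<xi> # \<Lambda>) \<longleftrightarrow> E (x' # y @ \<xi> # \<Lambda>)"
      using z(4) by (simp add: nth_append drop_append)
  qed
qed

text \<open>Angular components of nonzero elements only give the units of the residue ring, so a nonunit
  is written as a unit minus one.\<close>

lemma prep_RR: assumes IH: "prep (Suc m) ls" and n: "RR n \<in> sorts L" and ls: "set ls \<subseteq> sorts L"
  shows "prep m (RR n # ls)"
  unfolding prep_def
proof (intro allI impI)
  fix E assume E: "dset False (VF # VV m @ RR n # ls) E"
  let ?t2 = "\<lambda>z. radd n (vac K n z) (rneg n (rone n))"
  have t1: "dtm False [VF] (RR n) (\<lambda>e. vac K n (hd e))" and t2: "dtm False [VF] (RR n) (\<lambda>e. ?t2 (hd e))"
    by (rule dI | (use n in \<open>simp; fail\<close>))+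
  obtain l C where C: "RR l \<in> sorts L" "dset False (VF # VV m) C" "\<And>y. y \<in> tuples K (VV m) \<Longrightarrow> nob (\<lambda>c. C (c # y))"
    "\<And>y \<xi> \<Lambda> x x' r. \<lbrakk>y \<in> tuples K (VV m); \<Lambda> \<in> tuples K ls; x \<in> KF; x' \<in> KF;
      (\<forall>r. \<exists>z\<in>KF. z \<noteq> zz \<and> ord z = r \<and> vac K n z = \<xi>); far C l r x y; cl r x x'\<rbrakk> \<Longrightarrow> E (x # y @ \<xi> # \<Lambda>) \<longleftrightarrow> E (x' # y @ \<xi> # \<Lambda>)"
    by (rule prep_RR0[OF IH n ls t1 E]) (rule that)
  obtain l2 C2 where C2: "RR l2 \<in> sorts L" "dset False (VF # VV m) C2" "\<And>y. y \<in> tuples K (VV m) \<Longrightarrow> nob (\<lambda>c. C2 (c # y))"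
    "\<And>y \<xi> \<Lambda> x x' r. \<lbrakk>y \<in> tuples K (VV m); \<Lambda> \<in> tuples K ls; x \<in> KF; x' \<in> KF;
      (\<forall>r. \<exists>z\<in>KF. z \<noteq> zz \<and> ord z = r \<and> ?t2 z = \<xi>); far C2 l2 r x y; cl r x x'\<rbrakk> \<Longrightarrow> E (x # y @ \<xi> # \<Lambda>) \<longleftrightarrow> E (x' # y @ \<xi> # \<Lambda>)"
    by (rule prep_RR0[OF IH n ls t2 E]) (rule that)
  show "\<exists>l C. RR l \<in> sorts L \<and> dset False (VF # VV m) C \<and> (\<forall>y\<in>tuples K (VV m). nob (\<lambda>c. C (c # y))) \<and>
       (\<forall>y\<in>tuples K (VV m). \<forall>\<Lambda>\<in>tuples K (RR n # ls). \<forall>x\<in>KF. \<forall>x'\<in>KF. \<forall>r.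
          far C l r x y \<longrightarrow> cl r x x' \<longrightarrow> (E (x # y @ \<Lambda>) \<longleftrightarrow> E (x' # y @ \<Lambda>)))"
  proof (intro exI[of _ "max l l2"] exI[of _ "\<lambda>e. C e \<or> C2 e"] conjI ballI allI impI)
    show "RR (max l l2) \<in> sorts L" by (rule RR_max[OF C(1) C2(1)])
    show "dset False (VF # VV m) (\<lambda>e. C e \<or> C2 e)" by (rule dset_disj[OF C(2) C2(2)])
    fix y assume y: "y \<in> tuples K (VV m)"
    show "nob (\<lambda>c. C (c # y) \<or> C2 (c # y))"
      by (rule nob_Un[OF _ _ C(3)[OF y] C2(3)[OF y]]) (rule dset_app0[OF C(2)] dset_app0[OF C2(2)] dI | (use y in \<open>simp; fail\<close>))+
    fix \<Lambda> x x' r assume lam: "\<Lambda> \<in> tuples K (RR n # ls)" and x: "x \<in> KF" "x' \<in> KF"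
      and far: "\<forall>c\<in>KF. C (c # y) \<or> C2 (c # y) \<longrightarrow> \<not> cl (r + 1 - int (max l l2)) x c" and c: "cl r x x'"
    obtain \<xi> \<mu> where lm: "\<Lambda> = \<xi> # \<mu>" "\<xi> \<in> car K (RR n)" "\<mu> \<in> tuples K ls" using lam by (auto simp: tuples_Cons)
    have f1: "far C l r x y" and f2: "far C2 l2 r x y"
      using far cl_mono[of "r + 1 - int l" x _ "r + 1 - int (max l l2)"] cl_mono[of "r + 1 - int l2" x _ "r + 1 - int (max l l2)"] by auto
    show "E (x # y @ \<Lambda>) \<longleftrightarrow> E (x' # y @ \<Lambda>)" unfolding lm(1) using ac_surj[OF n lm(2)]
    proof
      assume "\<forall>r. \<exists>z\<in>KF. z \<noteq> zz \<and> ord z = r \<and> vac K n z = \<xi>"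
      then show "E (x # y @ \<xi> # \<mu>) \<longleftrightarrow> E (x' # y @ \<xi> # \<mu>)" by (rule C(4)[OF y lm(3) x _ f1 c])
    next
      assume h: "\<forall>r. \<exists>z\<in>KF. z \<noteq> zz \<and> ord z = r \<and> vac K n z = radd n \<xi> (rone n)"
      have "\<forall>r. \<exists>z\<in>KF. z \<noteq> zz \<and> ord z = r \<and> ?t2 z = \<xi>"
      proof
        fix r
        obtain z where "z \<in> KF" "z \<noteq> zz" "ord z = r" "vac K n z = radd n \<xi> (rone n)" using h by blast
        then show "\<exists>z\<in>KF. z \<noteq> zz \<and> ord z = r \<and> ?t2 z = \<xi>" using radd_rneg(1)[OF n lm(2)] by (intro bexI[of _ z]) simp_all
      qed
      then show "E (x # y @ \<xi> # \<mu>) \<longleftrightarrow> E (x' # y @ \<xi> # \<mu>)" by (rule C2(4)[OF y lm(3) x _ f2 c])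
    qed
  qed
qed

lemma prep_RRs: "set (RRs ns) \<subseteq> sorts L \<Longrightarrow> prep m (RRs ns)"
proof (induction ns arbitrary: m)
  case (Cons n ns)
  then show ?case unfolding RRs_Cons by (intro prep_RR) simp_all
qed (simp add: prep_Nil)

text \<open>A value group coordinate \<open>\<gamma>\<close> is replaced by an element \<open>v\<close> with \<open>ord v = \<gamma>\<close>.  If no such \<open>v\<close> has its
  exceptional points away from a ball, then the inverse of the exceptional point, a definable
  function of residue parameters, takes values of order \<open>\<gamma>\<close> throughout that ball.\<close>

lemma prep_G: assumes IH1: "prep (Suc m) ls" and IH2: "\<And>ns. set (RRs ns) \<subseteq> sorts L \<Longrightarrow> prep m (ls @ RRs ns)"
   and ls: "set ls \<subseteq> sorts L"
  shows "prep m (VG # ls)"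
  unfolding prep_def
proof (intro allI impI)
  fix E assume E: "dset False (VF # VV m @ VG # ls) E"
  let ?k = "length (VV m)"
  let ?E = "\<lambda>e. E (hd e # take ?k (tl e) @ hinv (ord (tl e ! ?k)) # drop (Suc ?k) (tl e))"
  have dl: "dtm False (VF # VV (Suc m) @ ls) VF (\<lambda>e. tl e ! ?k)"
    by (rule dtm_nth[OF dmap_tl[OF dmap_id]]) (use ls in \<open>simp_all add: VV_Suc\<close>)
  have dd: "dmap False (VF # VV (Suc m) @ ls) ls (\<lambda>e. drop (Suc ?k) (tl e))"
    by (rule dmap_drop[OF dmap_tl[OF dmap_id]]) (use ls in \<open>simp_all add: VV_Suc drop_append\<close>)
  have dE: "dset False (VF # VV (Suc m) @ ls) ?E"
    by (rule dset_app0[OF E] dd dl dI | (use ls in \<open>simp add: VV_Suc; fail\<close>))+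
  obtain l C where C: "RR l \<in> sorts L" "dset False (VF # VV (Suc m)) C" "\<And>y. y \<in> tuples K (VV (Suc m)) \<Longrightarrow> nob (\<lambda>c. C (c # y))"
    "\<And>y \<Lambda> x x' r. \<lbrakk>y \<in> tuples K (VV (Suc m)); \<Lambda> \<in> tuples K ls; x \<in> KF; x' \<in> KF; far C l r x y;
      cl r x x'\<rbrakk> \<Longrightarrow> ?E (x # y @ \<Lambda>) \<longleftrightarrow> ?E (x' # y @ \<Lambda>)"
    by (rule prepE[OF IH1 dE]) (rule that)
  have dC: "dset False (VF # VV m @ [VF]) C" using C(2) by (simp add: VV_Suc)
  have nC: "nob (\<lambda>c. C (c # y @ [v]))" if "y \<in> tuples K (VV m)" "v \<in> KF" for y v
    by (rule C(3)) (use that in \<open>simp add: VV_Suc\<close>)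
  define X where "X e \<longleftrightarrow> hd e \<noteq> zz \<and> C ((tl e ! ?k) # take ?k (tl e) @ [hd e])" for e
  have dX: "dset False (VF # VV (Suc m)) X" unfolding X_def VV_Suc
    by (rule dset_app0[OF dC] dtm_nth[OF dmap_tl[OF dmap_id]] dI dset_eqt | (simp; fail))+
  obtain ns g where g: "set (RRs ns) \<subseteq> sorts L" "dmap False (VF # VV (Suc m)) (RRs ns) g"
   "\<And>y x x'. \<lbrakk>y \<in> tuples K (VV (Suc m)); nob (\<lambda>x. X (x # y)); x \<in> KF; x' \<in> KF; X (x # y); X (x' # y);
     g (x # y) = g (x' # y)\<rbrakk> \<Longrightarrow> x = x'" by (rule code0[OF dX]) (rule that)
  have dg: "dmap False (VF # VV m @ [VF]) (RRs ns) g" using g(2) by (simp add: VV_Suc)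
  \<comment> \<open>\<open>G\<close> and \<open>d\<close> invert the exceptional relation: an
    exceptional point \<open>c\<close> and the code of \<open>v\<close> over \<open>c\<close> give
    back \<open>v\<close>, provided that only a small set of \<open>v\<close> belongs to
    \<open>c\<close>.\<close>
  define G where "G e v \<longleftrightarrow> v \<noteq> zz \<and> C (hd e # take ?k (tl e) @ [v]) \<and> g (v # take ?k (tl e) @ [hd e]) = drop ?k (tl e)" for e v
  define d where "d e = (if \<exists>!x. x \<in> KF \<and> G e x then THE x. x \<in> KF \<and> G e x else zz)" for e
  have dd: "dtm False (VF # VV m @ RRs ns) VF d" unfolding d_def
  proof (rule dtm_the)
    show "dset False ((VF # VV m @ RRs ns) @ [VF]) (\<lambda>z. G (take (length (VF # VV m @ RRs ns)) z) (z ! length (VF # VV m @ RRs ns)))"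
      unfolding G_def
      by (rule dset_conj dset_not dset_app0[OF dC] dset_eq dmap_app0[OF dg] dI dset_eqt | (use g(1) in \<open>simp; fail\<close>))+
  qed (use g(1) in simp)
  have dv: "d (c # y @ g (v # y @ [c])) = v"
    if y: "y \<in> tuples K (VV m)" "c \<in> KF" "v \<in> KF" "v \<noteq> zz" "C (c # y @ [v])" "nob (\<lambda>v. C (c # y @ [v]))" for y c v
  proof -
    have ly: "length y = ?k" using y(1) by (rule tuples_length)
    have yc: "y @ [c] \<in> tuples K (VV (Suc m))" using y by (simp add: VV_Suc)
    have Xv: "X (v # y @ [c]) \<longleftrightarrow> v \<noteq> zz \<and> C (c # y @ [v])" for v unfolding X_def using ly y(1) by (simp add: nth_append)
    have nX: "nob (\<lambda>v. X (v # y @ [c]))" by (rule nob_mono[OF y(6)]) (simp add: Xv)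
    have "x \<in> KF \<and> G (c # y @ g (v # y @ [c])) x \<longleftrightarrow> x = v" for x
    proof
      assume a: "x \<in> KF \<and> G (c # y @ g (v # y @ [c])) x"
      then have "X (x # y @ [c])" "g (x # y @ [c]) = g (v # y @ [c])" unfolding G_def Xv using y(1) by simp_all
      then show "x = v" using g(3)[OF yc nX _ y(3), of x] a Xv y by simp
    next
      assume "x = v"
      then show "x \<in> KF \<and> G (c # y @ g (v # y @ [c])) x" unfolding G_def using y by simp
    qed
    then show ?thesis unfolding d_def by simp
  qed
  obtain ms h where h: "set (RRs ms) \<subseteq> sorts L" "dmap False (VF # VV m @ RRs ns) (RRs ms) h"
    "\<And>y a r. \<lbrakk>y \<in> tuples K (VV m @ RRs ns); a \<in> KF;
      (\<forall>x\<in>KF. cl r a x \<longrightarrow> h (x # y) = h (a # y))\<rbrakk> \<Longrightarrow> constjac (\<lambda>x. d (x # y)) a r" by (rule jac[OF dd]) (rule that)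
  let ?n = "length (VF # VV m @ RRs ns)"
  \<comment> \<open>The set where \<open>d\<close> is nonzero and has a given Jacobian color. Far
    from its exceptional set \<open>C1\<close>, a ball inherits both properties from any of its
    points.\<close>
  have "dset False ((VF # VV m @ RRs ns) @ RRs ms) (\<lambda>e. d (take ?n e) \<noteq> zz \<and> h (take ?n e) = drop ?n e)"
    by (rule dset_conj dset_not dset_eq dmap_app0[OF h(2)] dset_eqt dtm_app0[OF dd] dI | (use g(1) h(1) in \<open>simp; fail\<close>))+
  then have dE1: "dset False (VF # VV m @ RRs (ns @ ms)) (\<lambda>e. d (take ?n e) \<noteq> zz \<and> h (take ?n e) = drop ?n e)"
    by (simp add: RRs_append)
  have nm: "set (RRs (ns @ ms)) \<subseteq> sorts L" using g(1) h(1) by (simp add: RRs_append)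
  obtain l1 C1 where C1: "RR l1 \<in> sorts L" "dset False (VF # VV m) C1" "\<And>y. y \<in> tuples K (VV m) \<Longrightarrow> nob (\<lambda>c. C1 (c # y))"
    "\<And>y \<Lambda> x x' r. \<lbrakk>y \<in> tuples K (VV m); \<Lambda> \<in> tuples K (RRs (ns @ ms)); x \<in> KF; x' \<in> KF; far C1 l1 r x y;
      cl r x x'\<rbrakk> \<Longrightarrow> (d (take ?n (x # y @ \<Lambda>)) \<noteq> zz \<and> h (take ?n (x # y @ \<Lambda>)) = drop ?n (x # y @ \<Lambda>)) \<longleftrightarrow>
          (d (take ?n (x' # y @ \<Lambda>)) \<noteq> zz \<and> h (take ?n (x' # y @ \<Lambda>)) = drop ?n (x' # y @ \<Lambda>))"
    by (rule prepE[OF prep_RRs[OF nm] dE1]) (rule that)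
  \<comment> \<open>The value group coordinate is replaced by the order of \<open>d\<close>, whose
    residue arguments join \<open>ls\<close>. This is where the second induction hypothesis is
    needed.\<close>
  let ?d = "\<lambda>e. d (hd e # take ?k (tl e) @ drop (length ls) (drop ?k (tl e)))"
  let ?E2 = "\<lambda>e. ?d e \<noteq> zz \<and> E (hd e # take ?k (tl e) @ hinv (ord (?d e)) # take (length ls) (drop ?k (tl e)))"
  have dE2: "dset False (VF # VV m @ ls @ RRs ns) ?E2"
    by (rule dset_app0[OF E] dtm_app0[OF dd] dI dset_eqt | (use ls g(1) in \<open>simp; fail\<close>))+
  obtain l2 C2 where C2: "RR l2 \<in> sorts L" "dset False (VF # VV m) C2" "\<And>y. y \<in> tuples K (VV m) \<Longrightarrow> nob (\<lambda>c. C2 (c # y))"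
    "\<And>y \<Lambda> x x' r. \<lbrakk>y \<in> tuples K (VV m); \<Lambda> \<in> tuples K (ls @ RRs ns); x \<in> KF; x' \<in> KF; far C2 l2 r x y;
      cl r x x'\<rbrakk> \<Longrightarrow> ?E2 (x # y @ \<Lambda>) \<longleftrightarrow> ?E2 (x' # y @ \<Lambda>)"
    by (rule prepE[OF IH2[OF g(1)] dE2]) (rule that)
  have dE1v: "(d (take ?n (x # y @ \<eta> @ \<zeta>)) \<noteq> zz \<and> h (take ?n (x # y @ \<eta> @ \<zeta>)) = drop ?n (x # y @ \<eta> @ \<zeta>)) \<longleftrightarrow>
      (d (x # y @ \<eta>) \<noteq> zz \<and> h (x # y @ \<eta>) = \<zeta>)" if "y \<in> tuples K (VV m)" "\<eta> \<in> tuples K (RRs ns)" for x y \<eta> \<zeta>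
    using that by (simp add: tuples_length)
  have dE2v: "?E2 (x # y @ \<Lambda> @ \<eta>) \<longleftrightarrow> d (x # y @ \<eta>) \<noteq> zz \<and> E (x # y @ hinv (ord (d (x # y @ \<eta>))) # \<Lambda>)"
    if "y \<in> tuples K (VV m)" "\<Lambda> \<in> tuples K ls" for x y \<Lambda> \<eta>
    using that by (simp add: tuples_length)
  \<comment> \<open>Over these \<open>c\<close> a whole ball of elements \<open>v\<close> occurs and
    \<open>d\<close> cannot recover \<open>v\<close>; by \<open>nob_dual\<close> there are few of
    them.\<close>
  define Cs where "Cs e \<longleftrightarrow> \<not> nob (\<lambda>v. C (hd e # tl e @ [v]))" for e
  have "dset False (VF # VF # VV m) (\<lambda>e. C (hd (tl e) # tl (tl e) @ [hd e]))"
    by (rule dset_app0[OF dC] dI | (simp; fail))+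
  from dset_not[OF dset_nob[OF this]] have dCs: "dset False (VF # VV m) Cs" unfolding Cs_def by simp
  have nCs: "nob (\<lambda>c. Cs (c # y))" if y: "y \<in> tuples K (VV m)" for y
    unfolding Cs_def list.sel
    by (rule nob_dual[of "\<lambda>c v. C (c # y @ [v])", OF _ nC[OF y]]) (rule dset_app0[OF dC] dI | (use y in \<open>simp; fail\<close>))+
  have lpos: "l \<ge> 1" "l1 \<ge> 1" "l2 \<ge> 1" using RR_pos C(1) C1(1) C2(1) by auto
  have mpos: "1 \<le> int (max l1 l2)" using lpos by linarith
  \<comment> \<open>The exceptional points of \<open>C\<close> may lie in the ball of radius
    \<open>\<rho> = r + 1 - l\<close>, and \<open>d\<close> has to be controlled on that ball, which
    costs a further depth \<open>max l1 l2\<close>.\<close>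
  let ?l = "l + max l1 l2 - 1"
  let ?C = "\<lambda>e. Cs e \<or> (C1 e \<or> C2 e)"
  show "\<exists>l C. RR l \<in> sorts L \<and> dset False (VF # VV m) C \<and> (\<forall>y\<in>tuples K (VV m). nob (\<lambda>c. C (c # y))) \<and>
       (\<forall>y\<in>tuples K (VV m). \<forall>\<Lambda>\<in>tuples K (VG # ls). \<forall>x\<in>KF. \<forall>x'\<in>KF. \<forall>r.
          far C l r x y \<longrightarrow> cl r x x' \<longrightarrow> (E (x # y @ \<Lambda>) \<longleftrightarrow> E (x' # y @ \<Lambda>)))"
  proof (intro exI[of _ ?l] exI[of _ ?C] conjI ballI allI impI)
    show "RR ?l \<in> sorts L" by (intro RR_add RR_max C(1) C1(1) C2(1))
    show "dset False (VF # VV m) ?C" by (intro dset_disj dCs C1(2) C2(2))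
    fix y assume y: "y \<in> tuples K (VV m)"
    have dd1: "dset True [VF] (\<lambda>e. A (hd e # y))" if A: "dset False (VF # VV m) A" for A
      by (rule dset_app0[OF A] dI | (use y in \<open>simp; fail\<close>))+
    show "nob (\<lambda>c. Cs (c # y) \<or> (C1 (c # y) \<or> C2 (c # y)))"
      by (intro nob_Un dset_disj dd1 dCs C1(2) C2(2) nCs[OF y] C1(3)[OF y] C2(3)[OF y])
    fix \<Lambda>0 x x' r assume lam: "\<Lambda>0 \<in> tuples K (VG # ls)" and x: "x \<in> KF" "x' \<in> KF"
      and far: "\<forall>c\<in>KF. Cs (c # y) \<or> (C1 (c # y) \<or> C2 (c # y)) \<longrightarrow> \<not> cl (r + 1 - int ?l) x c" and c: "cl r x x'"
    obtain \<gamma>0 \<Lambda> where lm0: "\<Lambda>0 = \<gamma>0 # \<Lambda>" "\<gamma>0 \<in> car K VG" "\<Lambda> \<in> tuples K ls" using lam by (auto simp: tuples_Cons)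
    define \<gamma> where "\<gamma> = hh \<gamma>0"
    have lm: "\<Lambda>0 = hinv \<gamma> # \<Lambda>" using lm0 by (simp add: \<gamma>_def)
    define \<rho> where "\<rho> = r + 1 - int l"
    have rl: "r + 1 - int ?l = \<rho> + 1 - int (max l1 l2)" using lpos by (simp add: \<rho>_def)
    have farx: "\<not> cl s x c" if "c \<in> KF" "Cs (c # y) \<or> (C1 (c # y) \<or> C2 (c # y))" "\<rho> + 1 - int (max l1 l2) \<le> s" for c s
      using far that cl_mono[of s x c "r + 1 - int ?l"] unfolding rl by blast
    show "E (x # y @ \<Lambda>0) \<longleftrightarrow> E (x' # y @ \<Lambda>0)" unfolding lm
    proof (cases "\<exists>v\<in>KF. v \<noteq> zz \<and> ord v = \<gamma> \<and> (\<forall>c\<in>KF. C (c # y @ [v]) \<longrightarrow> \<not> cl \<rho> x c)")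
      case True
      then obtain v where v: "v \<in> KF" "v \<noteq> zz" "ord v = \<gamma>" "\<forall>c\<in>KF. C (c # y @ [v]) \<longrightarrow> \<not> cl (r + 1 - int l) x c"
        unfolding \<rho>_def by blast
      have yv: "y @ [v] \<in> tuples K (VV (Suc m))" using y v by (simp add: VV_Suc)
      have "?E (x # (y @ [v]) @ \<Lambda>) \<longleftrightarrow> ?E (x' # (y @ [v]) @ \<Lambda>)" by (rule C(4)[OF yv lm0(3) x v(4) c])
      moreover have "length y = ?k" using y by (rule tuples_length)
      ultimately show "E (x # y @ hinv \<gamma> # \<Lambda>) \<longleftrightarrow> E (x' # y @ hinv \<gamma> # \<Lambda>)"
        using v(3) by (simp add: nth_append drop_append)
    next
      case False
      define I where "I v \<eta> \<longleftrightarrow> (\<exists>c\<in>KF. cl \<rho> x c \<and> d (c # y @ \<eta>) = v \<and> v \<noteq> zz \<and> ord v = \<gamma>)" for v \<eta>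
      have dI': "dset True (VF # RRs ns) (\<lambda>e. I (hd e) (tl e))" unfolding I_def
        by (rule dtm_app0[OF dd] dI dset_eqt dset_inteq | (use x y g(1) in \<open>simp; fail\<close>))+
      have all: "\<exists>\<eta>\<in>tuples K (RRs ns). I v \<eta>" if v: "v \<in> KF" "v \<noteq> zz" "ord v = \<gamma>" for v
      proof -
        obtain c where c: "c \<in> KF" "C (c # y @ [v])" "cl \<rho> x c" using False v by blast
        have "\<not> Cs (c # y)"
        proof
          assume "Cs (c # y)"
          then show False using farx[OF c(1), of \<rho>] c(3) mpos by simp
        qed
        then have "nob (\<lambda>v. C (c # y @ [v]))" unfolding Cs_def by simp
        from dv[OF y c(1) v(1,2) c(2) this] have "I v (g (v # y @ [c]))" unfolding I_def using c v by blast
        moreover have "g (v # y @ [c]) \<in> tuples K (RRs ns)" by (rule dmap_tuples[OF dg]) (use y c v in simp)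
        ultimately show ?thesis by blast
      qed
      have "\<not> nob (\<lambda>v. \<exists>\<eta>\<in>tuples K (RRs ns). I v \<eta>)"
      proof
        assume n: "nob (\<lambda>v. \<exists>\<eta>\<in>tuples K (RRs ns). I v \<eta>)"
        obtain v0 where v0: "v0 \<in> KF" "v0 \<noteq> zz" "ord v0 = \<gamma>" by (rule ord_surj)
        obtain v where v: "v \<in> KF" "cl (\<gamma> + 1) v0 v" "\<not> (\<exists>\<eta>\<in>tuples K (RRs ns). I v \<eta>)" using n v0(1) unfolding nob_def by blast
        have "v \<noteq> zz \<and> ord (vd v zz) = ord (vd v0 zz)" by (rule ord_cl_eq) (use v v0 in simp_all)
        then show False using all[OF v(1)] v v0 by simp
      qed
      then obtain \<eta> where eta: "\<eta> \<in> tuples K (RRs ns)" "\<not> nob (\<lambda>v. I v \<eta>)" using nob_union[OF dI'] by blast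
      obtain v1 s where v1: "v1 \<in> KF" "\<And>v. v \<in> KF \<Longrightarrow> cl s v1 v \<Longrightarrow> I v \<eta>" by (rule nobE[OF eta(2)]) (rule that)
      obtain v2 where v2: "v2 \<in> KF" "v2 \<noteq> v1" "ord (vd v1 v2) = s" using ex_exact[OF v1(1)] by metis
      have "I v1 \<eta>" "I v2 \<eta>" using v1(2)[OF v1(1)] v1(2)[OF v2(1)] v2 by (simp_all add: cl_def)
      then obtain c1 c2 where c1: "c1 \<in> KF" "cl \<rho> x c1" "d (c1 # y @ \<eta>) = v1" "v1 \<noteq> zz" "ord v1 = \<gamma>"
        and c2: "c2 \<in> KF" "cl \<rho> x c2" "d (c2 # y @ \<eta>) = v2" unfolding I_def by blast
      have ye: "y @ \<eta> \<in> tuples K (VV m @ RRs ns)" using y eta by simp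
      have he: "h (c1 # y @ \<eta>) \<in> tuples K (RRs ms)" by (rule dmap_tuples[OF h(2)]) (use y eta c1 in simp)
      have ez: "\<eta> @ h (c1 # y @ \<eta>) \<in> tuples K (RRs (ns @ ms))" using eta he by (simp add: RRs_append)
      have far1: "\<forall>c\<in>KF. C1 (c # y) \<longrightarrow> \<not> cl (\<rho> + 1 - int l1) x c" using farx[of _ "\<rho> + 1 - int l1"] by auto
      have E1eq: "(d (x # y @ \<eta>) \<noteq> zz \<and> h (x # y @ \<eta>) = h (c1 # y @ \<eta>)) \<longleftrightarrow> (d (c # y @ \<eta>) \<noteq> zz \<and> h (c # y @ \<eta>) = h (c1 # y @ \<eta>))"
        if "c \<in> KF" "cl \<rho> x c" for c
        using C1(4)[OF y ez x(1) that(1) far1 that(2)] unfolding dE1v[OF y eta(1)] .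
      have dx: "d (x # y @ \<eta>) \<noteq> zz \<and> h (x # y @ \<eta>) = h (c1 # y @ \<eta>)" using E1eq[OF c1(1,2)] c1 by simp
      have dc: "d (c # y @ \<eta>) \<noteq> zz \<and> h (c # y @ \<eta>) = h (x # y @ \<eta>)" if "c \<in> KF" "cl \<rho> x c" for c using E1eq[OF that] dx by simp
      have dK: "d (c # y @ \<eta>) \<in> KF" if "c \<in> KF" for c by (rule dtm_car[OF dd]) (use that y eta in simp)
      have "constjac (\<lambda>c. d (c # y @ \<eta>)) x \<rho>" by (rule h(3)[OF ye x(1)]) (use dc in blast)
      then have same: "ord (d (c # y @ \<eta>)) = ord (d (x # y @ \<eta>))" if c: "c \<in> KF" "cl \<rho> x c" for c
        unfolding constjac_def
      proof (elim disjE exE conjE)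
        assume "\<forall>c\<in>KF. cl \<rho> x c \<longrightarrow> d (c # y @ \<eta>) = d (x # y @ \<eta>)"
        then show ?thesis using c by simp
      next
        fix \<epsilon> assume e: "\<forall>c\<in>KF. \<forall>c'\<in>KF. cl \<rho> x c \<and> cl \<rho> x c' \<and> c \<noteq> c' \<longrightarrow> d (c # y @ \<eta>) \<noteq> d (c' # y @ \<eta>) \<and>
            ord (vd (d (c # y @ \<eta>)) (d (c' # y @ \<eta>))) = \<epsilon> + ord (vd c c')"
          "\<forall>w\<in>KF. cl (\<rho> + \<epsilon>) (d (x # y @ \<eta>)) w \<longrightarrow> (\<exists>c\<in>KF. cl \<rho> x c \<and> d (c # y @ \<eta>) = w)"
        \<comment> \<open>The image of the ball contains the ball of radius
          \<open>\<rho> + \<epsilon>\<close> about \<open>d\<close> at \<open>x\<close>. Since it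
          omits zero, the order of \<open>d\<close> is constant.\<close>
        have "\<not> cl (\<rho> + \<epsilon>) (d (x # y @ \<eta>)) zz"
        proof
          assume "cl (\<rho> + \<epsilon>) (d (x # y @ \<eta>)) zz"
          then obtain c where "c \<in> KF" "cl \<rho> x c" "d (c # y @ \<eta>) = zz" using e(2)[THEN bspec, OF zz_in] by blast
          then show False using dc by blast
        qed
        then have o: "ord (d (x # y @ \<eta>)) < \<rho> + \<epsilon>" using dK[OF x(1)] by (simp add: cl_def)
        show ?thesis
        proof (cases "c = x")
          case False
          have "ord (vd (d (x # y @ \<eta>)) (d (c # y @ \<eta>))) = \<epsilon> + ord (vd x c)" using e(1) x(1) c False cl_refl by blast
          moreover have "\<rho> \<le> ord (vd x c)" using c False by (simp add: cl_def)
          ultimately have "cl (ord (d (x # y @ \<eta>)) + 1) (d (x # y @ \<eta>)) (d (c # y @ \<eta>))" using o by (simp add: cl_def)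
          then have "d (c # y @ \<eta>) \<noteq> zz \<and> ord (vd (d (c # y @ \<eta>)) zz) = ord (vd (d (x # y @ \<eta>)) zz)"
            using dx dK x(1) c(1) by (intro ord_cl_eq) simp_all
          then show ?thesis using dK x(1) c(1) by simp
        qed simp
      qed
      have xr: "cl \<rho> x x'" using cl_mono[OF c] lpos by (simp add: \<rho>_def)
      have og: "ord (d (x # y @ \<eta>)) = \<gamma>" "ord (d (x' # y @ \<eta>)) = \<gamma>" using same[OF c1(1,2)] same[OF x(2) xr] c1 by simp_all
      have le: "\<Lambda> @ \<eta> \<in> tuples K (ls @ RRs ns)" using lm0 eta by simp
      have far2: "far C2 l2 r x y"
        using farx[of _ "r + 1 - int l2"] lpos by (auto simp: \<rho>_def)
      have "(d (x # y @ \<eta>) \<noteq> zz \<and> E (x # y @ hinv (ord (d (x # y @ \<eta>))) # \<Lambda>)) \<longleftrightarrow>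
        (d (x' # y @ \<eta>) \<noteq> zz \<and> E (x' # y @ hinv (ord (d (x' # y @ \<eta>))) # \<Lambda>))"
        using C2(4)[OF y le x far2 c] unfolding dE2v[OF y lm0(3)] .
      then show "E (x # y @ hinv \<gamma> # \<Lambda>) \<longleftrightarrow> E (x' # y @ hinv \<gamma> # \<Lambda>)" using dx dc[OF x(2) xr] og by simp
    qed
  qed
qed

section \<open>Induction over the parameter sorts and the resulting cells\<close>

definition GG :: "nat \<Rightarrow> vsort list" where "GG a = replicate a VG"

lemma GG_sorts [simp]: "set (GG a) \<subseteq> sorts L" by (auto simp: GG_def)

lemma GG_add: "GG (a + b) = GG a @ GG b" by (simp add: GG_def replicate_add)

lemma prep_all: "set (RRs ns) \<subseteq> sorts L \<Longrightarrow> prep m (GG a @ RRs ns)"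
proof (induction a arbitrary: m ns)
  case 0
  then show ?case using prep_RRs by (simp add: GG_def)
next
  case (Suc a)
  have "prep m (VG # (GG a @ RRs ns))"
  proof (rule prep_G)
    show "prep (Suc m) (GG a @ RRs ns)" by (rule Suc.IH[OF Suc.prems])
    show "prep m ((GG a @ RRs ns) @ RRs ms)" if "set (RRs ms) \<subseteq> sorts L" for ms
      using Suc.IH[of "ns @ ms" m] Suc.prems that by (simp add: RRs_append)
  qed (use Suc.prems in simp)
  then show ?case by (simp add: GG_def)
qed

text \<open>Rearranges parameters of arbitrary sorts into the order that \<open>prep_all\<close>
  expects. Because \<open>\<psi>\<close> is a left inverse, a family can be pulled back along it
  without loss.\<close>

lemma sort_split: "set ss \<subseteq> sorts L \<Longrightarrow> \<exists>m a ns \<phi> \<psi>. (VF \<notin> set ss \<longrightarrow> m = 0) \<and> set (RRs ns) \<subseteq> sorts L \<and>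
   dmap False ss (VV m @ GG a @ RRs ns) \<phi> \<and> dmap False (VV m @ GG a @ RRs ns) ss \<psi> \<and> (\<forall>y\<in>tuples K ss. \<psi> (\<phi> y) = y)"
proof (induction ss)
  case Nil
  show ?case
    by (intro exI[of _ 0] exI[of _ "[]"] exI[of _ "\<lambda>e. e"] conjI) (simp_all add: GG_def dmap_id)
next
  case (Cons s ss)
  then have ss: "set ss \<subseteq> sorts L" "s \<in> sorts L" by auto
  obtain m a ns \<phi> \<psi> where I: "VF \<notin> set ss \<longrightarrow> m = 0" "set (RRs ns) \<subseteq> sorts L"
   "dmap False ss (VV m @ GG a @ RRs ns) \<phi>" "dmap False (VV m @ GG a @ RRs ns) ss \<psi>" "\<forall>y\<in>tuples K ss. \<psi> (\<phi> y) = y"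
    using Cons.IH[OF ss(1)] by (elim exE conjE) (rule that)
  have ph: "\<phi> y \<in> tuples K (VV m @ GG a @ RRs ns)" if "y \<in> tuples K ss" for y by (rule dmap_tuples[OF I(3) that])
  show ?case
  proof (cases s)
    case VF
    have V: "VV (Suc m) = VF # VV m" by (simp add: VV_def)
    show ?thesis unfolding VF
    proof (rule exI[of _ "Suc m"], rule exI[of _ a], rule exI[of _ ns], rule exI[of _ "\<lambda>e. hd e # \<phi> (tl e)"], rule exI[of _ "\<lambda>e. hd e # \<psi> (tl e)"], intro conjI)
      show "dmap False (VF # ss) (VV (Suc m) @ GG a @ RRs ns) (\<lambda>e. hd e # \<phi> (tl e))" unfolding V append_Cons
        by (rule dmap_app0[OF I(3)] dI | (use ss in \<open>simp; fail\<close>))+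
      show "dmap False (VV (Suc m) @ GG a @ RRs ns) (VF # ss) (\<lambda>e. hd e # \<psi> (tl e))" unfolding V append_Cons
        by (rule dmap_app0[OF I(4)] dI | (use ss I(2) in \<open>simp; fail\<close>))+
    qed (use I in \<open>auto simp: tuples_Cons\<close>)
  next
    case VG
    let ?k = "length (VV m)"
    have V: "GG (Suc a) = VG # GG a" by (simp add: GG_def)
    have n: "dtm False (VV m @ VG # GG a @ RRs ns) VG (\<lambda>e. e ! ?k)"
      by (rule dtm_nth[OF dmap_id]) (use I(2) in simp_all)
    have d: "dmap False (VV m @ VG # GG a @ RRs ns) (GG a @ RRs ns) (\<lambda>e. drop (Suc ?k) e)"
      by (rule dmap_drop[OF dmap_id]) (use I(2) in \<open>simp_all add: drop_append\<close>)
    show ?thesis unfolding VG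
    proof (rule exI[of _ m], rule exI[of _ "Suc a"], rule exI[of _ ns], rule exI[of _ "\<lambda>e. take ?k (\<phi> (tl e)) @ hd e # drop ?k (\<phi> (tl e))"],
      rule exI[of _ "\<lambda>e. (e ! ?k) # \<psi> (take ?k e @ drop (Suc ?k) e)"], intro conjI)
      show "dmap False (VG # ss) (VV m @ GG (Suc a) @ RRs ns) (\<lambda>e. take ?k (\<phi> (tl e)) @ hd e # drop ?k (\<phi> (tl e)))"
        unfolding V append_Cons
        by (rule dmap_Cons dmap_append dmap_take dmap_drop dmap_app0[OF I(3)] dI | (use ss in \<open>simp; fail\<close>))+
      show "dmap False (VV m @ GG (Suc a) @ RRs ns) (VG # ss) (\<lambda>e. (e ! ?k) # \<psi> (take ?k e @ drop (Suc ?k) e))"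
        unfolding V append_Cons
        by (rule dmap_Cons n dmap_app0[OF I(4)] dmap_append d dI | (use ss I(2) in \<open>simp; fail\<close>))+
      show "\<forall>y\<in>tuples K (VG # ss). ((take ?k (\<phi> (tl y)) @ hd y # drop ?k (\<phi> (tl y))) ! ?k) #
          \<psi> (take ?k (take ?k (\<phi> (tl y)) @ hd y # drop ?k (\<phi> (tl y))) @ drop (Suc ?k) (take ?k (\<phi> (tl y)) @ hd y # drop ?k (\<phi> (tl y)))) = y"
      proof
        fix y assume "y \<in> tuples K (VG # ss)"
        then obtain \<gamma> z where y: "y = \<gamma> # z" "z \<in> tuples K ss" by (auto simp: tuples_Cons)
        obtain u w where uw: "\<phi> z = u @ w" "u \<in> tuples K (VV m)" using ph[OF y(2)] by (rule tuples_appendE)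
        have "length u = ?k" using uw(2) by (rule tuples_length)
        moreover have "\<psi> (u @ w) = z" using I(5)[rule_format, OF y(2)] unfolding uw(1) .
        ultimately show "((take ?k (\<phi> (tl y)) @ hd y # drop ?k (\<phi> (tl y))) ! ?k) #
          \<psi> (take ?k (take ?k (\<phi> (tl y)) @ hd y # drop ?k (\<phi> (tl y))) @ drop (Suc ?k) (take ?k (\<phi> (tl y)) @ hd y # drop ?k (\<phi> (tl y)))) = y"
          using y(1) uw(1) by (simp add: nth_append drop_append)
      qed
    qed (use I in simp_all)
  next
    case (RR n)
    let ?k = "length (VV m @ GG a @ RRs ns)"
    have V: "VV m @ GG a @ RRs (ns @ [n]) = (VV m @ GG a @ RRs ns) @ [RR n]" by (simp add: RRs_def)
    have s: "set (RRs (ns @ [n])) \<subseteq> sorts L" using I(2) ss RR by (simp add: RRs_def)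
    show ?thesis unfolding RR
    proof (rule exI[of _ m], rule exI[of _ a], rule exI[of _ "ns @ [n]"], rule exI[of _ "\<lambda>e. \<phi> (tl e) @ [hd e]"],
      rule exI[of _ "\<lambda>e. (e ! ?k) # \<psi> (take ?k e)"], intro conjI)
      show "dmap False (RR n # ss) (VV m @ GG a @ RRs (ns @ [n])) (\<lambda>e. \<phi> (tl e) @ [hd e])" unfolding V
        by (rule dmap_append dmap_app0[OF I(3)] dI | (use ss RR in \<open>simp; fail\<close>))+
      show "dmap False (VV m @ GG a @ RRs (ns @ [n])) (RR n # ss) (\<lambda>e. (e ! ?k) # \<psi> (take ?k e))" unfolding V
        by (rule dmap_app0[OF I(4)] dI | (use ss RR I(2) in \<open>simp; fail\<close>))+
      show "\<forall>y\<in>tuples K (RR n # ss). ((\<phi> (tl y) @ [hd y]) ! ?k) # \<psi> (take ?k (\<phi> (tl y) @ [hd y])) = y"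
      proof
        fix y assume "y \<in> tuples K (RR n # ss)"
        then obtain \<gamma> z where y: "y = \<gamma> # z" "z \<in> tuples K ss" by (auto simp: tuples_Cons)
        have "length (\<phi> z) = ?k" using ph[OF y(2)] by (rule tuples_length)
        then show "((\<phi> (tl y) @ [hd y]) ! ?k) # \<psi> (take ?k (\<phi> (tl y) @ [hd y])) = y"
          using I(5) y by (simp add: nth_append del: length_append)
      qed
    qed (use I s in simp_all)
  qed
qed

text \<open>The cells are those of the complement of the exceptional set \<open>C\<close>; since the cells do not meet \<open>C\<close>,
  they keep their balls away from it.\<close>

abbreviation cell_at where
  "cell_at E us l g c x y \<equiv> (\<forall>x'\<in>KF. g (x' # y) = g (x # y) \<longrightarrow> x' = x) \<or>
      (x \<noteq> c (y @ g (x # y)) \<and>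
       (\<forall>x'\<in>KF. cl (ord (vd x (c (y @ g (x # y)))) + int l) x x' \<longrightarrow> g (x' # y) = g (x # y) \<and>
          (\<forall>u\<in>tuples K us. E (x # y @ u) \<longleftrightarrow> E (x' # y @ u))) \<and>
       (\<forall>x'\<in>KF. g (x' # y) = g (x # y) \<longrightarrow> x' \<noteq> c (y @ g (x # y)) \<and>
          (ord (vd x' (c (y @ g (x # y)))) = ord (vd x (c (y @ g (x # y)))) \<longrightarrow> cl (ord (vd x (c (y @ g (x # y)))) + int l) x x')))"

lemma cell: assumes E: "dset False (VF # ss @ us) E" and us: "VF \<notin> set us"
  obtains l ns g c where "RR l \<in> sorts L" "set (RRs ns) \<subseteq> sorts L" "dmap False (VF # ss) (RRs ns) g"
    "dtm False (ss @ RRs ns) VF c"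
    "\<And>x y. x \<in> KF \<Longrightarrow> y \<in> tuples K ss \<Longrightarrow> cell_at E us l g c x y"
proof -
  have s: "set ss \<subseteq> sorts L" "set us \<subseteq> sorts L" using dset_sorts[OF E] by auto
  obtain m a ns \<phi> \<psi> where I: "set (RRs ns) \<subseteq> sorts L"
   "dmap False ss (VV m @ GG a @ RRs ns) \<phi>" "dmap False (VV m @ GG a @ RRs ns) ss \<psi>" "\<forall>y\<in>tuples K ss. \<psi> (\<phi> y) = y"
    using sort_split[OF s(1)] by (elim exE conjE) (rule that)
  obtain m' b ms \<phi>' \<psi>' where J0: "VF \<notin> set us \<longrightarrow> m' = 0" "set (RRs ms) \<subseteq> sorts L"
   "dmap False us (VV m' @ GG b @ RRs ms) \<phi>'" "dmap False (VV m' @ GG b @ RRs ms) us \<psi>'" "\<forall>y\<in>tuples K us. \<psi>' (\<phi>' y) = y"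
    using sort_split[OF s(2)] by (elim exE conjE) (rule that)
  have J: "set (RRs ms) \<subseteq> sorts L" "dmap False us (GG b @ RRs ms) \<phi>'" "dmap False (GG b @ RRs ms) us \<psi>'"
    "\<forall>y\<in>tuples K us. \<psi>' (\<phi>' y) = y" using J0 us by simp_all
  let ?k = "length (VV m)" and ?a = "length (GG a)" and ?b = "length (GG b)" and ?n = "length (RRs ns)"
  let ?E = "\<lambda>e. E (hd e # \<psi> (take ?k (tl e) @ take ?a (drop ?k (tl e)) @ take ?n (drop ?b (drop ?a (drop ?k (tl e))))) @
      \<psi>' (take ?b (drop ?a (drop ?k (tl e))) @ drop ?n (drop ?b (drop ?a (drop ?k (tl e))))))"
  have "dset False (VF # VV m @ GG a @ GG b @ RRs ns @ RRs ms) ?E"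
    by (rule dset_app0[OF E] dmap_app0[OF I(3)] dmap_app0[OF J(3)] dI | (use I(1) J(1) in \<open>simp; fail\<close>))+
  then have dE: "dset False (VF # VV m @ GG (a + b) @ RRs (ns @ ms)) ?E" by (simp add: GG_add RRs_append)
  have nsms: "set (RRs (ns @ ms)) \<subseteq> sorts L" using I(1) J(1) by (simp add: RRs_append)
  obtain l C where C: "RR l \<in> sorts L" "dset False (VF # VV m) C" "\<And>y. y \<in> tuples K (VV m) \<Longrightarrow> nob (\<lambda>c. C (c # y))"
    "\<And>y \<Lambda> x x' r. \<lbrakk>y \<in> tuples K (VV m); \<Lambda> \<in> tuples K (GG (a + b) @ RRs (ns @ ms)); x \<in> KF; x' \<in> KF; far C l r x y;
      cl r x x'\<rbrakk> \<Longrightarrow> ?E (x # y @ \<Lambda>) \<longleftrightarrow> ?E (x' # y @ \<Lambda>)"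
    by (rule prepE[OF prep_all[OF nsms] dE]) (rule that)
  define p where "p y = take ?k (\<phi> y)" for y
  have dp: "dmap False ss (VV m) p" unfolding p_def
    by (rule dmap_take[OF I(2)]) simp
  have near: "E (x # y @ u) \<longleftrightarrow> E (x' # y @ u)" if y: "y \<in> tuples K ss" and u: "u \<in> tuples K us" and x: "x \<in> KF" "x' \<in> KF"
    and far: "\<forall>c\<in>KF. C (c # p y) \<longrightarrow> \<not> cl (r + 1 - int l) x c" and c: "cl r x x'" for x x' y u r
  proof -
    obtain v w where vw: "\<phi> y = v @ w" "v \<in> tuples K (VV m)" "w \<in> tuples K (GG a @ RRs ns)"
      using dmap_tuples[OF I(2) y] by (rule tuples_appendE)
    obtain w1 w2 where w: "w = w1 @ w2" "w1 \<in> tuples K (GG a)" "w2 \<in> tuples K (RRs ns)" using vw(3) by (rule tuples_appendE)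
    obtain u1 u2 where u': "\<phi>' u = u1 @ u2" "u1 \<in> tuples K (GG b)" "u2 \<in> tuples K (RRs ms)"
      using dmap_tuples[OF J(2) u] by (rule tuples_appendE)
    have pv: "p y = v" unfolding p_def vw(1) using vw(2) by simp
    have L: "w1 @ u1 @ w2 @ u2 \<in> tuples K (GG (a + b) @ RRs (ns @ ms))"
      using w u' by (simp add: GG_add RRs_append)
    have y1: "\<psi> (v @ w1 @ w2) = y" using I(4)[rule_format, OF y] unfolding vw(1) w(1) .
    have u1: "\<psi>' (u1 @ u2) = u" using J(4)[rule_format, OF u] unfolding u'(1) .
    have Eq: "?E (x # v @ w1 @ u1 @ w2 @ u2) \<longleftrightarrow> E (x # y @ u)" for x
      using vw(2) w(2,3) u'(2,3) y1 u1 by simp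
    show ?thesis using C(4)[OF vw(2) L x far[unfolded pv] c] unfolding Eq .
  qed
  obtain ns0 g0 where g0: "set (RRs ns0) \<subseteq> sorts L" "dmap False (VF # VV m) (RRs ns0) g0"
   "\<And>y x x'. \<lbrakk>y \<in> tuples K (VV m); nob (\<lambda>x. C (x # y)); x \<in> KF; x' \<in> KF; C (x # y); C (x' # y);
     g0 (x # y) = g0 (x' # y)\<rbrakk> \<Longrightarrow> x = x'" by (rule code0[OF C(2)]) (rule that)
  let ?X = "\<lambda>e. \<not> C e"
  have dX: "dset False (VF # VV m) ?X" by (rule dset_not[OF C(2)])
  obtain l' ns1 g1 c where l': "RR l' \<in> sorts L" and ns1: "set (RRs ns1) \<subseteq> sorts L" 
   and g1: "dmap False (VF # VV m) (RRs ns1) g1"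
   and c: "dtm False (VV m @ RRs ns1) VF c" and
   P: "\<And>x y. \<lbrakk>x \<in> KF; y \<in> tuples K (VV m); ?X (x # y)\<rbrakk> \<Longrightarrow> bcell ?X l' g1 c x y"
    by (rule bmin[OF dX]) (rule that)
  \<comment> \<open>If \<open>o\<close> is the order of \<open>x - c\<close>, a ball of radius
    \<open>o + ?l\<close> is far from \<open>C\<close> at depth \<open>l\<close> as soon as the ball
    of radius \<open>o + l'\<close> misses \<open>C\<close>; the cells of the complement guarantee
    the latter.\<close>
  let ?l = "l + l' - 1"
  have lpos: "l \<ge> 1" "l' \<ge> 1" using RR_pos C(1) l' by auto
  have RRl: "RR ?l \<in> sorts L" by (rule RR_add[OF C(1) l'])
  define q where "q e = hd e # p (tl e)" for e
  have dq: "dmap False (VF # ss) (VF # VV m) q" unfolding q_def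
    by (rule dmap_app0[OF dp] dI | (use s in \<open>simp; fail\<close>))+
  let ?Z = "map (\<lambda>s. fint K (SZero s) []) (RRs ns0)"
  \<comment> \<open>The color records membership in \<open>C\<close>, a code for the points of
    \<open>C\<close>, the cell of the complement, and the angular component to the final depth
    \<open>?l\<close>, which cuts the balls of the coarser cells down to the new radius.\<close>
  define A where "A e = (if C (q e) then rone 1 else rzero 1)" for e
  define B where "B e = (if C (q e) then g0 (q e) else ?Z)" for e
  define W where "W e = vac K ?l (vd (hd e) (c (p (tl e) @ g1 (q e))))" for e
  define g where "g e = A e # B e @ g1 (q e) @ [W e]" for e
  let ?ns = "1 # ns0 @ ns1 @ [?l]"
  have nsq: "set (RRs ?ns) \<subseteq> sorts L" using g0(1) ns1 RRl by (simp add: RRs_Cons RRs_append)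
  have dCq: "dset False (VF # ss) (\<lambda>e. C (q e))" by (rule dset_app0[OF C(2) dq])
  have dA: "dtm False (VF # ss) (RR 1) A" unfolding A_def
    by (rule dtm_if dCq dI | (use s in \<open>simp; fail\<close>))+
  have dB: "dmap False (VF # ss) (RRs ns0) B" unfolding B_def
    by (rule dmap_if dCq dmap_app0[OF g0(2)] dq dmap_zeros | (use s g0(1) in \<open>simp; fail\<close>))+
  have dW: "dtm False (VF # ss) (RR ?l) W" unfolding W_def
    by (rule dtm_app0[OF c] dmap_app0[OF dp] dmap_app0[OF g1] dq dI | (use s RRl in \<open>simp; fail\<close>))+
  have dg: "dmap False (VF # ss) (RRs ?ns) g" unfolding g_def RRs_Cons RRs_append RRs_Nil
    by (rule dmap_Cons dmap_append dA dB dW dmap_app0[OF g1] dq dmap_Nil | (use s in \<open>simp; fail\<close>))+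
  let ?c = "\<lambda>e. c (p (take (length ss) e) @ take (length (RRs ns1)) (drop (length (RRs ns0)) (tl (drop (length ss) e))))"
  have dc: "dtm False (ss @ RRs ?ns) VF ?c" unfolding RRs_Cons RRs_append RRs_Nil
    by (rule dtm_app0[OF c] dmap_app0[OF dp] dI | (use s g0(1) ns1 RRl in \<open>simp; fail\<close>))+
  show ?thesis
  proof (rule that[OF RRl nsq dg dc])
    fix x y assume x: "x \<in> KF" and y: "y \<in> tuples K ss"
    have py: "p y \<in> tuples K (VV m)" by (rule dmap_tuples[OF dp y])
    have q: "q (x # y) = x # p y" for x by (simp add: q_def)
    have g1K: "g1 (x # p y) \<in> tuples K (RRs ns1)" if "x \<in> KF" for x by (rule dmap_tuples[OF g1]) (use that py in simp)
    have BK: "B (x # y) \<in> tuples K (RRs ns0)" if "x \<in> KF" for x by (rule dmap_tuples[OF dB]) (use that y in simp)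
    have ceq: "?c (y @ g (x # y)) = c (p y @ g1 (x # p y))" unfolding g_def q
      using y BK[OF x] g1K[OF x] by simp
    let ?d = "c (p y @ g1 (x # p y))"
    have dK: "?d \<in> KF" by (rule dtm_car[OF c]) (use py g1K[OF x] in simp)
    have geq: "g (x' # y) = g (x # y) \<longleftrightarrow> A (x' # y) = A (x # y) \<and> B (x' # y) = B (x # y) \<and>
      g1 (x' # p y) = g1 (x # p y) \<and> W (x' # y) = W (x # y)" if x': "x' \<in> KF" for x'
      unfolding g_def q using tuples_length[OF BK[OF x]] tuples_length[OF BK[OF x']] tuples_length[OF g1K[OF x]] tuples_length[OF g1K[OF x']]
      by simp
    have Aeq: "A (x' # y) = A (x # y) \<longleftrightarrow> C (x' # p y) = C (x # p y)" for x' unfolding A_def q using rone_ne by auto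
    show "cell_at E us ?l g ?c x y"
      unfolding ceq
    proof (cases "C (x # p y)")
      case True
      have "x' = x" if x': "x' \<in> KF" "g (x' # y) = g (x # y)" for x'
      proof -
        have "C (x' # p y)" "B (x' # y) = B (x # y)" using x' geq Aeq True by simp_all
        then show ?thesis using g0(3)[OF py C(3)[OF py] x'(1) x] True unfolding B_def q by simp
      qed
      then show "(\<forall>x'\<in>KF. g (x' # y) = g (x # y) \<longrightarrow> x' = x) \<or> (x \<noteq> ?d \<and>
       (\<forall>x'\<in>KF. cl (ord (vd x ?d) + int ?l) x x' \<longrightarrow> g (x' # y) = g (x # y) \<and>
          (\<forall>u\<in>tuples K us. E (x # y @ u) \<longleftrightarrow> E (x' # y @ u))) \<and>
       (\<forall>x'\<in>KF. g (x' # y) = g (x # y) \<longrightarrow> x' \<noteq> ?d \<and> (ord (vd x' ?d) = ord (vd x ?d) \<longrightarrow> cl (ord (vd x ?d) + int ?l) x x')))" by blast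
    next
      case False
      have sX: "\<not> C (x' # p y) \<and> g1 (x' # p y) = g1 (x # p y) \<and> W (x' # y) = W (x # y)" if "x' \<in> KF" "g (x' # y) = g (x # y)" for x'
        using that geq Aeq False by simp
      from P[OF x py False] show "(\<forall>x'\<in>KF. g (x' # y) = g (x # y) \<longrightarrow> x' = x) \<or> (x \<noteq> ?d \<and>
       (\<forall>x'\<in>KF. cl (ord (vd x ?d) + int ?l) x x' \<longrightarrow> g (x' # y) = g (x # y) \<and>
          (\<forall>u\<in>tuples K us. E (x # y @ u) \<longleftrightarrow> E (x' # y @ u))) \<and>
       (\<forall>x'\<in>KF. g (x' # y) = g (x # y) \<longrightarrow> x' \<noteq> ?d \<and> (ord (vd x' ?d) = ord (vd x ?d) \<longrightarrow> cl (ord (vd x ?d) + int ?l) x x')))"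
      proof (elim disjE conjE)
        assume "\<forall>x'\<in>KF. \<not> C (x' # p y) \<and> g1 (x' # p y) = g1 (x # p y) \<longrightarrow> x' = x"
        then show ?thesis using sX by blast
      next
        assume ne: "x \<noteq> ?d" and b: "\<forall>x'\<in>KF. cl (ord (vd x ?d) + int l') x x' \<longrightarrow> \<not> C (x' # p y) \<and> g1 (x' # p y) = g1 (x # p y)"
          and b': "\<forall>x'\<in>KF. \<not> C (x' # p y) \<and> g1 (x' # p y) = g1 (x # p y) \<longrightarrow> x' \<noteq> ?d \<and>
             (ord (vd x' ?d) = ord (vd x ?d) \<longrightarrow> cl (ord (vd x ?d) + int l') x x')"
        let ?o = "ord (vd x ?d)"
        have Wx: "W (x' # y) = vac K ?l (vd x' ?d)" if "g1 (x' # p y) = g1 (x # p y)" for x'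
          unfolding W_def q using that by simp
        have "g (x' # y) = g (x # y) \<and> (\<forall>u\<in>tuples K us. E (x # y @ u) \<longleftrightarrow> E (x' # y @ u))"
          if x': "x' \<in> KF" "cl (?o + int ?l) x x'" for x'
        proof -
          have "cl (?o + int l') x x'" using cl_mono[OF x'(2)] lpos by simp
          then have i: "\<not> C (x' # p y)" "g1 (x' # p y) = g1 (x # p y)" using b x' by blast+
          have "cl (?o + 1) x x'" using cl_mono[OF x'(2)] lpos by simp
          from ord_cl_eq[OF x x'(1) dK ne this] have o: "x' \<noteq> ?d" "ord (vd x' ?d) = ?o" by auto
          have "W (x' # y) = W (x # y)" using Wx[OF i(2)] Wx[OF refl] vac_eq[OF RRl x x'(1) dK ne o(1)] o(2) x'(2) by simp
          moreover have "B (x' # y) = B (x # y)" unfolding B_def q using i False by simp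
          ultimately have ge: "g (x' # y) = g (x # y)" using geq[OF x'(1)] Aeq i False by simp
          have "\<forall>c\<in>KF. C (c # p y) \<longrightarrow> \<not> cl (?o + int ?l + 1 - int l) x c"
          proof (intro ballI impI notI)
            fix d assume d: "d \<in> KF" "C (d # p y)" "cl (?o + int ?l + 1 - int l) x d"
            have "cl (?o + int l') x d" using d(3) lpos by simp
            then show False using b d by blast
          qed
          then show ?thesis using ge near[OF y _ x x'(1) _ x'(2)] by blast
        qed
        moreover have "x' \<noteq> ?d \<and> (ord (vd x' ?d) = ?o \<longrightarrow> cl (?o + int ?l) x x')" if x': "x' \<in> KF" "g (x' # y) = g (x # y)" for x'
        proof -
          have i: "\<not> C (x' # p y)" "g1 (x' # p y) = g1 (x # p y)" "W (x' # y) = W (x # y)" using sX[OF x'] by auto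
          have nd: "x' \<noteq> ?d" using b' i x' by blast
          have "vac K ?l (vd x' ?d) = vac K ?l (vd x ?d)" using Wx[OF i(2)] Wx[OF refl] i(3) by simp
          then show ?thesis using nd vac_eq[OF RRl x x'(1) dK ne nd] by metis
        qed
        ultimately show ?thesis using ne by blast
      qed
    qed
  qed
qed

text \<open>The analogue of \<open>code0\<close> for parameters of arbitrary sorts: a cell meeting a
  fiber without balls has to be a single point.\<close>

lemma code: assumes X: "dset False (VF # ss) X"
  obtains ns g where "set (RRs ns) \<subseteq> sorts L" "dmap False (VF # ss) (RRs ns) g"
   "\<And>y x x'. \<lbrakk>y \<in> tuples K ss; nob (\<lambda>x. X (x # y)); x \<in> KF; x' \<in> KF; X (x # y); g (x # y) = g (x' # y)\<rbrakk> \<Longrightarrow> x = x'"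
proof -
  have X': "dset False (VF # ss @ []) X" using X by simp
  obtain l ns g c where g: "RR l \<in> sorts L" "set (RRs ns) \<subseteq> sorts L" "dmap False (VF # ss) (RRs ns) g"
    "dtm False (ss @ RRs ns) VF c"
    "\<And>x y. x \<in> KF \<Longrightarrow> y \<in> tuples K ss \<Longrightarrow> cell_at X [] l g c x y"
    by (rule cell[OF X']) (simp, rule that)
  show ?thesis
  proof (rule that[OF g(2,3)])
    fix y x x' assume *: "y \<in> tuples K ss" "nob (\<lambda>x. X (x # y))" "x \<in> KF" "x' \<in> KF" "X (x # y)" "g (x # y) = g (x' # y)"
    show "x = x'" using g(5)[OF *(3,1)]
    proof
      assume "\<forall>x'\<in>KF. g (x' # y) = g (x # y) \<longrightarrow> x' = x"
      then show ?thesis using *(4,6) by simp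
    next
      assume "x \<noteq> c (y @ g (x # y)) \<and>
       (\<forall>x'\<in>KF. cl (ord (vd x (c (y @ g (x # y)))) + int l) x x' \<longrightarrow> g (x' # y) = g (x # y) \<and>
          (\<forall>u\<in>tuples K []. X (x # y @ u) \<longleftrightarrow> X (x' # y @ u))) \<and>
       (\<forall>x'\<in>KF. g (x' # y) = g (x # y) \<longrightarrow> x' \<noteq> c (y @ g (x # y)) \<and>
          (ord (vd x' (c (y @ g (x # y)))) = ord (vd x (c (y @ g (x # y)))) \<longrightarrow> cl (ord (vd x (c (y @ g (x # y)))) + int l) x x'))"
      then have "\<forall>x'\<in>KF. cl (ord (vd x (c (y @ g (x # y)))) + int l) x x' \<longrightarrow> X (x' # y)" using *(5) by simp
      then show ?thesis using *(2,3) unfolding nob_def by blast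
    qed
  qed
qed

subsection \<open>Lipschitz functions of one variable\<close>

definition lip_on :: "('u \<Rightarrow> 'u) \<Rightarrow> 'u \<Rightarrow> int \<Rightarrow> bool" where
  "lip_on f x s \<longleftrightarrow> (\<forall>x1\<in>KF. \<forall>x2\<in>KF. cl s x x1 \<and> cl s x x2 \<longrightarrow> (\<forall>r. cl r x1 x2 \<longrightarrow> cl r (f x1) (f x2)))"

definition loc_lip :: "('u \<Rightarrow> 'u) \<Rightarrow> 'u \<Rightarrow> bool" where
  "loc_lip f x \<longleftrightarrow> (\<exists>s. lip_on f x s)"

section \<open>Colorings by residue rings\<close>

definition col :: "vsort list \<Rightarrow> ('u list \<Rightarrow> 'u list) \<Rightarrow> bool" where
  "col ss g \<longleftrightarrow> (\<exists>ns. dmap False ss (RRs ns) g)"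

lemma colI: "dmap False ss (RRs ns) g \<Longrightarrow> col ss g"
  unfolding col_def by blast

lemma col_app: "col ts g \<Longrightarrow> dmap False ss ts a \<Longrightarrow> col ss (\<lambda>e. g (a e))"
  unfolding col_def using dmap_app0 by blast

lemma col_two: assumes "col ss g" "col ss h"
  obtains k where "col ss k"
    "\<And>e e'. \<lbrakk>e \<in> tuples K ss; e' \<in> tuples K ss; k e = k e'\<rbrakk> \<Longrightarrow> g e = g e' \<and> h e = h e'"
proof -
  obtain ns ms where g: "dmap False ss (RRs ns) g" and h: "dmap False ss (RRs ms) h" using assms unfolding col_def by blast
  have "dmap False ss (RRs (ns @ ms)) (\<lambda>e. g e @ h e)" unfolding RRs_append by (rule dmap_append[OF g h])
  from that[OF colI[OF this]] show ?thesis using tuples_length[OF dmap_tuples[OF g]] by simp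
qed

lemma col_nil: "set ss \<subseteq> sorts L \<Longrightarrow> col ss (\<lambda>e. [])"
  unfolding col_def by (intro exI[of _ "[]"]) (simp add: dmap_Nil)

lemma col_single: "dtm False ss (RR n) t \<Longrightarrow> col ss (\<lambda>e. [t e])"
  unfolding col_def by (intro exI[of _ "[n]"]) (simp add: RRs_def dtm_def)

lemma col_flag: assumes "dset False ss P"
  obtains g where "col ss g" "\<And>e e'. g e = g e' \<Longrightarrow> P e \<longleftrightarrow> P e'"
proof -
  have s: "set ss \<subseteq> sorts L" using dset_sorts[OF assms] .
  have "dtm False ss (RR 1) (\<lambda>e. if P e then rone 1 else rzero 1)"
    by (rule dtm_if assms dI | (use s in \<open>simp; fail\<close>))+
  then have "col ss (\<lambda>e. [if P e then rone 1 else rzero 1])" by (rule col_single)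
  then show ?thesis
  proof (rule that)
    fix e e' assume "[if P e then rone 1 else rzero 1] = [if P e' then rone 1 else rzero 1]"
    then show "P e \<longleftrightarrow> P e'" using rone_ne by (auto split: if_splits)
  qed
qed

lemma col_many: assumes s: "set ss \<subseteq> sorts L" and "\<And>i. i < (N::nat) \<Longrightarrow> col ss (g i)"
  shows "\<exists>k. col ss k \<and> (\<forall>e\<in>tuples K ss. \<forall>e'\<in>tuples K ss. k e = k e' \<longrightarrow> (\<forall>i<N. g i e = g i e'))"
  using assms(2)
proof (induction N)
  case 0
  show ?case using col_nil[OF s] by auto
next
  case (Suc N)
  obtain k where k: "col ss k" "\<forall>e\<in>tuples K ss. \<forall>e'\<in>tuples K ss. k e = k e' \<longrightarrow> (\<forall>i<N. g i e = g i e')"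
    using Suc by auto
  obtain k' where k': "col ss k'"
    "\<And>e e'. \<lbrakk>e \<in> tuples K ss; e' \<in> tuples K ss; k' e = k' e'\<rbrakk> \<Longrightarrow> k e = k e' \<and> g N e = g N e'"
    by (rule col_two[OF k(1) Suc.prems[of N]]) (simp, rule that)
  show ?case
  proof (intro exI[of _ k'] conjI k'(1) ballI impI allI)
    fix e e' i assume *: "e \<in> tuples K ss" "e' \<in> tuples K ss" "k' e = k' e'" "i < Suc N"
    have ke: "k e = k e'" "g N e = g N e'" using k'(2)[OF *(1-3)] by auto
    show "g i e = g i e'"
    proof (cases "i = N")
      case False
      then have "i < N" using *(4) by simp
      then show ?thesis using k(2)[THEN bspec, OF *(1), THEN bspec, OF *(2), THEN mp, OF ke(1)] by blast
    qed (use ke in simp)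
  qed
qed

text \<open>A color takes values in residue rings; for each of the finitely many integers below
  \<open>N\<close> it records by \<open>1\<close> or \<open>0\<close> whether \<open>t\<close> has
  that value.\<close>

lemma col_int: assumes t: "dint False ss t"
  obtains g where "col ss g"
    "\<And>e e'. \<lbrakk>e \<in> tuples K ss; e' \<in> tuples K ss; g e = g e'; 0 \<le> t e; t e < int N\<rbrakk> \<Longrightarrow> t e' = t e"
proof -
  have s: "set ss \<subseteq> sorts L" by (rule dint_sorts[OF t])
  define g where "g j e = [if t e = int j then rone 1 else rzero 1]" for j e
  have "col ss (g j)" for j unfolding g_def
    by (rule col_single) (rule dtm_if dset_inteq t dI | (use s in \<open>simp; fail\<close>))+
  then obtain k where k: "col ss k" "\<forall>e\<in>tuples K ss. \<forall>e'\<in>tuples K ss. k e = k e' \<longrightarrow> (\<forall>i<N. g i e = g i e')"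
    using col_many[OF s, of N g] by blast
  show ?thesis
  proof (rule that[OF k(1)])
    fix e e' assume *: "e \<in> tuples K ss" "e' \<in> tuples K ss" "k e = k e'" "0 \<le> t e" "t e < int N"
    obtain j where j: "t e = int j" using *(4) by (metis nonneg_int_cases)
    have "j < N" using *(5) j by simp
    then have "g j e = g j e'"
      using k(2)[THEN bspec, OF *(1), THEN bspec, OF *(2), THEN mp, OF *(3)] by blast
    then have "(if t e' = int j then rone 1 else rzero 1) = rone 1" unfolding g_def j by simp
    then show "t e' = t e" using rone_ne unfolding j by (metis (full_types))
  qed
qed

section \<open>Quotients and contractions\<close>

lemma vd_mult: assumes "u \<in> KF" "x \<in> KF" "y \<in> KF" shows "vd (u \<otimes>\<^bsub>F\<^esub> x) (u \<otimes>\<^bsub>F\<^esub> y) = u \<otimes>\<^bsub>F\<^esub> vd x y"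
  using assms by (simp add: vd_eq a_minus_def F.r_distr F.r_minus)

lemma cl_mult: assumes "u \<in> KF" "x \<in> KF" "y \<in> KF" "u \<noteq> zz"
  shows "cl (ord u + r) (u \<otimes>\<^bsub>F\<^esub> x) (u \<otimes>\<^bsub>F\<^esub> y) \<longleftrightarrow> cl r x y"
proof (cases "x = y")
  case False
  then have nz: "vd x y \<noteq> zz" using assms by simp
  have ne: "vd (u \<otimes>\<^bsub>F\<^esub> x) (u \<otimes>\<^bsub>F\<^esub> y) \<noteq> zz" unfolding vd_mult[OF assms(1-3)] using assms nz mult_nz by simp
  have "u \<otimes>\<^bsub>F\<^esub> x \<noteq> u \<otimes>\<^bsub>F\<^esub> y"
  proof
    assume "u \<otimes>\<^bsub>F\<^esub> x = u \<otimes>\<^bsub>F\<^esub> y"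
    then show False using ne assms by simp
  qed
  then show ?thesis using False ord_mult[of u "vd x y"] assms nz by (simp add: cl_def vd_mult)
qed simp

lemma cl_mult': assumes "u \<in> KF" "u' \<in> KF" "x \<in> KF" "x \<noteq> zz"
  shows "cl (ord x + r) (u \<otimes>\<^bsub>F\<^esub> x) (u' \<otimes>\<^bsub>F\<^esub> x) \<longleftrightarrow> cl r u u'"
  using cl_mult[of x u u'] assms F.m_comm[of u x] F.m_comm[of u' x] by simp

text \<open>The map \<open>z \<mapsto> c + (f z - d) / v\<close> is contracting on the ball; completeness is replaced by
  the existence of a common point of a definable chain of balls.\<close>

lemma surj_fix: assumes f: "dtm True [VF] VF (\<lambda>e. f (hd e))" and x: "x \<in> KF" "c \<in> KF" "d \<in> KF" "x \<noteq> c"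
   and lip: "lip_on f x s" and s: "s = ord (vd x c) + int l"
   and u: "u \<in> KF" "u \<otimes>\<^bsub>F\<^esub> vd x c = vd (f x) d" and v: "v \<in> KF" "v \<noteq> zz" "ord v < 0" "cl (ord v + int l) u v"
  obtains z where "z \<in> KF" "cl s x z" "vd (f z) d = v \<otimes>\<^bsub>F\<^esub> vd z c"
proof -
  have fK: "f z \<in> KF" if "z \<in> KF" for z using dtm_car[OF f, of "[z]"] that by simp
  have L: "cl r (f z) (f z')" if "z \<in> KF" "z' \<in> KF" "cl s x z" "cl s x z'" "cl r z z'" for z z' r
    using lip that unfolding lip_on_def by blast
  \<comment> \<open>The equation holds up to \<open>\<rho> + ord v\<close>. Multiplication by
    \<open>v\<close> shifts radii by \<open>ord v\<close>, so these approximate solutions form a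
    ball of radius \<open>\<rho>\<close>.\<close>
  define Q where "Q z \<rho> \<longleftrightarrow> cl s x z \<and> cl (\<rho> + ord v) (vd (f z) d) (v \<otimes>\<^bsub>F\<^esub> vd z c)" for z \<rho>
  have dQ: "dset True [VF, VG] (\<lambda>e. Q (hd e) (hh (hd (tl e))))" unfolding Q_def
    by (rule app1[OF f] dI | (use x v in \<open>simp; fail\<close>))+
  have vK: "v \<otimes>\<^bsub>F\<^esub> vd z c \<in> KF" if "z \<in> KF" for z using v x that by simp
  have mv: "cl (r + ord v) (v \<otimes>\<^bsub>F\<^esub> vd z c) (v \<otimes>\<^bsub>F\<^esub> vd z' c) \<longleftrightarrow> cl r z z'" if "z \<in> KF" "z' \<in> KF" for r z z'
    using cl_mult[of v "vd z c" "vd z' c" r] v x that by (simp add: add.commute cl_vd)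
  have fd: "cl r (vd (f z) d) (vd (f z') d) \<longleftrightarrow> cl r (f z) (f z')" if "z \<in> KF" "z' \<in> KF" for r z z'
    using cl_vd fK that x by simp
  have Q1: "\<exists>z\<in>KF. Q z \<rho>" if "s \<le> \<rho>" for \<rho>
    using that
  proof (induction \<rho> rule: int_ge_induct)
    case base
    have "cl (ord (vd x c) + (ord v + int l)) (u \<otimes>\<^bsub>F\<^esub> vd x c) (v \<otimes>\<^bsub>F\<^esub> vd x c)"
      using cl_mult'[of u v "vd x c" "ord v + int l"] u v x by simp
    then have "Q x s" unfolding Q_def using u(2) s by (simp add: ac_simps)
    then show ?case using x by blast
  next
    case (step \<rho>)
    then obtain z where z: "z \<in> KF" "Q z \<rho>" by blast
    obtain w where w: "w \<in> KF" "v \<otimes>\<^bsub>F\<^esub> w = vd (f z) d" using div_ex[of "vd (f z) d" v] fK z v x by auto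
    \<comment> \<open>The image of \<open>z\<close> under the contraction. The new error is that of
      \<open>f z'\<close> against \<open>f z\<close>, of order at least \<open>\<rho>\<close>, and
      \<open>ord v < 0\<close> makes this an improvement.\<close>
    define z' where "z' = w \<oplus>\<^bsub>F\<^esub> c"
    have z': "z' \<in> KF" "vd z' c = w" unfolding z'_def using w x by (simp_all add: vd_eq a_minus_def F.a_assoc)
    have "cl (\<rho> + ord v) (v \<otimes>\<^bsub>F\<^esub> vd z' c) (v \<otimes>\<^bsub>F\<^esub> vd z c)" using z(2) w(2) z'(2) unfolding Q_def by simp
    then have zz': "cl \<rho> z' z" using mv[OF z'(1) z(1)] by simp
    have "cl s x z'" using cl_trans[OF x(1) z(1) z'(1)] z(2) cl_mono[OF cl_sym[OF z'(1) z(1) zz'] step(1)] unfolding Q_def by blast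
    moreover have "cl (\<rho> + 1 + ord v) (vd (f z') d) (v \<otimes>\<^bsub>F\<^esub> vd z' c)"
    proof -
      have "cl \<rho> (f z') (f z)" using L[OF z'(1) z(1) _ _ zz'] calculation z(2) unfolding Q_def by blast
      then have "cl \<rho> (vd (f z') d) (vd (f z) d)" using fd[OF z'(1) z(1)] by simp
      then show ?thesis unfolding z'(2) w(2) using cl_mono v(3) by simp
    qed
    ultimately show ?case using z' unfolding Q_def by blast
  qed
  have Q2: "cl \<rho> z z'" if z: "z \<in> KF" "z' \<in> KF" and "s \<le> \<rho>" and q: "Q z \<rho>" "Q z' \<rho>" for z z' \<rho>
  proof (rule ccontr)
    assume n: "\<not> cl \<rho> z z'"
    define k where "k = ord (vd z z')"
    have k: "z \<noteq> z'" "k < \<rho>" "cl k z z'" using n unfolding k_def by (auto simp: cl_def)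
    have a: "cl (k + 1 + ord v) (v \<otimes>\<^bsub>F\<^esub> vd z c) (vd (f z) d)"
      using cl_sym[OF _ _ cl_mono[of "\<rho> + ord v" _ _ "k + 1 + ord v"]] q(1) k vK fK z x unfolding Q_def by simp
    have b: "cl (k + 1 + ord v) (vd (f z') d) (v \<otimes>\<^bsub>F\<^esub> vd z' c)"
      using cl_mono[of "\<rho> + ord v" _ _ "k + 1 + ord v"] q(2) k unfolding Q_def by simp
    have "cl k (f z) (f z')" using L[OF z _ _ k(3)] q unfolding Q_def by blast
    then have m: "cl (k + 1 + ord v) (vd (f z) d) (vd (f z') d)" using fd[OF z] cl_mono v(3) by simp
    have fz: "vd (f z) d \<in> KF" "vd (f z') d \<in> KF" using fK z x by simp_all
    have "cl (k + 1 + ord v) (v \<otimes>\<^bsub>F\<^esub> vd z c) (v \<otimes>\<^bsub>F\<^esub> vd z' c)"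
      using cl_trans[OF vK[OF z(1)] fz(1) vK[OF z(2)] a cl_trans[OF fz vK[OF z(2)] m b]] .
    then have "cl (k + 1) z z'" using mv[OF z] by simp
    then show False using k(1) by (simp add: cl_def k_def)
  qed
  have Q3: "Q z' \<rho>" if z: "z \<in> KF" "z' \<in> KF" and sr: "s \<le> \<rho>" and q: "Q z \<rho>" "cl \<rho> z z'" for z z' \<rho>
  proof -
    have b: "cl s x z'" using cl_trans[OF x(1) z] q(1) cl_mono[OF q(2) sr] unfolding Q_def by blast
    have zz': "cl \<rho> z' z" by (rule cl_sym[OF z q(2)])
    have "cl \<rho> (f z') (f z)" using L[OF z(2,1) b _ zz'] q(1) unfolding Q_def by blast
    then have m: "cl (\<rho> + ord v) (vd (f z') d) (vd (f z) d)" using fd[OF z(2,1)] cl_mono v(3) by simp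
    have fz: "vd (f z) d \<in> KF" "vd (f z') d \<in> KF" using fK z x by simp_all
    have "cl (\<rho> + ord v) (vd (f z) d) (v \<otimes>\<^bsub>F\<^esub> vd z' c)"
      using cl_trans[OF fz(1) vK[OF z(1)] vK[OF z(2)]] q mv[OF z] unfolding Q_def by blast
    then have "cl (\<rho> + ord v) (vd (f z') d) (v \<otimes>\<^bsub>F\<^esub> vd z' c)" using cl_trans[OF fz(2,1) vK[OF z(2)] m] by blast
    then show ?thesis using b unfolding Q_def by blast
  qed
  have Q4: "Q z \<rho>" if "\<rho> \<le> \<rho>'" "Q z \<rho>'" for z \<rho> \<rho>' using that cl_mono[of "\<rho>' + ord v" _ _ "\<rho> + ord v"] unfolding Q_def by simp
  obtain z where z: "z \<in> KF" "\<And>\<rho>. s \<le> \<rho> \<Longrightarrow> Q z \<rho>"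
    by (rule chain_point[OF dQ Q1 Q2 Q3 Q4]) (assumption | rule that)+
  have "vd (f z) d = v \<otimes>\<^bsub>F\<^esub> vd z c"
  proof (rule cl_all_eq[of _ _ "s + ord v"])
    show "cl r (vd (f z) d) (v \<otimes>\<^bsub>F\<^esub> vd z c)" if "s + ord v \<le> r" for r
      using z(2)[of "r - ord v"] that unfolding Q_def by simp
  qed (use fK z x vK in simp_all)
  then show ?thesis using that[OF z(1)] z(2)[of s] unfolding Q_def by blast
qed

lemma nob_single: assumes "\<And>x x'. \<lbrakk>x \<in> KF; x' \<in> KF; S x; S x'\<rbrakk> \<Longrightarrow> x = x'" shows "nob S"
proof (rule ccontr)
  assume "\<not> nob S"
  then obtain a r where a: "a \<in> KF" "\<And>x. x \<in> KF \<Longrightarrow> cl r a x \<Longrightarrow> S x" by (rule nobE) (rule that)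
  obtain x where x: "x \<in> KF" "x \<noteq> a" "ord (vd a x) = r" using ex_exact[OF a(1)] by metis
  then have "S a" "S x" using a by (simp_all add: cl_def)
  then show False using assms a(1) x by blast
qed

lemma quot_unique: assumes "u \<in> KF" "u' \<in> KF" "v \<in> KF" "v \<noteq> zz" "u \<otimes>\<^bsub>F\<^esub> v = u' \<otimes>\<^bsub>F\<^esub> v" shows "u = u'"
proof (rule cl_all_eq[OF assms(1,2)])
  show "cl r u u'" if "0 \<le> r" for r using cl_mult'[OF assms(1-4), of r] assms(5) by simp
qed

text \<open>The color consists of data of the quotient \<open>u = (f x - D) / (x - C)\<close>, which determines \<open>x\<close> up to residue
  rings.  If \<open>u\<close> is close to the center \<open>q\<close> of its cell, the solution \<open>x\<close> is moved to one with \<open>u = q\<close> by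
  \<open>surj_fix\<close>; otherwise the cell of \<open>u\<close> respects the value \<open>ord (x - C)\<close>.\<close>

lemma separate:
  assumes f: "dtm False (VF # pp) VF f" and C: "dtm False pp VF C" and D: "dtm False pp VF D"
    and M: "dset False (VF # pp) M" and l: "RR l \<in> sorts L"
    and H1: "\<And>x p. \<lbrakk>x \<in> KF; p \<in> tuples K pp; M (x # p)\<rbrakk> \<Longrightarrow> x \<noteq> C p"
    and H2: "\<And>x x' p. \<lbrakk>x \<in> KF; x' \<in> KF; p \<in> tuples K pp; M (x # p); cl (ord (vd x (C p)) + int l) x x'\<rbrakk> \<Longrightarrow> M (x' # p)"
    and H3: "\<And>x x' p. \<lbrakk>x \<in> KF; x' \<in> KF; p \<in> tuples K pp; M (x # p); M (x' # p);
      ord (vd x' (C p)) = ord (vd x (C p))\<rbrakk> \<Longrightarrow> cl (ord (vd x (C p)) + int l) x x'"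
    and H4: "\<And>x p. \<lbrakk>x \<in> KF; p \<in> tuples K pp; M (x # p)\<rbrakk> \<Longrightarrow> lip_on (\<lambda>z. f (z # p)) x (ord (vd x (C p)) + int l)"
  obtains g where "col (VF # pp) g"
    "\<And>p x x'. \<lbrakk>p \<in> tuples K pp; x \<in> KF; x' \<in> KF; M (x # p); M (x' # p); g (x # p) = g (x' # p); f (x # p) \<noteq> D p;
      f (x' # p) \<noteq> D p; ord (vd (f (x # p)) (D p)) < ord (vd x (C p)); ord (vd x (C p)) - ord (vd (f (x # p)) (D p)) = ord (vd x' (C p)) - ord (vd (f (x' # p)) (D p))\<rbrakk> \<Longrightarrow> ord (vd x (C p)) = ord (vd x' (C p))"
proof -
  have s: "set pp \<subseteq> sorts L" using dtm_sorts[OF C] by simp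
  have l1: "l \<ge> 1" by (rule RR_pos[OF l])
  let ?n = "length pp"
  have fK: "f (x # p) \<in> KF" if "x \<in> KF" "p \<in> tuples K pp" for x p by (rule dtm_car[OF f]) (use that in simp)
  have CK: "C p \<in> KF" if "p \<in> tuples K pp" for p by (rule dtm_car[OF C that])
  have DK: "D p \<in> KF" if "p \<in> tuples K pp" for p by (rule dtm_car[OF D that])
  \<comment> \<open>\<open>x\<close> is a point of \<open>M\<close> with quotient \<open>u\<close>;
    the condition \<open>ord u < 0\<close> says that the order of \<open>f x - D\<close> falls below
    that of \<open>x - C\<close>.\<close>
  define S where "S x p u \<longleftrightarrow> M (x # p) \<and> u \<noteq> zz \<and> ord u < 0 \<and> vd (f (x # p)) (D p) = u \<otimes>\<^bsub>F\<^esub> vd x (C p)" for x p u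
  have dS: "dset b c (\<lambda>e. S (t e) (a e) (u e))" if "dtm b c VF t" "dmap b c pp a" "dtm b c VF u" for b c t a u
  proof -
    have sc: "set c \<subseteq> sorts L" using dtm_sorts[OF that(1)] by simp
    show ?thesis unfolding S_def
      by (rule dset_app0[OF M] dtm_app0[OF f] dtm_app0[OF C] dtm_app0[OF D] that dI dset_eqt | (use sc in \<open>simp; fail\<close>))+
  qed
  \<comment> \<open>Two solutions of equal order lie in one ball. If they differ by order
    \<open>k\<close>, the Lipschitz bound forces the order of \<open>u (x - x')\<close> to be at
    least \<open>k\<close>, which \<open>ord u < 0\<close> excludes.\<close>
  have Suniq: "x = x'" if x: "x \<in> KF" "x' \<in> KF" "p \<in> tuples K pp" "u \<in> KF" "S x p u" "S x' p u"
    "ord (vd x (C p)) = ord (vd x' (C p))" for x x' p u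
  proof (rule ccontr)
    assume ne: "x \<noteq> x'"
    have m: "M (x # p)" "M (x' # p)" and u: "u \<noteq> zz" "ord u < 0"
      and e: "vd (f (x # p)) (D p) = u \<otimes>\<^bsub>F\<^esub> vd x (C p)" "vd (f (x' # p)) (D p) = u \<otimes>\<^bsub>F\<^esub> vd x' (C p)"
      using x(5,6) unfolding S_def by auto
    have c: "cl (ord (vd x (C p)) + int l) x x'" by (rule H3[OF x(1-3) m]) (use x(7) in simp)
    define k where "k = ord (vd x x')"
    have "cl k x x'" by (simp add: cl_def k_def)
    then have "cl k (f (x # p)) (f (x' # p))" using H4[OF x(1,3) m(1)] c x(1,2) cl_refl unfolding lip_on_def by blast
    then have "cl k (vd (f (x # p)) (D p)) (vd (f (x' # p)) (D p))" using cl_vd fK DK x by simp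
    then have "cl (ord u + (k - ord u)) (u \<otimes>\<^bsub>F\<^esub> vd x (C p)) (u \<otimes>\<^bsub>F\<^esub> vd x' (C p))" unfolding e by simp
    then have "cl (k - ord u) (vd x (C p)) (vd x' (C p))" using cl_mult[of u "vd x (C p)" "vd x' (C p)" "k - ord u"] x(1,2,4) u(1) CK[OF x(3)] by simp
    then have "cl (k - ord u) x x'" using cl_vd x CK by simp
    then show False using ne u(2) by (simp add: cl_def k_def)
  qed
  have nobS: "nob (\<lambda>x. S x p u)" if p: "p \<in> tuples K pp" and u: "u \<in> KF" for p u
  proof -
    have "nob (\<lambda>x. \<exists>\<gamma>. S x p u \<and> ord (vd x (C p)) = \<gamma>)"
    proof (rule nob_unionG)
      show "dset True [VF, VG] (\<lambda>e. S (hd e) p u \<and> ord (vd (hd e) (C p)) = hh (hd (tl e)))"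
        by (rule dS dI dset_inteq | (use p u CK s in \<open>simp; fail\<close>))+
      show "nob (\<lambda>x. S x p u \<and> ord (vd x (C p)) = k)" for k
        by (rule nob_single) (use Suniq p u in blast)
    qed
    then show ?thesis by simp
  qed
  have nth1: "dtm b (VF # pp @ [VF]) VF (\<lambda>e. tl e ! ?n)" for b
    by (rule dtm_nth[OF dmap_tl[OF dmap_id]]) (use s in simp_all)
  have dS1: "dset False (VF # pp @ [VF]) (\<lambda>e. S (hd e) (take ?n (tl e)) (tl e ! ?n))"
    by (rule dS nth1 dI | (use s in \<open>simp; fail\<close>))+
  obtain ks k where k: "set (RRs ks) \<subseteq> sorts L" "dmap False (VF # pp @ [VF]) (RRs ks) k"
    "\<And>y x x'. \<lbrakk>y \<in> tuples K (pp @ [VF]); nob (\<lambda>x. S (hd (x # y)) (take ?n (tl (x # y))) (tl (x # y) ! ?n)); x \<in> KF; x' \<in> KF;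
      S (hd (x # y)) (take ?n (tl (x # y))) (tl (x # y) ! ?n); k (x # y) = k (x' # y)\<rbrakk> \<Longrightarrow> x = x'"
    by (rule code[OF dS1]) (rule that)
  have kinj: "x = x'" if "p \<in> tuples K pp" "u \<in> KF" "x \<in> KF" "x' \<in> KF" "S x p u" "k (x # p @ [u]) = k (x' # p @ [u])" for p u x x'
    by (rule k(3)[of "p @ [u]" x x']) (use that nobS[OF that(1,2)] in simp_all)
  \<comment> \<open>The set of quotients that admit a solution of a given order with a given code.
    Cells compatible with it transport such solutions from one quotient to a neighboring
    one.\<close>
  define E3 where "E3 e \<longleftrightarrow> (\<exists>x\<in>KF. S x (take ?n (tl e)) (hd e) \<and> ord (vd x (C (take ?n (tl e)))) = hh (tl e ! ?n) \<and>
     k (x # take ?n (tl e) @ [hd e]) = drop (Suc ?n) (tl e))" for e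
  have dE3: "dset False (VF # pp @ VG # RRs ks) E3"
  proof -
    have n: "dtm False (VF # pp @ VG # RRs ks) VG (\<lambda>e. tl e ! ?n)"
      by (rule dtm_nth[OF dmap_tl[OF dmap_id]]) (use s k(1) in simp_all)
    have d: "dmap False (VF # pp @ VG # RRs ks) (RRs ks) (\<lambda>e. drop (Suc ?n) (tl e))"
      by (rule dmap_drop[OF dmap_tl[OF dmap_id]]) (use s k(1) in \<open>simp_all add: drop_append\<close>)
    show ?thesis unfolding E3_def
      by (rule dset_ex dset_conj dS dset_inteq dset_eq dmap_app0[OF k(2)] dtm_app0[OF C] dmap_lift[OF d] dint_hh[OF dtm_lift[OF n]] dI
        | (use s k(1) in \<open>simp; fail\<close>))+
  qed
  have nVF: "VF \<notin> set (VG # RRs ks)" by (auto simp: RRs_def)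
  obtain m4 ns2 g2 q0 where c4: "RR m4 \<in> sorts L" "set (RRs ns2) \<subseteq> sorts L" "dmap False (VF # pp) (RRs ns2) g2"
    "dtm False (pp @ RRs ns2) VF q0"
    "\<And>x y. x \<in> KF \<Longrightarrow> y \<in> tuples K pp \<Longrightarrow> cell_at E3 (VG # RRs ks) m4 g2 q0 x y"
    by (rule cell[OF dE3 nVF]) (rule that)
  define G1 where "G1 e u \<longleftrightarrow> u \<otimes>\<^bsub>F\<^esub> vd (hd e) (C (tl e)) = vd (f e) (D (tl e))" for e u
  define uu where "uu e = (if \<exists>!u. u \<in> KF \<and> G1 e u then THE u. u \<in> KF \<and> G1 e u else zz)" for e
  have duu: "dtm False (VF # pp) VF uu" unfolding uu_def
  proof (rule dtm_the)
    show "dset False ((VF # pp) @ [VF]) (\<lambda>z. G1 (take (length (VF # pp)) z) (z ! length (VF # pp)))" unfolding G1_def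
      by (rule dtm_app0[OF f] dtm_app0[OF C] dtm_app0[OF D] dI dset_eqt | (use s in \<open>simp; fail\<close>))+
  qed (use s in simp)
  have uu: "uu (x # p) \<in> KF \<and> uu (x # p) \<otimes>\<^bsub>F\<^esub> vd x (C p) = vd (f (x # p)) (D p)" if x: "x \<in> KF" "p \<in> tuples K pp" "x \<noteq> C p" for x p
  proof -
    have v: "vd x (C p) \<in> KF" "vd x (C p) \<noteq> zz" using x CK by simp_all
    obtain w where w: "w \<in> KF" "vd x (C p) \<otimes>\<^bsub>F\<^esub> w = vd (f (x # p)) (D p)" using div_ex[of "vd (f (x # p)) (D p)" "vd x (C p)"] v fK DK x by auto
    have w': "w \<otimes>\<^bsub>F\<^esub> vd x (C p) = vd (f (x # p)) (D p)" using w F.m_comm[of w "vd x (C p)"] v by simp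
    have "u \<in> KF \<and> G1 (x # p) u \<longleftrightarrow> u = w" for u
    proof
      assume u: "u \<in> KF \<and> G1 (x # p) u"
      show "u = w" by (rule quot_unique[OF _ w(1) v]) (use u w' in \<open>simp_all add: G1_def\<close>)
    next
      assume "u = w"
      then show "u \<in> KF \<and> G1 (x # p) u" using w(1) w' by (simp add: G1_def)
    qed
    then have "uu (x # p) = w" unfolding uu_def by simp
    then show ?thesis using w(1) w' by simp
  qed
  define qq where "qq e = q0 (tl e @ g2 (uu e # tl e))" for e
  have dqq: "dtm False (VF # pp) VF qq" unfolding qq_def
    by (rule dtm_app0[OF c4(4)] dmap_app0[OF c4(3)] duu dI | (use s in \<open>simp; fail\<close>))+
  \<comment> \<open>\<open>xs\<close> is the solution that has the cell center \<open>qq\<close> as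
    its quotient and the same order as the given point. Its code enters the color, which settles the
    case of a quotient too close to the center.\<close>
  define G2 where "G2 e x \<longleftrightarrow> S x (tl e) (qq e) \<and> ord (vd x (C (tl e))) = ord (vd (hd e) (C (tl e)))" for e x
  define xs where "xs e = (if \<exists>!x. x \<in> KF \<and> G2 e x then THE x. x \<in> KF \<and> G2 e x else zz)" for e
  have dxs: "dtm False (VF # pp) VF xs" unfolding xs_def
  proof (rule dtm_the)
    show "dset False ((VF # pp) @ [VF]) (\<lambda>z. G2 (take (length (VF # pp)) z) (z ! length (VF # pp)))" unfolding G2_def
      by (rule dset_conj dS dset_inteq dtm_app0[OF C] dtm_app0[OF dqq] dI dset_eqt | (use s in \<open>simp; fail\<close>))+
  qed (use s in simp)
  have k1: "col (VF # pp) (\<lambda>e. [vac K l (uu e)])"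
    by (rule col_single) (rule duu dI | (use l in \<open>simp; fail\<close>))+
  have k2: "col (VF # pp) (\<lambda>e. k (hd e # tl e @ [uu e]))"
    by (rule colI) (rule dmap_app0[OF k(2)] duu dI | (use s in \<open>simp; fail\<close>))+
  have k3: "col (VF # pp) (\<lambda>e. g2 (uu e # tl e))"
    by (rule colI) (rule dmap_app0[OF c4(3)] duu dI | (use s in \<open>simp; fail\<close>))+
  have k4: "col (VF # pp) (\<lambda>e. k (xs e # tl e @ [qq e]))"
    by (rule colI) (rule dmap_app0[OF k(2)] dxs dqq dI | (use s in \<open>simp; fail\<close>))+
  obtain h1 where h1: "col (VF # pp) h1" "\<And>e e'. \<lbrakk>e \<in> tuples K (VF # pp); e' \<in> tuples K (VF # pp);
    h1 e = h1 e'\<rbrakk> \<Longrightarrow> [vac K l (uu e)] = [vac K l (uu e')] \<and> k (hd e # tl e @ [uu e]) = k (hd e' # tl e' @ [uu e'])" by (rule col_two[OF k1 k2]) (rule that)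
  obtain h2 where h2: "col (VF # pp) h2" "\<And>e e'. \<lbrakk>e \<in> tuples K (VF # pp); e' \<in> tuples K (VF # pp);
    h2 e = h2 e'\<rbrakk> \<Longrightarrow> g2 (uu e # tl e) = g2 (uu e' # tl e') \<and> k (xs e # tl e @ [qq e]) = k (xs e' # tl e' @ [qq e'])" by (rule col_two[OF k3 k4]) (rule that)
  obtain g where g: "col (VF # pp) g" "\<And>e e'. \<lbrakk>e \<in> tuples K (VF # pp); e' \<in> tuples K (VF # pp);
    g e = g e'\<rbrakk> \<Longrightarrow> h1 e = h1 e' \<and> h2 e = h2 e'" by (rule col_two[OF h1(1) h2(1)]) (rule that)
  show ?thesis
  proof (rule that[OF g(1)], rule ccontr)
    fix p x x'
    assume p: "p \<in> tuples K pp" and x: "x \<in> KF" "x' \<in> KF" and m: "M (x # p)" "M (x' # p)" and ge: "g (x # p) = g (x' # p)"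
      and nD: "f (x # p) \<noteq> D p" "f (x' # p) \<noteq> D p" and lt: "ord (vd (f (x # p)) (D p)) < ord (vd x (C p))"
      and eq: "ord (vd x (C p)) - ord (vd (f (x # p)) (D p)) = ord (vd x' (C p)) - ord (vd (f (x' # p)) (D p))"
      and ne: "ord (vd x (C p)) \<noteq> ord (vd x' (C p))"
    have t: "x # p \<in> tuples K (VF # pp)" "x' # p \<in> tuples K (VF # pp)" using p x by simp_all
    have hh: "h1 (x # p) = h1 (x' # p)" "h2 (x # p) = h2 (x' # p)" using g(2)[OF t ge] by auto
    define u u' where "u = uu (x # p)" and "u' = uu (x' # p)"
    have ce: "vac K l u = vac K l u'" "k (x # p @ [u]) = k (x' # p @ [u'])" "g2 (u # p) = g2 (u' # p)"
      "k (xs (x # p) # p @ [qq (x # p)]) = k (xs (x' # p) # p @ [qq (x' # p)])"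
      using h1(2)[OF t hh(1)] h2(2)[OF t hh(2)] unfolding u_def u'_def by simp_all
    have nC: "x \<noteq> C p" "x' \<noteq> C p" using H1 x p m by blast+
    note cp = CK[OF p] and dp = DK[OF p]
    have cS: "u \<in> KF \<and> S x p u \<and> ord u = ord (vd (f (x # p)) (D p)) - ord (vd x (C p))"
      if "x \<in> KF" "M (x # p)" "f (x # p) \<noteq> D p" "ord (vd (f (x # p)) (D p)) < ord (vd x (C p))" "x \<noteq> C p" "u = uu (x # p)" for x u
    proof -
      have a: "u \<in> KF" "u \<otimes>\<^bsub>F\<^esub> vd x (C p) = vd (f (x # p)) (D p)" using uu[OF that(1) p that(5)] that(6) by auto
      have "u \<otimes>\<^bsub>F\<^esub> vd x (C p) \<noteq> zz" unfolding a(2) using that fK[OF that(1) p] dp by simp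
      then have nz: "u \<noteq> zz" using that cp by auto
      have "ord (vd (f (x # p)) (D p)) = ord u + ord (vd x (C p))" unfolding a(2)[symmetric] by (rule ord_mult) (use a nz that cp in simp_all)
      then show ?thesis unfolding S_def using a nz that by simp
    qed
    have U: "u \<in> KF" "S x p u" "ord u = ord (vd (f (x # p)) (D p)) - ord (vd x (C p))"
      using cS[OF x(1) m(1) nD(1) lt nC(1) u_def] by auto
    have lt': "ord (vd (f (x' # p)) (D p)) < ord (vd x' (C p))" using lt eq by simp
    have U': "u' \<in> KF" "S x' p u'" "ord u' = ord (vd (f (x' # p)) (D p)) - ord (vd x' (C p))"
      using cS[OF x(2) m(2) nD(2) lt' nC(2) u'_def] by auto
    have ou: "ord u' = ord u" using U(3) U'(3) eq by simp
    have unz: "u \<noteq> zz" "u' \<noteq> zz" "ord u < 0" using U(2) U'(2) unfolding S_def by auto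
    have cu: "cl (ord u + int l) u u'" using vac_eq0[OF l U(1) unz(1) U'(1) unz(2)] ou ce(1) by simp
    show False using c4(5)[OF U(1) p]
    proof (elim disjE conjE)
      assume "\<forall>v\<in>KF. g2 (v # p) = g2 (u # p) \<longrightarrow> v = u"
      then have "u' = u" using ce(3) U'(1) by simp
      then have "x = x'" using kinj[OF p U(1) x U(2)] ce(2) by simp
      then show False using ne by simp
    next
      let ?q = "q0 (p @ g2 (u # p))"
      assume uq: "u \<noteq> ?q" and c2: "\<forall>v\<in>KF. cl (ord (vd u ?q) + int m4) u v \<longrightarrow> g2 (v # p) = g2 (u # p) \<and>
          (\<forall>w\<in>tuples K (VG # RRs ks). E3 (u # p @ w) \<longleftrightarrow> E3 (v # p @ w))"
        and c3: "\<forall>v\<in>KF. g2 (v # p) = g2 (u # p) \<longrightarrow> v \<noteq> ?q \<and> (ord (vd v ?q) = ord (vd u ?q) \<longrightarrow> cl (ord (vd u ?q) + int m4) u v)"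
      have gk: "g2 (u # p) \<in> tuples K (RRs ns2)" by (rule dmap_tuples[OF c4(3)]) (use U p in simp)
      have qK: "?q \<in> KF" by (rule dtm_car[OF c4(4)]) (use gk p in simp)
      have qx: "qq (x # p) = ?q" "qq (x' # p) = ?q" unfolding qq_def using ce(3) by (simp_all add: u_def u'_def)
      show False
      proof (cases "cl (ord u + int l) u ?q")
        case True
        have "cl (ord u + 1) u ?q" using cl_mono[OF True] l1 by simp
        then have "?q \<noteq> zz \<and> ord (vd ?q zz) = ord (vd u zz)" using ord_cl_eq[OF U(1) qK zz_in unz(1)] U(1) by simp
        then have q: "?q \<noteq> zz" "ord ?q = ord u" using qK U(1) by simp_all
        have cq': "cl (ord u + int l) u' ?q" using cl_trans[OF U'(1) U(1) qK cl_sym[OF U(1) U'(1) cu] True] .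
        have df: "dtm True [VF] VF (\<lambda>e. f (hd e # p))" by (rule dtm_app0[OF f] dI | (use p s in \<open>simp; fail\<close>))+
        have sol: "\<exists>z\<in>KF. S z p ?q \<and> ord (vd z (C p)) = ord (vd x (C p)) \<and> xs (x # p) = z"
          if y: "x \<in> KF" "M (x # p)" "x \<noteq> C p" "u \<in> KF" "S x p u" "cl (ord ?q + int l) u ?q" "qq (x # p) = ?q" for x u
        proof -
          have e: "u \<otimes>\<^bsub>F\<^esub> vd x (C p) = vd (f (x # p)) (D p)" using y(5) unfolding S_def by simp
          obtain z where z: "z \<in> KF" "cl (ord (vd x (C p)) + int l) x z" "vd (f (z # p)) (D p) = ?q \<otimes>\<^bsub>F\<^esub> vd z (C p)"
            by (rule surj_fix[of "\<lambda>z. f (z # p)", OF df y(1) cp dp y(3) H4[OF y(1) p y(2)] refl y(4) e qK q(1) _ y(6)])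
              (use q unz in simp, rule that)
          have "cl (ord (vd x (C p)) + 1) x z" using cl_mono[OF z(2)] l1 by simp
          then have oz: "ord (vd z (C p)) = ord (vd x (C p))" using ord_cl_eq[OF y(1) z(1) cp y(3)] by blast
          have Sz: "S z p ?q" unfolding S_def using H2[OF y(1) z(1) p y(2) z(2)] z(3) q unz(3) by simp
          have "v \<in> KF \<and> G2 (x # p) v \<longleftrightarrow> v = z" for v
          proof
            assume v: "v \<in> KF \<and> G2 (x # p) v"
            then have "S v p ?q" "ord (vd v (C p)) = ord (vd x (C p))" unfolding G2_def y(7) list.sel by blast+
            then show "v = z" using Suniq[OF _ z(1) p qK _ Sz] v oz by metis
          next
            assume "v = z"
            then show "v \<in> KF \<and> G2 (x # p) v" unfolding G2_def y(7) list.sel using z(1) Sz oz by blast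
          qed
          then have "xs (x # p) = z" unfolding xs_def by simp
          then show ?thesis using z(1) Sz oz by blast
        qed
        obtain z where z: "z \<in> KF" "S z p ?q" "ord (vd z (C p)) = ord (vd x (C p))" "xs (x # p) = z"
          using sol[OF x(1) m(1) nC(1) U(1,2) _ qx(1)] True q by auto
        obtain z' where z': "z' \<in> KF" "S z' p ?q" "ord (vd z' (C p)) = ord (vd x' (C p))" "xs (x' # p) = z'"
          using sol[OF x(2) m(2) nC(2) U'(1,2) _ qx(2)] cq' q by auto
        have "z = z'" using kinj[OF p qK z(1) z'(1) z(2)] ce(4) unfolding z(4) z'(4) qx .
        then show False using z(3) z'(3) ne by simp
      next
        case False
        then have o: "ord (vd u ?q) < ord u + int l" by (simp add: cl_def)
        \<comment> \<open>\<open>u\<close> and \<open>u'\<close> agree to depth \<open>l\<close>,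
          which is finer than their distance to \<open>?q\<close>, so they lie in the same ball of
          the cell.\<close>
        have "cl (ord (vd u ?q) + 1) u u'" using cl_mono[OF cu] o by simp
        then have "ord (vd u' ?q) = ord (vd u ?q)" using ord_cl_eq[OF U(1) U'(1) qK uq] by blast
        then have c: "cl (ord (vd u ?q) + int m4) u u'" using c3 U'(1) ce(3) by simp
        let ?w = "hinv (ord (vd x' (C p))) # k (x' # p @ [u'])"
        have kk: "k (x' # p @ [u']) \<in> tuples K (RRs ks)" by (rule dmap_tuples[OF k(2)]) (use x p U' in simp)
        have w: "?w \<in> tuples K (VG # RRs ks)" using kk by simp
        have ln: "length p = ?n" using p by (rule tuples_length)
        have E3v: "E3 (v # p @ ?w) \<longleftrightarrow> (\<exists>z\<in>KF. S z p v \<and> ord (vd z (C p)) = ord (vd x' (C p)) \<and> k (z # p @ [v]) = k (x' # p @ [u']))" for v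
          unfolding E3_def using ln by (simp add: nth_append drop_append)
        have "E3 (u' # p @ ?w)" unfolding E3v using x(2) U'(2) by blast
        then have "E3 (u # p @ ?w)" using c2 c U'(1) w by blast
        then obtain z where z: "z \<in> KF" "S z p u" "ord (vd z (C p)) = ord (vd x' (C p))" "k (z # p @ [u]) = k (x' # p @ [u'])" unfolding E3v by blast
        have "z = x" using kinj[OF p U(1) z(1) x(1) z(2)] z(4) ce(2) by simp
        then show False using z(3) ne by simp
      qed
    qed
  qed
qed

section \<open>The theorem for functions of one variable\<close>

lemma constjac_lip: assumes c: "constjac f x s" and l: "loc_lip f x" and x: "x \<in> KF" shows "lip_on f x s"
  using c unfolding constjac_def
proof (elim disjE exE conjE)
  assume "\<forall>z\<in>KF. cl s x z \<longrightarrow> f z = f x"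
  then show ?thesis unfolding lip_on_def by (metis cl_refl)
next
  fix \<epsilon> assume e: "\<forall>z\<in>KF. \<forall>z'\<in>KF. cl s x z \<and> cl s x z' \<and> z \<noteq> z' \<longrightarrow> f z \<noteq> f z' \<and> ord (vd (f z) (f z')) = \<epsilon> + ord (vd z z')"
  obtain s' where s': "lip_on f x s'" using l unfolding loc_lip_def by blast
  \<comment> \<open>A single pair of points inside both balls is enough to see that
    \<open>\<epsilon> \<ge> 0\<close>.\<close>
  obtain z where z: "z \<in> KF" "z \<noteq> x" "ord (vd x z) = max s s'" using ex_exact[OF x] by metis
  have c: "cl s x z" "cl s' x z" "cl (max s s') x z" using z by (simp_all add: cl_def)
  have "f x \<noteq> f z \<and> ord (vd (f x) (f z)) = \<epsilon> + max s s'" using e x z c(1) cl_refl by metis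
  moreover have "cl (max s s') (f x) (f z)" using s' x z(1) c(2,3) cl_refl unfolding lip_on_def by blast
  ultimately have e0: "\<epsilon> \<ge> 0" by (simp add: cl_def)
  show ?thesis unfolding lip_on_def
  proof (intro ballI impI allI)
    fix z z' r assume zz: "z \<in> KF" "z' \<in> KF" "cl s x z \<and> cl s x z'" "cl r z z'"
    show "cl r (f z) (f z')"
    proof (cases "z = z'")
      case False
      then have "ord (vd (f z) (f z')) = \<epsilon> + ord (vd z z')" using e zz by blast
      then show ?thesis using zz(4) False e0 by (simp add: cl_def)
    qed simp
  qed
qed

text \<open>For points of one part in different balls, the distance is the larger of the distances
  to the center \<open>c\<close>. If at both points the order of \<open>x - c\<close> is at most
  that of \<open>f x - d\<close>, both values are as close to \<open>d\<close> as required.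
  Otherwise one difference of orders is positive; the color makes it the same at both points, and
  \<open>separate\<close> puts them into the same ball after all.\<close>

lemma curve: assumes f: "dtm False (VF # ss) VF f"
  obtains g where "col (VF # ss) g"
    "\<And>y x x' r. \<lbrakk>y \<in> tuples K ss; x \<in> KF; x' \<in> KF; loc_lip (\<lambda>z. f (z # y)) x; loc_lip (\<lambda>z. f (z # y)) x';
      g (x # y) = g (x' # y); cl r x x'\<rbrakk> \<Longrightarrow> cl r (f (x # y)) (f (x' # y))"
proof -
  have s: "set ss \<subseteq> sorts L" using dtm_sorts[OF f] by simp
  let ?n = "length ss"
  have fK: "f (x # y) \<in> KF" if "x \<in> KF" "y \<in> tuples K ss" for x y by (rule dtm_car[OF f]) (use that in simp)
  obtain ms h where h: "set (RRs ms) \<subseteq> sorts L" "dmap False (VF # ss) (RRs ms) h"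
    "\<And>y a r. \<lbrakk>y \<in> tuples K ss; a \<in> KF; (\<forall>x\<in>KF. cl r a x \<longrightarrow> h (x # y) = h (a # y))\<rbrakk> \<Longrightarrow> constjac (\<lambda>x. f (x # y)) a r" by (rule jac[OF f]) (rule that)
  define Lp where "Lp e \<longleftrightarrow> loc_lip (\<lambda>z. f (z # tl e)) (hd e)" for e
  have dLp: "dset False (VF # ss) Lp" unfolding Lp_def loc_lip_def lip_on_def
    by (rule dtm_app0[OF f] dI | (use s in \<open>simp; fail\<close>))+
  define E0 where "E0 e \<longleftrightarrow> Lp (take (length (VF # ss)) e) \<and> h (take (length (VF # ss)) e) = drop (length (VF # ss)) e" for e
  have "dset False ((VF # ss) @ RRs ms) E0" unfolding E0_def
    by (rule dset_conj dset_eq dset_app0[OF dLp] dmap_app0[OF h(2)] dI | (use s h(1) in \<open>simp; fail\<close>))+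
  then have dE: "dset False (VF # ss @ RRs ms) E0" by simp
  have Ev: "E0 (x # y @ u) \<longleftrightarrow> Lp (x # y) \<and> h (x # y) = u" if "y \<in> tuples K ss" for x y u
    unfolding E0_def using that by (simp add: tuples_length)
  have nVF: "VF \<notin> set (RRs ms)" by (auto simp: RRs_def)
  obtain l ns0 g0 c0 where c0: "RR l \<in> sorts L" "set (RRs ns0) \<subseteq> sorts L" "dmap False (VF # ss) (RRs ns0) g0"
    "dtm False (ss @ RRs ns0) VF c0"
    "\<And>x y. x \<in> KF \<Longrightarrow> y \<in> tuples K ss \<Longrightarrow> cell_at E0 (RRs ms) l g0 c0 x y"
    by (rule cell[OF dE nVF]) (rule that)
  have l1: "l \<ge> 1" by (rule RR_pos[OF c0(1)])
  have g0K: "g0 (x # y) \<in> tuples K (RRs ns0)" if "x \<in> KF" "y \<in> tuples K ss" for x y by (rule dmap_tuples[OF c0(3)]) (use that in simp)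
  have c0K: "c0 (y @ \<xi>) \<in> KF" if "\<xi> \<in> tuples K (RRs ns0)" "y \<in> tuples K ss" for \<xi> y by (rule dtm_car[OF c0(4)]) (use that in simp)
  have gen: "x \<noteq> c0 (y @ g0 (x # y)) \<and>
     (\<forall>x'\<in>KF. cl (ord (vd x (c0 (y @ g0 (x # y)))) + int l) x x' \<longrightarrow> g0 (x' # y) = g0 (x # y) \<and> Lp (x' # y)) \<and>
     (\<forall>x'\<in>KF. g0 (x' # y) = g0 (x # y) \<longrightarrow> x' \<noteq> c0 (y @ g0 (x # y)) \<and>
          (ord (vd x' (c0 (y @ g0 (x # y)))) = ord (vd x (c0 (y @ g0 (x # y)))) \<longrightarrow> cl (ord (vd x (c0 (y @ g0 (x # y)))) + int l) x x')) \<and>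
     lip_on (\<lambda>z. f (z # y)) x (ord (vd x (c0 (y @ g0 (x # y)))) + int l)"
    if x: "x \<in> KF" "y \<in> tuples K ss" "Lp (x # y)" "x1 \<in> KF" "x1 \<noteq> x" "g0 (x1 # y) = g0 (x # y)" for x y x1
    using c0(5)[OF x(1,2)]
  proof (elim disjE)
    assume "\<forall>x'\<in>KF. g0 (x' # y) = g0 (x # y) \<longrightarrow> x' = x"
    then show ?thesis using x by blast
  next
    let ?c = "c0 (y @ g0 (x # y))" let ?s = "ord (vd x ?c) + int l"
    assume "x \<noteq> ?c \<and>
       (\<forall>x'\<in>KF. cl ?s x x' \<longrightarrow> g0 (x' # y) = g0 (x # y) \<and>
          (\<forall>u\<in>tuples K (RRs ms). E0 (x # y @ u) \<longleftrightarrow> E0 (x' # y @ u))) \<and>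
       (\<forall>x'\<in>KF. g0 (x' # y) = g0 (x # y) \<longrightarrow> x' \<noteq> ?c \<and> (ord (vd x' ?c) = ord (vd x ?c) \<longrightarrow> cl ?s x x'))"
    note H = this[unfolded Ev[OF x(2)]]
    have hx: "h (x # y) \<in> tuples K (RRs ms)" by (rule dmap_tuples[OF h(2)]) (use x in simp)
    have b: "g0 (x' # y) = g0 (x # y) \<and> Lp (x' # y) \<and> h (x' # y) = h (x # y)" if "x' \<in> KF" "cl ?s x x'" for x'
      using H that hx x(3) by blast
    have "constjac (\<lambda>z. f (z # y)) x ?s" by (rule h(3)[OF x(2,1)]) (use b in blast)
    then have "lip_on (\<lambda>z. f (z # y)) x ?s" by (rule constjac_lip) (use x in \<open>simp_all add: Lp_def\<close>)
    then show ?thesis using H b by blast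
  qed
  let ?nz = "length (RRs ns0)"
  \<comment> \<open>The value group coordinate selects one ball of the part, so the cells on the
    image side are compatible with the image of each single ball.\<close>
  define H where "H e \<longleftrightarrow> (\<exists>x\<in>KF. f (x # take ?n (tl e)) = hd e \<and> g0 (x # take ?n (tl e)) = take ?nz (drop ?n (tl e)) \<and>
     Lp (x # take ?n (tl e)) \<and> ord (vd x (c0 (take ?n (tl e) @ take ?nz (drop ?n (tl e))))) = hh (hd (drop ?nz (drop ?n (tl e)))))" for e
  have "dset False (VF # ss @ RRs ns0 @ [VG]) H" unfolding H_def
    by (rule dset_ex dset_conj dset_inteq dset_eq dset_eqt dset_app0[OF dLp] dmap_app0[OF c0(3)] dtm_app0[OF c0(4)] dtm_app0[OF f] dI
        | (use s c0(2) in \<open>simp; fail\<close>))+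
  then have dH: "dset False (VF # (ss @ RRs ns0) @ [VG]) H" by simp
  obtain m1 ns1 g1 d0 where d0: "RR m1 \<in> sorts L" "set (RRs ns1) \<subseteq> sorts L" "dmap False (VF # (ss @ RRs ns0)) (RRs ns1) g1"
    "dtm False ((ss @ RRs ns0) @ RRs ns1) VF d0"
    "\<And>x y. x \<in> KF \<Longrightarrow> y \<in> tuples K (ss @ RRs ns0) \<Longrightarrow> cell_at H [VG] m1 g1 d0 x y"
    by (rule cell[OF dH]) (simp, rule that)
  let ?pp = "ss @ RRs ns0 @ RRs ns1"
  have spp: "set ?pp \<subseteq> sorts L" using s c0(2) d0(2) by simp
  have dg1: "dmap False (VF # ss @ RRs ns0) (RRs ns1) g1" using d0(3) by simp
  have dD: "dtm False ?pp VF d0" using d0(4) by simp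
  have Hv: "H (w # (y @ \<xi>) @ [\<gamma>]) \<longleftrightarrow> (\<exists>x\<in>KF. f (x # y) = w \<and> g0 (x # y) = \<xi> \<and> Lp (x # y) \<and> ord (vd x (c0 (y @ \<xi>))) = hh \<gamma>)"
    if "y \<in> tuples K ss" "\<xi> \<in> tuples K (RRs ns0)" for w y \<xi> \<gamma>
    unfolding H_def using that by simp
  define f' where "f' e = f (hd e # take ?n (tl e))" for e
  define C where "C q = c0 (take ?n q @ take ?nz (drop ?n q))" for q
  \<comment> \<open>The last clause excludes parts that are single points, for which the center
    carries no information.\<close>
  define M where "M e \<longleftrightarrow> Lp (hd e # take ?n (tl e)) \<and> g0 (hd e # take ?n (tl e)) = take ?nz (drop ?n (tl e)) \<and>
     (\<exists>x'\<in>KF. x' \<noteq> hd e \<and> g0 (x' # take ?n (tl e)) = take ?nz (drop ?n (tl e)))" for e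
  have df': "dtm False (VF # ?pp) VF f'" unfolding f'_def
    by (rule dtm_app0[OF f] dI | (use spp in \<open>simp; fail\<close>))+
  have dC: "dtm False ?pp VF C" unfolding C_def
    by (rule dtm_app0[OF c0(4)] dI | (use spp in \<open>simp; fail\<close>))+
  have dM: "dset False (VF # ?pp) M" unfolding M_def
    by (rule dset_ex dset_conj dset_not dset_eq dset_eqt dset_app0[OF dLp] dmap_app0[OF c0(3)] dI | (use spp in \<open>simp; fail\<close>))+
  have Mv: "M (x # y @ \<xi> @ \<eta>) \<longleftrightarrow> Lp (x # y) \<and> g0 (x # y) = \<xi> \<and> (\<exists>x'\<in>KF. x' \<noteq> x \<and> g0 (x' # y) = \<xi>)"
    "f' (x # y @ \<xi> @ \<eta>) = f (x # y)" "C (y @ \<xi> @ \<eta>) = c0 (y @ \<xi>)"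
    if "y \<in> tuples K ss" "\<xi> \<in> tuples K (RRs ns0)" for x y \<xi> \<eta>
    unfolding M_def f'_def C_def using that by simp_all
  have Mg: "x \<noteq> C q \<and> (\<forall>x'\<in>KF. cl (ord (vd x (C q)) + int l) x x' \<longrightarrow> M (x' # q)) \<and>
      (\<forall>x'\<in>KF. M (x' # q) \<and> ord (vd x' (C q)) = ord (vd x (C q)) \<longrightarrow> cl (ord (vd x (C q)) + int l) x x') \<and>
      lip_on (\<lambda>z. f' (z # q)) x (ord (vd x (C q)) + int l)" if x: "x \<in> KF" "q \<in> tuples K ?pp" "M (x # q)" for x q
  proof -
    obtain y q' where y: "q = y @ q'" "y \<in> tuples K ss" "q' \<in> tuples K (RRs ns0 @ RRs ns1)" using x(2) by (rule tuples_appendE)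
    obtain \<xi> \<eta> where xi: "q' = \<xi> @ \<eta>" "\<xi> \<in> tuples K (RRs ns0)" using y(3) by (rule tuples_appendE)
    have q: "q = y @ \<xi> @ \<eta>" using y xi by simp
    obtain x1 where m: "Lp (x # y)" "g0 (x # y) = \<xi>" "x1 \<in> KF" "x1 \<noteq> x" "g0 (x1 # y) = \<xi>"
      using x(3) unfolding q Mv(1)[OF y(2) xi(2)] by blast
    have g: "g0 (x1 # y) = g0 (x # y)" using m by simp
    note G = gen[OF x(1) y(2) m(1,3,4) g, unfolded m(2)]
    have "M (x' # q)" if x': "x' \<in> KF" "cl (ord (vd x (C q)) + int l) x x'" for x'
    proof -
      have "cl (ord (vd x (c0 (y @ \<xi>))) + int l) x x'" using x'(2) unfolding q Mv(3)[OF y(2) xi(2)] .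
      then have "g0 (x' # y) = \<xi>" "Lp (x' # y)" using G x'(1) by blast+
      moreover have "\<exists>x''\<in>KF. x'' \<noteq> x' \<and> g0 (x'' # y) = \<xi>" using m x(1) by metis
      ultimately show ?thesis unfolding q Mv(1)[OF y(2) xi(2)] by blast
    qed
    moreover have "cl (ord (vd x (C q)) + int l) x x'" if x': "x' \<in> KF" "M (x' # q)" "ord (vd x' (C q)) = ord (vd x (C q))" for x'
    proof -
      have "g0 (x' # y) = \<xi>" using x'(2) unfolding q Mv(1)[OF y(2) xi(2)] by blast
      then show ?thesis using G x'(1,3) unfolding q Mv(3)[OF y(2) xi(2)] by blast
    qed
    moreover have "x \<noteq> C q" "lip_on (\<lambda>z. f' (z # q)) x (ord (vd x (C q)) + int l)"
      using G unfolding q Mv(2,3)[OF y(2) xi(2)] by blast+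
    ultimately show ?thesis by blast
  qed
  obtain G where G: "col (VF # ?pp) G"
    "\<And>q x x'. \<lbrakk>q \<in> tuples K ?pp; x \<in> KF; x' \<in> KF; M (x # q); M (x' # q); G (x # q) = G (x' # q); f' (x # q) \<noteq> d0 q;
      f' (x' # q) \<noteq> d0 q; ord (vd (f' (x # q)) (d0 q)) < ord (vd x (C q)); ord (vd x (C q)) - ord (vd (f' (x # q)) (d0 q)) = ord (vd x' (C q)) - ord (vd (f' (x' # q)) (d0 q))\<rbrakk> \<Longrightarrow> ord (vd x (C q)) = ord (vd x' (C q))"
  proof (rule separate[OF df' dC dD dM c0(1)])
    show "x \<noteq> C q" if "x \<in> KF" "q \<in> tuples K ?pp" "M (x # q)" for x q using Mg[OF that] by blast
    show "M (x' # q)" if "x \<in> KF" "x' \<in> KF" "q \<in> tuples K ?pp" "M (x # q)" "cl (ord (vd x (C q)) + int l) x x'" for x x' q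
      using Mg[OF that(1,3,4)] that by blast
    show "cl (ord (vd x (C q)) + int l) x x'"
      if "x \<in> KF" "x' \<in> KF" "q \<in> tuples K ?pp" "M (x # q)" "M (x' # q)" "ord (vd x' (C q)) = ord (vd x (C q))" for x x' q
      using Mg[OF that(1,3,4)] that by blast
    show "lip_on (\<lambda>z. f' (z # q)) x (ord (vd x (C q)) + int l)" if "x \<in> KF" "q \<in> tuples K ?pp" "M (x # q)" for x q
      using Mg[OF that] by blast
  qed (rule that)
  define a where "a e = hd e # tl e @ g0 e @ g1 (f e # tl e @ g0 e)" for e
  have da: "dmap False (VF # ss) (VF # ?pp) a" unfolding a_def
    by (rule dmap_app0[OF dg1] dmap_app0[OF c0(3)] dtm_app0[OF f] dI | (use s in \<open>simp; fail\<close>))+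
  define t where "t e = ord (vd (hd e) (c0 (tl e @ g0 e))) - ord (vd (f e) (d0 (tl e @ g0 e @ g1 (f e # tl e @ g0 e))))" for e
  have dt: "dint False (VF # ss) t" unfolding t_def
    by (rule dtm_app0[OF c0(4)] dtm_app0[OF dD] dmap_app0[OF dg1] dmap_app0[OF c0(3)] dtm_app0[OF f] dI | (use s in \<open>simp; fail\<close>))+
  \<comment> \<open>By \<open>bd\<close> below, \<open>t\<close> stays under \<open>m1\<close> at
    the points that matter, so fixing the values in this range fixes every positive one.\<close>
  obtain g3 where g3: "col (VF # ss) g3"
    "\<And>e e'. \<lbrakk>e \<in> tuples K (VF # ss); e' \<in> tuples K (VF # ss); g3 e = g3 e'; 0 \<le> t e; t e < int m1\<rbrakk> \<Longrightarrow> t e' = t e"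
    by (rule col_int[OF dt]) (rule that)
  have k1: "col (VF # ss) (\<lambda>e. g1 (f e # tl e @ g0 e))"
    by (rule colI) (rule dmap_app0[OF dg1] dmap_app0[OF c0(3)] dtm_app0[OF f] dI | (use s in \<open>simp; fail\<close>))+
  obtain h1 where h1: "col (VF # ss) h1" "\<And>e e'. \<lbrakk>e \<in> tuples K (VF # ss); e' \<in> tuples K (VF # ss);
    h1 e = h1 e'\<rbrakk> \<Longrightarrow> g0 e = g0 e' \<and> g1 (f e # tl e @ g0 e) = g1 (f e' # tl e' @ g0 e')" by (rule col_two[OF colI[OF c0(3)] k1]) (rule that)
  obtain h2 where h2: "col (VF # ss) h2" "\<And>e e'. \<lbrakk>e \<in> tuples K (VF # ss); e' \<in> tuples K (VF # ss);
    h2 e = h2 e'\<rbrakk> \<Longrightarrow> g3 e = g3 e' \<and> G (a e) = G (a e')" by (rule col_two[OF g3(1) col_app[OF G(1) da]]) (rule that)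
  obtain g where g: "col (VF # ss) g" "\<And>e e'. \<lbrakk>e \<in> tuples K (VF # ss); e' \<in> tuples K (VF # ss);
    g e = g e'\<rbrakk> \<Longrightarrow> h1 e = h1 e' \<and> h2 e = h2 e'" by (rule col_two[OF h1(1) h2(1)]) (rule that)
  show ?thesis
  proof (rule that[OF g(1)])
    fix y x x' r
    assume y: "y \<in> tuples K ss" and x: "x \<in> KF" "x' \<in> KF" and L0: "loc_lip (\<lambda>z. f (z # y)) x" "loc_lip (\<lambda>z. f (z # y)) x'"
      and ge: "g (x # y) = g (x' # y)" and c: "cl r x x'"
    have L: "Lp (x # y)" "Lp (x' # y)" using L0 unfolding Lp_def by simp_all
    have tt: "x # y \<in> tuples K (VF # ss)" "x' # y \<in> tuples K (VF # ss)" using x y by simp_all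
    have hh': "h1 (x # y) = h1 (x' # y)" "h2 (x # y) = h2 (x' # y)" using g(2)[OF tt ge] by auto
    define \<xi> where "\<xi> = g0 (x # y)"
    define \<eta> where "\<eta> = g1 (f (x # y) # y @ \<xi>)"
    have e0: "g0 (x # y) = \<xi>" "g0 (x' # y) = \<xi>" using h1(2)[OF tt hh'(1)] unfolding \<xi>_def by auto
    have e1: "g1 (f (x # y) # y @ \<xi>) = \<eta>" "g1 (f (x' # y) # y @ \<xi>) = \<eta>" using h1(2)[OF tt hh'(1)] e0 unfolding \<eta>_def by simp_all
    have e3: "g3 (x # y) = g3 (x' # y)" "G (x # y @ \<xi> @ \<eta>) = G (x' # y @ \<xi> @ \<eta>)" using h2(2)[OF tt hh'(2)] e0 e1 unfolding a_def by simp_all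
    have xiK: "\<xi> \<in> tuples K (RRs ns0)" using g0K[OF x(1) y] e0 by simp
    have etaK: "\<eta> \<in> tuples K (RRs ns1)" unfolding \<eta>_def by (rule dmap_tuples[OF dg1]) (use xiK y fK[OF x(1) y] in simp)
    define c' where "c' = c0 (y @ \<xi>)"
    define d where "d = d0 (y @ \<xi> @ \<eta>)"
    have cK: "c' \<in> KF" unfolding c'_def using c0K xiK y by blast
    have dK: "d \<in> KF" unfolding d_def by (rule dtm_car[OF dD]) (use y xiK etaK in simp)
    have tv: "t (z # y) = ord (vd z c') - ord (vd (f (z # y)) d)" if "g0 (z # y) = \<xi>" "g1 (f (z # y) # y @ \<xi>) = \<eta>" for z
      unfolding t_def c'_def d_def using that by simp
    \<comment> \<open>The ball of radius \<open>ord (w - d) + m1\<close> about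
      \<open>w = f x1\<close> consists of values at points of the ball of \<open>x1\<close>, where
      \<open>f\<close> is 1-Lipschitz. A point on its boundary sphere gives
      \<open>ord (x1 - c) + l \<le> ord (w - d) + m1\<close>. The second value \<open>f x2\<close>
      of the same color ensures that the cell of \<open>w\<close> is not a single point.\<close>
    have bd: "f (x1 # y) \<noteq> d \<and> t (x1 # y) < int m1"
      if z: "x1 \<in> KF" "x2 \<in> KF" "Lp (x1 # y)" "g0 (x1 # y) = \<xi>" "g0 (x2 # y) = \<xi>" "x2 \<noteq> x1"
       "g1 (f (x1 # y) # y @ \<xi>) = \<eta>" "g1 (f (x2 # y) # y @ \<xi>) = \<eta>" "f (x1 # y) \<noteq> f (x2 # y)" for x1 x2
    proof -
      let ?w = "f (x1 # y)"
      have w: "?w \<in> KF" "f (x2 # y) \<in> KF" using fK z y by blast+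
      have g12: "g0 (x2 # y) = g0 (x1 # y)" using z(4,5) by simp
      note G1 = gen[OF z(1) y z(3,2,6) g12, unfolded z(4), folded c'_def]
      have yx: "y @ \<xi> \<in> tuples K (ss @ RRs ns0)" using y xiK by simp
      show ?thesis using d0(5)[OF w(1) yx]
      proof (elim disjE conjE)
        assume "\<forall>x'\<in>KF. g1 (x' # y @ \<xi>) = g1 (?w # y @ \<xi>) \<longrightarrow> x' = ?w"
        then show ?thesis using z(7,8,9) w by metis
      next
        assume a1: "?w \<noteq> d0 ((y @ \<xi>) @ g1 (?w # y @ \<xi>))"
          and a2: "\<forall>x'\<in>KF. cl (ord (vd ?w (d0 ((y @ \<xi>) @ g1 (?w # y @ \<xi>)))) + int m1) ?w x' \<longrightarrow> g1 (x' # y @ \<xi>) = g1 (?w # y @ \<xi>) \<and>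
            (\<forall>u\<in>tuples K [VG]. H (?w # (y @ \<xi>) @ u) \<longleftrightarrow> H (x' # (y @ \<xi>) @ u))"
        have dd: "d0 ((y @ \<xi>) @ g1 (?w # y @ \<xi>)) = d" using z(7) by (simp add: d_def)
        have nd: "?w \<noteq> d" using a1 unfolding dd .
        define \<gamma> where "\<gamma> = hinv (ord (vd x1 c'))"
        have gK: "[\<gamma>] \<in> tuples K [VG]" by (simp add: \<gamma>_def)
        have H1: "H (?w # (y @ \<xi>) @ [\<gamma>])" unfolding Hv[OF y xiK] using z by (intro bexI[of _ x1]) (simp_all add: \<gamma>_def c'_def)
        obtain w1 where w1: "w1 \<in> KF" "w1 \<noteq> ?w" "ord (vd ?w w1) = ord (vd ?w d) + int m1" using ex_exact[OF w(1)] by metis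
        have "cl (ord (vd ?w d) + int m1) ?w w1" using w1 by (simp add: cl_def)
        then have "H (w1 # (y @ \<xi>) @ [\<gamma>])" using a2 w1(1) H1 gK unfolding dd by blast
        then obtain x3 where x3: "x3 \<in> KF" "f (x3 # y) = w1" "g0 (x3 # y) = \<xi>" "ord (vd x3 c') = ord (vd x1 c')"
          unfolding Hv[OF y xiK] by (auto simp: \<gamma>_def c'_def)
        have c3: "cl (ord (vd x1 c') + int l) x1 x3" using G1 x3 by blast
        then have "cl (ord (vd x1 c') + int l) ?w (f (x3 # y))" using G1 z(1) x3(1) cl_refl unfolding lip_on_def by blast
        then have "ord (vd x1 c') + int l \<le> ord (vd ?w d) + int m1" using w1 x3(2) by (simp add: cl_def)
        then show ?thesis using nd l1 tv[OF z(4,7)] by simp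
      qed
    qed
    show "cl r (f (x # y)) (f (x' # y))"
    proof (cases "x = x' \<or> f (x # y) = f (x' # y)")
      case True
      then show ?thesis by auto
    next
      case False
      then have ne: "x \<noteq> x'" "f (x # y) \<noteq> f (x' # y)" by auto
      have w: "f (x # y) \<in> KF" "f (x' # y) \<in> KF" using fK x y by blast+
      have g12: "g0 (x' # y) = g0 (x # y)" using e0 by simp
      note Gx = gen[OF x(1) y L(1) x(2) ne(1)[symmetric] g12, unfolded e0(1), folded c'_def]
      have nc: "x \<noteq> c'" "x' \<noteq> c'" using Gx x(2) e0 by blast+
      show ?thesis
      proof (cases "ord (vd x' c') = ord (vd x c')")
        case True
        then have "cl (ord (vd x c') + int l) x x'" using Gx x(2) e0 by blast
        then show ?thesis using Gx x c cl_refl unfolding lip_on_def by blast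
      next
        case False
        have om: "ord (vd x x') = min (ord (vd x c')) (ord (vd x' c'))" using ord_ne[OF x cK nc] False by simp
        have r: "r \<le> ord (vd x c')" "r \<le> ord (vd x' c')" using c ne(1) om by (simp_all add: cl_def)
        have b1: "f (x # y) \<noteq> d" "t (x # y) < int m1" using bd[OF x L(1) e0 ne(1)[symmetric] e1 ne(2)] by auto
        have b2: "f (x' # y) \<noteq> d" "t (x' # y) < int m1" using bd[OF x(2,1) L(2) e0(2,1) ne(1) e1(2,1) ne(2)[symmetric]] by auto
        note t1 = tv[OF e0(1) e1(1)] and t2 = tv[OF e0(2) e1(2)]
        let ?q = "y @ \<xi> @ \<eta>"
        have q: "?q \<in> tuples K ?pp" using y xiK etaK by simp
        have Mx: "M (x # ?q)" "M (x' # ?q)" unfolding Mv(1)[OF y xiK] using L e0 x ne(1) ne(1)[symmetric] by blast+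
        note fv = Mv(2)[OF y xiK] and Cv = Mv(3)[OF y xiK, folded c'_def]
        have sep: False if z: "z \<in> KF" "z' \<in> KF" "M (z # ?q)" "M (z' # ?q)" "G (z # ?q) = G (z' # ?q)" "f (z # y) \<noteq> d" "f (z' # y) \<noteq> d"
          "ord (vd (f (z # y)) d) < ord (vd z c')" "ord (vd z c') - ord (vd (f (z # y)) d) = ord (vd z' c') - ord (vd (f (z' # y)) d)"
          "ord (vd z c') \<noteq> ord (vd z' c')" for z z'
          using G(2)[OF q z(1-5)] z(6-10) unfolding fv Cv d_def[symmetric] by blast
        have "t (x # y) \<le> 0"
        proof (rule ccontr)
          assume n: "\<not> t (x # y) \<le> 0"
          then have te: "t (x' # y) = t (x # y)" using g3(2)[OF tt e3(1)] b1(2) by simp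
          show False using sep[OF x Mx e3(2) b1(1) b2(1)] n te t1 t2 False by simp
        qed
        moreover have "t (x' # y) \<le> 0"
        proof (rule ccontr)
          assume n: "\<not> t (x' # y) \<le> 0"
          then have te: "t (x # y) = t (x' # y)" using g3(2)[OF tt(2,1) e3(1)[symmetric]] b2(2) by simp
          show False using sep[OF x(2,1) Mx(2,1) e3(2)[symmetric] b2(1) b1(1)] n te t1 t2 False by simp
        qed
        ultimately have "r \<le> ord (vd (f (x # y)) d)" "r \<le> ord (vd (f (x' # y)) d)" using r t1 t2 by linarith+
        then have "cl r (f (x # y)) d" "cl r (f (x' # y)) d" by (simp_all add: cl_def)
        then show ?thesis using cl_trans[OF w(1) dK w(2)] cl_sym[OF w(2) dK] by blast
      qed
    qed
  qed
qed

subsection \<open>One-dimensional sets in affine space\<close>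

lemma VV_len [simp]: "length (VV n) = n" by (simp add: VV_def)

lemma VV_nth [simp]: "k < n \<Longrightarrow> VV n ! k = VF" by (simp add: VV_def)

lemma tuple_nth: "x \<in> tuples K (VV n) \<Longrightarrow> k < n \<Longrightarrow> x ! k \<in> KF"
  using tuples_nth[of x K "VV n" k] by simp

lemma tuple_eqI: assumes "x \<in> tuples K (VV n)" "x' \<in> tuples K (VV n)" "\<And>k. k < n \<Longrightarrow> x ! k = x' ! k" shows "x = x'"
  by (rule nth_equalityI) (use assms tuples_length[of _ K "VV n"] in auto)

lemma dtm_coord: "dmap b c (VV n) a \<Longrightarrow> k < n \<Longrightarrow> dtm b c VF (\<lambda>e. a e ! k)"
  by (erule dtm_nth) simp_all

lemma dtm_coord': "set ss \<subseteq> sorts L \<Longrightarrow> k < n \<Longrightarrow> dtm b (VV n @ ss) VF (\<lambda>e. e ! k)"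
  by (rule dtm_nth[OF dmap_id]) (simp_all add: nth_append)

lemma nob_many: assumes "\<And>i. i < (N::nat) \<Longrightarrow> dset True [VF] (\<lambda>e. S i (hd e))" "\<And>i. i < N \<Longrightarrow> nob (S i)"
  shows "nob (\<lambda>x. \<exists>i<N. S i x)"
  using assms
proof (induction N)
  case 0
  show ?case by (rule nob_single) simp
next
  case (Suc N)
  have "nob (\<lambda>x. (\<exists>i<N. S i x) \<or> S N x)"
    by (rule nob_Un[OF dset_finex]) (use Suc in auto)
  then show ?case by (rule nob_mono) (auto simp: less_Suc_eq)
qed

section \<open>Families on which a color forces the Lipschitz inequality\<close>

abbreviation ncl :: "nat \<Rightarrow> int \<Rightarrow> 'u list \<Rightarrow> 'u list \<Rightarrow> bool" where
  "ncl n r x z \<equiv> \<forall>k<n. cl r (x ! k) (z ! k)"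

text \<open>The desired conclusion on the subset \<open>P\<close>, with the maximum norm expressed
  by congruences in all coordinates.\<close>

definition good :: "nat \<Rightarrow> vsort list \<Rightarrow> ('u list \<Rightarrow> 'u) \<Rightarrow> ('u list \<Rightarrow> bool) \<Rightarrow> bool" where
  "good n ss f P \<longleftrightarrow> (\<exists>g. col (VV n @ ss) g \<and> (\<forall>y\<in>tuples K ss. \<forall>x\<in>tuples K (VV n). \<forall>x'\<in>tuples K (VV n).
     P (x @ y) \<and> P (x' @ y) \<and> g (x @ y) = g (x' @ y) \<longrightarrow>
     (\<forall>r. ncl n r x x' \<longrightarrow> cl r (f (x @ y)) (f (x' @ y)))))"

lemma goodI: assumes "col (VV n @ ss) g"
  "\<And>y x x' r. \<lbrakk>y \<in> tuples K ss; x \<in> tuples K (VV n); x' \<in> tuples K (VV n); P (x @ y); P (x' @ y); g (x @ y) = g (x' @ y);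
    ncl n r x x'\<rbrakk> \<Longrightarrow> cl r (f (x @ y)) (f (x' @ y))"
  shows "good n ss f P"
  unfolding good_def using assms by blast

lemma goodE: assumes "good n ss f P"
  obtains g where "col (VV n @ ss) g"
  "\<And>y x x' r. \<lbrakk>y \<in> tuples K ss; x \<in> tuples K (VV n); x' \<in> tuples K (VV n); P (x @ y); P (x' @ y); g (x @ y) = g (x' @ y);
    ncl n r x x'\<rbrakk> \<Longrightarrow> cl r (f (x @ y)) (f (x' @ y))"
proof -
  obtain g where "col (VV n @ ss) g \<and> (\<forall>y\<in>tuples K ss. \<forall>x\<in>tuples K (VV n). \<forall>x'\<in>tuples K (VV n).
     P (x @ y) \<and> P (x' @ y) \<and> g (x @ y) = g (x' @ y) \<longrightarrow>
     (\<forall>r. ncl n r x x' \<longrightarrow> cl r (f (x @ y)) (f (x' @ y))))" using assms unfolding good_def by (elim exE) (rule that)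
  then show ?thesis using that[of g] by blast
qed

lemma good_inj: assumes "col (VV n @ ss) g"
  "\<And>y x x'. \<lbrakk>y \<in> tuples K ss; x \<in> tuples K (VV n); x' \<in> tuples K (VV n); P (x @ y); P (x' @ y);
    g (x @ y) = g (x' @ y)\<rbrakk> \<Longrightarrow> x = x'"
  shows "good n ss f P"
proof (rule goodI[OF assms(1)])
  fix y x x' r assume "y \<in> tuples K ss" "x \<in> tuples K (VV n)" "x' \<in> tuples K (VV n)" "P (x @ y)" "P (x' @ y)" "g (x @ y) = g (x' @ y)"
  then have "x = x'" by (rule assms(2))
  then show "cl r (f (x @ y)) (f (x' @ y))" by simp
qed

lemma good_mono: assumes "good n ss f P" "\<And>y x. \<lbrakk>y \<in> tuples K ss; x \<in> tuples K (VV n); Q (x @ y)\<rbrakk> \<Longrightarrow> P (x @ y)"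
  shows "good n ss f Q"
proof -
  obtain g where g: "col (VV n @ ss) g"
  "\<And>y x x' r. \<lbrakk>y \<in> tuples K ss; x \<in> tuples K (VV n); x' \<in> tuples K (VV n); P (x @ y); P (x' @ y); g (x @ y) = g (x' @ y);
    ncl n r x x'\<rbrakk> \<Longrightarrow> cl r (f (x @ y)) (f (x' @ y))" by (rule goodE[OF assms(1)]) (rule that)
  show ?thesis by (rule goodI[OF g(1)]) (rule g(2); (assumption | rule assms(2))+)
qed

text \<open>A flag for \<open>P\<close> is added to the color, so two points of one color either
  both satisfy \<open>P\<close> or both satisfy \<open>Q\<close>.\<close>

lemma good_Un: assumes dP: "dset False (VV n @ ss) P" and P: "good n ss f P" and Q: "good n ss f Q"
  shows "good n ss f (\<lambda>e. P e \<or> Q e)"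
proof -
  obtain g where g: "col (VV n @ ss) g"
  "\<And>y x x' r. \<lbrakk>y \<in> tuples K ss; x \<in> tuples K (VV n); x' \<in> tuples K (VV n); P (x @ y); P (x' @ y); g (x @ y) = g (x' @ y);
    ncl n r x x'\<rbrakk> \<Longrightarrow> cl r (f (x @ y)) (f (x' @ y))" by (rule goodE[OF P]) (rule that)
  obtain h where h: "col (VV n @ ss) h"
  "\<And>y x x' r. \<lbrakk>y \<in> tuples K ss; x \<in> tuples K (VV n); x' \<in> tuples K (VV n); Q (x @ y); Q (x' @ y); h (x @ y) = h (x' @ y);
    ncl n r x x'\<rbrakk> \<Longrightarrow> cl r (f (x @ y)) (f (x' @ y))" by (rule goodE[OF Q]) (rule that)
  obtain c where c: "col (VV n @ ss) c" "\<And>e e'. c e = c e' \<Longrightarrow> P e \<longleftrightarrow> P e'" by (rule col_flag[OF dP]) (rule that)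
  obtain k1 where k1: "col (VV n @ ss) k1" "\<And>e e'. \<lbrakk>e \<in> tuples K (VV n @ ss); e' \<in> tuples K (VV n @ ss);
    k1 e = k1 e'\<rbrakk> \<Longrightarrow> g e = g e' \<and> h e = h e'"
    by (rule col_two[OF g(1) h(1)]) (rule that)
  obtain k where k: "col (VV n @ ss) k" "\<And>e e'. \<lbrakk>e \<in> tuples K (VV n @ ss); e' \<in> tuples K (VV n @ ss);
    k e = k e'\<rbrakk> \<Longrightarrow> c e = c e' \<and> k1 e = k1 e'"
    by (rule col_two[OF c(1) k1(1)]) (rule that)
  show ?thesis
  proof (rule goodI[OF k(1)])
    fix y x x' r assume *: "y \<in> tuples K ss" "x \<in> tuples K (VV n)" "x' \<in> tuples K (VV n)" "P (x @ y) \<or> Q (x @ y)" "P (x' @ y) \<or> Q (x' @ y)"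
      "k (x @ y) = k (x' @ y)" "ncl n r x x'"
    have t: "x @ y \<in> tuples K (VV n @ ss)" "x' @ y \<in> tuples K (VV n @ ss)" using * by simp_all
    have a: "c (x @ y) = c (x' @ y)" "k1 (x @ y) = k1 (x' @ y)" using k(2)[OF t *(6)] by auto
    have b: "g (x @ y) = g (x' @ y)" "h (x @ y) = h (x' @ y)" using k1(2)[OF t a(2)] by auto
    show "cl r (f (x @ y)) (f (x' @ y))"
    proof (cases "P (x @ y)")
      case True
      then show ?thesis using g(2)[OF *(1-3) _ _ b(1) *(7)] c(2)[OF a(1)] by blast
    next
      case False
      then show ?thesis using h(2)[OF *(1-3) _ _ b(2) *(7)] c(2)[OF a(1)] *(4,5) by blast
    qed
  qed
qed

lemma good_many: assumes s: "set ss \<subseteq> sorts L" and "\<And>i. i < (N::nat) \<Longrightarrow> dset False (VV n @ ss) (P i)" "\<And>i. i < N \<Longrightarrow> good n ss f (P i)"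
  shows "good n ss f (\<lambda>e. \<exists>i<N. P i e)"
  using assms(2,3)
proof (induction N)
  case 0
  show ?case by (rule good_inj[OF col_nil]) (use s in auto)
next
  case (Suc N)
  have "good n ss f (\<lambda>e. (\<exists>i<N. P i e) \<or> P N e)"
    by (rule good_Un[OF dset_finex]) (use Suc s in auto)
  then show ?case by (rule good_mono) (auto simp: less_Suc_eq)
qed

text \<open>A color may be turned into an additional parameter: between points where it agrees the
  extended family has one common fiber, and the color found there is combined with the given
  one.\<close>

lemma good_param: assumes k: "dmap False (VV n @ ss) (RRs ks) k" and g: "good n (ss @ RRs ks) \<phi> R"
  and R: "\<And>x y. \<lbrakk>x \<in> tuples K (VV n); y \<in> tuples K ss; P (x @ y)\<rbrakk> \<Longrightarrow> R (x @ y @ k (x @ y))"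
  and ph: "\<And>x y z. \<lbrakk>x \<in> tuples K (VV n); y \<in> tuples K ss; z \<in> tuples K (RRs ks)\<rbrakk> \<Longrightarrow> \<phi> (x @ y @ z) = f (x @ y)"
  shows "good n ss f P"
proof -
  obtain h where h: "col (VV n @ ss @ RRs ks) h"
  "\<And>y x x' r. \<lbrakk>y \<in> tuples K (ss @ RRs ks); x \<in> tuples K (VV n); x' \<in> tuples K (VV n); R (x @ y); R (x' @ y); h (x @ y) = h (x' @ y);
    ncl n r x x'\<rbrakk> \<Longrightarrow> cl r (\<phi> (x @ y)) (\<phi> (x' @ y))" by (rule goodE[OF g]) (rule that)
  have s: "set ss \<subseteq> sorts L" using dmap_sorts[OF k] by simp
  have "dmap False (VV n @ ss) ((VV n @ ss) @ RRs ks) (\<lambda>e. e @ k e)"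
    by (rule dmap_append[OF dmap_id k]) (use s in simp)
  then have "dmap False (VV n @ ss) (VV n @ ss @ RRs ks) (\<lambda>e. e @ k e)" by simp
  from col_two[OF colI[OF k] col_app[OF h(1) this]] obtain c where c: "col (VV n @ ss) c"
    "\<And>e e'. \<lbrakk>e \<in> tuples K (VV n @ ss); e' \<in> tuples K (VV n @ ss);
      c e = c e'\<rbrakk> \<Longrightarrow> k e = k e' \<and> h (e @ k e) = h (e' @ k e')" by metis
  show ?thesis
  proof (rule goodI[OF c(1)])
    fix y x x' r assume *: "y \<in> tuples K ss" "x \<in> tuples K (VV n)" "x' \<in> tuples K (VV n)" "P (x @ y)" "P (x' @ y)"
      "c (x @ y) = c (x' @ y)" "ncl n r x x'"
    have t: "x @ y \<in> tuples K (VV n @ ss)" "x' @ y \<in> tuples K (VV n @ ss)" using * by simp_all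
    have e1: "k (x @ y) = k (x' @ y)" and e2: "h (x @ y @ k (x @ y)) = h (x' @ y @ k (x' @ y))"
      using c(2)[OF t *(6)] unfolding append_assoc by blast+
    note e = e1 e2[folded e1]
    have kk: "k (x @ y) \<in> tuples K (RRs ks)" by (rule dmap_tuples[OF k t(1)])
    have q: "y @ k (x @ y) \<in> tuples K (ss @ RRs ks)" using *(1) kk by simp
    have "cl r (\<phi> (x @ y @ k (x @ y))) (\<phi> (x' @ y @ k (x @ y)))"
      by (rule h(2)[OF q *(2,3) R[OF *(2,1,4)] _ e(2) *(7)]) (use R[OF *(3,1,5)] e(1) in simp)
    then show "cl r (f (x @ y)) (f (x' @ y))" using ph[OF *(2,1) kk] ph[OF *(3,1) kk] by simp
  qed
qed

text \<open>On \<open>R\<close> both \<open>f\<close> and \<open>x ! i\<close> are functions of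
  \<open>x ! j\<close>, and \<open>curve\<close> applies where the former is locally 1-Lipschitz.
  Domination is only known locally in \<open>x ! i\<close>, but by \<open>good_jac\<close> every
  ball contains one on which \<open>x ! i\<close> depends continuously on \<open>x ! j\<close>.
  Hence the values of \<open>x ! j\<close> where the local Lipschitz property fails contain no ball,
  and a code separates them.\<close>

lemma good_coord: assumes R: "dset False (VV n @ qq) R" and f: "dtm False (VV n @ qq) VF f" and ij: "i < n" "j < n"
  and inj: "\<And>x x' q. \<lbrakk>x \<in> tuples K (VV n); x' \<in> tuples K (VV n); q \<in> tuples K qq; R (x @ q); R (x' @ q);
    x ! j = x' ! j\<rbrakk> \<Longrightarrow> x = x'"
  and dom: "\<And>x q. \<lbrakk>x \<in> tuples K (VV n); q \<in> tuples K qq;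
    R (x @ q)\<rbrakk> \<Longrightarrow> \<exists>\<rho>. \<forall>x1\<in>tuples K (VV n). \<forall>x2\<in>tuples K (VV n). R (x1 @ q) \<and> R (x2 @ q) \<and> cl \<rho> (x ! i) (x1 ! i) \<and> cl \<rho> (x ! i) (x2 ! i) \<longrightarrow>
       (\<forall>r. cl r (x1 ! j) (x2 ! j) \<longrightarrow> ncl n r x1 x2)"
  and ll: "\<And>x q. \<lbrakk>x \<in> tuples K (VV n); q \<in> tuples K qq;
    R (x @ q)\<rbrakk> \<Longrightarrow> \<exists>s. \<forall>x1\<in>tuples K (VV n). \<forall>x2\<in>tuples K (VV n). R (x1 @ q) \<and> R (x2 @ q) \<and> ncl n s x x1 \<and> ncl n s x x2 \<longrightarrow>
       (\<forall>r. ncl n r x1 x2 \<longrightarrow> cl r (f (x1 @ q)) (f (x2 @ q)))"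
  shows "good n qq f R"
proof -
  have s: "set qq \<subseteq> sorts L" using dset_sorts[OF R] by simp
  note dco = dtm_coord[OF _ ij(1)] dtm_coord[OF _ ij(2)] dtm_coord'[OF _ ij(1)] dtm_coord'[OF _ ij(2)]
  define G where "G e w \<longleftrightarrow> (\<exists>x\<in>tuples K (VV n). R (x @ tl e) \<and> x ! j = hd e \<and> f (x @ tl e) = w)" for e w
  define F where "F e = (if \<exists>!w. w \<in> KF \<and> G e w then THE w. w \<in> KF \<and> G e w else zz)" for e
  have dF: "dtm False (VF # qq) VF F" unfolding F_def
  proof (rule dtm_the)
    show "dset False ((VF # qq) @ [VF]) (\<lambda>z. G (take (length (VF # qq)) z) (z ! length (VF # qq)))" unfolding G_def
      by (rule dset_app0[OF R] dtm_app0[OF f] dI dset_eqt dco | (use s in \<open>simp del: VV_len; fail\<close>))+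
  qed (use s in simp)
  have fK: "f (x @ q) \<in> KF" if "x \<in> tuples K (VV n)" "q \<in> tuples K qq" for x q by (rule dtm_car[OF f]) (use that in simp)
  have Fv: "F (x ! j # q) = f (x @ q)" if x: "x \<in> tuples K (VV n)" "q \<in> tuples K qq" "R (x @ q)" for x q
  proof -
    have "w \<in> KF \<and> G (x ! j # q) w \<longleftrightarrow> w = f (x @ q)" for w
      unfolding G_def list.sel using inj[OF _ x(1,2) _ x(3)] x fK[OF x(1,2)] by blast
    then show ?thesis unfolding F_def by simp
  qed
  define G' where "G' e t \<longleftrightarrow> (\<exists>x\<in>tuples K (VV n). R (x @ tl e) \<and> x ! j = hd e \<and> x ! i = t)" for e t
  define tt where "tt e = (if \<exists>!t. t \<in> KF \<and> G' e t then THE t. t \<in> KF \<and> G' e t else zz)" for e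
  have dtt: "dtm False (VF # qq) VF tt" unfolding tt_def
  proof (rule dtm_the)
    show "dset False ((VF # qq) @ [VF]) (\<lambda>z. G' (take (length (VF # qq)) z) (z ! length (VF # qq)))" unfolding G'_def
      by (rule dset_app0[OF R] dI dset_eqt dco | (use s in \<open>simp del: VV_len; fail\<close>))+
  qed (use s in simp)
  have ttv: "tt (x ! j # q) = x ! i" if x: "x \<in> tuples K (VV n)" "q \<in> tuples K qq" "R (x @ q)" for x q
  proof -
    have xi: "x ! i \<in> KF" by (rule tuple_nth[OF x(1) ij(1)])
    have "w \<in> KF \<and> G' (x ! j # q) w \<longleftrightarrow> w = x ! i" for w
      unfolding G'_def list.sel using inj[OF _ x(1,2) _ x(3)] x xi by blast
    then show ?thesis unfolding tt_def by simp
  qed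
  define Lp where "Lp e \<longleftrightarrow> loc_lip (\<lambda>z. F (z # tl e)) (hd e)" for e
  have dLp: "dset False (VF # qq) Lp" unfolding Lp_def loc_lip_def lip_on_def
    by (rule dtm_app0[OF dF] dI | (use s in \<open>simp; fail\<close>))+
  define N where "N e \<longleftrightarrow> (\<exists>x\<in>tuples K (VV n). R (x @ tl e) \<and> x ! j = hd e) \<and> \<not> Lp e" for e
  have dN: "dset False (VF # qq) N" unfolding N_def
    by (rule dset_conj dset_not dLp dset_app0[OF R] dI dset_eqt dco | (use s in \<open>simp del: VV_len; fail\<close>))+
  have nN: "nob (\<lambda>b. N (b # q))" if q: "q \<in> tuples K qq" for q
  proof (rule ccontr)
    assume "\<not> ?thesis"
    then obtain a r where a: "a \<in> KF" "\<And>b. b \<in> KF \<Longrightarrow> cl r a b \<Longrightarrow> N (b # q)" by (rule nobE) (rule that)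
    have dt1: "dtm True [VF] VF (\<lambda>e. tt (hd e # q))" by (rule dtm_app0[OF dtt] dI | (use q s in \<open>simp; fail\<close>))+
    obtain b s where b: "b \<in> KF" "cl r a b" "r \<le> s" "constjac (\<lambda>b. tt (b # q)) b s" by (rule good_jac[of "\<lambda>b. tt (b # q)", OF dt1 a(1)]) (rule that)
    have ex: "\<exists>x\<in>tuples K (VV n). R (x @ q) \<and> x ! j = b'" if b': "b' \<in> KF" "cl s b b'" for b'
      using a(2)[OF b'(1)] cl_trans[OF a(1) b(1) b'(1) b(2)] cl_mono[OF b'(2) b(3)] unfolding N_def by simp
    obtain x0 where x0: "x0 \<in> tuples K (VV n)" "R (x0 @ q)" "x0 ! j = b" using ex[OF b(1)] by auto
    obtain \<rho> where \<rho>: "\<forall>x1\<in>tuples K (VV n). \<forall>x2\<in>tuples K (VV n). R (x1 @ q) \<and> R (x2 @ q) \<and> cl \<rho> (x0 ! i) (x1 ! i) \<and> cl \<rho> (x0 ! i) (x2 ! i) \<longrightarrow>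
       (\<forall>r. cl r (x1 ! j) (x2 ! j) \<longrightarrow> ncl n r x1 x2)" using dom[OF x0(1) q x0(2)] by blast
    obtain \<sigma> where \<sigma>: "\<forall>x1\<in>tuples K (VV n). \<forall>x2\<in>tuples K (VV n). R (x1 @ q) \<and> R (x2 @ q) \<and> ncl n \<sigma> x0 x1 \<and> ncl n \<sigma> x0 x2 \<longrightarrow>
       (\<forall>r. ncl n r x1 x2 \<longrightarrow> cl r (f (x1 @ q)) (f (x2 @ q)))" using ll[OF x0(1) q x0(2)] by blast
    \<comment> \<open>Continuity of \<open>x ! i\<close> in \<open>x ! j\<close> brings the points
      within the distance \<open>\<rho>\<close> at which domination is known.\<close>
    have "\<exists>s'\<ge>s. \<forall>b'\<in>KF. cl s' b b' \<longrightarrow> cl \<rho> (tt (b # q)) (tt (b' # q))"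
      using b(4) unfolding constjac_def
    proof (elim disjE exE conjE)
      assume h: "\<forall>x\<in>KF. cl s b x \<longrightarrow> tt (x # q) = tt (b # q)"
      show ?thesis using h by (intro exI[of _ s]) simp
    next
      fix \<epsilon> assume e: "\<forall>x\<in>KF. \<forall>x'\<in>KF. cl s b x \<and> cl s b x' \<and> x \<noteq> x' \<longrightarrow> tt (x # q) \<noteq> tt (x' # q) \<and> ord (vd (tt (x # q)) (tt (x' # q))) = \<epsilon> + ord (vd x x')"
      show ?thesis
      proof (intro exI[of _ "max s (\<rho> - \<epsilon>)"] conjI ballI impI)
        fix b' assume b': "b' \<in> KF" "cl (max s (\<rho> - \<epsilon>)) b b'"
        show "cl \<rho> (tt (b # q)) (tt (b' # q))"
        proof (cases "b = b'")
          case False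
          have "cl s b b'" using cl_mono[OF b'(2)] by simp
          then have "ord (vd (tt (b # q)) (tt (b' # q))) = \<epsilon> + ord (vd b b')" using e b(1) b'(1) False cl_refl by blast
          then show ?thesis using b'(2) False by (simp add: cl_def)
        qed simp
      qed simp
    qed
    then obtain s' where s': "s' \<ge> s" "\<And>b'. b' \<in> KF \<Longrightarrow> cl s' b b' \<Longrightarrow> cl \<rho> (tt (b # q)) (tt (b' # q))" by blast
    have "lip_on (\<lambda>z. F (z # q)) b (max s' \<sigma>)" unfolding lip_on_def
    proof (intro ballI impI allI)
      fix b1 b2 r' assume c: "b1 \<in> KF" "b2 \<in> KF" "cl (max s' \<sigma>) b b1 \<and> cl (max s' \<sigma>) b b2" "cl r' b1 b2"
      have pt: "\<exists>x\<in>tuples K (VV n). R (x @ q) \<and> x ! j = b' \<and> cl \<rho> (x0 ! i) (x ! i) \<and> ncl n \<sigma> x0 x"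
        if b': "b' \<in> KF" "cl (max s' \<sigma>) b b'" for b'
      proof -
        have c1: "cl s b b'" "cl s' b b'" "cl \<sigma> b b'" using cl_mono[OF b'(2)] s'(1) by simp_all
        obtain x where x: "x \<in> tuples K (VV n)" "R (x @ q)" "x ! j = b'" using ex[OF b'(1) c1(1)] by blast
        have "cl \<rho> (x0 ! i) (x ! i)" using s'(2)[OF b'(1) c1(2)] ttv[OF x0(1) q x0(2)] ttv[OF x(1) q x(2)] x0(3) x(3) by simp
        moreover have "ncl n \<sigma> x0 x" using \<rho> x0 x calculation c1(3) cl_refl by blast
        ultimately show ?thesis using x by blast
      qed
      obtain x1 where x1: "x1\<in>tuples K (VV n)" "R (x1 @ q)" "x1 ! j = b1" "cl \<rho> (x0 ! i) (x1 ! i)" "ncl n \<sigma> x0 x1" using pt[OF c(1)] c(3) by blast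
      obtain x2 where x2: "x2\<in>tuples K (VV n)" "R (x2 @ q)" "x2 ! j = b2" "cl \<rho> (x0 ! i) (x2 ! i)" "ncl n \<sigma> x0 x2" using pt[OF c(2)] c(3) by blast
      have "ncl n r' x1 x2" using \<rho> x1 x2 c(4) by blast
      then have "cl r' (f (x1 @ q)) (f (x2 @ q))" using \<sigma> x1 x2 by blast
      then show "cl r' (F (b1 # q)) (F (b2 # q))" using Fv[OF x1(1) q x1(2)] Fv[OF x2(1) q x2(2)] x1(3) x2(3) by simp
    qed
    then have "Lp (b # q)" unfolding Lp_def loc_lip_def by auto
    then show False using a(2)[OF b(1,2)] unfolding N_def by blast
  qed
  obtain ns c where c: "set (RRs ns) \<subseteq> sorts L" "dmap False (VF # qq) (RRs ns) c"
   "\<And>y x x'. \<lbrakk>y \<in> tuples K qq; nob (\<lambda>x. N (x # y)); x \<in> KF; x' \<in> KF; N (x # y);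
     c (x # y) = c (x' # y)\<rbrakk> \<Longrightarrow> x = x'" by (rule code[OF dN]) (rule that)
  obtain g where g: "col (VF # qq) g"
    "\<And>y x x' r. \<lbrakk>y \<in> tuples K qq; x \<in> KF; x' \<in> KF; loc_lip (\<lambda>z. F (z # y)) x; loc_lip (\<lambda>z. F (z # y)) x';
      g (x # y) = g (x' # y); cl r x x'\<rbrakk> \<Longrightarrow> cl r (F (x # y)) (F (x' # y))" by (rule curve[OF dF]) (rule that)
  have dj: "dmap False (VV n @ qq) (VF # qq) (\<lambda>e. e ! j # drop (length (VV n)) e)"
    by (rule dI dco | (use s in \<open>simp del: VV_len; fail\<close>))+
  have dP: "dset False (VV n @ qq) (\<lambda>e. R e \<and> Lp (e ! j # drop (length (VV n)) e))"
    by (rule dset_conj R dset_app0[OF dLp] dj)+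
  have ej: "(x @ q) ! j = x ! j" "drop (length (VV n)) (x @ q) = q" if "x \<in> tuples K (VV n)" for x q
    using that ij(2) tuples_length[OF that] by (simp_all add: nth_append)
  have "good n qq f (\<lambda>e. R e \<and> Lp (e ! j # drop (length (VV n)) e))"
  proof (rule goodI[OF col_app[OF g(1) dj]])
    fix y x x' r assume *: "y \<in> tuples K qq" "x \<in> tuples K (VV n)" "x' \<in> tuples K (VV n)"
      "R (x @ y) \<and> Lp ((x @ y) ! j # drop (length (VV n)) (x @ y))" "R (x' @ y) \<and> Lp ((x' @ y) ! j # drop (length (VV n)) (x' @ y))"
      "g ((x @ y) ! j # drop (length (VV n)) (x @ y)) = g ((x' @ y) ! j # drop (length (VV n)) (x' @ y))" "ncl n r x x'"
    note e = ej[OF *(2)] ej[OF *(3)]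
    have "cl r (F (x ! j # y)) (F (x' ! j # y))"
      using g(2)[OF *(1) tuple_nth[OF *(2) ij(2)] tuple_nth[OF *(3) ij(2)]] *(4-7) ij(2) unfolding e Lp_def by simp
    then show "cl r (f (x @ y)) (f (x' @ y))" using Fv[OF *(2,1)] Fv[OF *(3,1)] *(4,5) by simp
  qed
  moreover have "good n qq f (\<lambda>e. R e \<and> \<not> Lp (e ! j # drop (length (VV n)) e))"
  proof (rule good_inj[OF col_app[OF colI[OF c(2)] dj]])
    fix y x x' assume *: "y \<in> tuples K qq" "x \<in> tuples K (VV n)" "x' \<in> tuples K (VV n)"
      "R (x @ y) \<and> \<not> Lp ((x @ y) ! j # drop (length (VV n)) (x @ y))" "R (x' @ y) \<and> \<not> Lp ((x' @ y) ! j # drop (length (VV n)) (x' @ y))"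
      "c ((x @ y) ! j # drop (length (VV n)) (x @ y)) = c ((x' @ y) ! j # drop (length (VV n)) (x' @ y))"
    note e = ej[OF *(2)] ej[OF *(3)]
    have "N (x ! j # y)" unfolding N_def using *(2,4) unfolding e by auto
    then have "x ! j = x' ! j" using c(3)[OF *(1) nN[OF *(1)] tuple_nth[OF *(2) ij(2)] tuple_nth[OF *(3) ij(2)]] *(6) unfolding e by blast
    then show "x = x'" using inj[OF *(2,3,1)] *(4,5) by blast
  qed
  ultimately have "good n qq f (\<lambda>e. (R e \<and> Lp (e ! j # drop (length (VV n)) e)) \<or> (R e \<and> \<not> Lp (e ! j # drop (length (VV n)) e)))"
    by (rule good_Un[OF dP])
  then show ?thesis by (rule good_mono) blast
qed

lemma good_jac_many: assumes "\<And>k. k < (N::nat) \<Longrightarrow> dtm True [VF] VF (\<lambda>e. h k (hd e))" and a: "a \<in> KF"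
  shows "\<exists>b s. b \<in> KF \<and> cl r a b \<and> r \<le> s \<and> (\<forall>k<N. constjac (h k) b s)"
  using assms(1)
proof (induction N)
  case 0
  show ?case using a by (intro exI[of _ a] exI[of _ r]) simp
next
  case (Suc N)
  then obtain b s where b: "b \<in> KF" "cl r a b" "r \<le> s" "\<forall>k<N. constjac (h k) b s" by auto
  obtain c t where c: "c \<in> KF" "cl s b c" "s \<le> t" "constjac (h N) c t"
    by (rule good_jac[OF Suc.prems[of N] b(1)]) (simp, rule that)
  have hK: "h k x \<in> KF" if "k < Suc N" "x \<in> KF" for k x using dtm_car[OF Suc.prems[OF that(1)], of "[x]"] that(2) by simp
  have "constjac (h k) c t" if "k < Suc N" for k
  proof (cases "k = N")
    case False
    then have "k < N" using that by simp
    then have bk: "constjac (h k) b s" using b(4) by blast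
    show ?thesis by (rule constjac_sub[OF bk _ b(1) c(1,2,3)]) (rule hK[OF that])
  qed (use c in simp)
  moreover have "cl r a c" using cl_trans[OF a b(1) c(1) b(2)] cl_mono[OF c(2) b(3)] by blast
  ultimately show ?case using c(1,3) b(3) by (intro exI[of _ c] exI[of _ t]) simp
qed

text \<open>Near a generic value of \<open>x ! i\<close> every coordinate is constant or scales
  distances by some \<open>\<epsilon>\<close>, and one with the least \<open>\<epsilon>\<close>,
  that is, with the largest derivative, dominates all others. The remaining values of
  \<open>x ! i\<close> contain no ball and are separated by a code.\<close>

lemma good_graph: assumes R: "dset False (VV n @ qq) R" and f: "dtm False (VV n @ qq) VF f" and i: "i < n"
  and inj: "\<And>x x' q. \<lbrakk>x \<in> tuples K (VV n); x' \<in> tuples K (VV n); q \<in> tuples K qq; R (x @ q); R (x' @ q);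
    x ! i = x' ! i\<rbrakk> \<Longrightarrow> x = x'"
  and ll: "\<And>x q. \<lbrakk>x \<in> tuples K (VV n); q \<in> tuples K qq;
    R (x @ q)\<rbrakk> \<Longrightarrow> \<exists>s. \<forall>x1\<in>tuples K (VV n). \<forall>x2\<in>tuples K (VV n). R (x1 @ q) \<and> R (x2 @ q) \<and> ncl n s x x1 \<and> ncl n s x x2 \<longrightarrow>
       (\<forall>r. ncl n r x1 x2 \<longrightarrow> cl r (f (x1 @ q)) (f (x2 @ q)))"
  shows "good n qq f R"
proof -
  have s: "set qq \<subseteq> sorts L" using dset_sorts[OF R] by simp
  let ?n = "length (VV n)"
  define Dm where "Dm j t q \<longleftrightarrow> (\<exists>\<rho>. \<forall>x1\<in>tuples K (VV n). \<forall>x2\<in>tuples K (VV n). R (x1 @ q) \<and> R (x2 @ q) \<and> cl \<rho> t (x1 ! i) \<and> cl \<rho> t (x2 ! i) \<longrightarrow>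
       (\<forall>r. cl r (x1 ! j) (x2 ! j) \<longrightarrow> ncl n r x1 x2))" for j t q
  have dDm: "dset False (VF # qq) (\<lambda>e. Dm j (hd e) (tl e))" if j: "j < n" for j unfolding Dm_def
    by (rule dset_app0[OF R] dI dset_eqt dset_finall dtm_coord | assumption | (use s i j in \<open>simp del: VV_len; fail\<close>))+
  have ej: "(x @ q) ! k = x ! k" "drop ?n (x @ q) = q" if "x \<in> tuples K (VV n)" "k < n" for x q k
    using that tuples_length[OF that(1)] by (simp_all add: nth_append)
  define ND where "ND t q \<longleftrightarrow> (\<exists>x\<in>tuples K (VV n). R (x @ q) \<and> x ! i = t) \<and> (\<forall>j<n. \<not> Dm j t q)" for t q
  have dND: "dset False (VF # qq) (\<lambda>e. ND (hd e) (tl e))" unfolding ND_def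
    by (rule dset_conj dset_finall dset_not dDm dset_app0[OF R] dI dset_eqt dtm_coord | assumption | (use s i in \<open>simp del: VV_len; fail\<close>))+
  define G where "G k e b \<longleftrightarrow> (\<exists>x\<in>tuples K (VV n). R (x @ tl e) \<and> x ! i = hd e \<and> x ! k = b)" for k e b
  define h where "h k e = (if \<exists>!b. b \<in> KF \<and> G k e b then THE b. b \<in> KF \<and> G k e b else zz)" for k e
  have dh: "dtm False (VF # qq) VF (h k)" if k: "k < n" for k unfolding h_def
  proof (rule dtm_the)
    show "dset False ((VF # qq) @ [VF]) (\<lambda>z. G k (take (length (VF # qq)) z) (z ! length (VF # qq)))" unfolding G_def
      by (rule dset_app0[OF R] dI dset_eqt dtm_coord | (use s i k in \<open>simp del: VV_len; fail\<close>))+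
  qed (use s in simp)
  have hv: "h k (x ! i # q) = x ! k" if x: "x \<in> tuples K (VV n)" "q \<in> tuples K qq" "R (x @ q)" "k < n" for x q k
  proof -
    have xi: "x ! k \<in> KF" by (rule tuple_nth[OF x(1,4)])
    have "w \<in> KF \<and> G k (x ! i # q) w \<longleftrightarrow> w = x ! k" for w
      unfolding G_def list.sel using inj[OF _ x(1,2) _ x(3)] x xi by blast
    then show ?thesis unfolding h_def by simp
  qed
  have nND: "nob (\<lambda>t. ND t q)" if q: "q \<in> tuples K qq" for q
  proof (rule ccontr)
    assume "\<not> ?thesis"
    then obtain a r where a: "a \<in> KF" "\<And>t. t \<in> KF \<Longrightarrow> cl r a t \<Longrightarrow> ND t q" by (rule nobE) (rule that)
    have dh1: "dtm True [VF] VF (\<lambda>e. h k (hd e # q))" if "k < n" for k by (rule dtm_app0[OF dh[OF that]] dI | (use q s in \<open>simp; fail\<close>))+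
    obtain b s' where b: "b \<in> KF" "cl r a b" "r \<le> s'" and bc: "\<forall>k<n. constjac (\<lambda>t. h k (t # q)) b s'"
      using good_jac_many[of n "\<lambda>k t. h k (t # q)" a r, OF dh1 a(1)] by blast
    have inb: "ND t q" if "t \<in> KF" "cl s' b t" for t
      using a(2)[OF that(1)] cl_trans[OF a(1) b(1) that(1) b(2)] cl_mono[OF that(2) b(3)] by blast
    have hi: "h i (t # q) = t" if t: "t \<in> KF" "cl s' b t" for t
    proof -
      obtain x where "x \<in> tuples K (VV n)" "R (x @ q)" "x ! i = t" using inb[OF t] unfolding ND_def by blast
      then show ?thesis using hv[of x q i] q i by simp
    qed
    define co where "co k \<longleftrightarrow> (\<forall>t\<in>KF. cl s' b t \<longrightarrow> h k (t # q) = h k (b # q))" for k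
    define sc where "sc k \<epsilon> \<longleftrightarrow> (\<forall>t\<in>KF. \<forall>t'\<in>KF. cl s' b t \<and> cl s' b t' \<and> t \<noteq> t' \<longrightarrow> h k (t # q) \<noteq> h k (t' # q) \<and>
       ord (vd (h k (t # q)) (h k (t' # q))) = \<epsilon> + ord (vd t t'))" for k \<epsilon>
    have "\<exists>\<epsilon>. sc k \<epsilon>" if "k < n" "\<not> co k" for k
      using bc[rule_format, OF that(1)] that(2) unfolding constjac_def co_def sc_def by blast
    then obtain ep where ep: "\<And>k. k < n \<Longrightarrow> \<not> co k \<Longrightarrow> sc k (ep k)" by metis
    \<comment> \<open>The coordinate \<open>i\<close> itself is not constant, so there is a least
      \<open>ep\<close>.\<close>
    have nci: "\<not> co i"
    proof
      assume c: "co i"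
      obtain t where t: "t \<in> KF" "t \<noteq> b" "ord (vd b t) = s'" using ex_exact[OF b(1)] by metis
      have "cl s' b t" using t by (simp add: cl_def)
      then have "t = b" using c hi[OF t(1)] hi[OF b(1)] t(1) unfolding co_def by simp
      then show False using t by simp
    qed
    let ?J = "{k. k < n \<and> \<not> co k}"
    have J: "finite (ep ` ?J)" "ep ` ?J \<noteq> {}" using nci i by auto
    obtain j where j: "j < n" "\<not> co j" "ep j = Min (ep ` ?J)" using Min_in[OF J] by auto
    have jmin: "ep j \<le> ep k" if "k < n" "\<not> co k" for k using j(3) Min_le[OF J(1), of "ep k"] that by auto
    have "Dm j b q" unfolding Dm_def
    proof (intro exI[of _ s'] ballI impI allI)
      fix x1 x2 r' k assume x: "x1 \<in> tuples K (VV n)" "x2 \<in> tuples K (VV n)"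
        "R (x1 @ q) \<and> R (x2 @ q) \<and> cl s' b (x1 ! i) \<and> cl s' b (x2 ! i)" "cl r' (x1 ! j) (x2 ! j)" "k < n"
      have t: "x1 ! i \<in> KF" "x2 ! i \<in> KF" using tuple_nth x(1,2) i by blast+
      have v: "h k (x1 ! i # q) = x1 ! k" "h k (x2 ! i # q) = x2 ! k" if "k < n" for k using hv x q that by blast+
      show "cl r' (x1 ! k) (x2 ! k)"
      proof (cases "x1 ! i = x2 ! i \<or> co k")
        case True
        then have "h k (x1 ! i # q) = h k (x2 ! i # q)" using x(3) t unfolding co_def by auto
        then show ?thesis using v[OF x(5)] by simp
      next
        case False
        have "x1 ! j \<noteq> x2 ! j \<and> ord (vd (x1 ! j) (x2 ! j)) = ep j + ord (vd (x1 ! i) (x2 ! i))"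
          using ep[OF j(1,2)] t x(3) False v[OF j(1)] unfolding sc_def by metis
        moreover have "ord (vd (x1 ! k) (x2 ! k)) = ep k + ord (vd (x1 ! i) (x2 ! i))"
          using ep[OF x(5)] t x(3) False v[OF x(5)] unfolding sc_def by metis
        ultimately show ?thesis using x(4) jmin[OF x(5)] False by (simp add: cl_def)
      qed
    qed
    then show False using inb[OF b(1)] j(1) unfolding ND_def by auto
  qed
  obtain ns c where c: "set (RRs ns) \<subseteq> sorts L" "dmap False (VF # qq) (RRs ns) c"
   "\<And>y x x'. \<lbrakk>y \<in> tuples K qq; nob (\<lambda>x. ND (hd (x # y)) (tl (x # y))); x \<in> KF; x' \<in> KF; ND (hd (x # y)) (tl (x # y));
     c (x # y) = c (x' # y)\<rbrakk> \<Longrightarrow> x = x'" by (rule code[OF dND]) (rule that)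
  have di: "dmap False (VV n @ qq) (VF # qq) (\<lambda>e. e ! i # drop ?n e)"
    by (rule dI dtm_coord' | (use s i in \<open>simp del: VV_len; fail\<close>))+
  let ?P = "\<lambda>j e. R e \<and> Dm j (e ! i) (drop ?n e)"
  have dP: "dset False (VV n @ qq) (?P j)" if "j < n" for j
    by (rule dset_conj R relR[OF dDm[OF that]] dI dtm_coord' | (use s i in \<open>simp del: VV_len; fail\<close>))+
  have "good n qq f (\<lambda>e. R e \<and> (\<forall>j<n. \<not> Dm j (e ! i) (drop ?n e)))"
  proof (rule good_inj[OF col_app[OF colI[OF c(2)] di]])
    fix y x x' assume *: "y \<in> tuples K qq" "x \<in> tuples K (VV n)" "x' \<in> tuples K (VV n)"
      "R (x @ y) \<and> (\<forall>j<n. \<not> Dm j ((x @ y) ! i) (drop ?n (x @ y)))" "R (x' @ y) \<and> (\<forall>j<n. \<not> Dm j ((x' @ y) ! i) (drop ?n (x' @ y)))"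
      "c ((x @ y) ! i # drop ?n (x @ y)) = c ((x' @ y) ! i # drop ?n (x' @ y))"
    note e = ej[OF *(2) i] ej[OF *(3) i]
    have "ND (x ! i) y" unfolding ND_def using *(2,4) unfolding e by blast
    then have "x ! i = x' ! i"
      using c(3)[OF *(1) _ tuple_nth[OF *(2) i] tuple_nth[OF *(3) i]] nND[OF *(1)] *(6) unfolding e list.sel by blast
    then show "x = x'" using inj[OF *(2,3,1)] *(4,5) by blast
  qed
  moreover have "good n qq f (?P j)" if j: "j < n" for j
  proof -
    define W where "W e \<longleftrightarrow> (\<exists>x\<in>tuples K (VV n). R (x @ tl (tl e)) \<and> x ! i = hd e \<and> x ! j = hd (tl e)) \<and> Dm j (hd e) (tl (tl e))" for e
    have dW: "dset False (VF # VF # qq) W" unfolding W_def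
      by (rule dset_conj relR[OF dDm[OF j]] dset_app0[OF R] dI dset_eqt dtm_coord | (use s i j in \<open>simp del: VV_len; fail\<close>))+
    \<comment> \<open>If one value \<open>b\<close> of \<open>x ! j\<close> were taken over a ball
      of values of \<open>x ! i\<close>, domination would identify points with different
      \<open>x ! i\<close>. A code therefore determines \<open>x ! i\<close> from
      \<open>x ! j\<close>.\<close>
    have nW: "nob (\<lambda>t. W (t # b # q))" if q: "q \<in> tuples K qq" for b q
    proof (rule ccontr)
      assume "\<not> ?thesis"
      then obtain a r where a: "a \<in> KF" "\<And>t. t \<in> KF \<Longrightarrow> cl r a t \<Longrightarrow> W (t # b # q)" by (rule nobE) (rule that)
      have Wa: "W (a # b # q)" using a by simp
      obtain \<rho> where \<rho>: "\<forall>x1\<in>tuples K (VV n). \<forall>x2\<in>tuples K (VV n). R (x1 @ q) \<and> R (x2 @ q) \<and> cl \<rho> a (x1 ! i) \<and> cl \<rho> a (x2 ! i) \<longrightarrow>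
       (\<forall>r. cl r (x1 ! j) (x2 ! j) \<longrightarrow> ncl n r x1 x2)" using Wa unfolding W_def Dm_def list.sel by blast
      obtain t where t: "t \<in> KF" "t \<noteq> a" "ord (vd a t) = max r \<rho>" using ex_exact[OF a(1)] by metis
      have tc: "cl r a t" "cl \<rho> a t" using t by (simp_all add: cl_def)
      obtain x1 where x1: "x1\<in>tuples K (VV n)" "R (x1 @ q)" "x1 ! i = a" "x1 ! j = b" using Wa unfolding W_def list.sel by blast
      obtain x2 where x2: "x2\<in>tuples K (VV n)" "R (x2 @ q)" "x2 ! i = t" "x2 ! j = b" using a(2)[OF t(1) tc(1)] unfolding W_def list.sel by blast
      have "cl r' (x1 ! j) (x2 ! j)" for r' using x1 x2 by simp
      then have "cl r' (x1 ! i) (x2 ! i)" for r' using \<rho> x1 x2 tc(2) i cl_refl by metis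
      then have "a = t" using x1(3) x2(3) cl_all_eq[OF a(1) t(1)] by blast
      then show False using t by simp
    qed
    obtain ms c2 where c2: "set (RRs ms) \<subseteq> sorts L" "dmap False (VF # VF # qq) (RRs ms) c2"
     "\<And>y x x'. \<lbrakk>y \<in> tuples K (VF # qq); nob (\<lambda>x. W (x # y)); x \<in> KF; x' \<in> KF; W (x # y);
       c2 (x # y) = c2 (x' # y)\<rbrakk> \<Longrightarrow> x = x'" by (rule code[OF dW]) (rule that)
    let ?k = "\<lambda>e. c2 (e ! i # e ! j # drop ?n e)"
    have dk: "dmap False (VV n @ qq) (RRs ms) ?k"
      by (rule dmap_app0[OF c2(2)] dI dtm_coord' | (use s i j in \<open>simp del: VV_len; fail\<close>))+
    let ?m = "length (VV n @ qq)"
    \<comment> \<open>The code becomes a parameter \<open>\<mu>\<close>, which makes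
      \<open>x ! j\<close> injective on every fiber; \<open>good_param\<close> removes it
      afterwards.\<close>
    let ?R = "\<lambda>e. ?P j (take ?m e) \<and> ?k (take ?m e) = drop ?m e"
    have "dset False ((VV n @ qq) @ RRs ms) ?R"
      by (rule dset_conj dset_eq dset_lift[OF dP[OF j]] dmap_lift[OF dk] dmap_last | (use s c2(1) in \<open>simp del: VV_len; fail\<close>))+
    then have dR: "dset False (VV n @ (qq @ RRs ms)) ?R" by simp
    have "dtm False ((VV n @ qq) @ RRs ms) VF (\<lambda>e. f (take ?m e))" by (rule dtm_lift[OF f c2(1)])
    then have df: "dtm False (VV n @ (qq @ RRs ms)) VF (\<lambda>e. f (take ?m e))" by simp
    have tm: "take ?m (x @ q @ \<mu>) = x @ q" "drop ?m (x @ q @ \<mu>) = \<mu>" if "x \<in> tuples K (VV n)" "q \<in> tuples K qq" for x q \<mu>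
      using that by (simp_all add: tuples_length)
    have Rv: "?R (x @ q @ \<mu>) \<longleftrightarrow> R (x @ q) \<and> Dm j (x ! i) q \<and> c2 (x ! i # x ! j # q) = \<mu>"
      if "x \<in> tuples K (VV n)" "q \<in> tuples K qq" for x q \<mu>
      unfolding tm[OF that] ej[OF that(1) i] ej[OF that(1) j] by blast
    have "good n (qq @ RRs ms) (\<lambda>e. f (take ?m e)) ?R"
    proof (rule good_coord[OF dR df i j])
      fix x x' q0 assume *: "x \<in> tuples K (VV n)" "x' \<in> tuples K (VV n)" "q0 \<in> tuples K (qq @ RRs ms)" "?R (x @ q0)" "?R (x' @ q0)" "x ! j = x' ! j"
      obtain q \<mu> where q: "q0 = q @ \<mu>" "q \<in> tuples K qq" using *(3) by (rule tuples_appendE)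
      have r: "R (x @ q)" "Dm j (x ! i) q" "c2 (x ! i # x ! j # q) = \<mu>" using *(4) unfolding q(1) Rv[OF *(1) q(2)] by auto
      have r': "R (x' @ q)" "Dm j (x' ! i) q" "c2 (x' ! i # x' ! j # q) = \<mu>" using *(5) unfolding q(1) Rv[OF *(2) q(2)] by auto
      have w: "W (x ! i # x ! j # q)" unfolding W_def list.sel using r *(1) by blast
      have bq: "x ! j # q \<in> tuples K (VF # qq)" using tuple_nth[OF *(1) j] q(2) by simp
      have "x ! i = x' ! i"
        by (rule c2(3)[OF bq nW[OF q(2)] tuple_nth[OF *(1) i] tuple_nth[OF *(2) i] w]) (use r(3) r'(3) *(6) in simp)
      then show "x = x'" using inj[OF *(1,2) q(2) r(1) r'(1)] by blast
    next
      fix x q0 assume *: "x \<in> tuples K (VV n)" "q0 \<in> tuples K (qq @ RRs ms)" "?R (x @ q0)"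
      obtain q \<mu> where q: "q0 = q @ \<mu>" "q \<in> tuples K qq" using *(2) by (rule tuples_appendE)
      have r: "R (x @ q)" "Dm j (x ! i) q" using *(3) unfolding q(1) Rv[OF *(1) q(2)] by auto
      obtain \<rho> where \<rho>: "\<forall>x1\<in>tuples K (VV n). \<forall>x2\<in>tuples K (VV n). R (x1 @ q) \<and> R (x2 @ q) \<and> cl \<rho> (x ! i) (x1 ! i) \<and> cl \<rho> (x ! i) (x2 ! i) \<longrightarrow>
       (\<forall>r. cl r (x1 ! j) (x2 ! j) \<longrightarrow> ncl n r x1 x2)" using r(2) unfolding Dm_def by blast
      show "\<exists>\<rho>. \<forall>x1\<in>tuples K (VV n). \<forall>x2\<in>tuples K (VV n). ?R (x1 @ q0) \<and> ?R (x2 @ q0) \<and> cl \<rho> (x ! i) (x1 ! i) \<and> cl \<rho> (x ! i) (x2 ! i) \<longrightarrow>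
       (\<forall>r. cl r (x1 ! j) (x2 ! j) \<longrightarrow> ncl n r x1 x2)"
      proof (rule exI[of _ \<rho>], intro ballI impI)
        fix x1 x2 assume y: "x1 \<in> tuples K (VV n)" "x2 \<in> tuples K (VV n)"
          "?R (x1 @ q0) \<and> ?R (x2 @ q0) \<and> cl \<rho> (x ! i) (x1 ! i) \<and> cl \<rho> (x ! i) (x2 ! i)"
        have "R (x1 @ q)" "R (x2 @ q)" using y(3) unfolding q(1) Rv[OF y(1) q(2)] Rv[OF y(2) q(2)] by blast+
        then show "\<forall>r. cl r (x1 ! j) (x2 ! j) \<longrightarrow> ncl n r x1 x2" using \<rho> y by blast
      qed
      obtain s where s: "\<forall>x1\<in>tuples K (VV n). \<forall>x2\<in>tuples K (VV n). R (x1 @ q) \<and> R (x2 @ q) \<and> ncl n s x x1 \<and> ncl n s x x2 \<longrightarrow>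
       (\<forall>r. ncl n r x1 x2 \<longrightarrow> cl r (f (x1 @ q)) (f (x2 @ q)))" using ll[OF *(1) q(2) r(1)] by blast
      show "\<exists>s. \<forall>x1\<in>tuples K (VV n). \<forall>x2\<in>tuples K (VV n). ?R (x1 @ q0) \<and> ?R (x2 @ q0) \<and> ncl n s x x1 \<and> ncl n s x x2 \<longrightarrow>
       (\<forall>r. ncl n r x1 x2 \<longrightarrow> cl r (f (take ?m (x1 @ q0))) (f (take ?m (x2 @ q0))))"
      proof (rule exI[of _ s], intro ballI impI)
        fix x1 x2 assume y: "x1 \<in> tuples K (VV n)" "x2 \<in> tuples K (VV n)"
          "?R (x1 @ q0) \<and> ?R (x2 @ q0) \<and> ncl n s x x1 \<and> ncl n s x x2"
        have "R (x1 @ q)" "R (x2 @ q)" using y(3) unfolding q(1) Rv[OF y(1) q(2)] Rv[OF y(2) q(2)] by blast+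
        then show "\<forall>r. ncl n r x1 x2 \<longrightarrow> cl r (f (take ?m (x1 @ q0))) (f (take ?m (x2 @ q0)))"
          unfolding q(1) tm(1)[OF y(1) q(2)] tm(1)[OF y(2) q(2)] using s y by blast
      qed
    qed
    then show ?thesis
    proof (rule good_param[OF dk])
      show "?R (x @ y @ ?k (x @ y))" if "x \<in> tuples K (VV n)" "y \<in> tuples K qq" "?P j (x @ y)" for x y
        unfolding tm[OF that(1,2)] using that(3) by blast
      show "f (take ?m (x @ y @ z)) = f (x @ y)" if "x \<in> tuples K (VV n)" "y \<in> tuples K qq" for x y z
        unfolding tm(1)[OF that] by (rule refl)
    qed
  qed
  ultimately have "good n qq f (\<lambda>e. (\<exists>j<n. ?P j e) \<or> (R e \<and> (\<forall>j<n. \<not> Dm j (e ! i) (drop ?n e))))"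
    by (intro good_Un good_many dset_finex dP) (use s in simp_all)
  then show ?thesis by (rule good_mono) blast
qed

text \<open>Call a value of \<open>x ! i\<close> bad for \<open>j\<close> if a ball of values of
  \<open>x ! j\<close> occurs over it. No projection to two coordinates contains a product of balls,
  so by \<open>dim2\<close> the bad values contain no ball. A point with a coordinate that is bad
  for no other index is determined by that coordinate and a code. At all other points every
  coordinate is a bad value, so a code determines the whole point.\<close>

lemma good_set: assumes X: "dset False (VV n @ ss) X" and f: "dtm False (VV n @ ss) VF f"
  and nd: "\<And>y i j a b s t. \<lbrakk>y \<in> tuples K ss; i < n; j < n; i \<noteq> j; a \<in> KF;
    b \<in> KF\<rbrakk> \<Longrightarrow> \<exists>u\<in>KF. \<exists>v\<in>KF. cl s a u \<and> cl t b v \<and> \<not> (\<exists>x\<in>tuples K (VV n). X (x @ y) \<and> x ! i = u \<and> x ! j = v)"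
  and ll: "\<And>x q. \<lbrakk>x \<in> tuples K (VV n); q \<in> tuples K ss;
    X (x @ q)\<rbrakk> \<Longrightarrow> \<exists>s. \<forall>x1\<in>tuples K (VV n). \<forall>x2\<in>tuples K (VV n). X (x1 @ q) \<and> X (x2 @ q) \<and> ncl n s x x1 \<and> ncl n s x x2 \<longrightarrow>
       (\<forall>r. ncl n r x1 x2 \<longrightarrow> cl r (f (x1 @ q)) (f (x2 @ q)))"
  shows "good n ss f X"
proof -
  have s: "set ss \<subseteq> sorts L" using dset_sorts[OF X] by simp
  let ?n = "length (VV n)"
  have ej: "(x @ q) ! k = x ! k" "drop ?n (x @ q) = q" if "x \<in> tuples K (VV n)" "k < n" for x q k
    using that tuples_length[OF that(1)] by (simp_all add: nth_append)
  define PP where "PP i j e \<longleftrightarrow> (\<exists>x\<in>tuples K (VV n). X (x @ tl (tl e)) \<and> x ! i = hd (tl e) \<and> x ! j = hd e)" for i j e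
  have dPP: "dset False (VF # VF # ss) (PP i j)" if "i < n" "j < n" for i j unfolding PP_def
    by (rule dset_app0[OF X] dI dset_eqt dtm_coord | (use s that in \<open>simp del: VV_len; fail\<close>))+
  define DD where "DD i j e \<longleftrightarrow> \<not> nob (\<lambda>b. PP i j (b # e))" for i j e
  have dDD: "dset False (VF # ss) (DD i j)" if "i < n" "j < n" for i j unfolding DD_def
    by (rule dset_not[OF dset_nob[OF dPP[OF that]]])
  have nDD: "nob (\<lambda>a. DD i j (a # y))" if ij: "i < n" "j < n" "i \<noteq> j" and y: "y \<in> tuples K ss" for i j y
  proof (rule ccontr)
    assume "\<not> ?thesis"
    then obtain a r where a: "a \<in> KF" "\<And>t. t \<in> KF \<Longrightarrow> cl r a t \<Longrightarrow> DD i j (t # y)" by (rule nobE) (rule that)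
    have d: "dset True [VF, VF] (\<lambda>e. PP i j (hd e # hd (tl e) # y))"
      by (rule dset_app0[OF dPP[OF ij(1,2)]] dI | (use s y in \<open>simp; fail\<close>))+
    have nn: "\<not> nob (\<lambda>b. PP i j (b # t # y))" if "t \<in> KF" "cl r a t" for t using a(2)[OF that] unfolding DD_def .
    obtain a1 b s t where "a1 \<in> KF" "b \<in> KF" "\<And>u v. \<lbrakk>u \<in> KF; v \<in> KF; cl s a1 u; cl t b v\<rbrakk> \<Longrightarrow> PP i j (v # u # y)"
      by (rule dim2[of "\<lambda>b t. PP i j (b # t # y)" a r, OF d a(1) nn]) (assumption, assumption, rule that)
    then show False using nd[OF y ij, of a1 b s t] unfolding PP_def list.sel by blast
  qed
  define Xi where "Xi i e \<longleftrightarrow> X e \<and> (\<forall>j<n. j \<noteq> i \<longrightarrow> \<not> DD i j (e ! i # drop ?n e))" for i e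
  define Xn where "Xn e \<longleftrightarrow> X e \<and> (\<forall>i<n. \<exists>j<n. j \<noteq> i \<and> DD i j (e ! i # drop ?n e))" for e
  have dXi: "dset False (VV n @ ss) (Xi i)" if i: "i < n" for i unfolding Xi_def
    by (rule dset_conj X dset_finall dset_imp dset_const dset_not dset_app0[OF dDD] dI dtm_coord' | assumption | (use s i in \<open>simp del: VV_len; fail\<close>))+
  have gi: "good n ss f (Xi i)" if i: "i < n" for i
  proof -
    have "\<exists>c. col (VF # VF # ss) c \<and> (\<forall>y\<in>tuples K ss. \<forall>a\<in>KF. \<forall>b\<in>KF. \<forall>b'\<in>KF. \<not> DD i j (a # y) \<and> PP i j (b # a # y) \<and>
        c (b # a # y) = c (b' # a # y) \<longrightarrow> b = b')" if j: "j < n" for j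
    proof -
      obtain ns c where c: "set (RRs ns) \<subseteq> sorts L" "dmap False (VF # VF # ss) (RRs ns) c"
       "\<And>y x x'. \<lbrakk>y \<in> tuples K (VF # ss); nob (\<lambda>x. PP i j (x # y)); x \<in> KF; x' \<in> KF; PP i j (x # y);
         c (x # y) = c (x' # y)\<rbrakk> \<Longrightarrow> x = x'" by (rule code[OF dPP[OF i j]]) (rule that)
      show ?thesis
      proof (intro exI[of _ c] conjI ballI impI)
        show "col (VF # VF # ss) c" by (rule colI[OF c(2)])
        fix y a b b' assume *: "y \<in> tuples K ss" "a \<in> KF" "b \<in> KF" "b' \<in> KF" "\<not> DD i j (a # y) \<and> PP i j (b # a # y) \<and> c (b # a # y) = c (b' # a # y)"
        show "b = b'" by (rule c(3)[of "a # y" b b']) (use * in \<open>simp_all add: DD_def\<close>)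
      qed
    qed
    then obtain C where C: "\<And>j. j < n \<Longrightarrow> col (VF # VF # ss) (C j)"
      "\<And>j. j < n \<Longrightarrow> \<forall>y\<in>tuples K ss. \<forall>a\<in>KF. \<forall>b\<in>KF. \<forall>b'\<in>KF. \<not> DD i j (a # y) \<and> PP i j (b # a # y) \<and>
        C j (b # a # y) = C j (b' # a # y) \<longrightarrow> b = b'" by metis
    have dj: "dmap False (VV n @ ss) (VF # VF # ss) (\<lambda>e. e ! j # e ! i # drop ?n e)" if j: "j < n" for j
      by (rule dI dtm_coord' | (use s i j in \<open>simp del: VV_len; fail\<close>))+
    have sn: "set (VV n @ ss) \<subseteq> sorts L" using s by simp
    have "\<exists>k0. col (VV n @ ss) k0 \<and> (\<forall>e\<in>tuples K (VV n @ ss). \<forall>e'\<in>tuples K (VV n @ ss). k0 e = k0 e' \<longrightarrow>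
        (\<forall>j<n. C j (e ! j # e ! i # drop ?n e) = C j (e' ! j # e' ! i # drop ?n e')))"
      by (rule col_many[OF sn]) (rule col_app[OF C(1) dj])
    then obtain ks k where k: "dmap False (VV n @ ss) (RRs ks) k" "\<And>e e' j. \<lbrakk>e\<in>tuples K (VV n @ ss); e'\<in>tuples K (VV n @ ss); k e = k e';
      j < n\<rbrakk> \<Longrightarrow> C j (e ! j # e ! i # drop ?n e) = C j (e' ! j # e' ! i # drop ?n e')" unfolding col_def by blast
    have ks: "set (RRs ks) \<subseteq> sorts L" using dmap_sorts[OF k(1)] by blast
    let ?m = "length (VV n @ ss)"
    let ?R = "\<lambda>e. Xi i (take ?m e) \<and> k (take ?m e) = drop ?m e"
    have "dset False ((VV n @ ss) @ RRs ks) ?R"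
      by (rule dset_conj dset_eq dset_lift[OF dXi[OF i]] dmap_lift[OF k(1)] dmap_last | (use s ks in \<open>simp del: VV_len; fail\<close>))+
    then have dR: "dset False (VV n @ (ss @ RRs ks)) ?R" by simp
    have "dtm False ((VV n @ ss) @ RRs ks) VF (\<lambda>e. f (take ?m e))" by (rule dtm_lift[OF f ks])
    then have df: "dtm False (VV n @ (ss @ RRs ks)) VF (\<lambda>e. f (take ?m e))" by simp
    have tm: "take ?m (x @ q @ \<mu>) = x @ q" "drop ?m (x @ q @ \<mu>) = \<mu>" if "x \<in> tuples K (VV n)" "q \<in> tuples K ss" for x q \<mu>
      using that by (simp_all add: tuples_length)
    have Xiv: "Xi i (x @ q) \<longleftrightarrow> X (x @ q) \<and> (\<forall>j<n. j \<noteq> i \<longrightarrow> \<not> DD i j (x ! i # q))" if "x \<in> tuples K (VV n)" for x q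
      unfolding Xi_def ej[OF that i] by blast
    have "good n (ss @ RRs ks) (\<lambda>e. f (take ?m e)) ?R"
    proof (rule good_graph[OF dR df i])
      fix x x' q0 assume *: "x \<in> tuples K (VV n)" "x' \<in> tuples K (VV n)" "q0 \<in> tuples K (ss @ RRs ks)" "?R (x @ q0)" "?R (x' @ q0)" "x ! i = x' ! i"
      obtain q \<mu> where q: "q0 = q @ \<mu>" "q \<in> tuples K ss" using *(3) by (rule tuples_appendE)
      have r: "Xi i (x @ q)" "k (x @ q) = \<mu>" using *(4) unfolding q(1) tm[OF *(1) q(2)] by auto
      have r': "Xi i (x' @ q)" "k (x' @ q) = \<mu>" using *(5) unfolding q(1) tm[OF *(2) q(2)] by auto
      have t: "x @ q \<in> tuples K (VV n @ ss)" "x' @ q \<in> tuples K (VV n @ ss)" using * q by simp_all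
      have kk: "k (x @ q) = k (x' @ q)" using r r' by simp
      show "x = x'"
      proof (rule tuple_eqI[OF *(1,2)])
        fix j assume j: "j < n"
        show "x ! j = x' ! j"
        proof (cases "j = i")
          case False
          have "C j (x ! j # x ! i # q) = C j (x' ! j # x ! i # q)"
            using k(2)[OF t kk j] unfolding ej[OF *(1) j] ej[OF *(2) j] ej[OF *(1) i] ej[OF *(2) i] *(6) .
          moreover have "PP i j (x ! j # x ! i # q)" unfolding PP_def list.sel using r(1) *(1) unfolding Xi_def by blast
          moreover have "\<not> DD i j (x ! i # q)" using r(1) j False unfolding Xiv[OF *(1)] by blast
          ultimately show ?thesis
            using C(2)[OF j] q(2) tuple_nth[OF *(1) i] tuple_nth[OF *(1) j] tuple_nth[OF *(2) j] by blast
        qed (use *(6) in simp)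
      qed
    next
      fix x q0 assume *: "x \<in> tuples K (VV n)" "q0 \<in> tuples K (ss @ RRs ks)" "?R (x @ q0)"
      obtain q \<mu> where q: "q0 = q @ \<mu>" "q \<in> tuples K ss" using *(2) by (rule tuples_appendE)
      have r: "X (x @ q)" using *(3) unfolding q(1) tm[OF *(1) q(2)] Xi_def by auto
      obtain s where s: "\<forall>x1\<in>tuples K (VV n). \<forall>x2\<in>tuples K (VV n). X (x1 @ q) \<and> X (x2 @ q) \<and> ncl n s x x1 \<and> ncl n s x x2 \<longrightarrow>
       (\<forall>r. ncl n r x1 x2 \<longrightarrow> cl r (f (x1 @ q)) (f (x2 @ q)))" using ll[OF *(1) q(2) r] by blast
      show "\<exists>s. \<forall>x1\<in>tuples K (VV n). \<forall>x2\<in>tuples K (VV n). ?R (x1 @ q0) \<and> ?R (x2 @ q0) \<and> ncl n s x x1 \<and> ncl n s x x2 \<longrightarrow>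
       (\<forall>r. ncl n r x1 x2 \<longrightarrow> cl r (f (take ?m (x1 @ q0))) (f (take ?m (x2 @ q0))))"
      proof (rule exI[of _ s], intro ballI impI)
        fix x1 x2 assume y: "x1 \<in> tuples K (VV n)" "x2 \<in> tuples K (VV n)"
          "?R (x1 @ q0) \<and> ?R (x2 @ q0) \<and> ncl n s x x1 \<and> ncl n s x x2"
        have "X (x1 @ q)" "X (x2 @ q)" using y(3) unfolding q(1) tm[OF y(1) q(2)] tm[OF y(2) q(2)] Xi_def by blast+
        then show "\<forall>r. ncl n r x1 x2 \<longrightarrow> cl r (f (take ?m (x1 @ q0))) (f (take ?m (x2 @ q0)))"
          unfolding q(1) tm(1)[OF y(1) q(2)] tm(1)[OF y(2) q(2)] using s y by blast
      qed
    qed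
    then show ?thesis
    proof (rule good_param[OF k(1)])
      show "?R (x @ y @ k (x @ y))" if "x \<in> tuples K (VV n)" "y \<in> tuples K ss" "Xi i (x @ y)" for x y
        unfolding tm[OF that(1,2)] using that(3) by blast
      show "f (take ?m (x @ y @ z)) = f (x @ y)" if "x \<in> tuples K (VV n)" "y \<in> tuples K ss" for x y z
        unfolding tm(1)[OF that] by (rule refl)
    qed
  qed
  have gn: "good n ss f Xn"
  proof -
    let ?N = "\<lambda>i e. \<exists>j<n. j \<noteq> i \<and> DD i j e"
    have "\<exists>c. col (VF # ss) c \<and> (\<forall>y\<in>tuples K ss. \<forall>a\<in>KF. \<forall>a'\<in>KF. ?N i (a # y) \<and> c (a # y) = c (a' # y) \<longrightarrow> a = a')" if i: "i < n" for i
    proof -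
      have dN: "dset False (VF # ss) (?N i)"
        by (rule dset_finex dset_conj dDD dset_const | assumption | (use s i in \<open>simp; fail\<close>))+
      have nN: "nob (\<lambda>a. ?N i (a # y))" if y: "y \<in> tuples K ss" for y
      proof (rule nob_many[of n "\<lambda>j a. j \<noteq> i \<and> DD i j (a # y)"])
        fix j assume j: "j < n"
        show "dset True [VF] (\<lambda>e. j \<noteq> i \<and> DD i j (hd e # y))"
          by (rule dset_conj dset_app0[OF dDD[OF i j]] dI | (use s y in \<open>simp; fail\<close>))+
        show "nob (\<lambda>a. j \<noteq> i \<and> DD i j (a # y))"
        proof (cases "j = i")
          case True
          then show ?thesis by (intro nob_single) simp
        next
          case False
          show ?thesis by (rule nob_mono[OF nDD[OF i j _ y]]) (use False in simp_all)
        qed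
      qed
      obtain ns c where c: "set (RRs ns) \<subseteq> sorts L" "dmap False (VF # ss) (RRs ns) c"
       "\<And>y x x'. \<lbrakk>y \<in> tuples K ss; nob (\<lambda>x. ?N i (x # y)); x \<in> KF; x' \<in> KF; ?N i (x # y);
         c (x # y) = c (x' # y)\<rbrakk> \<Longrightarrow> x = x'" by (rule code[OF dN]) (rule that)
      show ?thesis
      proof (intro exI[of _ c] conjI ballI impI)
        show "col (VF # ss) c" by (rule colI[OF c(2)])
        fix y a a' assume *: "y \<in> tuples K ss" "a \<in> KF" "a' \<in> KF" "?N i (a # y) \<and> c (a # y) = c (a' # y)"
        show "a = a'" by (rule c(3)[OF *(1) nN[OF *(1)] *(2,3)]) (use *(4) in blast)+
      qed
    qed
    then obtain C where C: "\<And>i. i < n \<Longrightarrow> col (VF # ss) (C i)"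
      "\<And>i. i < n \<Longrightarrow> \<forall>y\<in>tuples K ss. \<forall>a\<in>KF. \<forall>a'\<in>KF. ?N i (a # y) \<and> C i (a # y) = C i (a' # y) \<longrightarrow> a = a'" by metis
    have dj: "dmap False (VV n @ ss) (VF # ss) (\<lambda>e. e ! i # drop ?n e)" if j: "i < n" for i
      by (rule dI dtm_coord' | (use s j in \<open>simp del: VV_len; fail\<close>))+
    have sn: "set (VV n @ ss) \<subseteq> sorts L" using s by simp
    have "\<exists>k. col (VV n @ ss) k \<and> (\<forall>e\<in>tuples K (VV n @ ss). \<forall>e'\<in>tuples K (VV n @ ss). k e = k e' \<longrightarrow>
        (\<forall>i<n. C i (e ! i # drop ?n e) = C i (e' ! i # drop ?n e')))"
      by (rule col_many[OF sn]) (rule col_app[OF C(1) dj])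
    then obtain k where k: "col (VV n @ ss) k \<and> (\<forall>e\<in>tuples K (VV n @ ss). \<forall>e'\<in>tuples K (VV n @ ss). k e = k e' \<longrightarrow>
        (\<forall>i<n. C i (e ! i # drop ?n e) = C i (e' ! i # drop ?n e')))" by (elim exE) (rule that)
    show ?thesis
    proof (rule good_inj[OF conjunct1[OF k]])
      fix y x x' assume *: "y \<in> tuples K ss" "x \<in> tuples K (VV n)" "x' \<in> tuples K (VV n)" "Xn (x @ y)" "Xn (x' @ y)" "k (x @ y) = k (x' @ y)"
      have t: "x @ y \<in> tuples K (VV n @ ss)" "x' @ y \<in> tuples K (VV n @ ss)" using * by simp_all
      show "x = x'"
      proof (rule tuple_eqI[OF *(2,3)])
        fix i assume i: "i < n"
        have "C i ((x @ y) ! i # drop ?n (x @ y)) = C i ((x' @ y) ! i # drop ?n (x' @ y))"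
          using conjunct2[OF k, THEN bspec, OF t(1), THEN bspec, OF t(2), THEN mp, OF *(6)] i by blast
        then have "C i (x ! i # y) = C i (x' ! i # y)" unfolding ej[OF *(2) i] ej[OF *(3) i] .
        moreover have "?N i (x ! i # y)" using *(4) i unfolding Xn_def ej[OF *(2) i] ej(2)[OF *(2) i] using ej(1)[OF *(2)] by auto
        ultimately show "x ! i = x' ! i" using C(2)[OF i] *(1) tuple_nth[OF *(2) i] tuple_nth[OF *(3) i] by blast
      qed
    qed
  qed
  have "good n ss f (\<lambda>e. (\<exists>i<n. Xi i e) \<or> Xn e)"
    by (intro good_Un good_many dset_finex dXi gi gn) (use s in simp_all)
  then show ?thesis by (rule good_mono) (auto simp: Xi_def Xn_def)
qed

section \<open>Passage from congruences to absolute values\<close>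

lemma vabs_le: "vabs K v \<le> exp (- real_of_int r) \<longleftrightarrow> v = zz \<or> r \<le> ord v"
  by (simp add: vabs_def)

lemma cl_vabs: "a \<in> KF \<Longrightarrow> b \<in> KF \<Longrightarrow> cl r a b \<longleftrightarrow> vabs K (vd a b) \<le> exp (- real_of_int r)"
  by (simp add: vabs_le cl_def)

text \<open>Both sides of the inequality are \<open>0\<close> or of the form
  \<open>exp (- r)\<close> with an integer \<open>r\<close>, so it can be tested on these
  thresholds. If the right side is \<open>0\<close>, congruence for all \<open>r\<close> gives
  equality of \<open>a\<close> and \<open>b\<close>.\<close>

lemma lip_conv: assumes x: "x \<in> tuples K (VV n)" "x' \<in> tuples K (VV n)" and a: "a \<in> KF" "b \<in> KF"
  shows "vabs K (vd a b) \<le> vnabs K (map2 (vdiff K) x x') \<longleftrightarrow> (\<forall>r. ncl n r x x' \<longrightarrow> cl r a b)"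
proof -
  have len: "length x = n" "length x' = n" using tuples_length[OF x(1)] tuples_length[OF x(2)] by simp_all
  let ?S = "insert 0 (vabs K ` set (map2 (vdiff K) x x'))"
  have S: "?S = insert 0 ((\<lambda>k. vabs K (vd (x ! k) (x' ! k))) ` {..<n})"
    using len by (auto simp: set_zip image_iff)
  have fin: "finite ?S" "?S \<noteq> {}" by simp_all
  have ck: "cl r (x ! k) (x' ! k) \<longleftrightarrow> vabs K (vd (x ! k) (x' ! k)) \<le> exp (- real_of_int r)" if "k < n" for k r
    by (rule cl_vabs) (use tuple_nth x that in blast)+
  have le: "ncl n r x x' \<longleftrightarrow> vnabs K (map2 (vdiff K) x x') \<le> exp (- real_of_int r)" for r
    unfolding vnabs_def Max_le_iff[OF fin] unfolding S using ck by auto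
  show ?thesis
  proof
    assume "vabs K (vd a b) \<le> vnabs K (map2 (vdiff K) x x')"
    then show "\<forall>r. ncl n r x x' \<longrightarrow> cl r a b" unfolding le cl_vabs[OF a] by (meson order_trans)
  next
    assume h: "\<forall>r. ncl n r x x' \<longrightarrow> cl r a b"
    have "vnabs K (map2 (vdiff K) x x') \<in> ?S" unfolding vnabs_def by (rule Max_in[OF fin])
    then consider "vnabs K (map2 (vdiff K) x x') = 0" | r where "vnabs K (map2 (vdiff K) x x') = exp (- real_of_int r)"
      by (auto simp: vabs_def split: if_splits)
    then show "vabs K (vd a b) \<le> vnabs K (map2 (vdiff K) x x')"
    proof cases
      case 1
      then have "cl r a b" for r using h unfolding le by simp
      then have "a = b" using cl_all_eq[OF a] by blast
      then have "vd a b = zz" using a by simp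
      then show ?thesis using 1 by (simp add: vabs_def)
    next
      case (2 r)
      then have "cl r a b" using h unfolding le by simp
      then show ?thesis using 2 cl_vabs[OF a] by simp
    qed
  qed
qed

end

lemma nths_pair: assumes "i < j" "j < length xs" shows "nths xs {i, j} = [xs ! i, xs ! j]"
proof -
  have "filter (\<lambda>k. k = i \<or> k = j) [0..<length xs] = [i, j]"
    by (rule sorted_distinct_set_unique) (use assms in \<open>auto intro: sorted_wrt_filter\<close>)
  moreover have "nths xs {i, j} = map ((!) xs) (filter (\<lambda>k. k = i \<or> k = j) [0..<length xs])"
  proof -
    have "zip xs [0..<length xs] = map (\<lambda>k. (xs ! k, k)) [0..<length xs]" by (rule nth_equalityI) auto
    then show ?thesis by (simp add: nths_def filter_map o_def)
  qed
  ultimately show ?thesis by simp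
qed

theorem theorem2p17:
  fixes L :: "('f, 'r) vlang" and T :: "('f, 'r) vfm set" and p e :: nat
    and K :: "('f, 'r, 'u) vstruct"
    and n :: nat and ss :: "vsort list" and X Y :: "'u list set" and f :: "'u list \<Rightarrow> 'u"
  assumes universe_large: "{\<phi>. wf_fm L \<phi>} \<lesssim> (UNIV :: 'u set)"
    and tame: "tame TYPE('u) L p e T"
    and K: "T_field L p e T K" "residue_rings_saturated L K"
    and Y: "definable L K ss Y"
    and X: "definable L K (replicate n VF @ ss) X" "X \<subseteq> {x @ y |x y. length x = n \<and> y \<in> Y}"
    and f: "definable_fun L K (replicate n VF @ ss) X [VF] (\<lambda>z. [f z])"
    and dim: "\<forall>y\<in>Y. has_dim K n (fiber X n y) 1"
    and lip: "\<forall>y\<in>Y. locally_lipschitz K 1 (\<lambda>x. f (x @ y)) (fiber X n y)"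
  shows "\<exists>ns g. k_partition L K (replicate n VF @ ss) X ns g \<and>
           (\<forall>y\<in>Y. \<forall>\<xi>\<in>tuples K (map RR ns).
              globally_lipschitz K 1 (\<lambda>x. f (x @ y)) {x \<in> fiber X n y. g (x @ y) = \<xi>})"
proof -
  interpret tfield L T p e K by (unfold_locales) (rule tame K)+
  have Xsub: "X \<subseteq> tuples K (VV n @ ss)" using X(1) unfolding definable_def VV_def by auto
  then have Xeq: "{z \<in> tuples K (VV n @ ss). z \<in> X} = X" by blast
  have dX: "dset False (VV n @ ss) (\<lambda>z. z \<in> X)" using X(1) Xeq unfolding dset_False dset0_def VV_def by simp
  have Ysub: "Y \<subseteq> tuples K ss" using Y unfolding definable_def by auto
  obtain f0 where f0: "dmap False (VV n @ ss) [VF] f0" "\<And>z. z \<in> X \<Longrightarrow> f0 z = [f z]"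
    using dfun_total[OF f] by (auto simp: VV_def)
  have df: "dtm False (VV n @ ss) VF (\<lambda>z. hd (f0 z))" by (rule dtm_hd[OF f0(1)])
  have fv: "hd (f0 z) = f z" if "z \<in> X" for z using f0(2)[OF that] by simp
  have fK: "f z \<in> KF" if "z \<in> X" for z using dtm_car[OF df, of z] fv[OF that] Xsub that by auto
  have XY: "y \<in> Y" if xy: "x \<in> tuples K (VV n)" "x @ y \<in> X" for x y
  proof -
    obtain x' y' where "x @ y = x' @ y'" "length x' = n" "y' \<in> Y" using X(2) xy(2) by blast
    then show ?thesis using tuples_length[OF xy(1)] by simp
  qed
  have fib: "x \<in> fiber X n y \<longleftrightarrow> x \<in> tuples K (VV n) \<and> x @ y \<in> X" for x y
  proof
    assume "x \<in> fiber X n y"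
    then have "length x = n" "x @ y \<in> X" unfolding fiber_def by auto
    then show "x \<in> tuples K (VV n) \<and> x @ y \<in> X" using Xsub tuples_append[of "x @ y" K "VV n" ss] by auto
  next
    assume "x \<in> tuples K (VV n) \<and> x @ y \<in> X"
    then show "x \<in> fiber X n y" unfolding fiber_def using tuples_length[of x K "VV n"] by simp
  qed
  have gl: "globally_lipschitz K 1 (\<lambda>x. f (x @ y)) A \<longleftrightarrow> (\<forall>x1\<in>A. \<forall>x2\<in>A. \<forall>r. ncl n r x1 x2 \<longrightarrow> cl r (f (x1 @ y)) (f (x2 @ y)))"
    if A: "A \<subseteq> fiber X n y" for A y
    unfolding globally_lipschitz_def
  proof (intro ball_cong refl)
    fix x1 x2 assume "x1 \<in> A" "x2 \<in> A"
    then have x: "x1 \<in> tuples K (VV n)" "x1 @ y \<in> X" "x2 \<in> tuples K (VV n)" "x2 @ y \<in> X" using A fib by blast+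
    show "vabs K (vd (f (x1 @ y)) (f (x2 @ y))) \<le> 1 * vnabs K (map2 vd x1 x2) \<longleftrightarrow>
       (\<forall>r. ncl n r x1 x2 \<longrightarrow> cl r (f (x1 @ y)) (f (x2 @ y)))"
      using lip_conv[OF x(1,3) fK[OF x(2)] fK[OF x(4)]] by simp
  qed
  \<comment> \<open>A product of balls in the projection to two coordinates would contradict
    dimension one. \<open>nths\<close> lists coordinates in increasing order, hence
    \<open>i < j\<close>; the other case exchanges the two roles.\<close>
  have nd: "\<exists>u\<in>KF. \<exists>v\<in>KF. cl s a u \<and> cl t b v \<and> \<not> (\<exists>x\<in>tuples K (VV n). x @ y \<in> X \<and> x ! i = u \<and> x ! j = v)"
    if ij: "i < j" "j < n" and ab: "a \<in> KF" "b \<in> KF" for y i j a b s t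
  proof (rule ccontr)
    assume "\<not> ?thesis"
    then have all: "\<And>u v. \<lbrakk>u \<in> KF; v \<in> KF; cl s a u;
      cl t b v\<rbrakk> \<Longrightarrow> \<exists>x\<in>tuples K (VV n). x @ y \<in> X \<and> x ! i = u \<and> x ! j = v" by blast
    have yY: "y \<in> Y" using all[OF ab] XY by auto
    \<comment> \<open>Balls in the definition of dimension are given by a strict inequality, so
      \<open>\<gamma>\<close> stands for the radius \<open>\<gamma> + 1\<close>.\<close>
    let ?\<gamma> = "hinv (max s t - 1)"
    have "vnball K [a, b] ?\<gamma> \<subseteq> (\<lambda>x. nths x {i, j}) ` fiber X n y"
    proof
      fix z assume "z \<in> vnball K [a, b] ?\<gamma>"
      then obtain u v where z: "z = [u, v]" "u \<in> vball K a ?\<gamma>" "v \<in> vball K b ?\<gamma>"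
        unfolding vnball_def by (auto simp: list_all2_Cons2)
      have u: "u \<in> KF" "v \<in> KF" "cl (max s t) a u" "cl (max s t) b v" using z(2,3) vball_cl ab by simp_all
      obtain x where x: "x \<in> tuples K (VV n)" "x @ y \<in> X" "x ! i = u" "x ! j = v"
        using all[OF u(1,2)] cl_mono[OF u(3), of s] cl_mono[OF u(4), of t] by auto
      have "nths x {i, j} = z" using nths_pair[OF ij(1), of x] ij(2) tuples_length[OF x(1)] x(3,4) z(1) by simp
      then show "z \<in> (\<lambda>x. nths x {i, j}) ` fiber X n y" using fib x(1,2) by blast
    qed
    moreover have "[a, b] \<in> tuples K (replicate 2 VF)" using ab by (simp add: numeral_2_eq_2)
    moreover have "{i, j} \<subseteq> {..<n}" "card {i, j} = 2" using ij by auto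
    moreover have "?\<gamma> \<in> car K VG" by simp
    ultimately have "projection_has_ball K n (fiber X n y) 2" unfolding projection_has_ball_def by blast
    then show False using dim yY unfolding has_dim_def by fastforce
  qed
  have "good n ss (\<lambda>z. hd (f0 z)) (\<lambda>z. z \<in> X)"
  proof (rule good_set[OF dX df])
    fix y i j a b s t assume *: "i < n" "j < n" "i \<noteq> j" "a \<in> KF" "b \<in> KF"
    show "\<exists>u\<in>KF. \<exists>v\<in>KF. cl s a u \<and> cl t b v \<and> \<not> (\<exists>x\<in>tuples K (VV n). x @ y \<in> X \<and> x ! i = u \<and> x ! j = v)"
    proof (cases "i < j")
      case True
      then show ?thesis by (rule nd[OF _ *(2,4,5)])
    next
      case False
      then have "j < i" using *(3) by simp
      from nd[OF this *(1,5,4), of t s y] show ?thesis by blast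
    qed
  next
    fix x y assume x: "x \<in> tuples K (VV n)" "y \<in> tuples K ss" "x @ y \<in> X"
    have y: "y \<in> Y" by (rule XY[OF x(1,3)])
    have xf: "x \<in> fiber X n y" using fib x by blast
    obtain \<gamma> where g: "\<gamma> \<in> car K VG" "globally_lipschitz K 1 (\<lambda>x. f (x @ y)) (vnball K x \<gamma> \<inter> fiber X n y)"
      using lip y xf unfolding locally_lipschitz_def by blast
    note G = g(2)[unfolded gl[OF Int_lower2]]
    have inb: "z \<in> vnball K x \<gamma> \<inter> fiber X n y" if z: "z \<in> tuples K (VV n)" "z @ y \<in> X" "\<forall>k<n. cl (hh \<gamma> + 1) (x ! k) (z ! k)" for z
    proof -
      have "z ! k \<in> vball K (x ! k) \<gamma>" if "k < n" for k
        using vball_cl[OF tuple_nth[OF x(1) that] g(1)] z(3) tuple_nth[OF z(1) that] that by simp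
      then show ?thesis unfolding vnball_def using fib z(1,2) tuples_length[OF z(1)] tuples_length[OF x(1)]
        by (simp add: list_all2_conv_all_nth)
    qed
    show "\<exists>s. \<forall>x1\<in>tuples K (VV n). \<forall>x2\<in>tuples K (VV n). x1 @ y \<in> X \<and> x2 @ y \<in> X \<and> ncl n s x x1 \<and> ncl n s x x2 \<longrightarrow>
       (\<forall>r. ncl n r x1 x2 \<longrightarrow> cl r (hd (f0 (x1 @ y))) (hd (f0 (x2 @ y))))"
    proof (rule exI[of _ "hh \<gamma> + 1"], intro ballI impI)
      fix x1 x2 assume z: "x1 \<in> tuples K (VV n)" "x2 \<in> tuples K (VV n)" and
        zz: "x1 @ y \<in> X \<and> x2 @ y \<in> X \<and> (\<forall>k<n. cl (hh \<gamma> + 1) (x ! k) (x1 ! k)) \<and> (\<forall>k<n. cl (hh \<gamma> + 1) (x ! k) (x2 ! k))"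
      have X12: "x1 @ y \<in> X" "x2 @ y \<in> X" using zz by blast+
      show "\<forall>r. ncl n r x1 x2 \<longrightarrow> cl r (hd (f0 (x1 @ y))) (hd (f0 (x2 @ y)))"
        unfolding fv[OF X12(1)] fv[OF X12(2)] using G inb[OF z(1) X12(1)] inb[OF z(2) X12(2)] zz by blast
    qed
  qed
  then obtain g where g: "col (VV n @ ss) g"
    "\<And>y x x' r. \<lbrakk>y \<in> tuples K ss; x \<in> tuples K (VV n); x' \<in> tuples K (VV n); x @ y \<in> X; x' @ y \<in> X; g (x @ y) = g (x' @ y);
      ncl n r x x'\<rbrakk> \<Longrightarrow> cl r (hd (f0 (x @ y))) (hd (f0 (x' @ y)))"
    by (rule goodE) (rule that)
  obtain ns where ns: "dmap False (VV n @ ss) (RRs ns) g" using g(1) unfolding col_def by blast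
  have "k_partition L K (replicate n VF @ ss) X ns g"
    using dmap_dfun[OF dX ns] unfolding k_partition_def Xeq by (simp add: VV_def RRs_def)
  moreover have "globally_lipschitz K 1 (\<lambda>x. f (x @ y)) {x \<in> fiber X n y. g (x @ y) = \<xi>}" if y: "y \<in> Y" for y \<xi>
  proof -
    have "cl r (f (x1 @ y)) (f (x2 @ y))"
      if z: "x1 \<in> fiber X n y" "x2 \<in> fiber X n y" "g (x1 @ y) = \<xi>" "g (x2 @ y) = \<xi>" "ncl n r x1 x2" for x1 x2 r
    proof -
      have x: "x1 \<in> tuples K (VV n)" "x1 @ y \<in> X" "x2 \<in> tuples K (VV n)" "x2 @ y \<in> X" using z fib by blast+
      have yt: "y \<in> tuples K ss" using y Ysub by blast
      have "cl r (hd (f0 (x1 @ y))) (hd (f0 (x2 @ y)))" by (rule g(2)[OF yt x(1,3,2,4) _ z(5)]) (use z in simp)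
      then show ?thesis unfolding fv[OF x(2)] fv[OF x(4)] .
    qed
    moreover have "{x \<in> fiber X n y. g (x @ y) = \<xi>} \<subseteq> fiber X n y" by blast
    ultimately show ?thesis unfolding gl[OF \<open>{x \<in> fiber X n y. g (x @ y) = \<xi>} \<subseteq> fiber X n y\<close>] by blast
  qed
  ultimately show ?thesis by blast
qed

end
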